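(* Let $R$ be a commutative ring, let $\mathcal{U}$ and $\mathcal{T}$ be skeletally small additive $R$-categories, let $M\in\mathrm{Mod}(\mathcal{U}\otimes_R\mathcal{T}^{op})$, and let $\Lambda=\begin{bmatrix}\mathcal{T} & 0 \\ M & \mathcal{U}\end{bmatrix}$ be the triangular matrix category. Let $\mathcal{U}'=\begin{bmatrix}0 & 0 \\ M & \mathcal{U}\end{bmatrix}$ be the full subcategory of $\Lambda$ on the objects $\begin{bmatrix}0 & 0 \\ M & U\end{bmatrix}$, $U\in\mathcal{U}$. Then there is a recollement with left term $\mathrm{Mod}(\mathcal{T})=\mathrm{Mod}(\Lambda/I_{\mathcal{U}'})$, middle term $\mathrm{Mod}(\Lambda)$ and right term $\mathrm{Mod}(\mathcal{U}')=\mathrm{Mod}(\mathcal{U})$ (identifications along equivalences $\Lambda/I_{\mathcal{U}'}\simeq\mathcal{T}$ and $\mathcal{U}'\simeq\mathcal{U}$), given by the adjoint triples $$\left(\Lambda/I_{\mathcal{U}'}\otimes_{\Lambda}-,\ \mathrm{res}_{\Lambda},\ \Lambda(\Lambda/I_{\mathcal{U}'},-)\right)\quad\text{and}\quad\left(\Lambda\otimes_{\mathcal{U}'}-,\ \mathrm{res}_{\mathcal{U}'},\ \mathcal{U}'(\Lambda,-)\right),$$ where $\Lambda/I_{\mathcal{U}'}\otimes_{\Lambda}-:\mathrm{Mod}(\Lambda)\to\mathrm{Mod}(\Lambda/I_{\mathcal{U}'})$ is an exact functor.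
   Context: $R$-category: preadditive category with $R$-module Hom sets and $R$-bilinear composition. $\mathcal{U}\otimes_R\mathcal{T}^{op}$ has objects pairs $(U,T)$ and morphisms $\mathcal{U}(U,U')\otimes_R\mathcal{T}^{op}(T,T')$. $\mathrm{Mod}(\mathcal{A})$ is the category of additive covariant functors $\mathcal{A}\to\mathbf{Ab}$ (equivalently $R$-functors to $\mathrm{Mod}(R)$ when $\mathcal{A}$ is an $R$-category). Triangular matrix category $\Lambda=\begin{bmatrix}\mathcal{T} & 0 \\ M & \mathcal{U}\end{bmatrix}$: objects $\begin{bmatrix}T & 0 \\ M & U\end{bmatrix}$ with $T\in\mathcal{T}$, $U\in\mathcal{U}$; morphisms from $\begin{bmatrix}T & 0 \\ M & U\end{bmatrix}$ to $\begin{bmatrix}T' & 0 \\ M & U'\end{bmatrix}$ are matrices $\begin{bmatrix}t & 0 \\ m & u\end{bmatrix}$ with $t\in\mathcal{T}(T,T')$, $m\in M(U',T)$, $u\in\mathcal{U}(U,U')$; composition is $\begin{bmatrix}t_2 & 0 \\ m_2 & u_2\end{bmatrix}\circ\begin{bmatrix}t_1 & 0 \\ m_1 & u_1\end{bmatrix}=\begin{bmatrix}t_2t_1 & 0 \\ m_2\bullet t_1+u_2\bullet m_1 & u_2u_1\end{bmatrix}$ with $m_2\bullet t_1=M(1\otimes t_1^{op})(m_2)$, $u_2\bullet m_1=M(u_2\otimes1)(m_1)$. Tensor product: $\otimes_{\mathcal{A}}:\mathrm{Mod}(\mathcal{A}^{op})\times\mathrm{Mod}(\mathcal{A})\to\mathbf{Ab}$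 is the (unique up to isomorphism) functor which is right exact and preserves coproducts in each variable with $F\otimes_{\mathcal{A}}\mathcal{A}(A,-)=F(A)$ and $\mathcal{A}(-,A)\otimes_{\mathcal{A}}G=G(A)$. For a full additive subcategory $\mathcal{B}$ of an additive category $\mathcal{C}$ (here $\mathcal{C}=\Lambda$, $\mathcal{B}=\mathcal{U}'$): $I_{\mathcal{B}}(C,C')$ is the group of morphisms $C\to C'$ factoring through an object of $\mathcal{B}$; $\mathcal{C}/I_{\mathcal{B}}$ is the quotient category with the same objects and morphisms $\mathcal{C}(C,C')/I_{\mathcal{B}}(C,C')$, $\pi$ the projection; $\mathrm{res}_{\mathcal{C}}(F)=F\circ\pi$; $(\mathcal{C}/I_{\mathcal{B}}\otimes_{\mathcal{C}}N)(C)=\frac{\mathcal{C}(-,C)}{I_{\mathcal{B}}(-,C)}\otimes_{\mathcal{C}}N$; $\mathcal{C}(\mathcal{C}/I_{\mathcal{B}},N)(C)=\mathrm{Hom}_{\mathrm{Mod}(\mathcal{C})}\left(\frac{\mathcal{C}(C,-)}{I_{\mathcal{B}}(C,-)},N\right)$; $\mathrm{res}_{\mathcal{B}}$ is restriction to $\mathcal{B}$; $(\mathcal{C}\otimes_{\mathcal{B}}N)(C)=\mathcal{C}(-,C)|_{\mathcal{B}}\otimes_{\mathcal{B}}N$; $\mathcal{B}(\mathcal{C},N)(C)=\mathrm{Hom}_{\mathrm{Mod}(\mathcal{B})}(\mathcal{C}(C,-)|_{\mathcal{B}},N)$. Recollement of abelian categories (left term $\mathcal{B}'$, middle $\mathcal{A}'$,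 right $\mathcal{C}'$): additive functors $i_*:\mathcal{B}'\to\mathcal{A}'$, $i^*,i^!:\mathcal{A}'\to\mathcal{B}'$, $j^*:\mathcal{A}'\to\mathcal{C}'$, $j_!,j_*:\mathcal{C}'\to\mathcal{A}'$ such that $(i^*,i_*,i^!)$ and $(j_!,j^*,j_* )$ are adjoint triples, $\mathrm{Ker}(j^* )=\mathrm{Im}(i_* )$, and $i_*,j_!,j_*$ are fully faithful. *)

theory Defs
  imports "HOL-Algebra.Module" "HOL-Algebra.Generated_Groups" "HOL-Algebra.Free_Abelian_Groups"
begin

section \<open>Preadditive categories\<close>

text \<open>
  Abelian groups are the library's \<^locale>\<open>comm_group\<close>s, written multiplicatively:
  the multiplication of \<open>Hom C a b\<close> is the addition of morphisms and its unit is the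
  zero morphism.  Composition, identities and hom groups carry their objects as arguments,
  so hom sets need not be disjoint.  \<open>Cmp C a b c g f\<close> is \<open>g \<circ> f\<close> for
  \<open>f : a \<rightarrow> b\<close> and \<open>g : b \<rightarrow> c\<close>.
\<close>

record ('o, 'm) pcat =
  Ob  :: "'o set"
  Hom :: "'o \<Rightarrow> 'o \<Rightarrow> 'm monoid"
  Idt :: "'o \<Rightarrow> 'm"
  Cmp :: "'o \<Rightarrow> 'o \<Rightarrow> 'o \<Rightarrow> 'm \<Rightarrow> 'm \<Rightarrow> 'm"

abbreviation arr :: "('o, 'm, 'z) pcat_scheme \<Rightarrow> 'o \<Rightarrow> 'o \<Rightarrow> 'm set"
  where "arr C a b \<equiv> carrier (Hom C a b)"

abbreviation zero_arr :: "('o, 'm, 'z) pcat_scheme \<Rightarrow> 'o \<Rightarrow> 'o \<Rightarrow> 'm"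
  where "zero_arr C a b \<equiv> one (Hom C a b)"

locale preadditive_category =
  fixes C :: "('o, 'm, 'z) pcat_scheme"
  assumes Hom_comm_group: "a \<in> Ob C \<Longrightarrow> b \<in> Ob C \<Longrightarrow> comm_group (Hom C a b)"
    and Idt_arr: "a \<in> Ob C \<Longrightarrow> Idt C a \<in> arr C a a"
    and Cmp_hom_right: "a \<in> Ob C \<Longrightarrow> b \<in> Ob C \<Longrightarrow> c \<in> Ob C \<Longrightarrow> g \<in> arr C b c
      \<Longrightarrow> (\<lambda>f. Cmp C a b c g f) \<in> hom (Hom C a b) (Hom C a c)"
    and Cmp_hom_left: "a \<in> Ob C \<Longrightarrow> b \<in> Ob C \<Longrightarrow> c \<in> Ob C \<Longrightarrow> f \<in> arr C a b
      \<Longrightarrow> (\<lambda>g. Cmp C a b c g f) \<in> hom (Hom C b c) (Hom C a c)"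
    and Cmp_Idt_left: "a \<in> Ob C \<Longrightarrow> b \<in> Ob C \<Longrightarrow> f \<in> arr C a b
      \<Longrightarrow> Cmp C a b b (Idt C b) f = f"
    and Cmp_Idt_right: "a \<in> Ob C \<Longrightarrow> b \<in> Ob C \<Longrightarrow> f \<in> arr C a b
      \<Longrightarrow> Cmp C a a b f (Idt C a) = f"
    and Cmp_assoc: "a \<in> Ob C \<Longrightarrow> b \<in> Ob C \<Longrightarrow> c \<in> Ob C \<Longrightarrow> d \<in> Ob C
      \<Longrightarrow> f \<in> arr C a b \<Longrightarrow> g \<in> arr C b c \<Longrightarrow> h \<in> arr C c d
      \<Longrightarrow> Cmp C a c d h (Cmp C a b c g f) = Cmp C a b d (Cmp C b c d h g) f"

definition iso_arr :: "('o, 'm, 'z) pcat_scheme \<Rightarrow> 'o \<Rightarrow> 'o \<Rightarrow> 'm \<Rightarrow> bool"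
  where "iso_arr C a b f \<longleftrightarrow> f \<in> arr C a b \<and>
    (\<exists>g\<in>arr C b a. Cmp C a b a g f = Idt C a \<and> Cmp C b a b f g = Idt C b)"

definition isomorphic :: "('o, 'm, 'z) pcat_scheme \<Rightarrow> 'o \<Rightarrow> 'o \<Rightarrow> bool"
  where "isomorphic C a b \<longleftrightarrow> (\<exists>f. iso_arr C a b f)"

definition zero_object :: "('o, 'm, 'z) pcat_scheme \<Rightarrow> 'o \<Rightarrow> bool"
  where "zero_object C z \<longleftrightarrow> z \<in> Ob C \<and>
    (\<forall>a\<in>Ob C. (\<exists>!f. f \<in> arr C z a) \<and> (\<exists>!f. f \<in> arr C a z))"

definition biproduct ::
  "('o, 'm, 'z) pcat_scheme \<Rightarrow> 'o \<Rightarrow> 'o \<Rightarrow> 'o \<Rightarrow> 'm \<Rightarrow> 'm \<Rightarrow> 'm \<Rightarrow> 'm \<Rightarrow> bool"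
  where "biproduct C a b s i j p q \<longleftrightarrow>
    i \<in> arr C a s \<and> j \<in> arr C b s \<and> p \<in> arr C s a \<and> q \<in> arr C s b \<and>
    Cmp C a s a p i = Idt C a \<and> Cmp C b s b q j = Idt C b \<and>
    Cmp C b s a p j = zero_arr C b a \<and> Cmp C a s b q i = zero_arr C a b \<and>
    Cmp C s a s i p \<otimes>\<^bsub>Hom C s s\<^esub> Cmp C s b s j q = Idt C s"

definition additive_category :: "('o, 'm, 'z) pcat_scheme \<Rightarrow> bool"
  where "additive_category C \<longleftrightarrow> preadditive_category C \<and> (\<exists>z. zero_object C z) \<and>
    (\<forall>a\<in>Ob C. \<forall>b\<in>Ob C. \<exists>s\<in>Ob C. \<exists>i j p q. biproduct C a b s i j p q)"


subsection \<open>Abelian categories\<close>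

definition is_kernel :: "('o, 'm, 'z) pcat_scheme \<Rightarrow> 'o \<Rightarrow> 'o \<Rightarrow> 'm \<Rightarrow> 'o \<Rightarrow> 'm \<Rightarrow> bool"
  where "is_kernel C a b f k i \<longleftrightarrow> k \<in> Ob C \<and> i \<in> arr C k a \<and>
    Cmp C k a b f i = zero_arr C k b \<and>
    (\<forall>x\<in>Ob C. \<forall>h\<in>arr C x a. Cmp C x a b f h = zero_arr C x b \<longrightarrow>
      (\<exists>!h'. h' \<in> arr C x k \<and> Cmp C x k a i h' = h))"

definition is_cokernel :: "('o, 'm, 'z) pcat_scheme \<Rightarrow> 'o \<Rightarrow> 'o \<Rightarrow> 'm \<Rightarrow> 'o \<Rightarrow> 'm \<Rightarrow> bool"
  where "is_cokernel C a b f k p \<longleftrightarrow> k \<in> Ob C \<and> p \<in> arr C b k \<and>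
    Cmp C a b k p f = zero_arr C a k \<and>
    (\<forall>x\<in>Ob C. \<forall>h\<in>arr C b x. Cmp C a b x h f = zero_arr C a x \<longrightarrow>
      (\<exists>!h'. h' \<in> arr C k x \<and> Cmp C b k x h' p = h))"

definition monic :: "('o, 'm, 'z) pcat_scheme \<Rightarrow> 'o \<Rightarrow> 'o \<Rightarrow> 'm \<Rightarrow> bool"
  where "monic C a b f \<longleftrightarrow> (\<forall>x\<in>Ob C. inj_on (\<lambda>h. Cmp C x a b f h) (arr C x a))"

definition epic :: "('o, 'm, 'z) pcat_scheme \<Rightarrow> 'o \<Rightarrow> 'o \<Rightarrow> 'm \<Rightarrow> bool"
  where "epic C a b f \<longleftrightarrow> (\<forall>x\<in>Ob C. inj_on (\<lambda>h. Cmp C a b x h f) (arr C b x))"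

definition abelian_category :: "('o, 'm, 'z) pcat_scheme \<Rightarrow> bool"
  where "abelian_category C \<longleftrightarrow> additive_category C \<and>
    (\<forall>a\<in>Ob C. \<forall>b\<in>Ob C. \<forall>f\<in>arr C a b.
      (\<exists>k i. is_kernel C a b f k i) \<and> (\<exists>k p. is_cokernel C a b f k p) \<and>
      (monic C a b f \<longrightarrow> (\<exists>c\<in>Ob C. \<exists>g\<in>arr C b c. is_kernel C b c g a f)) \<and>
      (epic C a b f \<longrightarrow> (\<exists>c\<in>Ob C. \<exists>g\<in>arr C c a. is_cokernel C c a g b f)))"

definition short_exact :: "('o, 'm, 'z) pcat_scheme \<Rightarrow> 'o \<Rightarrow> 'o \<Rightarrow> 'o \<Rightarrow> 'm \<Rightarrow> 'm \<Rightarrow> bool"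
  where "short_exact C a b c f g \<longleftrightarrow> a \<in> Ob C \<and> b \<in> Ob C \<and> c \<in> Ob C \<and>
    f \<in> arr C a b \<and> g \<in> arr C b c \<and> is_kernel C b c g a f \<and> is_cokernel C a b f c g"


section \<open>Additive functors\<close>

record ('o1, 'm1, 'o2, 'm2) cfunctor =
  fobj :: "'o1 \<Rightarrow> 'o2"
  fmap :: "'o1 \<Rightarrow> 'o1 \<Rightarrow> 'm1 \<Rightarrow> 'm2"

definition additive_functor ::
  "('o1, 'm1, 'z1) pcat_scheme \<Rightarrow> ('o2, 'm2, 'z2) pcat_scheme
    \<Rightarrow> ('o1, 'm1, 'o2, 'm2) cfunctor \<Rightarrow> bool"
  where "additive_functor C D F \<longleftrightarrow>
    (\<forall>a\<in>Ob C. fobj F a \<in> Ob D) \<and>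
    (\<forall>a\<in>Ob C. \<forall>b\<in>Ob C. fmap F a b \<in> hom (Hom C a b) (Hom D (fobj F a) (fobj F b))) \<and>
    (\<forall>a\<in>Ob C. fmap F a a (Idt C a) = Idt D (fobj F a)) \<and>
    (\<forall>a\<in>Ob C. \<forall>b\<in>Ob C. \<forall>c\<in>Ob C. \<forall>f\<in>arr C a b. \<forall>g\<in>arr C b c.
      fmap F a c (Cmp C a b c g f)
        = Cmp D (fobj F a) (fobj F b) (fobj F c) (fmap F b c g) (fmap F a b f))"

definition fid :: "('o, 'm, 'o, 'm) cfunctor"
  where "fid = \<lparr>fobj = (\<lambda>a. a), fmap = (\<lambda>a b f. f)\<rparr>"

definition fcomp ::
  "('o2, 'm2, 'o3, 'm3) cfunctor \<Rightarrow> ('o1, 'm1, 'o2, 'm2) cfunctor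
    \<Rightarrow> ('o1, 'm1, 'o3, 'm3) cfunctor"  (infixl \<open>\<circ>\<^sub>F\<close> 55)
  where "G \<circ>\<^sub>F F = \<lparr>fobj = (\<lambda>a. fobj G (fobj F a)),
    fmap = (\<lambda>a b f. fmap G (fobj F a) (fobj F b) (fmap F a b f))\<rparr>"

definition nat_isomorphic ::
  "('o1, 'm1, 'z1) pcat_scheme \<Rightarrow> ('o2, 'm2, 'z2) pcat_scheme
    \<Rightarrow> ('o1, 'm1, 'o2, 'm2) cfunctor \<Rightarrow> ('o1, 'm1, 'o2, 'm2) cfunctor \<Rightarrow> bool"
  where "nat_isomorphic C D F G \<longleftrightarrow> (\<exists>\<eta>.
    (\<forall>a\<in>Ob C. iso_arr D (fobj F a) (fobj G a) (\<eta> a)) \<and>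
    (\<forall>a\<in>Ob C. \<forall>b\<in>Ob C. \<forall>f\<in>arr C a b.
      Cmp D (fobj F a) (fobj F b) (fobj G b) (\<eta> b) (fmap F a b f)
        = Cmp D (fobj F a) (fobj G a) (fobj G b) (fmap G a b f) (\<eta> a)))"

definition equivalence_pair ::
  "('o1, 'm1, 'z1) pcat_scheme \<Rightarrow> ('o2, 'm2, 'z2) pcat_scheme
    \<Rightarrow> ('o1, 'm1, 'o2, 'm2) cfunctor \<Rightarrow> ('o2, 'm2, 'o1, 'm1) cfunctor \<Rightarrow> bool"
  where "equivalence_pair C D F G \<longleftrightarrow> additive_functor C D F \<and> additive_functor D C G \<and>
    nat_isomorphic C C (G \<circ>\<^sub>F F) fid \<and> nat_isomorphic D D (F \<circ>\<^sub>F G) fid"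

definition fully_faithful ::
  "('o1, 'm1, 'z1) pcat_scheme \<Rightarrow> ('o2, 'm2, 'z2) pcat_scheme
    \<Rightarrow> ('o1, 'm1, 'o2, 'm2) cfunctor \<Rightarrow> bool"
  where "fully_faithful C D F \<longleftrightarrow> (\<forall>a\<in>Ob C. \<forall>b\<in>Ob C.
    bij_betw (fmap F a b) (arr C a b) (arr D (fobj F a) (fobj F b)))"

text \<open>\<open>adjoint C D L G\<close>: the functor \<open>L : C \<rightarrow> D\<close> is left adjoint to \<open>G : D \<rightarrow> C\<close>.\<close>

definition adjoint ::
  "('o1, 'm1, 'z1) pcat_scheme \<Rightarrow> ('o2, 'm2, 'z2) pcat_scheme
    \<Rightarrow> ('o1, 'm1, 'o2, 'm2) cfunctor \<Rightarrow> ('o2, 'm2, 'o1, 'm1) cfunctor \<Rightarrow> bool"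
  where "adjoint C D L G \<longleftrightarrow> (\<exists>\<phi>.
    (\<forall>c\<in>Ob C. \<forall>d\<in>Ob D. bij_betw (\<phi> c d) (arr D (fobj L c) d) (arr C c (fobj G d))) \<and>
    (\<forall>c\<in>Ob C. \<forall>c'\<in>Ob C. \<forall>d\<in>Ob D. \<forall>d'\<in>Ob D.
      \<forall>f\<in>arr C c' c. \<forall>g\<in>arr D (fobj L c) d. \<forall>h\<in>arr D d d'.
        \<phi> c' d' (Cmp D (fobj L c') d d' h (Cmp D (fobj L c') (fobj L c) d g (fmap L c' c f)))
          = Cmp C c' (fobj G d) (fobj G d') (fmap G d d' h)
              (Cmp C c' c (fobj G d) (\<phi> c d g) f)))"

definition exact_functor ::
  "('o1, 'm1, 'z1) pcat_scheme \<Rightarrow> ('o2, 'm2, 'z2) pcat_scheme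
    \<Rightarrow> ('o1, 'm1, 'o2, 'm2) cfunctor \<Rightarrow> bool"
  where "exact_functor C D F \<longleftrightarrow> additive_functor C D F \<and>
    (\<forall>a b c f g. short_exact C a b c f g \<longrightarrow>
      short_exact D (fobj F a) (fobj F b) (fobj F c) (fmap F a b f) (fmap F b c g))"

text \<open>
  \<open>recollement B A C iu il is js ju jl\<close> has left term \<open>B\<close>, middle term \<open>A\<close>, right term
  \<open>C\<close> and adjoint triples \<open>(iu, il, is) = (i\<^sup>*, i\<^sub>*, i\<^sup>!)\<close> and
  \<open>(js, ju, jl) = (j\<^sub>!, j\<^sup>*, j\<^sub>*)\<close>.  The image of \<open>i\<^sub>*\<close> is the essential image.
\<close>

definition recollement ::
  "('ob, 'mb, 'zb) pcat_scheme \<Rightarrow> ('oa, 'ma, 'za) pcat_scheme \<Rightarrow> ('oc, 'mc, 'zc) pcat_scheme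
    \<Rightarrow> ('oa, 'ma, 'ob, 'mb) cfunctor \<Rightarrow> ('ob, 'mb, 'oa, 'ma) cfunctor
    \<Rightarrow> ('oa, 'ma, 'ob, 'mb) cfunctor
    \<Rightarrow> ('oc, 'mc, 'oa, 'ma) cfunctor \<Rightarrow> ('oa, 'ma, 'oc, 'mc) cfunctor
    \<Rightarrow> ('oc, 'mc, 'oa, 'ma) cfunctor \<Rightarrow> bool"
  where "recollement B A C iu il is js ju jl \<longleftrightarrow>
    abelian_category B \<and> abelian_category A \<and> abelian_category C \<and>
    additive_functor A B iu \<and> additive_functor B A il \<and> additive_functor A B is \<and>
    additive_functor C A js \<and> additive_functor A C ju \<and> additive_functor C A jl \<and>
    adjoint A B iu il \<and> adjoint B A il is \<and>
    adjoint C A js ju \<and> adjoint A C ju jl \<and>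
    (\<forall>a\<in>Ob A. zero_object C (fobj ju a) \<longleftrightarrow> (\<exists>b\<in>Ob B. isomorphic A a (fobj il b))) \<and>
    fully_faithful B A il \<and> fully_faithful C A js \<and> fully_faithful C A jl"


section \<open>Constructions on categories\<close>

definition opp :: "('o, 'm, 'z) pcat_scheme \<Rightarrow> ('o, 'm, 'z) pcat_scheme"
  where "opp C = C\<lparr>Hom := (\<lambda>a b. Hom C b a), Cmp := (\<lambda>a b c g f. Cmp C c b a f g)\<rparr>"

definition full_subcat :: "('o, 'm) pcat \<Rightarrow> 'o set \<Rightarrow> ('o, 'm) pcat"
  where "full_subcat C B = C\<lparr>Ob := B\<rparr>"

text \<open>The inclusion of a full subcategory.\<close>

abbreviation incl :: "('o, 'm, 'o, 'm) cfunctor"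
  where "incl \<equiv> fid"

definition fact_ideal :: "('o, 'm, 'z) pcat_scheme \<Rightarrow> 'o set \<Rightarrow> 'o \<Rightarrow> 'o \<Rightarrow> 'm set"
  where "fact_ideal C B a b =
    {Cmp C a x b g f | x f g. x \<in> B \<and> f \<in> arr C a x \<and> g \<in> arr C x b}"

definition quotient_proj :: "('o, 'm, 'z) pcat_scheme \<Rightarrow> 'o set \<Rightarrow> ('o, 'm, 'o, 'm set) cfunctor"
  where "quotient_proj C B = \<lparr>fobj = (\<lambda>a. a),
    fmap = (\<lambda>a b f. fact_ideal C B a b #>\<^bsub>Hom C a b\<^esub> f)\<rparr>"

text \<open>
  The composite of two cosets is the common coset of all composites of representatives;
  it is written as the union of these (equal) cosets, and likewise for the maps on
  quotient groups below.
\<close>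

definition quotient_cat :: "('o, 'm, 'z) pcat_scheme \<Rightarrow> 'o set \<Rightarrow> ('o, 'm set) pcat"
  where "quotient_cat C B = \<lparr>Ob = Ob C,
    Hom = (\<lambda>a b. Hom C a b Mod fact_ideal C B a b),
    Idt = (\<lambda>a. fmap (quotient_proj C B) a a (Idt C a)),
    Cmp = (\<lambda>a b c Y X. \<Union>g\<in>Y. \<Union>f\<in>X. fmap (quotient_proj C B) a c (Cmp C a b c g f))\<rparr>"


subsection \<open>Categories over a commutative ring\<close>

record ('o, 'm, 'r) rcat = "('o, 'm) pcat" +
  Scal :: "'o \<Rightarrow> 'o \<Rightarrow> 'r \<Rightarrow> 'm \<Rightarrow> 'm"

text \<open>The multiplicative fields of the library's module record are irrelevant.\<close>

definition hom_module :: "('o, 'm, 'r) rcat \<Rightarrow> 'o \<Rightarrow> 'o \<Rightarrow> ('r, 'm) module"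
  where "hom_module C a b = \<lparr>carrier = arr C a b, mult = undefined, one = undefined,
    ring.zero = zero_arr C a b, add = mult (Hom C a b), smult = Scal C a b\<rparr>"

definition R_category :: "'r ring \<Rightarrow> ('o, 'm, 'r) rcat \<Rightarrow> bool"
  where "R_category R C \<longleftrightarrow> preadditive_category C \<and>
    (\<forall>a\<in>Ob C. \<forall>b\<in>Ob C. module R (hom_module C a b)) \<and>
    (\<forall>a\<in>Ob C. \<forall>b\<in>Ob C. \<forall>c\<in>Ob C. \<forall>f\<in>arr C a b. \<forall>g\<in>arr C b c. \<forall>r\<in>carrier R.
      Cmp C a b c (Scal C b c r g) f = Scal C a c r (Cmp C a b c g f) \<and>
      Cmp C a b c g (Scal C a b r f) = Scal C a c r (Cmp C a b c g f))"

definition ropp :: "('o, 'm, 'r) rcat \<Rightarrow> ('o, 'm, 'r) rcat"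
  where "ropp C = (opp C)\<lparr>Scal := (\<lambda>a b. Scal C b a)\<rparr>"

definition rtensor_rel :: "'r ring \<Rightarrow> ('r, 'x) module \<Rightarrow> ('r, 'y) module \<Rightarrow> ('x \<times> 'y \<Rightarrow>\<^sub>0 int) set"
  where "rtensor_rel R X Y = generate (free_Abelian_group (carrier X \<times> carrier Y))
    ({frag_of (x \<oplus>\<^bsub>X\<^esub> x', y) - frag_of (x, y) - frag_of (x', y) | x x' y.
        x \<in> carrier X \<and> x' \<in> carrier X \<and> y \<in> carrier Y} \<union>
     {frag_of (x, y \<oplus>\<^bsub>Y\<^esub> y') - frag_of (x, y) - frag_of (x, y') | x y y'.
        x \<in> carrier X \<and> y \<in> carrier Y \<and> y' \<in> carrier Y} \<union>
     {frag_of (r \<odot>\<^bsub>X\<^esub> x, y) - frag_of (x, r \<odot>\<^bsub>Y\<^esub> y) | r x y.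
        r \<in> carrier R \<and> x \<in> carrier X \<and> y \<in> carrier Y})"

definition rtensor :: "'r ring \<Rightarrow> ('r, 'x) module \<Rightarrow> ('r, 'y) module \<Rightarrow> ('x \<times> 'y \<Rightarrow>\<^sub>0 int) set monoid"
  where "rtensor R X Y = free_Abelian_group (carrier X \<times> carrier Y) Mod rtensor_rel R X Y"

definition rtensor_class ::
  "'r ring \<Rightarrow> ('r, 'x) module \<Rightarrow> ('r, 'y) module \<Rightarrow> ('x \<times> 'y \<Rightarrow>\<^sub>0 int) \<Rightarrow> ('x \<times> 'y \<Rightarrow>\<^sub>0 int) set"
  where "rtensor_class R X Y s =
    rtensor_rel R X Y #>\<^bsub>free_Abelian_group (carrier X \<times> carrier Y)\<^esub> s"

text \<open>
  The category \<open>A \<otimes>\<^sub>R B\<close>; composition is the biadditive extension of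
  \<open>(x \<otimes> y) \<circ> (x' \<otimes> y') = (x \<circ> x') \<otimes> (y \<circ> y')\<close>.
\<close>

definition tensor_cat ::
  "'r ring \<Rightarrow> ('o1, 'm1, 'r) rcat \<Rightarrow> ('o2, 'm2, 'r) rcat
    \<Rightarrow> ('o1 \<times> 'o2, ('m1 \<times> 'm2 \<Rightarrow>\<^sub>0 int) set) pcat"
  where "tensor_cat R A B = \<lparr>Ob = Ob A \<times> Ob B,
    Hom = (\<lambda>(a, b) (a', b'). rtensor R (hom_module A a a') (hom_module B b b')),
    Idt = (\<lambda>(a, b). rtensor_class R (hom_module A a a) (hom_module B b b)
             (frag_of (Idt A a, Idt B b))),
    Cmp = (\<lambda>(a, b) (a', b') (a'', b'') Y X. \<Union>s\<in>Y. \<Union>s'\<in>X.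
             rtensor_class R (hom_module A a a'') (hom_module B b b'')
               (frag_extend (\<lambda>(x, y). frag_extend (\<lambda>(x', y').
                  frag_of (Cmp A a a' a'' x x', Cmp B b b' b'' y y')) s') s))\<rparr>"


section \<open>Modules over a preadditive category\<close>

text \<open>
  \<open>Ab\<close> consists of all abelian groups whose carrier is a subset of the type \<open>'v\<close>, which
  plays the role of the universe.  Group homomorphisms are extensional functions, so that
  morphisms are equal iff they agree on the source.
\<close>

definition Ab_hom :: "'v monoid \<Rightarrow> 'w monoid \<Rightarrow> ('v \<Rightarrow> 'w) monoid"
  where "Ab_hom G H = \<lparr>carrier = hom G H \<inter> extensional (carrier G),
    mult = (\<lambda>f g. \<lambda>x\<in>carrier G. f x \<otimes>\<^bsub>H\<^esub> g x),
    one = (\<lambda>x\<in>carrier G. \<one>\<^bsub>H\<^esub>)\<rparr>"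

definition Ab :: "('v monoid, 'v \<Rightarrow> 'v) pcat"
  where "Ab = \<lparr>Ob = {G. comm_group G}, Hom = Ab_hom, Idt = (\<lambda>G. \<lambda>x\<in>carrier G. x),
    Cmp = (\<lambda>G H K g f. compose (carrier G) g f)\<rparr>"

type_synonym ('o, 'm, 'v) cmod = "('o, 'm, 'v monoid, 'v \<Rightarrow> 'v) cfunctor"

text \<open>
  The group \<open>Hom\<^bsub>Mod(A)\<^esub>(F, N)\<close> of natural transformations.  The values of \<open>F\<close> and \<open>N\<close> may
  live in different types, since representable functors take values in the morphism type.
\<close>

definition nat_group ::
  "('o, 'm, 'z) pcat_scheme \<Rightarrow> ('o, 'm, 'w) cmod \<Rightarrow> ('o, 'm, 'v) cmod \<Rightarrow> ('o \<Rightarrow> 'w \<Rightarrow> 'v) monoid"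
  where "nat_group A F N = \<lparr>carrier = {\<eta> \<in> extensional (Ob A).
      (\<forall>a\<in>Ob A. \<eta> a \<in> carrier (Ab_hom (fobj F a) (fobj N a))) \<and>
      (\<forall>a\<in>Ob A. \<forall>b\<in>Ob A. \<forall>f\<in>arr A a b. \<forall>x\<in>carrier (fobj F a).
        \<eta> b (fmap F a b f x) = fmap N a b f (\<eta> a x))},
    mult = (\<lambda>\<eta> \<theta>. \<lambda>a\<in>Ob A. \<eta> a \<otimes>\<^bsub>Ab_hom (fobj F a) (fobj N a)\<^esub> \<theta> a),
    one = (\<lambda>a\<in>Ob A. \<one>\<^bsub>Ab_hom (fobj F a) (fobj N a)\<^esub>)\<rparr>"

definition ModCat :: "('o, 'm, 'z) pcat_scheme \<Rightarrow> (('o, 'm, 'v) cmod, 'o \<Rightarrow> 'v \<Rightarrow> 'v) pcat"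
  where "ModCat A = \<lparr>Ob = {N. additive_functor A Ab N}, Hom = nat_group A,
    Idt = (\<lambda>N. \<lambda>a\<in>Ob A. Idt Ab (fobj N a)),
    Cmp = (\<lambda>F G H \<theta> \<eta>. \<lambda>a\<in>Ob A. Cmp Ab (fobj F a) (fobj G a) (fobj H a) (\<theta> a) (\<eta> a))\<rparr>"


subsection \<open>Smallness\<close>

text \<open>
  A set \<open>X\<close> is small relative to the universe \<open>'v\<close> if \<open>X\<close>-indexed powers of \<open>'v\<close> still fit
  into \<open>'v\<close>, that is, if \<open>Ab\<close> over \<open>'v\<close> has \<open>X\<close>-indexed products.
\<close>

definition small :: "'v itself \<Rightarrow> 'a set \<Rightarrow> bool"
  where "small _ X \<longleftrightarrow> (\<exists>e :: ('a \<Rightarrow> 'v) \<Rightarrow> 'v. inj_on e (X \<rightarrow>\<^sub>E UNIV))"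

definition skeletally_small :: "'v itself \<Rightarrow> ('o, 'm, 'z) pcat_scheme \<Rightarrow> bool"
  where "skeletally_small V C \<longleftrightarrow> (\<exists>S\<subseteq>Ob C. small V S \<and>
    (\<forall>a\<in>S. \<forall>b\<in>S. small V (arr C a b)) \<and> (\<forall>a\<in>Ob C. \<exists>s\<in>S. isomorphic C a s))"


text \<open>
  For every type \<open>'a\<close> the infinite universe \<open>'a list \<Rightarrow> bool\<close> makes all sets that embed into
  \<open>'a\<close> small.
\<close>

lemma small_list_powertype:
  fixes X :: "'b set" and g :: "'b \<Rightarrow> 'a"
  assumes g: "inj_on g X"
  shows "small TYPE('a list \<Rightarrow> bool) X"
proof -
  define e :: "('b \<Rightarrow> 'a list \<Rightarrow> bool) \<Rightarrow> 'a list \<Rightarrow> bool" where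
    "e f xs = (case xs of [] \<Rightarrow> False | x # ys \<Rightarrow> f (inv_into X g x) ys)" for f xs
  have "inj_on e (X \<rightarrow>\<^sub>E UNIV)"
  proof (rule inj_onI)
    fix f f' assume f: "f \<in> X \<rightarrow>\<^sub>E UNIV" "f' \<in> X \<rightarrow>\<^sub>E UNIV" and eq: "e f = e f'"
    have "f x = f' x" if "x \<in> X" for x
    proof
      fix ys
      have "e f (g x # ys) = e f' (g x # ys)" using eq by simp
      then show "f x ys = f' x ys" using that g by (simp add: e_def)
    qed
    then show "f = f'" by (rule PiE_ext[OF f])
  qed
  then show ?thesis unfolding small_def by blast
qed


subsection \<open>The tensor product of modules\<close>

text \<open>
  For \<open>F\<close> in \<open>Mod(A\<^sup>o\<^sup>p)\<close> and \<open>N\<close> in \<open>Mod(A)\<close>, the group \<open>F \<otimes>\<^sub>A N\<close> is generated by symbols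
  \<open>(a, x, y) = x \<otimes> y\<close> with \<open>x \<in> F(a)\<close>, \<open>y \<in> N(a)\<close>, biadditive and subject to
  \<open>F(f)(x) \<otimes> y = x \<otimes> N(f)(y)\<close> for \<open>f : a \<rightarrow> b\<close>, \<open>x \<in> F(b)\<close>, \<open>y \<in> N(a)\<close>.
\<close>

definition tensor_gen ::
  "('o, 'm, 'z) pcat_scheme \<Rightarrow> ('o, 'm, 'w) cmod \<Rightarrow> ('o, 'm, 'v) cmod \<Rightarrow> ('o \<times> 'w \<times> 'v) set"
  where "tensor_gen A F N =
    {(a, x, y). a \<in> Ob A \<and> x \<in> carrier (fobj F a) \<and> y \<in> carrier (fobj N a)}"

definition tensor_rels ::
  "('o, 'm, 'z) pcat_scheme \<Rightarrow> ('o, 'm, 'w) cmod \<Rightarrow> ('o, 'm, 'v) cmod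
    \<Rightarrow> ('o \<times> 'w \<times> 'v \<Rightarrow>\<^sub>0 int) set"
  where "tensor_rels A F N =
    {frag_of (a, x \<otimes>\<^bsub>fobj F a\<^esub> x', y) - frag_of (a, x, y) - frag_of (a, x', y) | a x x' y.
       a \<in> Ob A \<and> x \<in> carrier (fobj F a) \<and> x' \<in> carrier (fobj F a) \<and> y \<in> carrier (fobj N a)} \<union>
    {frag_of (a, x, y \<otimes>\<^bsub>fobj N a\<^esub> y') - frag_of (a, x, y) - frag_of (a, x, y') | a x y y'.
       a \<in> Ob A \<and> x \<in> carrier (fobj F a) \<and> y \<in> carrier (fobj N a) \<and> y' \<in> carrier (fobj N a)} \<union>
    {frag_of (a, fmap F b a f x, y) - frag_of (b, x, fmap N a b f y) | a b f x y.
       a \<in> Ob A \<and> b \<in> Ob A \<and> f \<in> arr A a b \<and> x \<in> carrier (fobj F b) \<and> y \<in> carrier (fobj N a)}"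

definition tensor_rel ::
  "('o, 'm, 'z) pcat_scheme \<Rightarrow> ('o, 'm, 'w) cmod \<Rightarrow> ('o, 'm, 'v) cmod
    \<Rightarrow> ('o \<times> 'w \<times> 'v \<Rightarrow>\<^sub>0 int) set"
  where "tensor_rel A F N =
    generate (free_Abelian_group (tensor_gen A F N)) (tensor_rels A F N)"

definition tensor ::
  "('o, 'm, 'z) pcat_scheme \<Rightarrow> ('o, 'm, 'w) cmod \<Rightarrow> ('o, 'm, 'v) cmod
    \<Rightarrow> ('o \<times> 'w \<times> 'v \<Rightarrow>\<^sub>0 int) set monoid"
  where "tensor A F N = free_Abelian_group (tensor_gen A F N) Mod tensor_rel A F N"

definition tensor_class ::
  "('o, 'm, 'z) pcat_scheme \<Rightarrow> ('o, 'm, 'w) cmod \<Rightarrow> ('o, 'm, 'v) cmod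
    \<Rightarrow> ('o \<times> 'w \<times> 'v \<Rightarrow>\<^sub>0 int) \<Rightarrow> ('o \<times> 'w \<times> 'v \<Rightarrow>\<^sub>0 int) set"
  where "tensor_class A F N s =
    tensor_rel A F N #>\<^bsub>free_Abelian_group (tensor_gen A F N)\<^esub> s"

lemma comm_group_tensor: "comm_group (tensor A F N)"
  and tensor_rel_normal: "tensor_rel A F N \<lhd> free_Abelian_group (tensor_gen A F N)"
  if F: "additive_functor (opp A) Ab F" and N: "additive_functor A Ab N"
proof -
  let ?Z = "free_Abelian_group (tensor_gen A F N)"
  interpret Z: comm_group ?Z by (rule abelian_free_Abelian_group)
  have gF: "comm_group (fobj F a)" if "a \<in> Ob A" for a
    using F that by (auto simp: additive_functor_def Ab_def opp_def)
  have gN: "comm_group (fobj N a)" if "a \<in> Ob A" for a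
    using N that by (auto simp: additive_functor_def Ab_def)
  have cF: "fmap F b a f x \<in> carrier (fobj F a)"
    if "a \<in> Ob A" "b \<in> Ob A" "f \<in> arr A a b" "x \<in> carrier (fobj F b)" for a b f x
  proof -
    have "fmap F b a \<in> hom (Hom A a b) (Ab_hom (fobj F b) (fobj F a))"
      using F that by (auto simp: additive_functor_def Ab_def opp_def)
    then show ?thesis using that by (auto simp: hom_def Ab_hom_def Pi_iff)
  qed
  have cN: "fmap N a b f x \<in> carrier (fobj N b)"
    if "a \<in> Ob A" "b \<in> Ob A" "f \<in> arr A a b" "x \<in> carrier (fobj N a)" for a b f x
  proof -
    have "fmap N a b \<in> hom (Hom A a b) (Ab_hom (fobj N a) (fobj N b))"
      using N that by (auto simp: additive_functor_def Ab_def)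
    then show ?thesis using that by (auto simp: hom_def Ab_hom_def Pi_iff)
  qed
  have mF: "x \<otimes>\<^bsub>fobj F a\<^esub> x' \<in> carrier (fobj F a)"
    if "a \<in> Ob A" "x \<in> carrier (fobj F a)" "x' \<in> carrier (fobj F a)" for a x x'
    using gF[OF that(1)] that by (meson comm_group.axioms(2) group.is_monoid monoid.m_closed)
  have mN: "x \<otimes>\<^bsub>fobj N a\<^esub> x' \<in> carrier (fobj N a)"
    if "a \<in> Ob A" "x \<in> carrier (fobj N a)" "x' \<in> carrier (fobj N a)" for a x x'
    using gN[OF that(1)] that by (meson comm_group.axioms(2) group.is_monoid monoid.m_closed)
  have d: "s - t \<in> carrier ?Z" if "s \<in> carrier ?Z" "t \<in> carrier ?Z" for s t
    using that keys_diff[of s t] by auto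
  have "tensor_rels A F N \<subseteq> carrier ?Z"
    unfolding tensor_rels_def
    by (intro Un_least subsetI; clarify; intro d; simp add: tensor_gen_def mF mN cF cN)
  then have "subgroup (tensor_rel A F N) ?Z"
    unfolding tensor_rel_def by (rule Z.generate_is_subgroup)
  then show "tensor_rel A F N \<lhd> ?Z" by (rule Z.subgroup_imp_normal)
  show "comm_group (tensor A F N)"
    unfolding tensor_def by (rule Z.abelian_FactGroup) fact
qed

text \<open>
  The universal property.  It says that homomorphisms \<open>F \<otimes>\<^sub>A N \<rightarrow> G\<close> are the same as natural
  transformations from \<open>F\<close> to \<open>Hom(N -, G)\<close>, or from \<open>N\<close> to \<open>Hom(F -, G)\<close>, so \<open>\<otimes>\<^sub>A\<close> is right
  exact and preserves coproducts in each variable.  Together with \<open>tensor_yoneda_left\<close> and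
  \<open>tensor_yoneda_right\<close> below this is the usual characterization of \<open>\<otimes>\<^sub>A\<close> up to isomorphism.
\<close>

lemma tensor_universal:
  fixes F :: "('o, 'm, 'w) cmod" and N :: "('o, 'm, 'v) cmod" and G :: "'g monoid"
  assumes F: "additive_functor (opp A) Ab F" and N: "additive_functor A Ab N"
    and G: "comm_group G"
    and cl: "\<And>a x y. (a, x, y) \<in> tensor_gen A F N \<Longrightarrow> \<beta> a x y \<in> carrier G"
    and add_left: "\<And>a x x' y. (a, x, y) \<in> tensor_gen A F N \<Longrightarrow> (a, x', y) \<in> tensor_gen A F N
      \<Longrightarrow> \<beta> a (x \<otimes>\<^bsub>fobj F a\<^esub> x') y = \<beta> a x y \<otimes>\<^bsub>G\<^esub> \<beta> a x' y"
    and add_right: "\<And>a x y y'. (a, x, y) \<in> tensor_gen A F N \<Longrightarrow> (a, x, y') \<in> tensor_gen A F N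
      \<Longrightarrow> \<beta> a x (y \<otimes>\<^bsub>fobj N a\<^esub> y') = \<beta> a x y \<otimes>\<^bsub>G\<^esub> \<beta> a x y'"
    and bal: "\<And>a b f x y. a \<in> Ob A \<Longrightarrow> b \<in> Ob A \<Longrightarrow> f \<in> arr A a b \<Longrightarrow> x \<in> carrier (fobj F b)
      \<Longrightarrow> y \<in> carrier (fobj N a) \<Longrightarrow> \<beta> a (fmap F b a f x) y = \<beta> b x (fmap N a b f y)"
  shows "\<exists>!h. h \<in> carrier (Ab_hom (tensor A F N) G) \<and>
    (\<forall>(a, x, y) \<in> tensor_gen A F N. h (tensor_class A F N (frag_of (a, x, y))) = \<beta> a x y)"
proof -
  let ?S = "tensor_gen A F N"
  let ?Z = "free_Abelian_group ?S"
  interpret Z: comm_group ?Z by (rule abelian_free_Abelian_group)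
  interpret G: comm_group G by fact
  have nrm: "tensor_rel A F N \<lhd> ?Z" by (rule tensor_rel_normal[OF F N])
  then have sub: "subgroup (tensor_rel A F N) ?Z" by (rule normal_imp_subgroup)
  have gF: "comm_group (fobj F a)" if "a \<in> Ob A" for a
    using F that by (auto simp: additive_functor_def Ab_def opp_def)
  have gN: "comm_group (fobj N a)" if "a \<in> Ob A" for a
    using N that by (auto simp: additive_functor_def Ab_def)
  have cF: "fmap F b a f x \<in> carrier (fobj F a)"
    if "a \<in> Ob A" "b \<in> Ob A" "f \<in> arr A a b" "x \<in> carrier (fobj F b)" for a b f x
  proof -
    have "fmap F b a \<in> hom (Hom A a b) (Ab_hom (fobj F b) (fobj F a))"
      using F that by (auto simp: additive_functor_def Ab_def opp_def)
    then show ?thesis using that by (auto simp: hom_def Ab_hom_def Pi_iff)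
  qed
  have cN: "fmap N a b f x \<in> carrier (fobj N b)"
    if "a \<in> Ob A" "b \<in> Ob A" "f \<in> arr A a b" "x \<in> carrier (fobj N a)" for a b f x
  proof -
    have "fmap N a b \<in> hom (Hom A a b) (Ab_hom (fobj N a) (fobj N b))"
      using N that by (auto simp: additive_functor_def Ab_def)
    then show ?thesis using that by (auto simp: hom_def Ab_hom_def Pi_iff)
  qed
  have mF: "x \<otimes>\<^bsub>fobj F a\<^esub> x' \<in> carrier (fobj F a)"
    if "a \<in> Ob A" "x \<in> carrier (fobj F a)" "x' \<in> carrier (fobj F a)" for a x x'
    using gF[OF that(1)] that by (meson comm_group.axioms(2) group.is_monoid monoid.m_closed)
  have mN: "x \<otimes>\<^bsub>fobj N a\<^esub> x' \<in> carrier (fobj N a)"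
    if "a \<in> Ob A" "x \<in> carrier (fobj N a)" "x' \<in> carrier (fobj N a)" for a x x'
    using gN[OF that(1)] that by (meson comm_group.axioms(2) group.is_monoid monoid.m_closed)
  have "(\<lambda>(a, x, y). \<beta> a x y) ` ?S \<subseteq> carrier G" using cl by auto
  then obtain h0 where h0: "h0 \<in> hom ?Z G"
    and h0_of: "\<And>p. p \<in> ?S \<Longrightarrow> h0 (frag_of p) = (\<lambda>(a, x, y). \<beta> a x y) p"
    using G.free_Abelian_group_universal[of "\<lambda>(a, x, y). \<beta> a x y" ?S] by blast
  interpret h0: group_hom ?Z G h0
    by (simp add: group_hom_def group_hom_axioms_def h0 Z.is_group G.is_group)
  have diff: "s - t \<in> carrier ?Z \<and> h0 (s - t) = h0 s \<otimes>\<^bsub>G\<^esub> inv\<^bsub>G\<^esub> (h0 t)"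
    if "s \<in> carrier ?Z" "t \<in> carrier ?Z" for s t
  proof -
    have e: "s - t = s \<otimes>\<^bsub>?Z\<^esub> inv\<^bsub>?Z\<^esub> t" using that by simp
    show ?thesis unfolding e using that by (metis Z.inv_closed Z.m_closed h0.hom_inv h0.hom_mult)
  qed
  have three: "frag_of p - frag_of q - frag_of r \<in> kernel ?Z G h0"
    if "p \<in> ?S" "q \<in> ?S" "r \<in> ?S" "h0 (frag_of p) = h0 (frag_of q) \<otimes>\<^bsub>G\<^esub> h0 (frag_of r)" for p q r
  proof -
    have c: "frag_of p \<in> carrier ?Z" "frag_of q \<in> carrier ?Z" "frag_of r \<in> carrier ?Z"
      using that by auto
    have "h0 (frag_of p - frag_of q - frag_of r)
        = h0 (frag_of q) \<otimes>\<^bsub>G\<^esub> h0 (frag_of r) \<otimes>\<^bsub>G\<^esub> inv\<^bsub>G\<^esub> h0 (frag_of q) \<otimes>\<^bsub>G\<^esub> inv\<^bsub>G\<^esub> h0 (frag_of r)"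
      using diff c that(4) by simp
    also have "\<dots> = \<one>\<^bsub>G\<^esub>"
      using h0.hom_closed[OF c(2)] h0.hom_closed[OF c(3)]
      by (metis G.inv_closed G.inv_mult G.m_assoc G.m_closed G.r_inv)
    finally show ?thesis using diff c by (simp add: kernel_def)
  qed
  have two: "frag_of p - frag_of q \<in> kernel ?Z G h0"
    if "p \<in> ?S" "q \<in> ?S" "h0 (frag_of p) = h0 (frag_of q)" for p q
  proof -
    have c: "frag_of p \<in> carrier ?Z" "frag_of q \<in> carrier ?Z" using that by auto
    have "h0 (frag_of p - frag_of q) = \<one>\<^bsub>G\<^esub>"
      using diff[OF c] that(3) h0.hom_closed[OF c(2)] by simp
    then show ?thesis using diff[OF c] by (simp add: kernel_def)
  qed
  have "tensor_rels A F N \<subseteq> kernel ?Z G h0"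
    unfolding tensor_rels_def
    apply (intro Un_least subsetI; clarify)
      apply (rule three; simp add: h0_of tensor_gen_def mF mN add_left)
     apply (rule three; simp add: h0_of tensor_gen_def mF mN add_right)
    apply (rule two; simp add: h0_of tensor_gen_def cF cN bal)
    done
  then have "tensor_rel A F N \<subseteq> kernel ?Z G h0"
    unfolding tensor_rel_def by (intro Z.generate_subgroup_incl h0.subgroup_kernel)
  then obtain g where g: "g \<in> hom (tensor A F N) G"
    and g_of: "\<And>s. s \<in> carrier ?Z \<Longrightarrow> g (tensor_class A F N s) = h0 s"
    using h0.FactGroup_universal_kernel[OF nrm] unfolding tensor_def tensor_class_def by blast
  have carr: "carrier (tensor A F N) = tensor_class A F N ` carrier ?Z"
    by (auto simp: tensor_def tensor_class_def FactGroup_def RCOSETS_def)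
  have cls_hom: "tensor_class A F N \<in> hom ?Z (tensor A F N)"
    unfolding tensor_def tensor_class_def using normal.r_coset_hom_Mod[OF nrm] by (simp add: eta_contract_eq)
  interpret T: comm_group "tensor A F N" by (rule comm_group_tensor[OF F N])
  show ?thesis
  proof (rule ex1I[where a = "restrict g (carrier (tensor A F N))"])
    have "restrict g (carrier (tensor A F N)) \<in> hom (tensor A F N) G"
      using g by (auto simp: hom_def)
    moreover have "tensor_class A F N (frag_of p) \<in> carrier (tensor A F N)" if "p \<in> ?S" for p
      using that unfolding carr by auto
    ultimately show "restrict g (carrier (tensor A F N)) \<in> carrier (Ab_hom (tensor A F N) G) \<and>
      (\<forall>(a, x, y)\<in>?S. restrict g (carrier (tensor A F N)) (tensor_class A F N (frag_of (a, x, y))) = \<beta> a x y)"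
      using g_of h0_of by (auto simp: Ab_hom_def)
  next
    fix h
    assume h: "h \<in> carrier (Ab_hom (tensor A F N) G) \<and>
      (\<forall>(a, x, y)\<in>?S. h (tensor_class A F N (frag_of (a, x, y))) = \<beta> a x y)"
    then have hh: "h \<in> hom (tensor A F N) G" and hx: "h \<in> extensional (carrier (tensor A F N))"
      by (auto simp: Ab_hom_def)
    interpret k: group_hom ?Z G "h \<circ> tensor_class A F N"
      using hom_compose[OF cls_hom hh]
      by (simp add: group_hom_def group_hom_axioms_def Z.is_group G.is_group)
    have "(h \<circ> tensor_class A F N) s = h0 s" if "Poly_Mapping.keys s \<subseteq> ?S" for s
    proof (rule free_Abelian_group_induct[OF that])
      show "(h \<circ> tensor_class A F N) 0 = h0 0"
        using k.hom_one h0.hom_one by simp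
    next
      fix s t
      assume c: "Poly_Mapping.keys s \<subseteq> ?S" "Poly_Mapping.keys t \<subseteq> ?S"
        and i: "(h \<circ> tensor_class A F N) s = h0 s" "(h \<circ> tensor_class A F N) t = h0 t"
      have c': "s \<in> carrier ?Z" "t \<in> carrier ?Z" using c by auto
      have e: "s - t = s \<otimes>\<^bsub>?Z\<^esub> inv\<^bsub>?Z\<^esub> t" using c by simp
      show "(h \<circ> tensor_class A F N) (s - t) = h0 (s - t)"
        unfolding e using i c' by (metis Z.inv_closed k.hom_inv k.hom_mult h0.hom_inv h0.hom_mult)
    next
      fix p assume "p \<in> ?S"
      then show "(h \<circ> tensor_class A F N) (frag_of p) = h0 (frag_of p)"
        using h h0_of by (cases p) auto
    qed
    then have "h X = g X" if "X \<in> carrier (tensor A F N)" for X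
      using that g_of unfolding carr by auto
    then show "h = restrict g (carrier (tensor A F N))"
      using hx by (auto simp: extensional_def restrict_def)
  qed
qed

text \<open>The map \<open>\<alpha> \<otimes> \<beta> : F \<otimes>\<^sub>A N \<rightarrow> F' \<otimes>\<^sub>A N'\<close>.\<close>

definition tensor_map ::
  "('o, 'm, 'z) pcat_scheme \<Rightarrow> ('o, 'm, 'w) cmod \<Rightarrow> ('o, 'm, 'v) cmod
    \<Rightarrow> ('o, 'm, 'w) cmod \<Rightarrow> ('o, 'm, 'v) cmod \<Rightarrow> ('o \<Rightarrow> 'w \<Rightarrow> 'w) \<Rightarrow> ('o \<Rightarrow> 'v \<Rightarrow> 'v)
    \<Rightarrow> ('o \<times> 'w \<times> 'v \<Rightarrow>\<^sub>0 int) set \<Rightarrow> ('o \<times> 'w \<times> 'v \<Rightarrow>\<^sub>0 int) set"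
  where "tensor_map A F N F' N' \<alpha> \<beta> = (\<lambda>X\<in>carrier (tensor A F N). \<Union>s\<in>X.
    tensor_class A F' N' (frag_extend (\<lambda>(a, x, y). frag_of (a, \<alpha> a x, \<beta> a y)) s))"


subsection \<open>Isomorphic copies inside the universe\<close>

text \<open>
  Tensor products and groups of natural transformations live in types other than \<open>'v\<close>;
  \<open>copy\<close> replaces such a group by a chosen isomorphic abelian group on a subset of \<open>'v\<close>
  (which exists when the group is not larger than \<open>'v\<close>).
\<close>

definition copy :: "'a monoid \<Rightarrow> 'v monoid"
  where "copy G = (SOME H. comm_group H \<and> G \<cong> H)"

definition copy_iso :: "'a monoid \<Rightarrow> 'a \<Rightarrow> 'v"
  where "copy_iso G = (SOME h. h \<in> iso G (copy G :: 'v monoid))"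

definition copy_map :: "'a monoid \<Rightarrow> 'b monoid \<Rightarrow> ('a \<Rightarrow> 'b) \<Rightarrow> 'v \<Rightarrow> 'v"
  where "copy_map G H f = (\<lambda>x\<in>carrier (copy G :: 'v monoid).
    copy_iso H (f (inv_into (carrier G) (copy_iso G) x)))"

definition copy_mod :: "('o, 'm, 'a) cmod \<Rightarrow> ('o, 'm, 'v) cmod"
  where "copy_mod F = \<lparr>fobj = (\<lambda>a. copy (fobj F a)),
    fmap = (\<lambda>a b f. copy_map (fobj F a) (fobj F b) (fmap F a b f))\<rparr>"


subsection \<open>Change of categories\<close>

text \<open>
  Let \<open>P : C \<rightarrow> D\<close> be an additive functor.  For an object \<open>d\<close> of \<open>D\<close>, \<open>rep_right C D P d\<close> is the
  right \<open>C\<close>-module \<open>D(P -, d)\<close> and \<open>rep_left C D P d\<close> is the left \<open>C\<close>-module \<open>D(d, P -)\<close>.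
  For the projection \<open>P : C \<rightarrow> C/I\<close> they are \<open>C(-, d)/I(-, d)\<close> and \<open>C(d, -)/I(d, -)\<close>; for the
  inclusion of a full subcategory \<open>B\<close> they are \<open>C(-, d)|\<^sub>B\<close> and \<open>C(d, -)|\<^sub>B\<close>.
\<close>

definition rep_right ::
  "('o, 'm) pcat \<Rightarrow> ('p, 'n) pcat \<Rightarrow> ('o, 'm, 'p, 'n) cfunctor \<Rightarrow> 'p \<Rightarrow> ('o, 'm, 'n) cmod"
  where "rep_right C D P d = \<lparr>fobj = (\<lambda>a. Hom D (fobj P a) d),
    fmap = (\<lambda>b a f. \<lambda>x\<in>arr D (fobj P b) d.
              Cmp D (fobj P a) (fobj P b) d x (fmap P a b f))\<rparr>"

definition rep_left ::
  "('o, 'm) pcat \<Rightarrow> ('p, 'n) pcat \<Rightarrow> ('o, 'm, 'p, 'n) cfunctor \<Rightarrow> 'p \<Rightarrow> ('o, 'm, 'n) cmod"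
  where "rep_left C D P d = \<lparr>fobj = (\<lambda>a. Hom D d (fobj P a)),
    fmap = (\<lambda>a b f. \<lambda>x\<in>arr D d (fobj P a).
              Cmp D d (fobj P a) (fobj P b) (fmap P a b f) x)\<rparr>"

text \<open>
  The isomorphisms \<open>F \<otimes>\<^sub>A A(a, -) \<cong> F(a)\<close> and \<open>A(-, a) \<otimes>\<^sub>A N \<cong> N(a)\<close>, \<open>x \<otimes> f \<mapsto> F(f)(x)\<close> and
  \<open>f \<otimes> y \<mapsto> N(f)(y)\<close>.
\<close>

lemma rep_left_additive:
  assumes A: "preadditive_category A" and a: "a \<in> Ob A"
  shows "additive_functor A Ab (rep_left A A fid a)"
proof -
  interpret preadditive_category A by fact
  have cl: "Cmp A x y w g f \<in> arr A x w"
    if "x \<in> Ob A" "y \<in> Ob A" "w \<in> Ob A" "f \<in> arr A x y" "g \<in> arr A y w" for x y w f g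
    using Cmp_hom_right[OF that(1-3,5)] that(4) by (auto simp: hom_def)
  have dist: "Cmp A x y w g (f \<otimes>\<^bsub>Hom A x y\<^esub> f') = Cmp A x y w g f \<otimes>\<^bsub>Hom A x w\<^esub> Cmp A x y w g f'"
    if "x \<in> Ob A" "y \<in> Ob A" "w \<in> Ob A" "f \<in> arr A x y" "f' \<in> arr A x y" "g \<in> arr A y w" for x y w f f' g
    using Cmp_hom_right[OF that(1-3,6)] that by (auto simp: hom_def)
  have dist': "Cmp A x y w (g \<otimes>\<^bsub>Hom A y w\<^esub> g') f = Cmp A x y w g f \<otimes>\<^bsub>Hom A x w\<^esub> Cmp A x y w g' f"
    if "x \<in> Ob A" "y \<in> Ob A" "w \<in> Ob A" "f \<in> arr A x y" "g \<in> arr A y w" "g' \<in> arr A y w" for x y w f g g'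
    using Cmp_hom_left[OF that(1-4)] that by (auto simp: hom_def)
  have m: "f \<otimes>\<^bsub>Hom A x y\<^esub> f' \<in> arr A x y"
    if "x \<in> Ob A" "y \<in> Ob A" "f \<in> arr A x y" "f' \<in> arr A x y" for x y f f'
    using Hom_comm_group[OF that(1,2)] that by (meson comm_group.axioms(2) group.is_monoid monoid.m_closed)
  show ?thesis
    unfolding additive_functor_def
  proof (intro conjI ballI)
    fix b assume "b \<in> Ob A"
    then show "fobj (rep_left A A fid a) b \<in> Ob Ab"
      by (simp add: rep_left_def fid_def Ab_def Hom_comm_group a)
  next
    fix b c assume bc: "b \<in> Ob A" "c \<in> Ob A"
    show "fmap (rep_left A A fid a) b c \<in> hom (Hom A b c)
        (Hom Ab (fobj (rep_left A A fid a) b) (fobj (rep_left A A fid a) c))"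
      by (rule homI) (auto simp: rep_left_def fid_def Ab_def Ab_hom_def hom_def a bc cl dist dist' m
          intro!: restrict_ext)
  next
    fix b assume "b \<in> Ob A"
    then show "fmap (rep_left A A fid a) b b (Idt A b) = Idt Ab (fobj (rep_left A A fid a) b)"
      by (auto simp: rep_left_def fid_def Ab_def a Cmp_Idt_left intro!: restrict_ext)
  next
    fix b c d f g
    assume "b \<in> Ob A" "c \<in> Ob A" "d \<in> Ob A" "f \<in> arr A b c" "g \<in> arr A c d"
    then show "fmap (rep_left A A fid a) b d (Cmp A b c d g f) =
      Cmp Ab (fobj (rep_left A A fid a) b) (fobj (rep_left A A fid a) c) (fobj (rep_left A A fid a) d)
        (fmap (rep_left A A fid a) c d g) (fmap (rep_left A A fid a) b c f)"
      by (auto simp: rep_left_def fid_def Ab_def a compose_def cl Cmp_assoc intro!: restrict_ext)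
  qed
qed

lemma preadditive_opp:
  assumes A: "preadditive_category A"
  shows "preadditive_category (opp A)"
proof -
  interpret preadditive_category A by fact
  show ?thesis
    by (rule preadditive_category.intro)
      (auto simp: opp_def Hom_comm_group Idt_arr Cmp_hom_left Cmp_hom_right Cmp_Idt_left
        Cmp_Idt_right Cmp_assoc)
qed

lemma rep_right_additive:
  assumes A: "preadditive_category A" and a: "a \<in> Ob A"
  shows "additive_functor (opp A) Ab (rep_right A A fid a)"
proof -
  have "rep_right A A fid a = rep_left (opp A) (opp A) fid a"
    by (simp add: rep_right_def rep_left_def opp_def fid_def)
  then show ?thesis
    using rep_left_additive[OF preadditive_opp[OF A]] a by (simp add: opp_def)
qed

lemma tensor_class_eqI:
  assumes F: "additive_functor (opp A) Ab F" and N: "additive_functor A Ab N"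
    and s: "s \<in> carrier (free_Abelian_group (tensor_gen A F N))"
    and t: "t \<in> carrier (free_Abelian_group (tensor_gen A F N))"
    and st: "s - t \<in> tensor_rels A F N"
  shows "tensor_class A F N s = tensor_class A F N t"
proof -
  let ?Z = "free_Abelian_group (tensor_gen A F N)"
  interpret Z: comm_group ?Z by (rule abelian_free_Abelian_group)
  have sub: "subgroup (tensor_rel A F N) ?Z"
    using tensor_rel_normal[OF F N] by (rule normal_imp_subgroup)
  have "s - t \<in> tensor_rel A F N"
    unfolding tensor_rel_def using st by (rule generate.incl)
  then have "s \<in> tensor_rel A F N #>\<^bsub>?Z\<^esub> t"
    unfolding r_coset_def by (auto intro!: bexI[of _ "s - t"])
  then show ?thesis
    unfolding tensor_class_def using Z.repr_independence[OF _ t sub] by simp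
qed

lemma tensor_yoneda_left:
  fixes F :: "('o, 'm, 'w) cmod" and A :: "('o, 'm) pcat"
  assumes A: "preadditive_category A" and F: "additive_functor (opp A) Ab F" and a: "a \<in> Ob A"
  shows "\<exists>h\<in>iso (tensor A F (rep_left A A fid a)) (fobj F a).
    \<forall>b\<in>Ob A. \<forall>x\<in>carrier (fobj F b). \<forall>f\<in>arr A a b.
      h (tensor_class A F (rep_left A A fid a) (frag_of (b, x, f))) = fmap F b a f x"
proof -
  interpret preadditive_category A by fact
  let ?N = "rep_left A A fid a"
  let ?S = "tensor_gen A F ?N"
  let ?Z = "free_Abelian_group ?S"
  let ?cl = "tensor_class A F ?N"
  interpret Z: comm_group ?Z by (rule abelian_free_Abelian_group)
  have N: "additive_functor A Ab ?N" by (rule rep_left_additive[OF A a])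
  have gF: "comm_group (fobj F b)" if "b \<in> Ob A" for b
    using F that by (auto simp: additive_functor_def Ab_def opp_def)
  interpret Fa: comm_group "fobj F a" by (rule gF[OF a])
  have gen: "(b, x, f) \<in> ?S \<longleftrightarrow> b \<in> Ob A \<and> x \<in> carrier (fobj F b) \<and> f \<in> arr A a b" for b x f
    by (simp add: tensor_gen_def rep_left_def fid_def)
  have homF: "fmap F b c \<in> hom (Hom A c b) (Ab_hom (fobj F b) (fobj F c))"
    if "b \<in> Ob A" "c \<in> Ob A" for b c
    using F that by (auto simp: additive_functor_def Ab_def opp_def)
  have mapF: "fmap F b c f \<in> hom (fobj F b) (fobj F c)"
    if "b \<in> Ob A" "c \<in> Ob A" "f \<in> arr A c b" for b c f
    using homF[OF that(1,2)] that(3) by (auto simp: hom_def Ab_hom_def Pi_iff)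
  have addF: "fmap F b c (f \<otimes>\<^bsub>Hom A c b\<^esub> f') x = fmap F b c f x \<otimes>\<^bsub>fobj F c\<^esub> fmap F b c f' x"
    if "b \<in> Ob A" "c \<in> Ob A" "f \<in> arr A c b" "f' \<in> arr A c b" "x \<in> carrier (fobj F b)" for b c f f' x
    using hom_mult[OF homF[OF that(1,2)] that(3,4)] that(5) by (simp add: Ab_hom_def)
  have cmpF: "fmap F b d (Cmp A d c b f g) x = fmap F c d g (fmap F b c f x)"
    if "b \<in> Ob A" "c \<in> Ob A" "d \<in> Ob A" "f \<in> arr A c b" "g \<in> arr A d c" "x \<in> carrier (fobj F b)"
    for b c d f g x
  proof -
    have "fmap F b d (Cmp A d c b f g)
        = compose (carrier (fobj F b)) (fmap F c d g) (fmap F b c f)"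
      using F that by (simp add: additive_functor_def Ab_def opp_def)
    then show ?thesis using that by (simp add: compose_def)
  qed
  have idF: "fmap F b b (Idt A b) x = x" if "b \<in> Ob A" "x \<in> carrier (fobj F b)" for b x
    using F that by (simp add: additive_functor_def Ab_def opp_def)
  obtain h where h: "h \<in> carrier (Ab_hom (tensor A F ?N) (fobj F a))"
    and h_of: "\<And>b x f. (b, x, f) \<in> ?S \<Longrightarrow> h (?cl (frag_of (b, x, f))) = fmap F b a f x"
  proof -
    have "\<exists>!h. h \<in> carrier (Ab_hom (tensor A F ?N) (fobj F a)) \<and>
      (\<forall>(b, x, f)\<in>?S. h (?cl (frag_of (b, x, f))) = fmap F b a f x)"
    proof (rule tensor_universal[OF F N gF[OF a]])
      show "fmap F b a f x \<in> carrier (fobj F a)" if "(b, x, f) \<in> ?S" for b x f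
        using that mapF[of b a f] a unfolding gen by (auto simp: hom_def)
      show "fmap F b a f (x \<otimes>\<^bsub>fobj F b\<^esub> x') = fmap F b a f x \<otimes>\<^bsub>fobj F a\<^esub> fmap F b a f x'"
        if "(b, x, f) \<in> ?S" "(b, x', f) \<in> ?S" for b x x' f
        using that mapF[of b a f] a unfolding gen by (auto simp: hom_def)
      show "fmap F b a (f \<otimes>\<^bsub>fobj ?N b\<^esub> f') x = fmap F b a f x \<otimes>\<^bsub>fobj F a\<^esub> fmap F b a f' x"
        if "(b, x, f) \<in> ?S" "(b, x, f') \<in> ?S" for b x f f'
        using that addF[of b a f f' x] a unfolding gen by (simp add: rep_left_def fid_def)
      show "fmap F b a f (fmap F c b g x) = fmap F c a (fmap ?N b c g f) x"
        if "b \<in> Ob A" "c \<in> Ob A" "g \<in> arr A b c" "x \<in> carrier (fobj F c)" "f \<in> carrier (fobj ?N b)"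
        for b c g x f
        using that cmpF[of c b a g f x] a by (simp add: rep_left_def fid_def)
    qed
    then show ?thesis using that by blast
  qed
  have hh: "h \<in> hom (tensor A F ?N) (fobj F a)" using h by (simp add: Ab_hom_def)
  interpret T: comm_group "tensor A F ?N" by (rule comm_group_tensor[OF F N])
  have cls_hom: "?cl \<in> hom ?Z (tensor A F ?N)"
    unfolding tensor_def tensor_class_def
    using normal.r_coset_hom_Mod[OF tensor_rel_normal[OF F N]] by (simp add: eta_contract_eq)
  interpret c: group_hom ?Z "tensor A F ?N" ?cl
    using cls_hom by (simp add: group_hom_def group_hom_axioms_def Z.is_group T.is_group)
  interpret h: group_hom "tensor A F ?N" "fobj F a" h
    using hh by (simp add: group_hom_def group_hom_axioms_def Fa.is_group T.is_group)
  have carr: "carrier (tensor A F ?N) = ?cl ` carrier ?Z"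
    by (auto simp: tensor_def tensor_class_def FactGroup_def RCOSETS_def)
  let ?k = "\<lambda>x. ?cl (frag_of (a, x, Idt A a))"
  have genk: "(a, x, Idt A a) \<in> ?S" if "x \<in> carrier (fobj F a)" for x
    using that by (simp add: gen a Idt_arr)
  have k_mult: "?k (x \<otimes>\<^bsub>fobj F a\<^esub> y) = ?k x \<otimes>\<^bsub>tensor A F ?N\<^esub> ?k y"
    if xy: "x \<in> carrier (fobj F a)" "y \<in> carrier (fobj F a)" for x y
  proof -
    have c: "frag_of (a, x \<otimes>\<^bsub>fobj F a\<^esub> y, Idt A a) \<in> carrier ?Z"
        "frag_of (a, x, Idt A a) \<in> carrier ?Z" "frag_of (a, y, Idt A a) \<in> carrier ?Z"
      using genk xy by auto
    have "?k (x \<otimes>\<^bsub>fobj F a\<^esub> y) = ?cl (frag_of (a, x, Idt A a) \<otimes>\<^bsub>?Z\<^esub> frag_of (a, y, Idt A a))"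
    proof (rule tensor_class_eqI[OF F N c(1) Z.m_closed[OF c(2,3)]])
      show "frag_of (a, x \<otimes>\<^bsub>fobj F a\<^esub> y, Idt A a)
          - (frag_of (a, x, Idt A a) \<otimes>\<^bsub>?Z\<^esub> frag_of (a, y, Idt A a)) \<in> tensor_rels A F ?N"
        unfolding tensor_rels_def mult_free_Abelian_group diff_diff_add[symmetric]
        using xy a Idt_arr[OF a] by (intro UnI1) (auto simp: rep_left_def fid_def)
    qed
    then show ?thesis using c.hom_mult[OF c(2,3)] by simp
  qed
  have k_hom: "?k \<in> hom (fobj F a) (tensor A F ?N)"
  proof (rule homI)
    show "?k x \<in> carrier (tensor A F ?N)" if "x \<in> carrier (fobj F a)" for x
      using genk[OF that] unfolding carr by auto
  qed (rule k_mult)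
  interpret k: group_hom "fobj F a" "tensor A F ?N" ?k
    using k_hom by (simp add: group_hom_def group_hom_axioms_def Fa.is_group T.is_group)
  have hk: "h (?k x) = x" if "x \<in> carrier (fobj F a)" for x
    using h_of[OF genk[OF that]] idF[OF a that] by simp
  have kh: "?k (h (?cl s)) = ?cl s" if "Poly_Mapping.keys s \<subseteq> ?S" for s
  proof (rule free_Abelian_group_induct[OF that])
    show "?k (h (?cl 0)) = ?cl 0"
      using c.hom_one h.hom_one k.hom_one by simp
  next
    fix s t
    assume st: "Poly_Mapping.keys s \<subseteq> ?S" "Poly_Mapping.keys t \<subseteq> ?S"
      and i: "?k (h (?cl s)) = ?cl s" "?k (h (?cl t)) = ?cl t"
    have c: "s \<in> carrier ?Z" "t \<in> carrier ?Z" using st by auto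
    have "?cl (s - t) = ?cl s \<otimes>\<^bsub>tensor A F ?N\<^esub> inv\<^bsub>tensor A F ?N\<^esub> ?cl t"
      using c.hom_mult[OF c(1) Z.inv_closed[OF c(2)]] c.hom_inv[OF c(2)] st by simp
    moreover have "?k (h (?cl s \<otimes>\<^bsub>tensor A F ?N\<^esub> inv\<^bsub>tensor A F ?N\<^esub> ?cl t))
        = ?k (h (?cl s)) \<otimes>\<^bsub>tensor A F ?N\<^esub> inv\<^bsub>tensor A F ?N\<^esub> ?k (h (?cl t))"
      using c.hom_closed[OF c(1)] c.hom_closed[OF c(2)]
      by (simp only: h.hom_mult h.hom_inv k.hom_mult k.hom_inv T.inv_closed h.hom_closed Fa.inv_closed)
    ultimately show "?k (h (?cl (s - t))) = ?cl (s - t)" using i by simp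
  next
    fix p assume p: "p \<in> ?S"
    obtain b x f where [simp]: "p = (b, x, f)" by (cases p)
    have bxf: "b \<in> Ob A" "x \<in> carrier (fobj F b)" "f \<in> arr A a b" using p by (auto simp: gen)
    have Ff: "fmap F b a f x \<in> carrier (fobj F a)"
      using mapF[OF bxf(1) a bxf(3)] bxf by (auto simp: hom_def)
    have "?k (fmap F b a f x) = ?cl (frag_of (b, x, f))"
    proof (rule tensor_class_eqI[OF F N])
      show "frag_of (a, fmap F b a f x, Idt A a) \<in> carrier ?Z" using genk[OF Ff] by simp
      show "frag_of (b, x, f) \<in> carrier ?Z" using p by simp
      have "fmap ?N a b f (Idt A a) = f"
        using bxf a Idt_arr[OF a] by (simp add: rep_left_def fid_def Cmp_Idt_right)
      moreover have "Idt A a \<in> carrier (fobj ?N a)"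
        using Idt_arr[OF a] by (simp add: rep_left_def fid_def)
      ultimately show "frag_of (a, fmap F b a f x, Idt A a) - frag_of (b, x, f) \<in> tensor_rels A F ?N"
        unfolding tensor_rels_def using bxf a
        by (intro UnI2 CollectI exI[of _ a] exI[of _ b] exI[of _ f] exI[of _ x] exI[of _ "Idt A a"]) simp
    qed
    then show "?k (h (?cl (frag_of p))) = ?cl (frag_of p)" using h_of p by simp
  qed
  have "bij_betw h (carrier (tensor A F ?N)) (carrier (fobj F a))"
  proof (rule bij_betw_byWitness[where f' = ?k])
    show "\<forall>t\<in>carrier (tensor A F ?N). ?k (h t) = t" using kh unfolding carr by auto
    show "h ` carrier (tensor A F ?N) \<subseteq> carrier (fobj F a)" using h.hom_closed by auto
    show "?k ` carrier (fobj F a) \<subseteq> carrier (tensor A F ?N)" using k.hom_closed by auto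
  qed (use hk in auto)
  then have "h \<in> iso (tensor A F ?N) (fobj F a)" using hh by (simp add: iso_def)
  then show ?thesis using h_of gen by blast
qed

lemma tensor_yoneda_right:
  fixes N :: "('o, 'm, 'v) cmod" and A :: "('o, 'm) pcat"
  assumes A: "preadditive_category A" and N: "additive_functor A Ab N" and a: "a \<in> Ob A"
  shows "\<exists>h\<in>iso (tensor A (rep_right A A fid a) N) (fobj N a).
    \<forall>b\<in>Ob A. \<forall>f\<in>arr A b a. \<forall>y\<in>carrier (fobj N b).
      h (tensor_class A (rep_right A A fid a) N (frag_of (b, f, y))) = fmap N b a f y"
proof -
  interpret preadditive_category A by fact
  let ?F = "rep_right A A fid a"
  let ?S = "tensor_gen A ?F N"
  let ?Z = "free_Abelian_group ?S"
  let ?cl = "tensor_class A ?F N"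
  interpret Z: comm_group ?Z by (rule abelian_free_Abelian_group)
  have F: "additive_functor (opp A) Ab ?F" by (rule rep_right_additive[OF A a])
  have gN: "comm_group (fobj N b)" if "b \<in> Ob A" for b
    using N that by (auto simp: additive_functor_def Ab_def)
  interpret Na: comm_group "fobj N a" by (rule gN[OF a])
  have gen: "(b, f, y) \<in> ?S \<longleftrightarrow> b \<in> Ob A \<and> f \<in> arr A b a \<and> y \<in> carrier (fobj N b)" for b y f
    by (simp add: tensor_gen_def rep_right_def fid_def)
  have homN: "fmap N b c \<in> hom (Hom A b c) (Ab_hom (fobj N b) (fobj N c))"
    if "b \<in> Ob A" "c \<in> Ob A" for b c
    using N that by (auto simp: additive_functor_def Ab_def)
  have mapN: "fmap N b c f \<in> hom (fobj N b) (fobj N c)"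
    if "b \<in> Ob A" "c \<in> Ob A" "f \<in> arr A b c" for b c f
    using homN[OF that(1,2)] that(3) by (auto simp: hom_def Ab_hom_def Pi_iff)
  have addN: "fmap N b c (f \<otimes>\<^bsub>Hom A b c\<^esub> f') x = fmap N b c f x \<otimes>\<^bsub>fobj N c\<^esub> fmap N b c f' x"
    if "b \<in> Ob A" "c \<in> Ob A" "f \<in> arr A b c" "f' \<in> arr A b c" "x \<in> carrier (fobj N b)" for b c f f' x
    using hom_mult[OF homN[OF that(1,2)] that(3,4)] that(5) by (simp add: Ab_hom_def)
  have cmpN: "fmap N b d (Cmp A b c d g f) x = fmap N c d g (fmap N b c f x)"
    if "b \<in> Ob A" "c \<in> Ob A" "d \<in> Ob A" "f \<in> arr A b c" "g \<in> arr A c d" "x \<in> carrier (fobj N b)"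
    for b c d f g x
  proof -
    have "fmap N b d (Cmp A b c d g f)
        = compose (carrier (fobj N b)) (fmap N c d g) (fmap N b c f)"
      using N that by (simp add: additive_functor_def Ab_def)
    then show ?thesis using that by (simp add: compose_def)
  qed
  have idN: "fmap N b b (Idt A b) x = x" if "b \<in> Ob A" "x \<in> carrier (fobj N b)" for b x
    using N that by (simp add: additive_functor_def Ab_def)
  obtain h where h: "h \<in> carrier (Ab_hom (tensor A ?F N) (fobj N a))"
    and h_of: "\<And>b f y. (b, f, y) \<in> ?S \<Longrightarrow> h (?cl (frag_of (b, f, y))) = fmap N b a f y"
  proof -
    have "\<exists>!h. h \<in> carrier (Ab_hom (tensor A ?F N) (fobj N a)) \<and>
      (\<forall>(b, f, y)\<in>?S. h (?cl (frag_of (b, f, y))) = fmap N b a f y)"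
    proof (rule tensor_universal[OF F N gN[OF a]])
      show "fmap N b a f y \<in> carrier (fobj N a)" if "(b, f, y) \<in> ?S" for b y f
        using that mapN[of b a f] a unfolding gen by (auto simp: hom_def)
      show "fmap N b a f (y \<otimes>\<^bsub>fobj N b\<^esub> y') = fmap N b a f y \<otimes>\<^bsub>fobj N a\<^esub> fmap N b a f y'"
        if "(b, f, y) \<in> ?S" "(b, f, y') \<in> ?S" for b y y' f
        using that mapN[of b a f] a unfolding gen by (auto simp: hom_def)
      show "fmap N b a (f \<otimes>\<^bsub>fobj ?F b\<^esub> f') y = fmap N b a f y \<otimes>\<^bsub>fobj N a\<^esub> fmap N b a f' y"
        if "(b, f, y) \<in> ?S" "(b, f', y) \<in> ?S" for b y f f'
        using that addN[of b a f f' y] a unfolding gen by (simp add: rep_right_def fid_def)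
      show "fmap N b a (fmap ?F c b g f) y = fmap N c a f (fmap N b c g y)"
        if "b \<in> Ob A" "c \<in> Ob A" "g \<in> arr A b c" "f \<in> carrier (fobj ?F c)" "y \<in> carrier (fobj N b)"
        for b c g f y
        using that cmpN[of b c a g f y] a by (simp add: rep_right_def fid_def)
    qed
    then show ?thesis using that by blast
  qed
  have hh: "h \<in> hom (tensor A ?F N) (fobj N a)" using h by (simp add: Ab_hom_def)
  interpret T: comm_group "tensor A ?F N" by (rule comm_group_tensor[OF F N])
  have cls_hom: "?cl \<in> hom ?Z (tensor A ?F N)"
    unfolding tensor_def tensor_class_def
    using normal.r_coset_hom_Mod[OF tensor_rel_normal[OF F N]] by (simp add: eta_contract_eq)
  interpret c: group_hom ?Z "tensor A ?F N" ?cl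
    using cls_hom by (simp add: group_hom_def group_hom_axioms_def Z.is_group T.is_group)
  interpret h: group_hom "tensor A ?F N" "fobj N a" h
    using hh by (simp add: group_hom_def group_hom_axioms_def Na.is_group T.is_group)
  have carr: "carrier (tensor A ?F N) = ?cl ` carrier ?Z"
    by (auto simp: tensor_def tensor_class_def FactGroup_def RCOSETS_def)
  let ?k = "\<lambda>y. ?cl (frag_of (a, Idt A a, y))"
  have genk: "(a, Idt A a, y) \<in> ?S" if "y \<in> carrier (fobj N a)" for y
    using that by (simp add: gen a Idt_arr)
  have k_mult: "?k (x \<otimes>\<^bsub>fobj N a\<^esub> y) = ?k x \<otimes>\<^bsub>tensor A ?F N\<^esub> ?k y"
    if xy: "x \<in> carrier (fobj N a)" "y \<in> carrier (fobj N a)" for x y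
  proof -
    have c: "frag_of (a, Idt A a, x \<otimes>\<^bsub>fobj N a\<^esub> y) \<in> carrier ?Z"
        "frag_of (a, Idt A a, x) \<in> carrier ?Z" "frag_of (a, Idt A a, y) \<in> carrier ?Z"
      using genk xy by auto
    have "?k (x \<otimes>\<^bsub>fobj N a\<^esub> y) = ?cl (frag_of (a, Idt A a, x) \<otimes>\<^bsub>?Z\<^esub> frag_of (a, Idt A a, y))"
    proof (rule tensor_class_eqI[OF F N c(1) Z.m_closed[OF c(2,3)]])
      show "frag_of (a, Idt A a, x \<otimes>\<^bsub>fobj N a\<^esub> y)
          - (frag_of (a, Idt A a, x) \<otimes>\<^bsub>?Z\<^esub> frag_of (a, Idt A a, y)) \<in> tensor_rels A ?F N"
        unfolding tensor_rels_def mult_free_Abelian_group diff_diff_add[symmetric]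
        using xy a Idt_arr[OF a] by (intro UnI1[OF UnI2]) (auto simp: rep_right_def fid_def)
    qed
    then show ?thesis using c.hom_mult[OF c(2,3)] by simp
  qed
  have k_hom: "?k \<in> hom (fobj N a) (tensor A ?F N)"
  proof (rule homI)
    show "?k x \<in> carrier (tensor A ?F N)" if "x \<in> carrier (fobj N a)" for x
      using genk[OF that] unfolding carr by auto
  qed (rule k_mult)
  interpret k: group_hom "fobj N a" "tensor A ?F N" ?k
    using k_hom by (simp add: group_hom_def group_hom_axioms_def Na.is_group T.is_group)
  have hk: "h (?k x) = x" if "x \<in> carrier (fobj N a)" for x
    using h_of[OF genk[OF that]] idN[OF a that] by simp
  have kh: "?k (h (?cl s)) = ?cl s" if "Poly_Mapping.keys s \<subseteq> ?S" for s
  proof (rule free_Abelian_group_induct[OF that])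
    show "?k (h (?cl 0)) = ?cl 0"
      using c.hom_one h.hom_one k.hom_one by simp
  next
    fix s t
    assume st: "Poly_Mapping.keys s \<subseteq> ?S" "Poly_Mapping.keys t \<subseteq> ?S"
      and i: "?k (h (?cl s)) = ?cl s" "?k (h (?cl t)) = ?cl t"
    have c: "s \<in> carrier ?Z" "t \<in> carrier ?Z" using st by auto
    have "?cl (s - t) = ?cl s \<otimes>\<^bsub>tensor A ?F N\<^esub> inv\<^bsub>tensor A ?F N\<^esub> ?cl t"
      using c.hom_mult[OF c(1) Z.inv_closed[OF c(2)]] c.hom_inv[OF c(2)] st by simp
    moreover have "?k (h (?cl s \<otimes>\<^bsub>tensor A ?F N\<^esub> inv\<^bsub>tensor A ?F N\<^esub> ?cl t))
        = ?k (h (?cl s)) \<otimes>\<^bsub>tensor A ?F N\<^esub> inv\<^bsub>tensor A ?F N\<^esub> ?k (h (?cl t))"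
      using c.hom_closed[OF c(1)] c.hom_closed[OF c(2)]
      by (simp only: h.hom_mult h.hom_inv k.hom_mult k.hom_inv T.inv_closed h.hom_closed Na.inv_closed)
    ultimately show "?k (h (?cl (s - t))) = ?cl (s - t)" using i by simp
  next
    fix p assume p: "p \<in> ?S"
    obtain b f y where [simp]: "p = (b, f, y)" by (cases p)
    have bfy: "b \<in> Ob A" "f \<in> arr A b a" "y \<in> carrier (fobj N b)" using p by (auto simp: gen)
    have Nf: "fmap N b a f y \<in> carrier (fobj N a)"
      using mapN[OF bfy(1) a bfy(2)] bfy by (auto simp: hom_def)
    have "?cl (frag_of (b, f, y)) = ?k (fmap N b a f y)"
    proof (rule tensor_class_eqI[OF F N])
      show "frag_of (a, Idt A a, fmap N b a f y) \<in> carrier ?Z" using genk[OF Nf] by simp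
      show "frag_of (b, f, y) \<in> carrier ?Z" using p by simp
      have "fmap ?F a b f (Idt A a) = f"
        using bfy a Idt_arr[OF a] by (simp add: rep_right_def fid_def Cmp_Idt_left)
      moreover have "Idt A a \<in> carrier (fobj ?F a)"
        using Idt_arr[OF a] by (simp add: rep_right_def fid_def)
      ultimately show "frag_of (b, f, y) - frag_of (a, Idt A a, fmap N b a f y) \<in> tensor_rels A ?F N"
        unfolding tensor_rels_def using bfy a
        by (intro UnI2 CollectI exI[of _ b] exI[of _ a] exI[of _ f] exI[of _ "Idt A a"] exI[of _ y]) simp
    qed
    from this[symmetric] show "?k (h (?cl (frag_of p))) = ?cl (frag_of p)"
      using h_of[of b f y] p by simp
  qed
  have "bij_betw h (carrier (tensor A ?F N)) (carrier (fobj N a))"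
  proof (rule bij_betw_byWitness[where f' = ?k])
    show "\<forall>t\<in>carrier (tensor A ?F N). ?k (h t) = t" using kh unfolding carr by auto
    show "h ` carrier (tensor A ?F N) \<subseteq> carrier (fobj N a)" using h.hom_closed by auto
    show "?k ` carrier (fobj N a) \<subseteq> carrier (tensor A ?F N)" using k.hom_closed by auto
  qed (use hk in auto)
  then have "h \<in> iso (tensor A ?F N) (fobj N a)" using hh by (simp add: iso_def)
  then show ?thesis using h_of gen by blast
qed

text \<open>\<open>(D \<otimes>\<^sub>C N)(d) = D(P -, d) \<otimes>\<^sub>C N\<close>\<close>

definition ind_mod ::
  "('o, 'm) pcat \<Rightarrow> ('p, 'n) pcat \<Rightarrow> ('o, 'm, 'p, 'n) cfunctor
    \<Rightarrow> ('o, 'm, 'v) cmod \<Rightarrow> ('p, 'n, ('o \<times> 'n \<times> 'v \<Rightarrow>\<^sub>0 int) set) cmod"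
  where "ind_mod C D P N = \<lparr>fobj = (\<lambda>d. tensor C (rep_right C D P d) N),
    fmap = (\<lambda>d d' g. tensor_map C (rep_right C D P d) N (rep_right C D P d') N
              (\<lambda>a x. Cmp D (fobj P a) d d' g x) (\<lambda>a y. y))\<rparr>"

definition ind_functor ::
  "('o, 'm) pcat \<Rightarrow> ('p, 'n) pcat \<Rightarrow> ('o, 'm, 'p, 'n) cfunctor
    \<Rightarrow> (('o, 'm, 'v) cmod, 'o \<Rightarrow> 'v \<Rightarrow> 'v, ('p, 'n, 'v) cmod, 'p \<Rightarrow> 'v \<Rightarrow> 'v) cfunctor"
  where "ind_functor C D P = \<lparr>fobj = (\<lambda>N. copy_mod (ind_mod C D P N)),
    fmap = (\<lambda>N N' \<beta>. \<lambda>d\<in>Ob D. copy_map (fobj (ind_mod C D P N) d) (fobj (ind_mod C D P N') d)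
              (tensor_map C (rep_right C D P d) N (rep_right C D P d) N' (\<lambda>a x. x) \<beta>))\<rparr>"

text \<open>Restriction along \<open>P\<close>: \<open>N \<mapsto> N \<circ> P\<close>.\<close>

definition res_functor ::
  "('o, 'm, 'z) pcat_scheme \<Rightarrow> ('o, 'm, 'p, 'n) cfunctor
    \<Rightarrow> (('p, 'n, 'v) cmod, 'p \<Rightarrow> 'v \<Rightarrow> 'v, ('o, 'm, 'v) cmod, 'o \<Rightarrow> 'v \<Rightarrow> 'v) cfunctor"
  where "res_functor C P = \<lparr>fobj = (\<lambda>N. N \<circ>\<^sub>F P),
    fmap = (\<lambda>N N' \<eta>. \<lambda>a\<in>Ob C. \<eta> (fobj P a))\<rparr>"

text \<open>\<open>C(D, N)(d) = Hom\<^bsub>Mod(C)\<^esub>(D(d, P -), N)\<close>\<close>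

definition coind_mod ::
  "('o, 'm) pcat \<Rightarrow> ('p, 'n) pcat \<Rightarrow> ('o, 'm, 'p, 'n) cfunctor
    \<Rightarrow> ('o, 'm, 'v) cmod \<Rightarrow> ('p, 'n, 'o \<Rightarrow> 'n \<Rightarrow> 'v) cmod"
  where "coind_mod C D P N = \<lparr>fobj = (\<lambda>d. nat_group C (rep_left C D P d) N),
    fmap = (\<lambda>d d' g. \<lambda>\<eta>\<in>carrier (nat_group C (rep_left C D P d) N).
              \<lambda>a\<in>Ob C. \<lambda>x\<in>arr D d' (fobj P a). \<eta> a (Cmp D d d' (fobj P a) x g))\<rparr>"

definition coind_functor ::
  "('o, 'm) pcat \<Rightarrow> ('p, 'n) pcat \<Rightarrow> ('o, 'm, 'p, 'n) cfunctor
    \<Rightarrow> (('o, 'm, 'v) cmod, 'o \<Rightarrow> 'v \<Rightarrow> 'v, ('p, 'n, 'v) cmod, 'p \<Rightarrow> 'v \<Rightarrow> 'v) cfunctor"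
  where "coind_functor C D P = \<lparr>fobj = (\<lambda>N. copy_mod (coind_mod C D P N)),
    fmap = (\<lambda>N N' \<beta>. \<lambda>d\<in>Ob D. copy_map (fobj (coind_mod C D P N) d) (fobj (coind_mod C D P N') d)
              (\<lambda>\<eta>. \<lambda>a\<in>Ob C. compose (arr D d (fobj P a)) (\<beta> a) (\<eta> a)))\<rparr>"


section \<open>Triangular matrix categories\<close>

text \<open>
  The matrix with rows \<open>(t, 0)\<close>, \<open>(m, u)\<close> is the triple \<open>(t, m, u)\<close>, and the object with
  diagonal \<open>(T, U)\<close> is the pair \<open>(T, U)\<close>.  \<open>tri_tensor\<close> is the morphism \<open>u \<otimes> t\<^sup>o\<^sup>p\<close> of
  \<open>U \<otimes>\<^sub>R T\<^sup>o\<^sup>p\<close> from \<open>(b, a')\<close> to \<open>(b', a)\<close>, where \<open>u : b \<rightarrow> b'\<close> and \<open>t : a \<rightarrow> a'\<close>.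
\<close>

definition tri_tensor ::
  "'r ring \<Rightarrow> ('ot, 't, 'r) rcat \<Rightarrow> ('ou, 'u, 'r) rcat \<Rightarrow> 'ou \<Rightarrow> 'ou \<Rightarrow> 'ot \<Rightarrow> 'ot
    \<Rightarrow> 'u \<Rightarrow> 't \<Rightarrow> ('u \<times> 't \<Rightarrow>\<^sub>0 int) set"
  where "tri_tensor R T U b b' a' a u t =
    rtensor_class R (hom_module U b b') (hom_module (ropp T) a' a) (frag_of (u, t))"

definition tri_cat ::
  "'r ring \<Rightarrow> ('ot, 't, 'r) rcat \<Rightarrow> ('ou \<times> 'ot, ('u \<times> 't \<Rightarrow>\<^sub>0 int) set, 'w) cmod
    \<Rightarrow> ('ou, 'u, 'r) rcat \<Rightarrow> ('ot \<times> 'ou, 't \<times> 'w \<times> 'u) pcat"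
  where "tri_cat R T M U = \<lparr>Ob = Ob T \<times> Ob U,
    Hom = (\<lambda>(a, b) (a', b'). Hom T a a' \<times>\<times> (fobj M (b', a) \<times>\<times> Hom U b b')),
    Idt = (\<lambda>(a, b). (Idt T a, \<one>\<^bsub>fobj M (b, a)\<^esub>, Idt U b)),
    Cmp = (\<lambda>(a, b) (a', b') (a'', b'') (t2, m2, u2) (t1, m1, u1).
      (Cmp T a a' a'' t2 t1,
       fmap M (b'', a') (b'', a) (tri_tensor R T U b'' b'' a' a (Idt U b'') t1) m2
         \<otimes>\<^bsub>fobj M (b'', a)\<^esub>
       fmap M (b', a) (b'', a) (tri_tensor R T U b' b'' a a u2 (Idt T a)) m1,
       Cmp U b b' b'' u2 u1))\<rparr>"

text \<open>
  The comparison functors \<open>\<Lambda>/I \<rightarrow> T\<close> and \<open>U' \<rightarrow> U\<close> take the diagonal entry; all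
  representatives of a morphism of \<open>\<Lambda>/I\<close> have the same entry in \<open>T\<close>.
\<close>

definition diag_T :: "('ot \<times> 'ou, ('t \<times> 'w \<times> 'u) set, 'ot, 't) cfunctor"
  where "diag_T = \<lparr>fobj = fst, fmap = (\<lambda>_ _ X. the_elem (fst ` X))\<rparr>"

definition diag_U :: "('ot \<times> 'ou, 't \<times> 'w \<times> 'u, 'ou, 'u) cfunctor"
  where "diag_U = \<lparr>fobj = snd, fmap = (\<lambda>_ _ (t, m, u). u)\<rparr>"

end

theory Submission
  imports Defs
begin

text \<open>
  Restriction along a functor \<open>S\<close> is left adjoint to restriction along \<open>P\<close> whenever \<open>P\<close> is left
  adjoint to \<open>S\<close>, so the tensor product with \<open>D(P -, -)\<close> is restriction along \<open>S\<close>; the natural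
  isomorphism sends \<open>y\<close> in \<open>N(S d)\<close> to the tensor of the counit at \<open>d\<close> with \<open>y\<close>.  Both functors
  of the theorem have such right adjoints.  The projection \<open>\<pi>\<close> from \<open>\<Lambda>\<close> to \<open>Q\<close> has the right adjoint
  \<open>(a, b) \<mapsto> (a, 0)\<close>, and the inclusion of \<open>U'\<close> into \<open>\<Lambda>\<close> has the right adjoint \<open>(a, b) \<mapsto> (0, b)\<close>.
  Hence \<open>Q \<otimes> -\<close> is exact, and \<open>\<Lambda> \<otimes> -\<close> over \<open>U'\<close> is fully faithful because its right adjoint index functor
  is full and surjective on objects.  Coinduction is right adjoint to restriction by the Yoneda argument;
  it stays inside the universe because its values embed into \<open>N(d)\<close> in the first case and into a
  small power of the universe in the second.  A module vanishing on \<open>U'\<close>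
  inverts the unit \<open>(a, b) \<rightarrow> (a, 0)\<close>, hence comes from \<open>Q\<close>.
\<close>

section \<open>Modules and natural transformations, elementwise\<close>

text \<open>The definitions of induction and coinduction mix quotient groups, unions over
  representatives and arbitrarily chosen copies inside the universe, so functoriality cannot be read
  off from them. Induction is compared with a restriction functor, which involves no choices: when
  \<open>P\<close> is left adjoint to \<open>S\<close>, the right module \<open>D(P -, d)\<close> is
  \<open>C(-, S d)\<close>, and tensoring with a representable module is evaluation. The same
  comparison bounds the size of the tensor product, so that its copy exists. The adjoints exist
  because \<open>M\<close> vanishes at zero objects: arrows of \<open>\<Lambda>\<close> from
  \<open>(a, b)\<close> to \<open>(a', 0)\<close> reduce to \<open>T(a, a')\<close>, and arrows from
  \<open>(0, b)\<close> to \<open>(a', b')\<close> reduce to \<open>U(b, b')\<close>. On the other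
  side the symmetry breaks: arrows out of \<open>(a, 0)\<close> and arrows into
  \<open>(0, b)\<close> still involve \<open>M\<close>, so the evident left adjoints of the index
  functors fail. Coinduction is therefore treated directly, and its size needs an argument of its
  own. The version over \<open>T\<close> and \<open>U\<close> is obtained by transport: restrictions
  along mutually inverse equivalences are adjoint to each other on both sides, so adjoint triples
  stay adjoint triples.\<close>

lemma (in preadditive_category) Cmp_arr:
  "a \<in> Ob C \<Longrightarrow> b \<in> Ob C \<Longrightarrow> c \<in> Ob C \<Longrightarrow> f \<in> arr C a b \<Longrightarrow> g \<in> arr C b c \<Longrightarrow> Cmp C a b c g f \<in> arr C a c"
  using Cmp_hom_right[of a b c g] by (auto simp: hom_def)

lemma (in preadditive_category) Cmp_add_right:
  "a \<in> Ob C \<Longrightarrow> b \<in> Ob C \<Longrightarrow> c \<in> Ob C \<Longrightarrow> f \<in> arr C a b \<Longrightarrow> f' \<in> arr C a b \<Longrightarrow> g \<in> arr C b c \<Longrightarrow>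
    Cmp C a b c g (f \<otimes>\<^bsub>Hom C a b\<^esub> f') = Cmp C a b c g f \<otimes>\<^bsub>Hom C a c\<^esub> Cmp C a b c g f'"
  using Cmp_hom_right[of a b c g] by (auto simp: hom_def)

lemma (in preadditive_category) Cmp_add_left:
  "a \<in> Ob C \<Longrightarrow> b \<in> Ob C \<Longrightarrow> c \<in> Ob C \<Longrightarrow> f \<in> arr C a b \<Longrightarrow> g \<in> arr C b c \<Longrightarrow> g' \<in> arr C b c \<Longrightarrow>
    Cmp C a b c (g \<otimes>\<^bsub>Hom C b c\<^esub> g') f = Cmp C a b c g f \<otimes>\<^bsub>Hom C a c\<^esub> Cmp C a b c g' f"
  using Cmp_hom_left[of a b c f] by (auto simp: hom_def)

lemma (in preadditive_category) zero_arr_closed: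
  "a \<in> Ob C \<Longrightarrow> b \<in> Ob C \<Longrightarrow> zero_arr C a b \<in> arr C a b"
  by (meson Hom_comm_group comm_group.axioms(2) group.is_monoid monoid.one_closed)

lemma (in preadditive_category) add_arr_closed:
  "a \<in> Ob C \<Longrightarrow> b \<in> Ob C \<Longrightarrow> f \<in> arr C a b \<Longrightarrow> g \<in> arr C a b \<Longrightarrow> f \<otimes>\<^bsub>Hom C a b\<^esub> g \<in> arr C a b"
  by (meson Hom_comm_group comm_group.axioms(2) group.is_monoid monoid.m_closed)

lemma comm_group_imp_group: "comm_group G \<Longrightarrow> group G"
  by (rule comm_group.axioms)

lemma group_hom_comm_groups: "comm_group G \<Longrightarrow> comm_group H \<Longrightarrow> h \<in> hom G H \<Longrightarrow> group_hom G H h"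
  by (simp add: group_hom_def group_hom_axioms_def comm_group_imp_group)

lemma (in preadditive_category) Cmp_zero_right:
  assumes "a \<in> Ob C" "b \<in> Ob C" "c \<in> Ob C" "g \<in> arr C b c"
  shows "Cmp C a b c g (zero_arr C a b) = zero_arr C a c"
  using group_hom.hom_one[OF group_hom_comm_groups[OF _ _ Cmp_hom_right[OF assms]]] assms
  by (simp add: Hom_comm_group)

lemma (in preadditive_category) Cmp_zero_left:
  assumes "a \<in> Ob C" "b \<in> Ob C" "c \<in> Ob C" "f \<in> arr C a b"
  shows "Cmp C a b c (zero_arr C b c) f = zero_arr C a c"
  using group_hom.hom_one[OF group_hom_comm_groups[OF _ _ Cmp_hom_left[OF assms]]] assms
  by (simp add: Hom_comm_group)

lemma Ab_simps [simp]:
  "Ob Ab = {G. comm_group G}" "Hom Ab = Ab_hom" "Idt Ab = (\<lambda>G. \<lambda>x\<in>carrier G. x)"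
  "Cmp Ab = (\<lambda>G H K g f. compose (carrier G) g f)"
  by (simp_all add: Ab_def)

section \<open>Modules: the functor laws on elements\<close>

lemma module_group: "additive_functor A Ab N \<Longrightarrow> a \<in> Ob A \<Longrightarrow> comm_group (fobj N a)"
  by (simp add: additive_functor_def)

lemma module_hom:
  assumes "additive_functor A Ab N" "a \<in> Ob A" "b \<in> Ob A" "f \<in> arr A a b"
  shows "fmap N a b f \<in> hom (fobj N a) (fobj N b) \<inter> extensional (carrier (fobj N a))"
proof -
  have "fmap N a b \<in> hom (Hom A a b) (Ab_hom (fobj N a) (fobj N b))"
    using assms by (simp add: additive_functor_def)
  from hom_in_carrier[OF this assms(4)] show ?thesis by (simp add: Ab_hom_def)
qed

lemma module_closed:
  "additive_functor A Ab N \<Longrightarrow> a \<in> Ob A \<Longrightarrow> b \<in> Ob A \<Longrightarrow> f \<in> arr A a b \<Longrightarrow> x \<in> carrier (fobj N a) \<Longrightarrow>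
    fmap N a b f x \<in> carrier (fobj N b)"
  using module_hom[of A N a b f] by (auto simp: hom_def)

lemma module_mult:
  "additive_functor A Ab N \<Longrightarrow> a \<in> Ob A \<Longrightarrow> b \<in> Ob A \<Longrightarrow> f \<in> arr A a b \<Longrightarrow>
    x \<in> carrier (fobj N a) \<Longrightarrow> y \<in> carrier (fobj N a) \<Longrightarrow>
    fmap N a b f (x \<otimes>\<^bsub>fobj N a\<^esub> y) = fmap N a b f x \<otimes>\<^bsub>fobj N b\<^esub> fmap N a b f y"
  using module_hom[of A N a b f] by (auto simp: hom_def)

lemma module_ext:
  "additive_functor A Ab N \<Longrightarrow> a \<in> Ob A \<Longrightarrow> b \<in> Ob A \<Longrightarrow> f \<in> arr A a b \<Longrightarrow>
    fmap N a b f \<in> extensional (carrier (fobj N a))"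
  using module_hom[of A N a b f] by auto

lemma module_add:
  "additive_functor A Ab N \<Longrightarrow> a \<in> Ob A \<Longrightarrow> b \<in> Ob A \<Longrightarrow> f \<in> arr A a b \<Longrightarrow> g \<in> arr A a b \<Longrightarrow>
    x \<in> carrier (fobj N a) \<Longrightarrow>
    fmap N a b (f \<otimes>\<^bsub>Hom A a b\<^esub> g) x = fmap N a b f x \<otimes>\<^bsub>fobj N b\<^esub> fmap N a b g x"
  by (simp add: additive_functor_def Ab_hom_def hom_def[of "Hom A _ _"])

lemma module_Idt:
  "additive_functor A Ab N \<Longrightarrow> a \<in> Ob A \<Longrightarrow> x \<in> carrier (fobj N a) \<Longrightarrow> fmap N a a (Idt A a) x = x"
  by (simp add: additive_functor_def)

lemma module_Cmp:
  "additive_functor A Ab N \<Longrightarrow> a \<in> Ob A \<Longrightarrow> b \<in> Ob A \<Longrightarrow> c \<in> Ob A \<Longrightarrow> f \<in> arr A a b \<Longrightarrow> g \<in> arr A b c \<Longrightarrow>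
    x \<in> carrier (fobj N a) \<Longrightarrow> fmap N a c (Cmp A a b c g f) x = fmap N b c g (fmap N a b f x)"
  by (simp add: additive_functor_def compose_def)

lemma module_group_hom:
  "additive_functor A Ab N \<Longrightarrow> a \<in> Ob A \<Longrightarrow> b \<in> Ob A \<Longrightarrow> f \<in> arr A a b \<Longrightarrow>
    group_hom (fobj N a) (fobj N b) (fmap N a b f)"
  by (rule group_hom_comm_groups[OF module_group module_group IntD1[OF module_hom]])

lemma module_one:
  "additive_functor A Ab N \<Longrightarrow> a \<in> Ob A \<Longrightarrow> b \<in> Ob A \<Longrightarrow> f \<in> arr A a b \<Longrightarrow>
    fmap N a b f \<one>\<^bsub>fobj N a\<^esub> = \<one>\<^bsub>fobj N b\<^esub>"
  by (rule group_hom.hom_one[OF module_group_hom])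

lemma module_one_closed:
  "additive_functor A Ab N \<Longrightarrow> a \<in> Ob A \<Longrightarrow> \<one>\<^bsub>fobj N a\<^esub> \<in> carrier (fobj N a)"
  by (rule monoid.one_closed[OF group.is_monoid[OF comm_group_imp_group[OF module_group]]])

lemma module_m_closed:
  "additive_functor A Ab N \<Longrightarrow> a \<in> Ob A \<Longrightarrow> x \<in> carrier (fobj N a) \<Longrightarrow> y \<in> carrier (fobj N a) \<Longrightarrow>
    x \<otimes>\<^bsub>fobj N a\<^esub> y \<in> carrier (fobj N a)"
  by (rule monoid.m_closed[OF group.is_monoid[OF comm_group_imp_group[OF module_group]]])

text \<open>Since \<open>0 + 0 = 0\<close> in the hom group, the value is idempotent in the group
  \<open>fobj N b\<close> and hence trivial.\<close>

lemma module_zero: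
  assumes A: "preadditive_category A" and N: "additive_functor A Ab N"
    and ab: "a \<in> Ob A" "b \<in> Ob A" and x: "x \<in> carrier (fobj N a)"
  shows "fmap N a b (zero_arr A a b) x = \<one>\<^bsub>fobj N b\<^esub>"
proof -
  interpret preadditive_category A by fact
  interpret H: comm_group "Hom A a b" by (rule Hom_comm_group[OF ab])
  interpret B: comm_group "fobj N b" by (rule module_group[OF N ab(2)])
  have z: "fmap N a b (zero_arr A a b) x \<in> carrier (fobj N b)"
    using module_closed[OF N ab _ x] by simp
  have "fmap N a b (zero_arr A a b) x \<otimes>\<^bsub>fobj N b\<^esub> fmap N a b (zero_arr A a b) x
      = fmap N a b (zero_arr A a b) x"
    using module_add[OF N ab _ _ x, of "zero_arr A a b" "zero_arr A a b"] by simp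
  then show ?thesis using z B.l_cancel_one by blast
qed

text \<open>Maps in \<open>Ab\<close> are extensional functions. The premises on closure of
  \<open>arr A\<close> under sums, identities and composites make both sides of each functor law
  extensional, so that pointwise equations suffice.\<close>

lemma moduleI:
  assumes "\<And>a. a \<in> Ob A \<Longrightarrow> comm_group (fobj N a)"
    and "\<And>a b f x. a \<in> Ob A \<Longrightarrow> b \<in> Ob A \<Longrightarrow> f \<in> arr A a b \<Longrightarrow> x \<in> carrier (fobj N a) \<Longrightarrow>
      fmap N a b f x \<in> carrier (fobj N b)"
    and "\<And>a b f. a \<in> Ob A \<Longrightarrow> b \<in> Ob A \<Longrightarrow> f \<in> arr A a b \<Longrightarrow>
      fmap N a b f \<in> extensional (carrier (fobj N a))"
    and "\<And>a b f x y. a \<in> Ob A \<Longrightarrow> b \<in> Ob A \<Longrightarrow> f \<in> arr A a b \<Longrightarrow>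
      x \<in> carrier (fobj N a) \<Longrightarrow> y \<in> carrier (fobj N a) \<Longrightarrow>
      fmap N a b f (x \<otimes>\<^bsub>fobj N a\<^esub> y) = fmap N a b f x \<otimes>\<^bsub>fobj N b\<^esub> fmap N a b f y"
    and "\<And>a b f g x. a \<in> Ob A \<Longrightarrow> b \<in> Ob A \<Longrightarrow> f \<in> arr A a b \<Longrightarrow> g \<in> arr A a b \<Longrightarrow>
      x \<in> carrier (fobj N a) \<Longrightarrow>
      fmap N a b (f \<otimes>\<^bsub>Hom A a b\<^esub> g) x = fmap N a b f x \<otimes>\<^bsub>fobj N b\<^esub> fmap N a b g x"
    and "\<And>a b f g. a \<in> Ob A \<Longrightarrow> b \<in> Ob A \<Longrightarrow> f \<in> arr A a b \<Longrightarrow> g \<in> arr A a b \<Longrightarrow>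
      f \<otimes>\<^bsub>Hom A a b\<^esub> g \<in> arr A a b"
    and "\<And>a. a \<in> Ob A \<Longrightarrow> Idt A a \<in> arr A a a"
    and "\<And>a x. a \<in> Ob A \<Longrightarrow> x \<in> carrier (fobj N a) \<Longrightarrow> fmap N a a (Idt A a) x = x"
    and "\<And>a b c f g. a \<in> Ob A \<Longrightarrow> b \<in> Ob A \<Longrightarrow> c \<in> Ob A \<Longrightarrow> f \<in> arr A a b \<Longrightarrow> g \<in> arr A b c \<Longrightarrow>
      Cmp A a b c g f \<in> arr A a c"
    and "\<And>a b c f g x. a \<in> Ob A \<Longrightarrow> b \<in> Ob A \<Longrightarrow> c \<in> Ob A \<Longrightarrow> f \<in> arr A a b \<Longrightarrow> g \<in> arr A b c \<Longrightarrow>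
      x \<in> carrier (fobj N a) \<Longrightarrow> fmap N a c (Cmp A a b c g f) x = fmap N b c g (fmap N a b f x)"
  shows "additive_functor A Ab N"
proof -
  have ext: "f = g" if "f \<in> extensional X" "g \<in> extensional X" "\<And>x. x \<in> X \<Longrightarrow> f x = g x"
    for f g :: "'d \<Rightarrow> 'd" and X
    using that by (auto intro: extensionalityI)
  show ?thesis
    unfolding additive_functor_def
  proof (intro conjI ballI)
    fix a b assume ab: "a \<in> Ob A" "b \<in> Ob A"
    show "fmap N a b \<in> hom (Hom A a b) (Hom Ab (fobj N a) (fobj N b))"
    proof (rule homI)
      show "fmap N a b f \<in> carrier (Hom Ab (fobj N a) (fobj N b))" if "f \<in> arr A a b" for f
        using assms ab that by (simp add: Ab_hom_def hom_def)
      show "fmap N a b (f \<otimes>\<^bsub>Hom A a b\<^esub> g) = fmap N a b f \<otimes>\<^bsub>Hom Ab (fobj N a) (fobj N b)\<^esub> fmap N a b g"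
        if "f \<in> arr A a b" "g \<in> arr A a b" for f g
        using assms ab that by (intro ext[of _ "carrier (fobj N a)"]) (auto simp: Ab_hom_def)
    qed
  next
    fix a assume "a \<in> Ob A"
    then show "fmap N a a (Idt A a) = Idt Ab (fobj N a)"
      using assms by (intro ext[of _ "carrier (fobj N a)"]) auto
  next
    fix a b c f g
    assume "a \<in> Ob A" "b \<in> Ob A" "c \<in> Ob A" "f \<in> arr A a b" "g \<in> arr A b c"
    then show "fmap N a c (Cmp A a b c g f) =
        Cmp Ab (fobj N a) (fobj N b) (fobj N c) (fmap N b c g) (fmap N a b f)"
      using assms by (intro ext[of _ "carrier (fobj N a)"]) (auto simp: compose_def)
  qed (use assms in auto)
qed

section \<open>Natural transformations: components and pointwise addition\<close>

abbreviation ntr :: "('o, 'm, 'z) pcat_scheme \<Rightarrow> ('o, 'm, 'w) cmod \<Rightarrow> ('o, 'm, 'v) cmod \<Rightarrow> ('o \<Rightarrow> 'w \<Rightarrow> 'v) set"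
  where "ntr A F N \<equiv> carrier (nat_group A F N)"

lemma ntrI:
  assumes "\<eta> \<in> extensional (Ob A)"
    and "\<And>a. a \<in> Ob A \<Longrightarrow> \<eta> a \<in> extensional (carrier (fobj F a))"
    and "\<And>a x. a \<in> Ob A \<Longrightarrow> x \<in> carrier (fobj F a) \<Longrightarrow> \<eta> a x \<in> carrier (fobj N a)"
    and "\<And>a x y. a \<in> Ob A \<Longrightarrow> x \<in> carrier (fobj F a) \<Longrightarrow> y \<in> carrier (fobj F a) \<Longrightarrow>
      \<eta> a (x \<otimes>\<^bsub>fobj F a\<^esub> y) = \<eta> a x \<otimes>\<^bsub>fobj N a\<^esub> \<eta> a y"
    and "\<And>a b f x. a \<in> Ob A \<Longrightarrow> b \<in> Ob A \<Longrightarrow> f \<in> arr A a b \<Longrightarrow> x \<in> carrier (fobj F a) \<Longrightarrow>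
      \<eta> b (fmap F a b f x) = fmap N a b f (\<eta> a x)"
  shows "\<eta> \<in> ntr A F N"
  using assms by (auto simp: nat_group_def Ab_hom_def hom_def)

lemma ntr_extensional: "\<eta> \<in> ntr A F N \<Longrightarrow> \<eta> \<in> extensional (Ob A)"
  by (simp add: nat_group_def)

lemma ntr_comp_ext: "\<eta> \<in> ntr A F N \<Longrightarrow> a \<in> Ob A \<Longrightarrow> \<eta> a \<in> extensional (carrier (fobj F a))"
  by (simp add: nat_group_def Ab_hom_def)

lemma ntr_hom: "\<eta> \<in> ntr A F N \<Longrightarrow> a \<in> Ob A \<Longrightarrow> \<eta> a \<in> hom (fobj F a) (fobj N a)"
  by (simp add: nat_group_def Ab_hom_def)

lemma ntr_closed: "\<eta> \<in> ntr A F N \<Longrightarrow> a \<in> Ob A \<Longrightarrow> x \<in> carrier (fobj F a) \<Longrightarrow> \<eta> a x \<in> carrier (fobj N a)"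
  using ntr_hom[of \<eta> A F N a] by (auto simp: hom_def)

lemma ntr_mult:
  "\<eta> \<in> ntr A F N \<Longrightarrow> a \<in> Ob A \<Longrightarrow> x \<in> carrier (fobj F a) \<Longrightarrow> y \<in> carrier (fobj F a) \<Longrightarrow>
    \<eta> a (x \<otimes>\<^bsub>fobj F a\<^esub> y) = \<eta> a x \<otimes>\<^bsub>fobj N a\<^esub> \<eta> a y"
  using ntr_hom[of \<eta> A F N a] by (auto simp: hom_def)

lemma ntr_natural:
  "\<eta> \<in> ntr A F N \<Longrightarrow> a \<in> Ob A \<Longrightarrow> b \<in> Ob A \<Longrightarrow> f \<in> arr A a b \<Longrightarrow> x \<in> carrier (fobj F a) \<Longrightarrow>
    \<eta> b (fmap F a b f x) = fmap N a b f (\<eta> a x)"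
  by (simp add: nat_group_def)

lemma ntr_group_hom:
  "additive_functor A Ab F \<Longrightarrow> additive_functor A Ab N \<Longrightarrow> \<eta> \<in> ntr A F N \<Longrightarrow> a \<in> Ob A \<Longrightarrow>
    group_hom (fobj F a) (fobj N a) (\<eta> a)"
  by (rule group_hom_comm_groups[OF module_group module_group ntr_hom])

text \<open>The targets \<open>N\<close> and \<open>N'\<close> may differ, because only the source
  determines where the components are extensional.\<close>

lemma ntr_eqI:
  assumes "\<eta> \<in> ntr A F N" "\<theta> \<in> ntr A F N'"
    and "\<And>a x. a \<in> Ob A \<Longrightarrow> x \<in> carrier (fobj F a) \<Longrightarrow> \<eta> a x = \<theta> a x"
  shows "\<eta> = \<theta>"
proof (rule extensionalityI)
  show "\<eta> a = \<theta> a" if "a \<in> Ob A" for a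
    by (rule extensionalityI[OF ntr_comp_ext[OF assms(1) that] ntr_comp_ext[OF assms(2) that]])
      (rule assms(3)[OF that])
qed (use assms in \<open>auto dest: ntr_extensional\<close>)

lemma nat_group_mult_apply:
  "a \<in> Ob A \<Longrightarrow> x \<in> carrier (fobj F a) \<Longrightarrow>
    (\<eta> \<otimes>\<^bsub>nat_group A F N\<^esub> \<theta>) a x = \<eta> a x \<otimes>\<^bsub>fobj N a\<^esub> \<theta> a x"
  by (simp add: nat_group_def Ab_hom_def)

lemma nat_group_one_apply:
  "a \<in> Ob A \<Longrightarrow> x \<in> carrier (fobj F a) \<Longrightarrow> \<one>\<^bsub>nat_group A F N\<^esub> a x = \<one>\<^bsub>fobj N a\<^esub>"
  by (simp add: nat_group_def Ab_hom_def)

text \<open>A pointwise sum or inverse of homomorphisms is again a homomorphism because the target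
  groups are commutative; naturality survives because the maps of \<open>N\<close> are
  additive.\<close>

lemma comm_group_nat_group:
  assumes F: "additive_functor A Ab F" and N: "additive_functor A Ab N"
  shows "comm_group (nat_group A F N)"
proof -
  have gN: "comm_group (fobj N a)" if "a \<in> Ob A" for a using N that by (rule module_group)
  have gF: "comm_group (fobj F a)" if "a \<in> Ob A" for a using F that by (rule module_group)
  note monN = gN[THEN comm_group_imp_group, THEN group.is_monoid]
  note mF = gF[THEN comm_group_imp_group, THEN group.is_monoid, THEN monoid.m_closed]
  have mult: "\<eta> \<otimes>\<^bsub>nat_group A F N\<^esub> \<theta> \<in> ntr A F N" if e: "\<eta> \<in> ntr A F N" "\<theta> \<in> ntr A F N" for \<eta> \<theta>
  proof (rule ntrI)
    fix a x y assume a: "a \<in> Ob A" and x: "x \<in> carrier (fobj F a)" and y: "y \<in> carrier (fobj F a)"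
    interpret comm_group "fobj N a" by (rule gN[OF a])
    show "(\<eta> \<otimes>\<^bsub>nat_group A F N\<^esub> \<theta>) a (x \<otimes>\<^bsub>fobj F a\<^esub> y)
        = (\<eta> \<otimes>\<^bsub>nat_group A F N\<^esub> \<theta>) a x \<otimes>\<^bsub>fobj N a\<^esub> (\<eta> \<otimes>\<^bsub>nat_group A F N\<^esub> \<theta>) a y"
      using ntr_closed[OF e(1) a] ntr_closed[OF e(2) a] x y a mF[OF a x y]
      by (simp add: nat_group_mult_apply ntr_mult[OF e(1) a] ntr_mult[OF e(2) a] m_ac)
  next
    fix a b f x assume ab: "a \<in> Ob A" "b \<in> Ob A" and f: "f \<in> arr A a b" and x: "x \<in> carrier (fobj F a)"
    show "(\<eta> \<otimes>\<^bsub>nat_group A F N\<^esub> \<theta>) b (fmap F a b f x) = fmap N a b f ((\<eta> \<otimes>\<^bsub>nat_group A F N\<^esub> \<theta>) a x)"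
      using ab f x e
      by (simp add: nat_group_mult_apply module_closed[OF F] ntr_natural[OF e(1)] ntr_natural[OF e(2)]
        module_mult[OF N] ntr_closed[OF e(1)] ntr_closed[OF e(2)])
  qed (use e gN in \<open>simp_all add: nat_group_mult_apply ntr_closed monoid.m_closed[OF monN],
       simp_all add: nat_group_def Ab_hom_def\<close>)
  have one: "\<one>\<^bsub>nat_group A F N\<^esub> \<in> ntr A F N"
    by (rule ntrI)
      (simp_all add: nat_group_one_apply module_closed[OF F] mF monN monoid.one_closed module_one[OF N] monoid.r_one,
       simp_all add: nat_group_def Ab_hom_def)
  have inv: "\<exists>\<theta>\<in>ntr A F N. \<theta> \<otimes>\<^bsub>nat_group A F N\<^esub> \<eta> = \<one>\<^bsub>nat_group A F N\<^esub>" if e: "\<eta> \<in> ntr A F N" for \<eta>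
  proof
    let ?t = "\<lambda>a\<in>Ob A. \<lambda>x\<in>carrier (fobj F a). inv\<^bsub>fobj N a\<^esub> (\<eta> a x)"
    show t: "?t \<in> ntr A F N"
    proof (rule ntrI)
      fix a x y assume a: "a \<in> Ob A" and x: "x \<in> carrier (fobj F a)" and y: "y \<in> carrier (fobj F a)"
      interpret comm_group "fobj N a" by (rule gN[OF a])
      show "?t a (x \<otimes>\<^bsub>fobj F a\<^esub> y) = ?t a x \<otimes>\<^bsub>fobj N a\<^esub> ?t a y"
        using x y a by (simp add: mF ntr_mult[OF e] inv_mult ntr_closed[OF e])
      show "?t a x \<in> carrier (fobj N a)" using a x by (simp add: ntr_closed[OF e])
    next
      fix a b f x assume ab: "a \<in> Ob A" "b \<in> Ob A" and f: "f \<in> arr A a b" and x: "x \<in> carrier (fobj F a)"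
      show "?t b (fmap F a b f x) = fmap N a b f (?t a x)"
        using ab f x by (simp add: module_closed[OF F] ntr_natural[OF e]
           group_hom.hom_inv[OF module_group_hom[OF N]] ntr_closed[OF e])
    qed auto
    show "?t \<otimes>\<^bsub>nat_group A F N\<^esub> \<eta> = \<one>\<^bsub>nat_group A F N\<^esub>"
      by (rule ntr_eqI[OF mult[OF t e] one])
        (simp add: nat_group_mult_apply nat_group_one_apply group.l_inv ntr_closed[OF e]
          comm_group_imp_group gN)
  qed
  show ?thesis
  proof (rule comm_groupI)
    fix x y z assume x: "x \<in> ntr A F N" and y: "y \<in> ntr A F N" and z: "z \<in> ntr A F N"
    show "x \<otimes>\<^bsub>nat_group A F N\<^esub> y \<otimes>\<^bsub>nat_group A F N\<^esub> z
        = x \<otimes>\<^bsub>nat_group A F N\<^esub> (y \<otimes>\<^bsub>nat_group A F N\<^esub> z)"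
      by (rule ntr_eqI[OF mult[OF mult[OF x y] z] mult[OF x mult[OF y z]]])
        (simp add: nat_group_mult_apply ntr_closed[OF x] ntr_closed[OF y] ntr_closed[OF z]
          monoid.m_assoc[OF monN])
  next
    fix x y assume x: "x \<in> ntr A F N" and y: "y \<in> ntr A F N"
    show "x \<otimes>\<^bsub>nat_group A F N\<^esub> y = y \<otimes>\<^bsub>nat_group A F N\<^esub> x"
      by (rule ntr_eqI[OF mult[OF x y] mult[OF y x]])
        (simp add: nat_group_mult_apply ntr_closed[OF x] ntr_closed[OF y]
          comm_monoid.m_comm[OF comm_group.axioms(1)[OF gN]])
  next
    fix x assume x: "x \<in> ntr A F N"
    show "\<one>\<^bsub>nat_group A F N\<^esub> \<otimes>\<^bsub>nat_group A F N\<^esub> x = x"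
      by (rule ntr_eqI[OF mult[OF one x] x])
        (simp add: nat_group_mult_apply nat_group_one_apply ntr_closed[OF x] monoid.l_one[OF monN])
  qed (use mult one inv in auto)
qed

subsection \<open>Composition\<close>

text \<open>
  The values of the modules below may live in different types, so natural transformations
  are composed here and not in the category of modules over one universe.
\<close>

definition ncmp :: "('o, 'm, 'z) pcat_scheme \<Rightarrow> ('o, 'm, 'a) cmod \<Rightarrow> ('o \<Rightarrow> 'b \<Rightarrow> 'c) \<Rightarrow> ('o \<Rightarrow> 'a \<Rightarrow> 'b) \<Rightarrow> 'o \<Rightarrow> 'a \<Rightarrow> 'c"
  where "ncmp A F \<theta> \<eta> = (\<lambda>a\<in>Ob A. compose (carrier (fobj F a)) (\<theta> a) (\<eta> a))"

definition nid :: "('o, 'm, 'z) pcat_scheme \<Rightarrow> ('o, 'm, 'a) cmod \<Rightarrow> 'o \<Rightarrow> 'a \<Rightarrow> 'a"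
  where "nid A F = (\<lambda>a\<in>Ob A. \<lambda>x\<in>carrier (fobj F a). x)"

definition ninv :: "('o, 'm, 'z) pcat_scheme \<Rightarrow> ('o, 'm, 'a) cmod \<Rightarrow> ('o, 'm, 'b) cmod \<Rightarrow> ('o \<Rightarrow> 'a \<Rightarrow> 'b) \<Rightarrow> 'o \<Rightarrow> 'b \<Rightarrow> 'a"
  where "ninv A F G \<eta> = (\<lambda>a\<in>Ob A. \<lambda>y\<in>carrier (fobj G a). inv_into (carrier (fobj F a)) (\<eta> a) y)"

text \<open>Isomorphism is expressed by bijective components and not by an inverse transformation,
  since the two modules may take values in different types and then are not objects of one
  category.\<close>

definition niso :: "('o, 'm, 'z) pcat_scheme \<Rightarrow> ('o, 'm, 'a) cmod \<Rightarrow> ('o, 'm, 'b) cmod \<Rightarrow> ('o \<Rightarrow> 'a \<Rightarrow> 'b) \<Rightarrow> bool"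
  where "niso A F G \<eta> \<longleftrightarrow> \<eta> \<in> ntr A F G \<and>
    (\<forall>a\<in>Ob A. bij_betw (\<eta> a) (carrier (fobj F a)) (carrier (fobj G a)))"

lemma ncmp_apply [simp]:
  "a \<in> Ob A \<Longrightarrow> x \<in> carrier (fobj F a) \<Longrightarrow> ncmp A F \<theta> \<eta> a x = \<theta> a (\<eta> a x)"
  by (simp add: ncmp_def compose_def)

lemma nid_apply [simp]: "a \<in> Ob A \<Longrightarrow> x \<in> carrier (fobj F a) \<Longrightarrow> nid A F a x = x"
  by (simp add: nid_def)

lemma ncmp_ntr:
  assumes F: "additive_functor A Ab F" and e: "\<eta> \<in> ntr A F G" and t: "\<theta> \<in> ntr A G H"
  shows "ncmp A F \<theta> \<eta> \<in> ntr A F H"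
  by (rule ntrI)
    (use F in \<open>simp_all add: ntr_closed[OF e] ntr_closed[OF t] ntr_mult[OF e] ntr_mult[OF t]
      module_m_closed module_closed ntr_natural[OF e] ntr_natural[OF t], simp_all add: ncmp_def\<close>)

lemma nid_ntr:
  assumes F: "additive_functor A Ab F"
  shows "nid A F \<in> ntr A F F"
  by (rule ntrI) (use F in \<open>simp_all add: module_m_closed module_closed, simp_all add: nid_def\<close>)

lemma ncmp_nid_left: "\<eta> \<in> ntr A F G \<Longrightarrow> additive_functor A Ab F \<Longrightarrow> additive_functor A Ab G \<Longrightarrow> ncmp A F (nid A G) \<eta> = \<eta>"
  by (rule ntr_eqI[of _ A F G _ G]) (simp_all add: ncmp_ntr[OF _ _ nid_ntr] ntr_closed)

lemma ncmp_nid_right: "\<eta> \<in> ntr A F G \<Longrightarrow> additive_functor A Ab F \<Longrightarrow> ncmp A F \<eta> (nid A F) = \<eta>"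
  by (rule ntr_eqI[of _ A F G _ G]) (simp_all add: ncmp_ntr[OF _ nid_ntr])

lemma ncmp_assoc:
  assumes F: "additive_functor A Ab F" "additive_functor A Ab G"
    and e: "\<eta> \<in> ntr A F G" "\<theta> \<in> ntr A G H" "\<zeta> \<in> ntr A H K"
  shows "ncmp A F \<zeta> (ncmp A F \<theta> \<eta>) = ncmp A F (ncmp A G \<zeta> \<theta>) \<eta>"
  by (rule ntr_eqI[OF ncmp_ntr[OF F(1) ncmp_ntr[OF F(1) e(1,2)] e(3)] ncmp_ntr[OF F(1) e(1) ncmp_ntr[OF F(2) e(2,3)]]])
    (simp add: ntr_closed[OF e(1)])

lemma niso_apply:
  assumes "niso A F G \<eta>" "a \<in> Ob A"
  shows "bij_betw (\<eta> a) (carrier (fobj F a)) (carrier (fobj G a))"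
    and "x \<in> carrier (fobj F a) \<Longrightarrow> ninv A F G \<eta> a (\<eta> a x) = x"
    and "y \<in> carrier (fobj G a) \<Longrightarrow> \<eta> a (ninv A F G \<eta> a y) = y"
    and "y \<in> carrier (fobj G a) \<Longrightarrow> ninv A F G \<eta> a y \<in> carrier (fobj F a)"
proof -
  show b: "bij_betw (\<eta> a) (carrier (fobj F a)) (carrier (fobj G a))"
    using assms by (simp add: niso_def)
  show "ninv A F G \<eta> a (\<eta> a x) = x" if "x \<in> carrier (fobj F a)"
    using b that assms(2) by (simp add: ninv_def bij_betw_inv_into_left bij_betwE)
  show "\<eta> a (ninv A F G \<eta> a y) = y" "ninv A F G \<eta> a y \<in> carrier (fobj F a)" if "y \<in> carrier (fobj G a)"
    using b that assms(2) bij_betwE[OF bij_betw_inv_into[OF b]]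
    by (simp_all add: ninv_def bij_betw_inv_into_right)
qed

text \<open>Each law for the inverse is checked after applying the injective component of
  \<open>\<eta>\<close>, where it becomes the corresponding law of \<open>\<eta>\<close>.\<close>

lemma ninv_ntr:
  assumes F: "additive_functor A Ab F" and G: "additive_functor A Ab G" and e: "niso A F G \<eta>"
  shows "ninv A F G \<eta> \<in> ntr A G F"
proof -
  have n: "\<eta> \<in> ntr A F G" using e by (simp add: niso_def)
  note i = niso_apply[OF e]
  have inj: "x = y" if "a \<in> Ob A" "x \<in> carrier (fobj F a)" "y \<in> carrier (fobj F a)" "\<eta> a x = \<eta> a y" for a x y
    using i(2)[OF that(1,2)] i(2)[OF that(1,3)] that(4) by argo
  show ?thesis
  proof (rule ntrI)
    show "ninv A F G \<eta> a (x \<otimes>\<^bsub>fobj G a\<^esub> y) = ninv A F G \<eta> a x \<otimes>\<^bsub>fobj F a\<^esub> ninv A F G \<eta> a y"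
      if "a \<in> Ob A" "x \<in> carrier (fobj G a)" "y \<in> carrier (fobj G a)" for a x y
      by (rule inj[OF that(1)])
        (use that F G in \<open>simp_all add: i module_m_closed ntr_mult[OF n]\<close>)
    show "ninv A F G \<eta> b (fmap G a b f x) = fmap F a b f (ninv A F G \<eta> a x)"
      if "a \<in> Ob A" "b \<in> Ob A" "f \<in> arr A a b" "x \<in> carrier (fobj G a)" for a b f x
      by (rule inj[OF that(2)])
        (use that F G in \<open>simp_all add: i module_closed ntr_natural[OF n]\<close>)
  qed (simp_all add: i, simp_all add: ninv_def)
qed

lemma niso_ncmp:
  assumes F: "additive_functor A Ab F" and e: "niso A F G \<eta>" "niso A G H \<theta>"
  shows "niso A F H (ncmp A F \<theta> \<eta>)"
proof -
  have "bij_betw (ncmp A F \<theta> \<eta> a) (carrier (fobj F a)) (carrier (fobj H a))" if "a \<in> Ob A" for a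
    using bij_betw_trans[OF niso_apply(1)[OF e(1) that] niso_apply(1)[OF e(2) that]] that
    by (subst bij_betw_cong[of _ _ "\<theta> a \<circ> \<eta> a"]) simp_all
  moreover have "ncmp A F \<theta> \<eta> \<in> ntr A F H" using e ncmp_ntr[OF F, of \<eta> G \<theta> H] by (simp add: niso_def)
  ultimately show ?thesis by (simp add: niso_def)
qed

text \<open>Every element of \<open>fobj G a\<close> has the form \<open>k a x\<close>, and
  \<open>nat\<close> expresses the action on it through \<open>F\<close>; so all module laws descend
  from \<open>F\<close> to \<open>G\<close>. With bijective \<open>k\<close> this yields copies and
  tensor modules, with quotient maps it yields cokernels.\<close>

lemma module_surj_transport:
  assumes A: "preadditive_category A" and F: "additive_functor A Ab F"
    and k: "\<And>a. a \<in> Ob A \<Longrightarrow> k a \<in> hom (fobj F a) (fobj G a)"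
    and ks': "\<And>a. a \<in> Ob A \<Longrightarrow> k a ` carrier (fobj F a) = carrier (fobj G a)"
    and g: "\<And>a. a \<in> Ob A \<Longrightarrow> comm_group (fobj G a)"
    and ext: "\<And>a b f. a \<in> Ob A \<Longrightarrow> b \<in> Ob A \<Longrightarrow> f \<in> arr A a b \<Longrightarrow>
      fmap G a b f \<in> extensional (carrier (fobj G a))"
    and nat: "\<And>a b f x. a \<in> Ob A \<Longrightarrow> b \<in> Ob A \<Longrightarrow> f \<in> arr A a b \<Longrightarrow> x \<in> carrier (fobj F a) \<Longrightarrow>
      fmap G a b f (k a x) = k b (fmap F a b f x)"
  shows "additive_functor A Ab G"
    and "(\<lambda>a\<in>Ob A. \<lambda>x\<in>carrier (fobj F a). k a x) \<in> ntr A F G"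
proof -
  interpret preadditive_category A by fact
  have kc: "k a x \<in> carrier (fobj G a)" if "a \<in> Ob A" "x \<in> carrier (fobj F a)" for a x
    using k[OF that(1)] that(2) by (auto simp: hom_def)
  have km: "k a (x \<otimes>\<^bsub>fobj F a\<^esub> y) = k a x \<otimes>\<^bsub>fobj G a\<^esub> k a y"
    if "a \<in> Ob A" "x \<in> carrier (fobj F a)" "y \<in> carrier (fobj F a)" for a x y
    using k[OF that(1)] that(2,3) by (auto simp: hom_def)
  have ks: "\<exists>x\<in>carrier (fobj F a). y = k a x" if "a \<in> Ob A" "y \<in> carrier (fobj G a)" for a y
    using ks'[OF that(1)] that(2) by auto
  note F' = module_m_closed[OF F] module_closed[OF F]
  show "additive_functor A Ab G"
  proof (rule moduleI)
    show "fmap G a b f y \<in> carrier (fobj G b)"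
      if "a \<in> Ob A" "b \<in> Ob A" "f \<in> arr A a b" "y \<in> carrier (fobj G a)" for a b f y
      using ks[OF that(1,4)] that by (auto simp: nat kc F')
    show "fmap G a b f (y \<otimes>\<^bsub>fobj G a\<^esub> z) = fmap G a b f y \<otimes>\<^bsub>fobj G b\<^esub> fmap G a b f z"
      if "a \<in> Ob A" "b \<in> Ob A" "f \<in> arr A a b" "y \<in> carrier (fobj G a)" "z \<in> carrier (fobj G a)" for a b f y z
      using ks[OF that(1,4)] ks[OF that(1,5)] that
      by (auto simp: nat km[symmetric] F' module_mult[OF F])
    show "fmap G a b (f \<otimes>\<^bsub>Hom A a b\<^esub> g) y = fmap G a b f y \<otimes>\<^bsub>fobj G b\<^esub> fmap G a b g y"
      if "a \<in> Ob A" "b \<in> Ob A" "f \<in> arr A a b" "g \<in> arr A a b" "y \<in> carrier (fobj G a)" for a b f g y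
      using ks[OF that(1,5)] that
      by (auto simp: nat km[symmetric] F' module_add[OF F] add_arr_closed)
    show "fmap G a a (Idt A a) y = y" if "a \<in> Ob A" "y \<in> carrier (fobj G a)" for a y
      using ks[OF that] that by (auto simp: nat module_Idt[OF F] Idt_arr)
    show "fmap G a c (Cmp A a b c g f) y = fmap G b c g (fmap G a b f y)"
      if "a \<in> Ob A" "b \<in> Ob A" "c \<in> Ob A" "f \<in> arr A a b" "g \<in> arr A b c" "y \<in> carrier (fobj G a)" for a b c f g y
      using ks[OF that(1,6)] that by (auto simp: nat module_Cmp[OF F] Cmp_arr F')
  qed (simp_all add: g ext add_arr_closed Idt_arr Cmp_arr)
  show "(\<lambda>a\<in>Ob A. \<lambda>x\<in>carrier (fobj F a). k a x) \<in> ntr A F G"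
    by (rule ntrI) (simp_all add: kc km F' nat)
qed

lemma module_transport:
  assumes A: "preadditive_category A" and F: "additive_functor A Ab F"
    and k: "\<And>a. a \<in> Ob A \<Longrightarrow> k a \<in> iso (fobj F a) (fobj G a)"
    and g: "\<And>a. a \<in> Ob A \<Longrightarrow> comm_group (fobj G a)"
    and ext: "\<And>a b f. a \<in> Ob A \<Longrightarrow> b \<in> Ob A \<Longrightarrow> f \<in> arr A a b \<Longrightarrow>
      fmap G a b f \<in> extensional (carrier (fobj G a))"
    and nat: "\<And>a b f x. a \<in> Ob A \<Longrightarrow> b \<in> Ob A \<Longrightarrow> f \<in> arr A a b \<Longrightarrow> x \<in> carrier (fobj F a) \<Longrightarrow>
      fmap G a b f (k a x) = k b (fmap F a b f x)"
  shows "additive_functor A Ab G"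
    and "niso A F G (\<lambda>a\<in>Ob A. \<lambda>x\<in>carrier (fobj F a). k a x)"
proof -
  have k1: "k a \<in> hom (fobj F a) (fobj G a)" if "a \<in> Ob A" for a
    using k[OF that] by (simp add: iso_def)
  have bij: "bij_betw (k a) (carrier (fobj F a)) (carrier (fobj G a))" if "a \<in> Ob A" for a
    using k[OF that] by (simp add: iso_def)
  note t = module_surj_transport[OF A F k1 bij_betw_imp_surj_on[OF bij] g ext nat]
  show "additive_functor A Ab G" by (rule t(1))
  show "niso A F G (\<lambda>a\<in>Ob A. \<lambda>x\<in>carrier (fobj F a). k a x)"
    using bij t(2) by (simp add: niso_def)
qed

subsection \<open>Copies inside the universe\<close>

text \<open>The size condition under which the choice made by \<open>copy\<close> is
  meaningful.\<close>

definition fits :: "'v itself \<Rightarrow> 'a set \<Rightarrow> bool"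
  where "fits _ X \<longleftrightarrow> (\<exists>e :: 'a \<Rightarrow> 'v. inj_on e X)"

lemma fits_same [simp]: "fits TYPE('v) (X :: 'v set)"
  unfolding fits_def by (rule exI[of _ "\<lambda>x. x"]) simp

lemma fits_inj: "fits TYPE('v) Y \<Longrightarrow> inj_on f X \<Longrightarrow> f ` X \<subseteq> Y \<Longrightarrow> fits TYPE('v) X"
  unfolding fits_def by (meson comp_inj_on inj_on_subset)

lemma fits_bij: "bij_betw f X Y \<Longrightarrow> fits TYPE('v) X \<Longrightarrow> fits TYPE('v) Y"
  by (metis bij_betw_def bij_betw_inv_into fits_inj order_refl)

text \<open>An injection into the universe carries the group structure to its image, so the property
  from which \<open>copy\<close> chooses is satisfiable; the two choices can then be
  unfolded.\<close>

lemma copy_group: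
  assumes G: "comm_group G" and f: "fits TYPE('v) (carrier G)"
  shows "comm_group (copy G :: 'v monoid)" and "copy_iso G \<in> iso G (copy G :: 'v monoid)"
proof -
  interpret comm_group G by fact
  obtain e :: "'a \<Rightarrow> 'v" where e: "inj_on e (carrier G)" using f by (auto simp: fits_def)
  define H where "H = \<lparr>carrier = e ` carrier G, mult = (\<lambda>x y. e (inv_into (carrier G) e x \<otimes>\<^bsub>G\<^esub> inv_into (carrier G) e y)),
    one = e \<one>\<^bsub>G\<^esub>\<rparr>"
  have eiso: "e \<in> iso G H"
    using e by (auto simp: iso_def hom_def H_def bij_betw_def)
  have m: "monoid H" using e by (intro monoidI) (auto simp: H_def m_assoc)
  have "comm_group H"
    using iso_imp_comm_group[OF is_isoI[OF eiso] m] .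
  then have "\<exists>H :: 'v monoid. comm_group H \<and> G \<cong> H" using eiso is_isoI by blast
  from someI_ex[OF this] have c: "comm_group (copy G :: 'v monoid)" "G \<cong> (copy G :: 'v monoid)"
    by (simp_all add: copy_def)
  show "comm_group (copy G :: 'v monoid)" by (rule c)
  from c(2) have "\<exists>h. h \<in> iso G (copy G :: 'v monoid)" by (auto simp: is_iso_def)
  then show "copy_iso G \<in> iso G (copy G :: 'v monoid)" unfolding copy_iso_def by (rule someI_ex)
qed

lemma copy_map_apply:
  assumes G: "comm_group G" and f: "fits TYPE('v) (carrier G)" and x: "x \<in> carrier G"
  shows "copy_map G H f (copy_iso G x :: 'v) = copy_iso H (f x)"
proof -
  have "bij_betw (copy_iso G :: 'a \<Rightarrow> 'v) (carrier G) (carrier (copy G))"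
    using copy_group(2)[OF G f] by (simp add: iso_def)
  then show ?thesis using x by (auto simp: copy_map_def bij_betw_inv_into_left bij_betwE)
qed

definition copy_nat :: "('o, 'm, 'z) pcat_scheme \<Rightarrow> ('o, 'm, 'a) cmod \<Rightarrow> 'o \<Rightarrow> 'a \<Rightarrow> 'v"
  where "copy_nat A F = (\<lambda>a\<in>Ob A. \<lambda>x\<in>carrier (fobj F a). copy_iso (fobj F a) x)"

lemma copy_module:
  fixes F :: "('o, 'm, 'a) cmod"
  assumes A: "preadditive_category A" and F: "additive_functor A Ab F"
    and fit: "\<And>a. a \<in> Ob A \<Longrightarrow> fits TYPE('v) (carrier (fobj F a))"
  shows "additive_functor A Ab (copy_mod F :: ('o, 'm, 'v) cmod)"
    and "niso A F (copy_mod F :: ('o, 'm, 'v) cmod) (copy_nat A F)"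
proof -
  let ?k = "\<lambda>a. copy_iso (fobj F a) :: 'a \<Rightarrow> 'v"
  have k: "?k a \<in> iso (fobj F a) (fobj (copy_mod F) a)" if "a \<in> Ob A" for a
    using that by (simp add: copy_mod_def copy_group module_group[OF F] fit)
  have g: "comm_group (fobj (copy_mod F) a :: 'v monoid)" if "a \<in> Ob A" for a
    using that by (simp add: copy_mod_def copy_group module_group[OF F] fit)
  have ext: "fmap (copy_mod F) a b f \<in> extensional (carrier (fobj (copy_mod F) a :: 'v monoid))" for a b f
    by (simp add: copy_mod_def copy_map_def)
  have nat: "fmap (copy_mod F) a b f (?k a x) = ?k b (fmap F a b f x)"
    if "a \<in> Ob A" "b \<in> Ob A" "f \<in> arr A a b" "x \<in> carrier (fobj F a)" for a b f x
    using that by (simp add: copy_mod_def copy_map_apply module_group[OF F] fit)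
  note t = module_transport[OF A F k g ext nat]
  show "additive_functor A Ab (copy_mod F :: ('o, 'm, 'v) cmod)" by (rule t(1))
  show "niso A F (copy_mod F :: ('o, 'm, 'v) cmod) (copy_nat A F)" unfolding copy_nat_def by (rule t(2))
qed

section \<open>The abelian category of modules\<close>

lemma ModCat_simps [simp]:
  "Ob (ModCat A) = {N. additive_functor A Ab N}"
  "Hom (ModCat A) = nat_group A"
  "Idt (ModCat A) = nid A"
  "Cmp (ModCat A) F G H = ncmp A F"
  by (auto simp: ModCat_def nid_def ncmp_def fun_eq_iff)

lemma nat_group_m_closed:
  assumes "additive_functor A Ab F" "additive_functor A Ab N" "\<eta> \<in> ntr A F N" "\<theta> \<in> ntr A F N"
  shows "\<eta> \<otimes>\<^bsub>nat_group A F N\<^esub> \<theta> \<in> ntr A F N"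
  by (rule monoid.m_closed[OF group.is_monoid[OF comm_group_imp_group[OF comm_group_nat_group[OF assms(1,2)]]] assms(3,4)])

lemma nat_group_one_closed:
  assumes "additive_functor A Ab F" "additive_functor A Ab N"
  shows "\<one>\<^bsub>nat_group A F N\<^esub> \<in> ntr A F N"
  by (rule monoid.one_closed[OF group.is_monoid[OF comm_group_imp_group[OF comm_group_nat_group[OF assms(1,2)]]]])

lemma ncmp_hom_right:
  assumes F: "additive_functor A Ab F" and G: "additive_functor A Ab G" and H: "additive_functor A Ab H"
    and t: "\<theta> \<in> ntr A G H"
  shows "(\<lambda>\<eta>. ncmp A F \<theta> \<eta>) \<in> hom (nat_group A F G) (nat_group A F H)"
proof (rule homI)
  show "ncmp A F \<theta> \<eta> \<in> ntr A F H" if "\<eta> \<in> ntr A F G" for \<eta> by (rule ncmp_ntr[OF F that t])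
  show "ncmp A F \<theta> (\<eta> \<otimes>\<^bsub>nat_group A F G\<^esub> \<eta>') = ncmp A F \<theta> \<eta> \<otimes>\<^bsub>nat_group A F H\<^esub> ncmp A F \<theta> \<eta>'"
    if e: "\<eta> \<in> ntr A F G" "\<eta>' \<in> ntr A F G" for \<eta> \<eta>'
    by (rule ntr_eqI[OF ncmp_ntr[OF F nat_group_m_closed[OF F G e] t]
          nat_group_m_closed[OF F H ncmp_ntr[OF F e(1) t] ncmp_ntr[OF F e(2) t]]])
      (simp add: nat_group_mult_apply ntr_mult[OF t] ntr_closed[OF e(1)] ntr_closed[OF e(2)])
qed

lemma ncmp_hom_left:
  assumes F: "additive_functor A Ab F" and G: "additive_functor A Ab G" and H: "additive_functor A Ab H"
    and e: "\<eta> \<in> ntr A F G"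
  shows "(\<lambda>\<theta>. ncmp A F \<theta> \<eta>) \<in> hom (nat_group A G H) (nat_group A F H)"
proof (rule homI)
  show "ncmp A F \<theta> \<eta> \<in> ntr A F H" if "\<theta> \<in> ntr A G H" for \<theta> by (rule ncmp_ntr[OF F e that])
  show "ncmp A F (\<theta> \<otimes>\<^bsub>nat_group A G H\<^esub> \<theta>') \<eta> = ncmp A F \<theta> \<eta> \<otimes>\<^bsub>nat_group A F H\<^esub> ncmp A F \<theta>' \<eta>"
    if t: "\<theta> \<in> ntr A G H" "\<theta>' \<in> ntr A G H" for \<theta> \<theta>'
    by (rule ntr_eqI[OF ncmp_ntr[OF F e nat_group_m_closed[OF G H t]]
          nat_group_m_closed[OF F H ncmp_ntr[OF F e t(1)] ncmp_ntr[OF F e t(2)]]])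
      (simp add: nat_group_mult_apply ntr_closed[OF e])
qed

lemma preadditive_ModCat: "preadditive_category (ModCat A :: (('o, 'm, 'v) cmod, _) pcat)"
proof (rule preadditive_category.intro; unfold ModCat_simps mem_Collect_eq)
  fix F G H K :: "('o, 'm, 'v) cmod"
  assume F: "additive_functor A Ab F"
  show "nid A F \<in> ntr A F F" by (rule nid_ntr[OF F])
  assume G: "additive_functor A Ab G"
  show "comm_group (nat_group A F G)" by (rule comm_group_nat_group[OF F G])
  show "ncmp A F (nid A G) f = f" if "f \<in> ntr A F G" for f by (rule ncmp_nid_left[OF that F G])
  show "ncmp A F f (nid A F) = f" if "f \<in> ntr A F G" for f by (rule ncmp_nid_right[OF that F])
  assume H: "additive_functor A Ab H"
  show "ncmp A F g \<in> hom (nat_group A F G) (nat_group A F H)" if "g \<in> ntr A G H" for g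
    using ncmp_hom_right[OF F G H that] by simp
  show "(\<lambda>g. ncmp A F g f) \<in> hom (nat_group A G H) (nat_group A F H)" if "f \<in> ntr A F G" for f
    by (rule ncmp_hom_left[OF F G H that])
  show "ncmp A F h (ncmp A F g f) = ncmp A F (ncmp A G h g) f"
    if "f \<in> ntr A F G" "g \<in> ntr A G H" "h \<in> ntr A H K" for f g h
    by (rule ncmp_assoc[OF F G that])
qed

lemma iso_arr_ModCat:
  assumes F: "additive_functor A Ab F" and G: "additive_functor A Ab G"
  shows "iso_arr (ModCat A) F G \<eta> \<longleftrightarrow> niso A F G \<eta>"
proof
  assume i: "iso_arr (ModCat A) F G \<eta>"
  then obtain \<theta> where e: "\<eta> \<in> ntr A F G" and t: "\<theta> \<in> ntr A G F"
    and c: "ncmp A F \<theta> \<eta> = nid A F" "ncmp A G \<eta> \<theta> = nid A G"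
    by (auto simp: iso_arr_def)
  have "bij_betw (\<eta> a) (carrier (fobj F a)) (carrier (fobj G a))" if a: "a \<in> Ob A" for a
  proof (rule bij_betw_byWitness[where f' = "\<theta> a"])
    show "\<forall>x\<in>carrier (fobj F a). \<theta> a (\<eta> a x) = x"
    proof
      fix x assume x: "x \<in> carrier (fobj F a)"
      show "\<theta> a (\<eta> a x) = x"
        using fun_cong[OF fun_cong[OF c(1), of a], of x] a x by simp
    qed
    show "\<forall>x\<in>carrier (fobj G a). \<eta> a (\<theta> a x) = x"
    proof
      fix x assume x: "x \<in> carrier (fobj G a)"
      show "\<eta> a (\<theta> a x) = x"
        using fun_cong[OF fun_cong[OF c(2), of a], of x] a x by simp
    qed
  qed (use ntr_closed[OF e a] ntr_closed[OF t a] in auto)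
  then show "niso A F G \<eta>" using e by (simp add: niso_def)
next
  assume i: "niso A F G \<eta>"
  then have e: "\<eta> \<in> ntr A F G" by (simp add: niso_def)
  have t: "ninv A F G \<eta> \<in> ntr A G F" by (rule ninv_ntr[OF F G i])
  have "ncmp A F (ninv A F G \<eta>) \<eta> = nid A F"
    by (rule ntr_eqI[OF ncmp_ntr[OF F e t] nid_ntr[OF F]]) (simp add: niso_apply[OF i])
  moreover have "ncmp A G \<eta> (ninv A F G \<eta>) = nid A G"
    by (rule ntr_eqI[OF ncmp_ntr[OF G t e] nid_ntr[OF G]]) (simp add: niso_apply[OF i])
  ultimately show "iso_arr (ModCat A) F G \<eta>"
    using e t by (auto simp: iso_arr_def)
qed

subsection \<open>Zero object\<close>

text \<open>The value \<open>undefined\<close> is the one element that can be named in an arbitrary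
  universe type.\<close>

definition zero_module :: "('o, 'm, 'v) cmod"
  where "zero_module = \<lparr>fobj = (\<lambda>a. \<lparr>carrier = {undefined}, mult = (\<lambda>x y. undefined), one = undefined\<rparr>),
    fmap = (\<lambda>a b f. \<lambda>x\<in>{undefined}. undefined)\<rparr>"

lemma zero_module:
  assumes "preadditive_category A"
  shows "additive_functor A Ab zero_module"
proof -
  interpret preadditive_category A by fact
  show ?thesis
    by (rule moduleI)
      (auto simp: zero_module_def add_arr_closed Idt_arr Cmp_arr intro!: comm_groupI)
qed

text \<open>On a zero object the identity equals the zero endomorphism, and evaluating both at
  \<open>x\<close> gives \<open>x = 0\<close>. This turns the kernel condition of a recollement into
  a statement about values.\<close>

lemma zero_object_ModCat:
  "zero_object (ModCat A) (N :: ('o, 'm, 'v) cmod) \<longleftrightarrow>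
    additive_functor A Ab N \<and> (\<forall>a\<in>Ob A. carrier (fobj N a) = {\<one>\<^bsub>fobj N a\<^esub>})"
proof (intro iffI conjI ballI)
  assume z: "zero_object (ModCat A) N"
  then show N: "additive_functor A Ab N" by (simp add: zero_object_def)
  fix a assume a: "a \<in> Ob A"
  have "nid A N = \<one>\<^bsub>nat_group A N N\<^esub>"
    using z nid_ntr[OF N] nat_group_one_closed[OF N N] N unfolding zero_object_def by auto
  then have eq: "nid A N a x = \<one>\<^bsub>nat_group A N N\<^esub> a x" for x by simp
  have "x = \<one>\<^bsub>fobj N a\<^esub>" if "x \<in> carrier (fobj N a)" for x
    by (rule eq[of x, unfolded nid_apply[OF a that] nat_group_one_apply[OF a that]])
  then show "carrier (fobj N a) = {\<one>\<^bsub>fobj N a\<^esub>}" using module_one_closed[OF N a] by blast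
next
  assume N: "additive_functor A Ab N \<and> (\<forall>a\<in>Ob A. carrier (fobj N a) = {\<one>\<^bsub>fobj N a\<^esub>})"
  have "\<exists>!f. f \<in> ntr A N X" "\<exists>!f. f \<in> ntr A X N" if X: "additive_functor A Ab X" for X :: "('o, 'm, 'v) cmod"
  proof -
    have N': "additive_functor A Ab N" using N by simp
    show "\<exists>!f. f \<in> ntr A N X"
    proof (rule ex_ex1I)
      show "\<exists>f. f \<in> ntr A N X" using nat_group_one_closed[OF N' X] by blast
      fix f g assume f: "f \<in> ntr A N X" and g: "g \<in> ntr A N X"
      show "f = g"
      proof (rule ntr_eqI[OF f g])
        fix a x assume a: "a \<in> Ob A" and "x \<in> carrier (fobj N a)"
        then have "x = \<one>\<^bsub>fobj N a\<^esub>" using N by auto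
        then show "f a x = g a x"
          using group_hom.hom_one[OF ntr_group_hom[OF N' X f a]] group_hom.hom_one[OF ntr_group_hom[OF N' X g a]]
          by simp
      qed
    qed
    show "\<exists>!f. f \<in> ntr A X N"
    proof (rule ex_ex1I)
      show "\<exists>f. f \<in> ntr A X N" using nat_group_one_closed[OF X N'] by blast
      fix f g assume f: "f \<in> ntr A X N" and g: "g \<in> ntr A X N"
      show "f = g"
      proof (rule ntr_eqI[OF f g])
        fix a x assume a: "a \<in> Ob A" and x: "x \<in> carrier (fobj X a)"
        have "carrier (fobj N a) = {\<one>\<^bsub>fobj N a\<^esub>}" using N a by simp
        then show "f a x = g a x"
          using ntr_closed[OF f a x] ntr_closed[OF g a x] by simp
      qed
    qed
  qed
  then show "zero_object (ModCat A) N" using N by (simp add: zero_object_def)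
qed

subsection \<open>Biproducts\<close>

lemma comm_group_DirProd:
  assumes "comm_group G" "comm_group H"
  shows "comm_group (G \<times>\<times> H)"
proof -
  interpret G: comm_group G by fact
  interpret H: comm_group H by fact
  show ?thesis
  proof (rule comm_groupI)
    fix x assume "x \<in> carrier (G \<times>\<times> H)"
    then show "\<exists>y\<in>carrier (G \<times>\<times> H). y \<otimes>\<^bsub>G \<times>\<times> H\<^esub> x = \<one>\<^bsub>G \<times>\<times> H\<^esub>"
      by (cases x) (auto simp: DirProd_def intro!: bexI[of _ "inv\<^bsub>G\<^esub> fst x"] bexI[of _ "inv\<^bsub>H\<^esub> snd x"])
  qed (auto simp: DirProd_def G.m_ac H.m_ac)
qed

definition direct_sum :: "('o, 'm, 'v) cmod \<Rightarrow> ('o, 'm, 'w) cmod \<Rightarrow> ('o, 'm, 'v \<times> 'w) cmod"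
  where "direct_sum F G = \<lparr>fobj = (\<lambda>a. fobj F a \<times>\<times> fobj G a),
    fmap = (\<lambda>a b f. \<lambda>p\<in>carrier (fobj F a) \<times> carrier (fobj G a). (fmap F a b f (fst p), fmap G a b f (snd p)))\<rparr>"

lemma direct_sum_additive:
  assumes A: "preadditive_category A" and F: "additive_functor A Ab F" and G: "additive_functor A Ab G"
  shows "additive_functor A Ab (direct_sum F G)"
proof -
  interpret preadditive_category A by fact
  note FG = module_closed[OF F] module_closed[OF G] module_m_closed[OF F] module_m_closed[OF G]
    module_mult[OF F] module_mult[OF G] module_add[OF F] module_add[OF G] module_Idt[OF F] module_Idt[OF G]
    module_Cmp[OF F] module_Cmp[OF G]
  show ?thesis
    by (rule moduleI)
      (auto simp: direct_sum_def comm_group_DirProd module_group[OF F] module_group[OF G]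
        add_arr_closed Idt_arr Cmp_arr FG)
qed

text \<open>An infinite universe is equipotent to its square. This is what brings direct sums, whose
  values consist of pairs, back into the universe.\<close>

lemma fits_Times:
  assumes "infinite (UNIV :: 'v set)"
  shows "fits TYPE('v) (X :: ('v \<times> 'v) set)"
proof -
  have "|UNIV \<times> UNIV :: ('v \<times> 'v) set| =o |UNIV :: 'v set|"
    by (rule card_of_Times_same_infinite[OF assms])
  then obtain f :: "'v \<times> 'v \<Rightarrow> 'v" where "bij_betw f (UNIV \<times> UNIV) UNIV"
    using card_of_ordIso[THEN iffD2] by blast
  then have "inj_on f X" by (auto simp: bij_betw_def intro: inj_on_subset)
  then show ?thesis unfolding fits_def by (rule exI[of _ f])
qed

text \<open>The usual injections and projections exist for \<open>direct_sum\<close>, whose values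
  lie in a product type; they are carried over to its copy along \<open>?k\<close> and its inverse
  \<open>?l\<close>.\<close>

lemma biproduct_ModCat:
  assumes inf: "infinite (UNIV :: 'v set)" and A: "preadditive_category A"
    and F: "additive_functor A Ab (F :: ('o, 'm, 'v) cmod)" and G: "additive_functor A Ab (G :: ('o, 'm, 'v) cmod)"
  shows "\<exists>S\<in>Ob (ModCat A). \<exists>i j p q. biproduct (ModCat A) F G (S :: ('o, 'm, 'v) cmod) i j p q"
proof -
  let ?D = "direct_sum F G"
  let ?S = "copy_mod ?D :: ('o, 'm, 'v) cmod"
  have D: "additive_functor A Ab ?D" by (rule direct_sum_additive[OF A F G])
  note S = copy_module[OF A D fits_Times[OF inf]]
  let ?k = "copy_nat A ?D :: 'o \<Rightarrow> _ \<Rightarrow> 'v"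
  let ?l = "ninv A ?D ?S ?k"
  have k: "?k \<in> ntr A ?D ?S" using S(2) by (simp add: niso_def)
  have l: "?l \<in> ntr A ?S ?D" by (rule ninv_ntr[OF D S])
  note kl = niso_apply[OF S(2)]
  define i0 where "i0 = (\<lambda>a\<in>Ob A. \<lambda>x\<in>carrier (fobj F a). (x, \<one>\<^bsub>fobj G a\<^esub>))"
  define j0 where "j0 = (\<lambda>a\<in>Ob A. \<lambda>x\<in>carrier (fobj G a). (\<one>\<^bsub>fobj F a\<^esub>, x))"
  define p0 where "p0 = (\<lambda>a\<in>Ob A. \<lambda>z\<in>carrier (fobj F a) \<times> carrier (fobj G a). fst z)"
  define q0 where "q0 = (\<lambda>a\<in>Ob A. \<lambda>z\<in>carrier (fobj F a) \<times> carrier (fobj G a). snd z)"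
  note one = monoid.r_one[OF group.is_monoid[OF comm_group_imp_group[OF module_group[OF G]]]]
     monoid.r_one[OF group.is_monoid[OF comm_group_imp_group[OF module_group[OF F]]]]
     monoid.l_one[OF group.is_monoid[OF comm_group_imp_group[OF module_group[OF F]]]]
     monoid.l_one[OF group.is_monoid[OF comm_group_imp_group[OF module_group[OF G]]]]
  have one_mem: "\<one>\<^bsub>fobj F a\<^esub> \<in> carrier (fobj F a)" "\<one>\<^bsub>fobj G a\<^esub> \<in> carrier (fobj G a)" if "a \<in> Ob A" for a
    using module_one_closed[OF F that] module_one_closed[OF G that] by auto
  note FG = module_closed[OF F] module_closed[OF G] module_m_closed[OF F] module_m_closed[OF G]
    module_one[OF F] module_one[OF G]
  have i0: "i0 \<in> ntr A F ?D"
    by (rule ntrI) (auto simp: i0_def direct_sum_def FG one_mem one)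
  have j0: "j0 \<in> ntr A G ?D"
    by (rule ntrI) (auto simp: j0_def direct_sum_def FG one_mem one)
  have p0: "p0 \<in> ntr A ?D F"
    by (rule ntrI) (auto simp: p0_def direct_sum_def FG)
  have q0: "q0 \<in> ntr A ?D G"
    by (rule ntrI) (auto simp: q0_def direct_sum_def FG)
  have i: "ncmp A F ?k i0 \<in> ntr A F ?S" by (rule ncmp_ntr[OF F i0 k])
  have j: "ncmp A G ?k j0 \<in> ntr A G ?S" by (rule ncmp_ntr[OF G j0 k])
  have p: "ncmp A ?S p0 ?l \<in> ntr A ?S F" by (rule ncmp_ntr[OF S(1) l p0])
  have q: "ncmp A ?S q0 ?l \<in> ntr A ?S G" by (rule ncmp_ntr[OF S(1) l q0])
  have mem: "(x, y) \<in> carrier (fobj ?D a)" if "x \<in> carrier (fobj F a)" "y \<in> carrier (fobj G a)" for x y a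
    using that by (simp add: direct_sum_def)
  have carrD: "carrier (fobj ?D a) = carrier (fobj F a) \<times> carrier (fobj G a)" for a
    by (simp add: direct_sum_def)
  have "biproduct (ModCat A) F G ?S (ncmp A F ?k i0) (ncmp A G ?k j0) (ncmp A ?S p0 ?l) (ncmp A ?S q0 ?l)"
    unfolding biproduct_def ModCat_simps
  proof (intro conjI)
    have e: "ncmp A F ?k i0 a x = ?k a (x, \<one>\<^bsub>fobj G a\<^esub>)" "?k a (x, \<one>\<^bsub>fobj G a\<^esub>) \<in> carrier (fobj ?S a)"
      if "a \<in> Ob A" "x \<in> carrier (fobj F a)" for a x
      using that ntr_closed[OF k that(1) mem[OF that(2) one_mem(2)]] by (simp_all add: i0_def)
    have e': "ncmp A G ?k j0 a x = ?k a (\<one>\<^bsub>fobj F a\<^esub>, x)" "?k a (\<one>\<^bsub>fobj F a\<^esub>, x) \<in> carrier (fobj ?S a)"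
      if "a \<in> Ob A" "x \<in> carrier (fobj G a)" for a x
      using that ntr_closed[OF k that(1) mem[OF one_mem(1) that(2)]] by (simp_all add: j0_def)
    have pq: "ncmp A ?S p0 ?l a (?k a z) = fst z" "ncmp A ?S q0 ?l a (?k a z) = snd z"
      if "a \<in> Ob A" "z \<in> carrier (fobj ?D a)" for a z
      using that ntr_closed[OF k that] by (simp_all add: kl(2) p0_def q0_def carrD)
    show "ncmp A F (ncmp A ?S p0 ?l) (ncmp A F ?k i0) = nid A F"
      by (rule ntr_eqI[OF ncmp_ntr[OF F i p] nid_ntr[OF F]])
        (use e pq mem one_mem in \<open>simp del: ncmp_apply add: i0_def ncmp_apply[where F = F]\<close>)
    show "ncmp A G (ncmp A ?S q0 ?l) (ncmp A G ?k j0) = nid A G"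
      by (rule ntr_eqI[OF ncmp_ntr[OF G j q] nid_ntr[OF G]])
        (use e' pq mem one_mem in \<open>simp del: ncmp_apply add: j0_def ncmp_apply[where F = G]\<close>)
    show "ncmp A G (ncmp A ?S p0 ?l) (ncmp A G ?k j0) = \<one>\<^bsub>nat_group A G F\<^esub>"
      by (rule ntr_eqI[OF ncmp_ntr[OF G j p] nat_group_one_closed[OF G F]])
        (use e' pq mem one_mem in \<open>simp del: ncmp_apply add: j0_def ncmp_apply[where F = G] nat_group_one_apply\<close>)
    show "ncmp A F (ncmp A ?S q0 ?l) (ncmp A F ?k i0) = \<one>\<^bsub>nat_group A F G\<^esub>"
      by (rule ntr_eqI[OF ncmp_ntr[OF F i q] nat_group_one_closed[OF F G]])
        (use e pq mem one_mem in \<open>simp del: ncmp_apply add: i0_def ncmp_apply[where F = F] nat_group_one_apply\<close>)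
    have ip: "ncmp A ?S (ncmp A F ?k i0) (ncmp A ?S p0 ?l) \<in> ntr A ?S ?S"
      by (rule ncmp_ntr[OF S(1) p i])
    have jq: "ncmp A ?S (ncmp A G ?k j0) (ncmp A ?S q0 ?l) \<in> ntr A ?S ?S"
      by (rule ncmp_ntr[OF S(1) q j])
    show "ncmp A ?S (ncmp A F ?k i0) (ncmp A ?S p0 ?l) \<otimes>\<^bsub>nat_group A ?S ?S\<^esub>
        ncmp A ?S (ncmp A G ?k j0) (ncmp A ?S q0 ?l) = nid A ?S"
    proof (rule ntr_eqI[OF nat_group_m_closed[OF S(1) S(1) ip jq] nid_ntr[OF S(1)]])
      fix a s assume a: "a \<in> Ob A" and s: "s \<in> carrier (fobj ?S a)"
      obtain x y where z: "?l a s = (x, y)" by (cases "?l a s")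
      have xy: "x \<in> carrier (fobj F a)" "y \<in> carrier (fobj G a)"
        using kl(4)[OF a s] z by (auto simp: direct_sum_def)
      have s': "s = ?k a (x, y)" using kl(3)[OF a s] z by simp
      \<comment> \<open>The decomposition \<open>(x, y) = (x, 0) + (0, y)\<close> is the last
        biproduct equation before it is moved to the copy.\<close>
      have d: "(x, \<one>\<^bsub>fobj G a\<^esub>) \<otimes>\<^bsub>fobj ?D a\<^esub> (\<one>\<^bsub>fobj F a\<^esub>, y) = (x, y)"
        using xy a one by (simp add: direct_sum_def)
      have m: "ncmp A ?S p0 ?l a s = x" "ncmp A ?S q0 ?l a s = y"
        unfolding s' using pq[OF a mem[OF xy]] by auto
      have "(ncmp A ?S (ncmp A F ?k i0) (ncmp A ?S p0 ?l) \<otimes>\<^bsub>nat_group A ?S ?S\<^esub>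
        ncmp A ?S (ncmp A G ?k j0) (ncmp A ?S q0 ?l)) a s
        = ncmp A F ?k i0 a (ncmp A ?S p0 ?l a s) \<otimes>\<^bsub>fobj ?S a\<^esub> ncmp A G ?k j0 a (ncmp A ?S q0 ?l a s)"
        using a s by (simp add: nat_group_mult_apply del: ncmp_apply add: ncmp_apply[where F = ?S and \<theta> = "ncmp A F ?k i0"] ncmp_apply[where F = ?S and \<theta> = "ncmp A G ?k j0"])
      also have "\<dots> = ?k a (x, \<one>\<^bsub>fobj G a\<^esub>) \<otimes>\<^bsub>fobj ?S a\<^esub> ?k a (\<one>\<^bsub>fobj F a\<^esub>, y)"
        unfolding m using e(1)[OF a xy(1)] e'(1)[OF a xy(2)] by (rule arg_cong2)
      also have "\<dots> = s"
        using ntr_mult[OF k a mem[OF xy(1) one_mem(2)[OF a]] mem[OF one_mem(1)[OF a] xy(2)]] s' d by simp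
      finally show "(ncmp A ?S (ncmp A F ?k i0) (ncmp A ?S p0 ?l) \<otimes>\<^bsub>nat_group A ?S ?S\<^esub>
        ncmp A ?S (ncmp A G ?k j0) (ncmp A ?S q0 ?l)) a s = nid A ?S a s"
        using a s by simp
    qed
  qed (rule i j p q)+
  moreover have "?S \<in> Ob (ModCat A)" using S(1) by simp
  ultimately show ?thesis by blast
qed

subsection \<open>Kernels\<close>

definition kernel_module :: "('o, 'm, 'v) cmod \<Rightarrow> ('o, 'm, 'w) cmod \<Rightarrow> ('o \<Rightarrow> 'v \<Rightarrow> 'w) \<Rightarrow> ('o, 'm, 'v) cmod"
  where "kernel_module F G \<eta> = \<lparr>fobj = (\<lambda>a. (fobj F a)\<lparr>carrier := kernel (fobj F a) (fobj G a) (\<eta> a)\<rparr>),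
    fmap = (\<lambda>a b f. restrict (fmap F a b f) (kernel (fobj F a) (fobj G a) (\<eta> a)))\<rparr>"

lemma kernel_module:
  assumes A: "preadditive_category A" and F: "additive_functor A Ab F" and G: "additive_functor A Ab G"
    and e: "\<eta> \<in> ntr A F G"
  shows "additive_functor A Ab (kernel_module F G \<eta>)"
    and "nid A (kernel_module F G \<eta>) \<in> ntr A (kernel_module F G \<eta>) F"
proof -
  interpret preadditive_category A by fact
  have sub: "subgroup (kernel (fobj F a) (fobj G a) (\<eta> a)) (fobj F a)" if "a \<in> Ob A" for a
    by (rule group_hom.subgroup_kernel[OF ntr_group_hom[OF F G e that]])
  have mem: "fmap F a b f x \<in> kernel (fobj F b) (fobj G b) (\<eta> b)"
    if "a \<in> Ob A" "b \<in> Ob A" "f \<in> arr A a b" "x \<in> kernel (fobj F a) (fobj G a) (\<eta> a)" for a b f x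
    using that F G by (simp add: kernel_def module_closed ntr_natural[OF e] module_one)
  have k: "x \<in> carrier (fobj F a)" if "x \<in> kernel (fobj F a) (fobj G a) (\<eta> a)" for x a
    using that by (simp add: kernel_def)
  show m: "additive_functor A Ab (kernel_module F G \<eta>)"
  proof (rule moduleI)
    show "comm_group (fobj (kernel_module F G \<eta>) a)" if a: "a \<in> Ob A" for a
    proof -
      interpret comm_group "fobj F a" by (rule module_group[OF F a])
      have "comm_group ((fobj F a)\<lparr>carrier := kernel (fobj F a) (fobj G a) (\<eta> a)\<rparr>)"
        by (rule group.group_comm_groupI[OF subgroup.subgroup_is_group[OF sub[OF a] is_group]])
          (simp add: k m_comm)
      then show ?thesis by (simp add: kernel_module_def)
    qed
  qed (use F sub[THEN subgroup.m_closed] in \<open>auto simp: kernel_module_def mem k add_arr_closed Idt_arr Cmp_arr module_mult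
      module_add module_Idt module_Cmp\<close>)
  show "nid A (kernel_module F G \<eta>) \<in> ntr A (kernel_module F G \<eta>) F"
  proof (rule ntrI)
    fix a x y assume "a \<in> Ob A" "x \<in> carrier (fobj (kernel_module F G \<eta>) a)" "y \<in> carrier (fobj (kernel_module F G \<eta>) a)"
    with module_m_closed[OF m this] show "nid A (kernel_module F G \<eta>) a (x \<otimes>\<^bsub>fobj (kernel_module F G \<eta>) a\<^esub> y)
       = nid A (kernel_module F G \<eta>) a x \<otimes>\<^bsub>fobj F a\<^esub> nid A (kernel_module F G \<eta>) a y"
      by (simp add: kernel_module_def nid_def)
  qed (auto simp: nid_def kernel_module_def mem k)
qed

text \<open>The factorization of \<open>h\<close> inverts \<open>\<iota> a\<close> on its image;
  injectivity makes it additive, natural and unique. The criterion covers arbitrary modules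
  \<open>K\<close>, not only \<open>kernel_module\<close>, so that monics can be recognized as
  kernels.\<close>

lemma is_kernelI:
  fixes F :: "('o, 'm, 'v) cmod"
  assumes F: "additive_functor A Ab F" and G: "additive_functor A Ab G" and K: "additive_functor A Ab K"
    and e: "\<eta> \<in> ntr A F G" and i: "\<iota> \<in> ntr A K F"
    and inj: "\<And>a. a \<in> Ob A \<Longrightarrow> inj_on (\<iota> a) (carrier (fobj K a))"
    and im: "\<And>a. a \<in> Ob A \<Longrightarrow> \<iota> a ` carrier (fobj K a) = kernel (fobj F a) (fobj G a) (\<eta> a)"
  shows "is_kernel (ModCat A) F G \<eta> K \<iota>"
  unfolding is_kernel_def ModCat_simps
proof (intro conjI ballI impI)
  show "ncmp A K \<eta> \<iota> = \<one>\<^bsub>nat_group A K G\<^esub>"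
  proof (rule ntr_eqI[OF ncmp_ntr[OF K i e] nat_group_one_closed[OF K G]])
    fix a x assume ax: "a \<in> Ob A" "x \<in> carrier (fobj K a)"
    then have "\<iota> a x \<in> kernel (fobj F a) (fobj G a) (\<eta> a)" using im by auto
    then show "ncmp A K \<eta> \<iota> a x = \<one>\<^bsub>nat_group A K G\<^esub> a x" using ax by (simp add: nat_group_one_apply kernel_def)
  qed
next
  fix X :: "('o, 'm, 'v) cmod" and h
  assume "X \<in> {N. additive_functor A Ab N}" and h: "h \<in> ntr A X F" and z: "ncmp A X \<eta> h = \<one>\<^bsub>nat_group A X G\<^esub>"
  then have X: "additive_functor A Ab X" by simp
  have hk: "h a x \<in> \<iota> a ` carrier (fobj K a)" if "a \<in> Ob A" "x \<in> carrier (fobj X a)" for a x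
    using fun_cong[OF fun_cong[OF z, of a], of x] that im[OF that(1)]
    by (simp add: nat_group_one_apply kernel_def ntr_closed[OF h])
  define g where "g = (\<lambda>a\<in>Ob A. \<lambda>x\<in>carrier (fobj X a). inv_into (carrier (fobj K a)) (\<iota> a) (h a x))"
  have gi: "\<iota> a (g a x) = h a x" "g a x \<in> carrier (fobj K a)" if "a \<in> Ob A" "x \<in> carrier (fobj X a)" for a x
    using hk[OF that] that by (simp_all add: g_def f_inv_into_f inv_into_into)
  have g: "g \<in> ntr A X K"
  proof (rule ntrI)
    fix a x y assume a: "a \<in> Ob A" and xy: "x \<in> carrier (fobj X a)" "y \<in> carrier (fobj X a)"
    show "g a (x \<otimes>\<^bsub>fobj X a\<^esub> y) = g a x \<otimes>\<^bsub>fobj K a\<^esub> g a y"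
      by (rule inj_onD[OF inj[OF a]])
        (use a xy X K in \<open>simp_all add: gi ntr_mult[OF i] ntr_mult[OF h] module_m_closed\<close>)
  next
    fix a b f x assume ab: "a \<in> Ob A" "b \<in> Ob A" and f: "f \<in> arr A a b" and x: "x \<in> carrier (fobj X a)"
    show "g b (fmap X a b f x) = fmap K a b f (g a x)"
      by (rule inj_onD[OF inj[OF ab(2)]])
        (use ab f x X K in \<open>simp_all add: gi ntr_natural[OF i] ntr_natural[OF h] module_closed\<close>)
  qed (simp_all add: gi, simp_all add: g_def)
  show "\<exists>!h'. h' \<in> ntr A X K \<and> ncmp A X \<iota> h' = h"
  proof (rule ex1I[of _ g])
    show "g \<in> ntr A X K \<and> ncmp A X \<iota> g = h"
      using g ntr_eqI[OF ncmp_ntr[OF X g i] h] gi by simp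
    fix g' assume g': "g' \<in> ntr A X K \<and> ncmp A X \<iota> g' = h"
    show "g' = g"
    proof (rule ntr_eqI[OF conjunct1[OF g'] g])
      fix a x assume a: "a \<in> Ob A" and x: "x \<in> carrier (fobj X a)"
      have "\<iota> a (g' a x) = \<iota> a (g a x)"
        using fun_cong[OF fun_cong[OF conjunct2[OF g'], of a], of x] a x gi by simp
      then show "g' a x = g a x"
        by (rule inj_onD[OF inj[OF a]]) (use a x gi g' in \<open>auto simp: ntr_closed\<close>)
    qed
  qed
qed (use K i in simp_all)

text \<open>The inclusion of the kernel and the zero map have the same composite with
  \<open>\<eta>\<close>. Cancelling \<open>\<eta>\<close> makes the kernel trivial in every
  component.\<close>

lemma monic_imp_inj:
  assumes A: "preadditive_category A" and F: "additive_functor A Ab F" and G: "additive_functor A Ab G"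
    and e: "\<eta> \<in> ntr A F G" and m: "monic (ModCat A) F G \<eta>" and a: "a \<in> Ob A"
  shows "inj_on (\<eta> a) (carrier (fobj F a))"
proof -
  let ?K = "kernel_module F G \<eta>"
  note K = kernel_module[OF A F G e]
  have z: "\<one>\<^bsub>nat_group A ?K F\<^esub> \<in> ntr A ?K F" by (rule nat_group_one_closed[OF K(1) F])
  have "ncmp A ?K \<eta> (nid A ?K) = ncmp A ?K \<eta> \<one>\<^bsub>nat_group A ?K F\<^esub>"
  proof (rule ntr_eqI[OF ncmp_ntr[OF K(1) K(2) e] ncmp_ntr[OF K(1) z e]])
    fix b x assume b: "b \<in> Ob A" and x: "x \<in> carrier (fobj ?K b)"
    then show "ncmp A ?K \<eta> (nid A ?K) b x = ncmp A ?K \<eta> \<one>\<^bsub>nat_group A ?K F\<^esub> b x"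
      using group_hom.hom_one[OF ntr_group_hom[OF F G e b]]
      by (simp add: nat_group_one_apply) (simp add: kernel_module_def kernel_def)
  qed
  then have "nid A ?K = \<one>\<^bsub>nat_group A ?K F\<^esub>"
    using m K z unfolding monic_def by (auto dest!: bspec[of _ _ ?K] dest: inj_onD)
  then have eq: "nid A ?K a x = \<one>\<^bsub>nat_group A ?K F\<^esub> a x" for x by simp
  have "x = \<one>\<^bsub>fobj F a\<^esub>" if x: "x \<in> carrier (fobj ?K a)" for x
    by (rule eq[of x, unfolded nid_apply[OF a x] nat_group_one_apply[OF a x]])
  then have "carrier (fobj ?K a) \<subseteq> {\<one>\<^bsub>fobj F a\<^esub>}" by blast
  then have *: "kernel (fobj F a) (fobj G a) (\<eta> a) \<subseteq> {\<one>\<^bsub>fobj F a\<^esub>}" by (simp add: kernel_module_def)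
  interpret group_hom "fobj F a" "fobj G a" "\<eta> a" by (rule ntr_group_hom[OF F G e a])
  have "kernel (fobj F a) (fobj G a) (\<eta> a) = {\<one>\<^bsub>fobj F a\<^esub>}"
    using * subgroup.one_closed[OF subgroup_kernel] by blast
  then show ?thesis using inj_iff_trivial_ker by simp
qed

text \<open>Uniqueness in the universal property makes \<open>\<iota>\<close> monic, hence
  injective. That the image is the whole kernel follows by factoring the inclusion of
  \<open>kernel_module\<close> through \<open>\<iota>\<close>.\<close>

lemma is_kernelD:
  fixes F :: "('o, 'm, 'v) cmod"
  assumes A: "preadditive_category A"
    and F: "additive_functor A Ab F" and G: "additive_functor A Ab G" and K: "additive_functor A Ab K"
    and e: "\<eta> \<in> ntr A F G" and k: "is_kernel (ModCat A) F G \<eta> K \<iota>" and a: "a \<in> Ob A"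
  shows "inj_on (\<iota> a) (carrier (fobj K a))"
    and "\<iota> a ` carrier (fobj K a) = kernel (fobj F a) (fobj G a) (\<eta> a)"
proof -
  note k' = k[unfolded is_kernel_def ModCat_simps, THEN conjunct2]
  have i: "\<iota> \<in> ntr A K F" by (rule k'[THEN conjunct1])
  have z: "ncmp A K \<eta> \<iota> = \<one>\<^bsub>nat_group A K G\<^esub>" by (rule k'[THEN conjunct2, THEN conjunct1])
  have u: "\<And>(X :: ('o, 'm, 'v) cmod) h. additive_functor A Ab X \<Longrightarrow> h \<in> ntr A X F \<Longrightarrow> ncmp A X \<eta> h = \<one>\<^bsub>nat_group A X G\<^esub> \<Longrightarrow>
      \<exists>!h'. h' \<in> ntr A X K \<and> ncmp A X \<iota> h' = h"
    by (rule k'[THEN conjunct2, THEN conjunct2, THEN bspec, THEN bspec, THEN mp]) simp_all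
  have zero: "ncmp A X \<eta> (ncmp A X \<iota> h) = \<one>\<^bsub>nat_group A X G\<^esub>"
    if X: "additive_functor A Ab X" and h: "h \<in> ntr A X K" for X :: "('o, 'm, 'v) cmod" and h
  proof (rule ntr_eqI[OF ncmp_ntr[OF X ncmp_ntr[OF X h i] e] nat_group_one_closed[OF X G]])
    fix b x assume b: "b \<in> Ob A" and x: "x \<in> carrier (fobj X b)"
    have "h b x \<in> carrier (fobj K b)" by (rule ntr_closed[OF h b x])
    then show "ncmp A X \<eta> (ncmp A X \<iota> h) b x = \<one>\<^bsub>nat_group A X G\<^esub> b x"
      using fun_cong[OF fun_cong[OF z, of b], of "h b x"] b x by (simp add: nat_group_one_apply)
  qed
  have "monic (ModCat A) K F \<iota>"
    unfolding monic_def ModCat_simps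
  proof (intro ballI inj_onI)
    fix X :: "('o, 'm, 'v) cmod" and h h'
    assume X: "X \<in> {N. additive_functor A Ab N}" and h: "h \<in> ntr A X K" "h' \<in> ntr A X K"
      and eq: "ncmp A X \<iota> h = ncmp A X \<iota> h'"
    then have X': "additive_functor A Ab X" by simp
    from u[OF X' ncmp_ntr[OF X' h(1) i] zero[OF X' h(1)]] h eq show "h = h'" by auto
  qed
  then show "inj_on (\<iota> a) (carrier (fobj K a))" by (rule monic_imp_inj[OF A K F i _ a])
  show "\<iota> a ` carrier (fobj K a) = kernel (fobj F a) (fobj G a) (\<eta> a)"
  proof
    show "\<iota> a ` carrier (fobj K a) \<subseteq> kernel (fobj F a) (fobj G a) (\<eta> a)"
    proof
      fix y assume "y \<in> \<iota> a ` carrier (fobj K a)"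
      then obtain x where x: "x \<in> carrier (fobj K a)" "y = \<iota> a x" by auto
      show "y \<in> kernel (fobj F a) (fobj G a) (\<eta> a)"
        using fun_cong[OF fun_cong[OF z, of a], of x] x a ntr_closed[OF i a x(1)]
        by (simp add: nat_group_one_apply kernel_def)
    qed
    let ?K = "kernel_module F G \<eta>"
    note K' = kernel_module[OF A F G e]
    have "ncmp A ?K \<eta> (nid A ?K) = \<one>\<^bsub>nat_group A ?K G\<^esub>"
    proof (rule ntr_eqI[OF ncmp_ntr[OF K'(1) K'(2) e] nat_group_one_closed[OF K'(1) G]])
      fix b x assume "b \<in> Ob A" "x \<in> carrier (fobj ?K b)"
      then show "ncmp A ?K \<eta> (nid A ?K) b x = \<one>\<^bsub>nat_group A ?K G\<^esub> b x"
        by (simp add: nat_group_one_apply) (simp add: kernel_module_def kernel_def)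
    qed
    from u[OF K' this] obtain h where h: "h \<in> ntr A ?K K" "ncmp A ?K \<iota> h = nid A ?K" by auto
    show "kernel (fobj F a) (fobj G a) (\<eta> a) \<subseteq> \<iota> a ` carrier (fobj K a)"
    proof
      fix x assume "x \<in> kernel (fobj F a) (fobj G a) (\<eta> a)"
      then have x: "x \<in> carrier (fobj ?K a)" by (simp add: kernel_module_def)
      have "\<iota> a (h a x) = x" using fun_cong[OF fun_cong[OF h(2), of a], of x] x a by simp
      then show "x \<in> \<iota> a ` carrier (fobj K a)" using ntr_closed[OF h(1) a x] by (auto intro: image_eqI[OF sym])
    qed
  qed
qed

subsection \<open>Cokernels\<close>

text \<open>The cokernel is realized on chosen representatives, so that its values lie in the same type.\<close>

definition coset_rep :: "'a monoid \<Rightarrow> 'a set \<Rightarrow> 'a \<Rightarrow> 'a"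
  where "coset_rep G H x = (SOME y. y \<in> H #>\<^bsub>G\<^esub> x)"

definition rep_group :: "'a monoid \<Rightarrow> 'a set \<Rightarrow> 'a monoid"
  where "rep_group G H = \<lparr>carrier = coset_rep G H ` carrier G, mult = (\<lambda>x y. coset_rep G H (x \<otimes>\<^bsub>G\<^esub> y)),
    one = coset_rep G H \<one>\<^bsub>G\<^esub>\<rparr>"

lemma coset_rep:
  assumes G: "comm_group G" and H: "subgroup H G" and x: "x \<in> carrier G"
  shows "coset_rep G H x \<in> carrier G"
    and "y \<in> carrier G \<Longrightarrow> coset_rep G H x = coset_rep G H y \<longleftrightarrow> H #>\<^bsub>G\<^esub> x = H #>\<^bsub>G\<^esub> y"
    and "H #>\<^bsub>G\<^esub> coset_rep G H x = H #>\<^bsub>G\<^esub> x"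
    and "coset_rep G H x = coset_rep G H \<one>\<^bsub>G\<^esub> \<longleftrightarrow> x \<in> H"
    and "y \<in> carrier G \<Longrightarrow> coset_rep G H (x \<otimes>\<^bsub>G\<^esub> y) = coset_rep G H (coset_rep G H x \<otimes>\<^bsub>G\<^esub> coset_rep G H y)"
proof -
  interpret comm_group G by fact
  interpret H: subgroup H G by fact
  have r: "coset_rep G H z \<in> H #>\<^bsub>G\<^esub> z" if "z \<in> carrier G" for z
    unfolding coset_rep_def by (rule someI[of "\<lambda>y. y \<in> H #>\<^bsub>G\<^esub> z", OF rcos_self[OF that H]])
  have rc: "coset_rep G H z \<in> carrier G" if "z \<in> carrier G" for z
    using r_coset_subset_G[OF H.subset that] r[OF that] by auto
  have e: "H #>\<^bsub>G\<^esub> coset_rep G H z = H #>\<^bsub>G\<^esub> z" if "z \<in> carrier G" for z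
    using repr_independence[OF r[OF that] that H] by simp
  show "coset_rep G H x \<in> carrier G" "H #>\<^bsub>G\<^esub> coset_rep G H x = H #>\<^bsub>G\<^esub> x"
    using x by (rule rc, rule e)
  \<comment> \<open>The representative is chosen from the coset as a set, so equal cosets have equal
    representatives.\<close>
  have eq: "coset_rep G H z = coset_rep G H y \<longleftrightarrow> H #>\<^bsub>G\<^esub> z = H #>\<^bsub>G\<^esub> y" if "z \<in> carrier G" "y \<in> carrier G" for y z
    using e[OF that(1)] e[OF that(2)] by (metis coset_rep_def)
  then show "y \<in> carrier G \<Longrightarrow> coset_rep G H x = coset_rep G H y \<longleftrightarrow> H #>\<^bsub>G\<^esub> x = H #>\<^bsub>G\<^esub> y"
    using x by blast
  show "coset_rep G H x = coset_rep G H \<one>\<^bsub>G\<^esub> \<longleftrightarrow> x \<in> H"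
    unfolding eq[OF x one_closed] using x coset_join1[OF _ x H] coset_join2[OF x H] H.subset
    by (metis coset_mult_one)
  show "coset_rep G H (x \<otimes>\<^bsub>G\<^esub> y) = coset_rep G H (coset_rep G H x \<otimes>\<^bsub>G\<^esub> coset_rep G H y)" if y: "y \<in> carrier G"
  proof -
    have N: "H \<lhd> G" by (rule subgroup_imp_normal[OF H])
    have "H #>\<^bsub>G\<^esub> (x \<otimes>\<^bsub>G\<^esub> y) = H #>\<^bsub>G\<^esub> (coset_rep G H x \<otimes>\<^bsub>G\<^esub> coset_rep G H y)"
      using normal.rcos_sum[OF N x y] normal.rcos_sum[OF N rc[OF x] rc[OF y]] e[OF x] e[OF y] by simp
    then show ?thesis using eq[of "x \<otimes>\<^bsub>G\<^esub> y"] x y rc by simp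
  qed
qed

lemma rep_group:
  assumes G: "comm_group G" and H: "subgroup H G"
  shows "comm_group (rep_group G H)" and "coset_rep G H \<in> hom G (rep_group G H)"
proof -
  interpret comm_group G by fact
  show h: "coset_rep G H \<in> hom G (rep_group G H)"
    by (rule homI) (simp_all add: rep_group_def coset_rep(5)[OF G H])
  have "comm_group (rep_group G H \<lparr>carrier := coset_rep G H ` carrier G, one := coset_rep G H \<one>\<^bsub>G\<^esub>\<rparr>)"
    by (rule hom_imp_img_comm_group[OF h])
  then show "comm_group (rep_group G H)" by (simp add: rep_group_def)
qed

definition cokernel_module :: "('o, 'm, 'w) cmod \<Rightarrow> ('o, 'm, 'v) cmod \<Rightarrow> ('o \<Rightarrow> 'w \<Rightarrow> 'v) \<Rightarrow> ('o, 'm, 'v) cmod"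
  where "cokernel_module F G \<eta> = \<lparr>fobj = (\<lambda>a. rep_group (fobj G a) (\<eta> a ` carrier (fobj F a))),
    fmap = (\<lambda>a b f. \<lambda>x\<in>carrier (rep_group (fobj G a) (\<eta> a ` carrier (fobj F a))).
      coset_rep (fobj G b) (\<eta> b ` carrier (fobj F b)) (fmap G a b f x))\<rparr>"

definition cokernel_proj :: "('o, 'm, 'z) pcat_scheme \<Rightarrow> ('o, 'm, 'w) cmod \<Rightarrow> ('o, 'm, 'v) cmod \<Rightarrow> ('o \<Rightarrow> 'w \<Rightarrow> 'v) \<Rightarrow> 'o \<Rightarrow> 'v \<Rightarrow> 'v"
  where "cokernel_proj A F G \<eta> = (\<lambda>a\<in>Ob A. \<lambda>x\<in>carrier (fobj G a). coset_rep (fobj G a) (\<eta> a ` carrier (fobj F a)) x)"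

lemma cokernel_module:
  assumes A: "preadditive_category A" and F: "additive_functor A Ab F" and G: "additive_functor A Ab G"
    and e: "\<eta> \<in> ntr A F G"
  shows "additive_functor A Ab (cokernel_module F G \<eta>)"
    and "cokernel_proj A F G \<eta> \<in> ntr A G (cokernel_module F G \<eta>)"
    and "\<And>a. a \<in> Ob A \<Longrightarrow> cokernel_proj A F G \<eta> a ` carrier (fobj G a) = carrier (fobj (cokernel_module F G \<eta>) a)"
    and "\<And>a. a \<in> Ob A \<Longrightarrow> kernel (fobj G a) (fobj (cokernel_module F G \<eta>) a) (cokernel_proj A F G \<eta> a) = \<eta> a ` carrier (fobj F a)"
proof -
  interpret preadditive_category A by fact
  have sub: "subgroup (\<eta> a ` carrier (fobj F a)) (fobj G a)" if "a \<in> Ob A" for a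
    by (rule group_hom.img_is_subgroup[OF ntr_group_hom[OF F G e that]])
  have gG: "comm_group (fobj G a)" if "a \<in> Ob A" for a using G that by (rule module_group)
  let ?k = "\<lambda>a. coset_rep (fobj G a) (\<eta> a ` carrier (fobj F a))"
  let ?C = "cokernel_module F G \<eta>"
  have k: "?k a \<in> hom (fobj G a) (fobj ?C a)" if "a \<in> Ob A" for a
    using rep_group(2)[OF gG[OF that] sub[OF that]] by (simp add: cokernel_module_def)
  have s: "?k a ` carrier (fobj G a) = carrier (fobj ?C a)" if "a \<in> Ob A" for a
    by (simp add: cokernel_module_def rep_group_def)
  have g: "comm_group (fobj ?C a)" if "a \<in> Ob A" for a
    using rep_group(1)[OF gG[OF that] sub[OF that]] by (simp add: cokernel_module_def)
  have ext: "fmap ?C a b f \<in> extensional (carrier (fobj ?C a))" for a b f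
    by (simp add: cokernel_module_def)
  have nat: "fmap ?C a b f (?k a x) = ?k b (fmap G a b f x)"
    if ab: "a \<in> Ob A" "b \<in> Ob A" and f: "f \<in> arr A a b" and x: "x \<in> carrier (fobj G a)" for a b f x
  proof -
    interpret G: comm_group "fobj G a" by (rule gG[OF ab(1)])
    interpret Gb: comm_group "fobj G b" by (rule gG[OF ab(2)])
    \<comment> \<open>The representative differs from \<open>x\<close> by some
      \<open>\<eta> a y\<close>, and naturality of \<open>\<eta>\<close> sends this difference into
      the image at \<open>b\<close>.\<close>
    have "?k a x \<in> (\<eta> a ` carrier (fobj F a)) #>\<^bsub>fobj G a\<^esub> x"
      using coset_rep(3)[OF gG[OF ab(1)] sub[OF ab(1)] x] G.rcos_self[OF coset_rep(1)[OF gG[OF ab(1)] sub[OF ab(1)] x] sub[OF ab(1)]]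
      by simp
    then obtain y where y: "y \<in> carrier (fobj F a)" and kx: "?k a x = \<eta> a y \<otimes>\<^bsub>fobj G a\<^esub> x"
      unfolding r_coset_def by auto
    have "fmap G a b f (?k a x) = \<eta> b (fmap F a b f y) \<otimes>\<^bsub>fobj G b\<^esub> fmap G a b f x"
      unfolding kx using module_mult[OF G ab f ntr_closed[OF e ab(1) y] x] ntr_natural[OF e ab f y] by simp
    then have "fmap G a b f (?k a x) \<in> (\<eta> b ` carrier (fobj F b)) #>\<^bsub>fobj G b\<^esub> fmap G a b f x"
      unfolding r_coset_def using module_closed[OF F ab f y] by auto
    then have "(\<eta> b ` carrier (fobj F b)) #>\<^bsub>fobj G b\<^esub> fmap G a b f x
        = (\<eta> b ` carrier (fobj F b)) #>\<^bsub>fobj G b\<^esub> fmap G a b f (?k a x)"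
      by (rule Gb.repr_independence[OF _ module_closed[OF G ab f x] sub[OF ab(2)]])
    then have "?k b (fmap G a b f (?k a x)) = ?k b (fmap G a b f x)" by (simp add: coset_rep_def)
    then show ?thesis using x by (simp add: cokernel_module_def rep_group_def)
  qed
  note t = module_surj_transport[OF A G k s g ext nat]
  show "additive_functor A Ab ?C" by (rule t(1))
  show "cokernel_proj A F G \<eta> \<in> ntr A G ?C" unfolding cokernel_proj_def by (rule t(2))
  fix a assume a: "a \<in> Ob A"
  show "cokernel_proj A F G \<eta> a ` carrier (fobj G a) = carrier (fobj ?C a)"
    using s[OF a] a by (simp add: cokernel_proj_def)
  have "\<eta> a ` carrier (fobj F a) \<subseteq> carrier (fobj G a)" using sub[OF a] by (rule subgroup.subset)
  then show "kernel (fobj G a) (fobj ?C a) (cokernel_proj A F G \<eta> a) = \<eta> a ` carrier (fobj F a)"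
    using a coset_rep(4)[OF gG[OF a] sub[OF a]]
    by (auto simp: kernel_def cokernel_proj_def cokernel_module_def rep_group_def)
qed

text \<open>Since \<open>h\<close> kills the image of \<open>\<eta>\<close>, which is the kernel of
  \<open>\<rho>\<close>, it is constant on the fibres of \<open>\<rho>\<close> and descends to
  \<open>K\<close>.\<close>

lemma is_cokernelI:
  fixes F :: "('o, 'm, 'v) cmod"
  assumes F: "additive_functor A Ab F" and G: "additive_functor A Ab G" and K: "additive_functor A Ab K"
    and e: "\<eta> \<in> ntr A F G" and p: "\<rho> \<in> ntr A G K"
    and surj: "\<And>a. a \<in> Ob A \<Longrightarrow> \<rho> a ` carrier (fobj G a) = carrier (fobj K a)"
    and ker: "\<And>a. a \<in> Ob A \<Longrightarrow> kernel (fobj G a) (fobj K a) (\<rho> a) = \<eta> a ` carrier (fobj F a)"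
  shows "is_cokernel (ModCat A) F G \<eta> K \<rho>"
  unfolding is_cokernel_def ModCat_simps
proof (intro conjI ballI impI)
  show "ncmp A F \<rho> \<eta> = \<one>\<^bsub>nat_group A F K\<^esub>"
  proof (rule ntr_eqI[OF ncmp_ntr[OF F e p] nat_group_one_closed[OF F K]])
    fix a x assume ax: "a \<in> Ob A" "x \<in> carrier (fobj F a)"
    then have "\<eta> a x \<in> kernel (fobj G a) (fobj K a) (\<rho> a)" using ker by auto
    then show "ncmp A F \<rho> \<eta> a x = \<one>\<^bsub>nat_group A F K\<^esub> a x" using ax by (simp add: nat_group_one_apply kernel_def)
  qed
next
  fix X :: "('o, 'm, 'v) cmod" and h
  assume "X \<in> {N. additive_functor A Ab N}" and h: "h \<in> ntr A G X" and z: "ncmp A F h \<eta> = \<one>\<^bsub>nat_group A F X\<^esub>"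
  then have X: "additive_functor A Ab X" by simp
  have hk: "h a x = h a y" if a: "a \<in> Ob A" and x: "x \<in> carrier (fobj G a)" and y: "y \<in> carrier (fobj G a)"
    and eq: "\<rho> a x = \<rho> a y" for a x y
  proof -
    interpret r: group_hom "fobj G a" "fobj K a" "\<rho> a" by (rule ntr_group_hom[OF G K p a])
    interpret h: group_hom "fobj G a" "fobj X a" "h a" by (rule ntr_group_hom[OF G X h a])
    have "x \<otimes>\<^bsub>fobj G a\<^esub> inv\<^bsub>fobj G a\<^esub> y \<in> kernel (fobj G a) (fobj K a) (\<rho> a)"
      using x y eq by (simp add: kernel_def)
    then obtain w where w: "w \<in> carrier (fobj F a)" "x \<otimes>\<^bsub>fobj G a\<^esub> inv\<^bsub>fobj G a\<^esub> y = \<eta> a w"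
      using ker[OF a] by auto
    have "h a (\<eta> a w) = \<one>\<^bsub>fobj X a\<^esub>"
      using fun_cong[OF fun_cong[OF z, of a], of w] a w(1) by (simp add: nat_group_one_apply)
    then have "h a x \<otimes>\<^bsub>fobj X a\<^esub> inv\<^bsub>fobj X a\<^esub> h a y = \<one>\<^bsub>fobj X a\<^esub>"
      unfolding w(2)[symmetric] using x y by simp
    then show ?thesis using h.H.right_cancel h.H.r_inv h.hom_closed h.H.inv_closed x y by metis
  qed
  \<comment> \<open>An arbitrary set-theoretic section of \<open>\<rho> a\<close>. By
    \<open>hk\<close> the value of \<open>h\<close> does not depend on this choice.\<close>
  define s where "s = (\<lambda>a y. inv_into (carrier (fobj G a)) (\<rho> a) y)"
  have s: "s a y \<in> carrier (fobj G a)" "\<rho> a (s a y) = y" if "a \<in> Ob A" "y \<in> carrier (fobj K a)" for a y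
    using that surj[OF that(1)] by (simp_all add: s_def f_inv_into_f inv_into_into)
  define g where "g = (\<lambda>a\<in>Ob A. \<lambda>y\<in>carrier (fobj K a). h a (s a y))"
  have gr: "g a (\<rho> a x) = h a x" if "a \<in> Ob A" "x \<in> carrier (fobj G a)" for a x
    using that ntr_closed[OF p that] by (simp add: g_def) (rule hk, simp_all add: s)
  have g: "g \<in> ntr A K X"
  proof (rule ntrI)
    fix a x y assume a: "a \<in> Ob A" and xy: "x \<in> carrier (fobj K a)" "y \<in> carrier (fobj K a)"
    note sx = s[OF a xy(1)] and sy = s[OF a xy(2)]
    \<comment> \<open>The section is not additive, so additivity of \<open>g\<close> is checked on
      the image of a product of preimages.\<close>
    have "g a (\<rho> a (s a x \<otimes>\<^bsub>fobj G a\<^esub> s a y)) = g a (\<rho> a (s a x)) \<otimes>\<^bsub>fobj X a\<^esub> g a (\<rho> a (s a y))"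
      using a sx(1) sy(1) G by (simp only: gr module_m_closed ntr_mult[OF h])
    then show "g a (x \<otimes>\<^bsub>fobj K a\<^esub> y) = g a x \<otimes>\<^bsub>fobj X a\<^esub> g a y"
      using sx sy by (simp add: ntr_mult[OF p a])
  next
    fix a b f x assume ab: "a \<in> Ob A" "b \<in> Ob A" and f: "f \<in> arr A a b" and x: "x \<in> carrier (fobj K a)"
    note sx = s[OF ab(1) x]
    have "g b (\<rho> b (fmap G a b f (s a x))) = fmap X a b f (g a (\<rho> a (s a x)))"
      using ab f sx(1) G by (simp only: gr module_closed ntr_natural[OF h])
    then show "g b (fmap K a b f x) = fmap X a b f (g a x)"
      using sx by (simp add: ntr_natural[OF p ab f])
  next
    show "g a x \<in> carrier (fobj X a)" if "a \<in> Ob A" "x \<in> carrier (fobj K a)" for a x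
      using that s by (simp add: g_def ntr_closed[OF h])
  qed (simp_all add: g_def)
  show "\<exists>!h'. h' \<in> ntr A K X \<and> ncmp A G h' \<rho> = h"
  proof (rule ex1I[of _ g])
    show "g \<in> ntr A K X \<and> ncmp A G g \<rho> = h"
      using g ntr_eqI[OF ncmp_ntr[OF G p g] h] gr by simp
    fix g' assume g': "g' \<in> ntr A K X \<and> ncmp A G g' \<rho> = h"
    show "g' = g"
    proof (rule ntr_eqI[OF conjunct1[OF g'] g])
      fix a x assume a: "a \<in> Ob A" and x: "x \<in> carrier (fobj K a)"
      show "g' a x = g a x"
        using fun_cong[OF fun_cong[OF conjunct2[OF g'], of a], of "s a x"] s[OF a x] gr[OF a, of "s a x"] a by simp
    qed
  qed
qed (use K p in simp_all)

text \<open>The projection onto the cokernel and the zero map agree after \<open>\<eta>\<close>.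
  Cancelling \<open>\<eta>\<close> makes the projection zero, so its kernel, the image of
  \<open>\<eta> a\<close>, is everything.\<close>

lemma epic_imp_surj:
  assumes A: "preadditive_category A" and F: "additive_functor A Ab F" and G: "additive_functor A Ab G"
    and e: "\<eta> \<in> ntr A F G" and m: "epic (ModCat A) F G \<eta>" and a: "a \<in> Ob A"
  shows "\<eta> a ` carrier (fobj F a) = carrier (fobj G a)"
proof -
  let ?C = "cokernel_module F G \<eta>"
  let ?p = "cokernel_proj A F G \<eta>"
  note C = cokernel_module[OF A F G e]
  have z: "\<one>\<^bsub>nat_group A G ?C\<^esub> \<in> ntr A G ?C" by (rule nat_group_one_closed[OF G C(1)])
  have "ncmp A F ?p \<eta> = ncmp A F \<one>\<^bsub>nat_group A G ?C\<^esub> \<eta>"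
  proof (rule ntr_eqI[OF ncmp_ntr[OF F e C(2)] ncmp_ntr[OF F e z]])
    fix b x assume b: "b \<in> Ob A" and x: "x \<in> carrier (fobj F b)"
    then have "\<eta> b x \<in> kernel (fobj G b) (fobj ?C b) (?p b)" using C(4) by auto
    then show "ncmp A F ?p \<eta> b x = ncmp A F \<one>\<^bsub>nat_group A G ?C\<^esub> \<eta> b x"
      using b x by (simp add: nat_group_one_apply kernel_def)
  qed
  then have "?p = \<one>\<^bsub>nat_group A G ?C\<^esub>"
    using m C z unfolding epic_def by (auto dest!: bspec[of _ _ ?C] dest: inj_onD)
  then have eq: "?p a x = \<one>\<^bsub>nat_group A G ?C\<^esub> a x" for x by simp
  have "x \<in> kernel (fobj G a) (fobj ?C a) (?p a)" if "x \<in> carrier (fobj G a)" for x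
    using eq[of x] that a by (simp add: nat_group_one_apply kernel_def)
  then show ?thesis using C(4)[OF a] ntr_closed[OF e a] by auto
qed

text \<open>Uniqueness makes \<open>\<rho>\<close> epic, hence surjective. The projection onto
  \<open>cokernel_module\<close> factors through \<open>\<rho>\<close>, so whatever
  \<open>\<rho>\<close> kills lies in the image of \<open>\<eta>\<close>.\<close>

lemma is_cokernelD:
  fixes F :: "('o, 'm, 'v) cmod"
  assumes A: "preadditive_category A"
    and F: "additive_functor A Ab F" and G: "additive_functor A Ab G" and K: "additive_functor A Ab K"
    and e: "\<eta> \<in> ntr A F G" and k: "is_cokernel (ModCat A) F G \<eta> K \<rho>" and a: "a \<in> Ob A"
  shows "\<rho> a ` carrier (fobj G a) = carrier (fobj K a)"
    and "kernel (fobj G a) (fobj K a) (\<rho> a) = \<eta> a ` carrier (fobj F a)"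
proof -
  note k' = k[unfolded is_cokernel_def ModCat_simps, THEN conjunct2]
  have p: "\<rho> \<in> ntr A G K" by (rule k'[THEN conjunct1])
  have z: "ncmp A F \<rho> \<eta> = \<one>\<^bsub>nat_group A F K\<^esub>" by (rule k'[THEN conjunct2, THEN conjunct1])
  have u: "\<And>(X :: ('o, 'm, 'v) cmod) h. additive_functor A Ab X \<Longrightarrow> h \<in> ntr A G X \<Longrightarrow> ncmp A F h \<eta> = \<one>\<^bsub>nat_group A F X\<^esub> \<Longrightarrow>
      \<exists>!h'. h' \<in> ntr A K X \<and> ncmp A G h' \<rho> = h"
    by (rule k'[THEN conjunct2, THEN conjunct2, THEN bspec, THEN bspec, THEN mp]) simp_all
  have rz: "\<rho> b (\<eta> b x) = \<one>\<^bsub>fobj K b\<^esub>" if "b \<in> Ob A" "x \<in> carrier (fobj F b)" for b x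
    using fun_cong[OF fun_cong[OF z, of b], of x] that by (simp add: nat_group_one_apply)
  have zero: "ncmp A F (ncmp A G h \<rho>) \<eta> = \<one>\<^bsub>nat_group A F X\<^esub>"
    if X: "additive_functor A Ab X" and h: "h \<in> ntr A K X" for X :: "('o, 'm, 'v) cmod" and h
  proof (rule ntr_eqI[OF ncmp_ntr[OF F e ncmp_ntr[OF G p h]] nat_group_one_closed[OF F X]])
    fix b x assume b: "b \<in> Ob A" and x: "x \<in> carrier (fobj F b)"
    then show "ncmp A F (ncmp A G h \<rho>) \<eta> b x = \<one>\<^bsub>nat_group A F X\<^esub> b x"
      using rz[OF b x] group_hom.hom_one[OF ntr_group_hom[OF K X h b]] ntr_closed[OF e b x]
      by (simp add: nat_group_one_apply)
  qed
  have "epic (ModCat A) G K \<rho>"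
    unfolding epic_def ModCat_simps
  proof (intro ballI inj_onI)
    fix X :: "('o, 'm, 'v) cmod" and h h'
    assume X: "X \<in> {N. additive_functor A Ab N}" and h: "h \<in> ntr A K X" "h' \<in> ntr A K X"
      and eq: "ncmp A G h \<rho> = ncmp A G h' \<rho>"
    then have X': "additive_functor A Ab X" by simp
    from u[OF X' ncmp_ntr[OF G p h(1)] zero[OF X' h(1)]] h eq show "h = h'" by auto
  qed
  then show "\<rho> a ` carrier (fobj G a) = carrier (fobj K a)" by (rule epic_imp_surj[OF A G K p _ a])
  show "kernel (fobj G a) (fobj K a) (\<rho> a) = \<eta> a ` carrier (fobj F a)"
  proof
    show "\<eta> a ` carrier (fobj F a) \<subseteq> kernel (fobj G a) (fobj K a) (\<rho> a)"
      using rz[OF a] ntr_closed[OF e a] by (auto simp: kernel_def)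
    let ?C = "cokernel_module F G \<eta>"
    let ?p = "cokernel_proj A F G \<eta>"
    note C = cokernel_module[OF A F G e]
    have "ncmp A F ?p \<eta> = \<one>\<^bsub>nat_group A F ?C\<^esub>"
      using is_cokernelI[OF F G C(1) e C(2-4)] by (simp add: is_cokernel_def)
    from u[OF C(1,2) this] obtain h where h: "h \<in> ntr A K ?C" "ncmp A G h \<rho> = ?p" by auto
    show "kernel (fobj G a) (fobj K a) (\<rho> a) \<subseteq> \<eta> a ` carrier (fobj F a)"
    proof
      fix x assume x: "x \<in> kernel (fobj G a) (fobj K a) (\<rho> a)"
      then have x': "x \<in> carrier (fobj G a)" by (simp add: kernel_def)
      have "?p a x = h a (\<rho> a x)" using fun_cong[OF fun_cong[OF h(2), of a], of x] x' a by simp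
      also have "\<dots> = \<one>\<^bsub>fobj ?C a\<^esub>"
        using x group_hom.hom_one[OF ntr_group_hom[OF K C(1) h(1) a]] by (simp add: kernel_def)
      finally have "x \<in> kernel (fobj G a) (fobj ?C a) (?p a)" using x' by (simp add: kernel_def)
      then show "x \<in> \<eta> a ` carrier (fobj F a)" using C(4)[OF a] by simp
    qed
  qed
qed

text \<open>Every monic is the kernel of its cokernel and every epic is the cokernel of its kernel;
  both are read off from the componentwise criteria.\<close>

theorem abelian_ModCat:
  assumes inf: "infinite (UNIV :: 'v set)" and A: "preadditive_category A"
  shows "abelian_category (ModCat A :: (('o, 'm, 'v) cmod, _) pcat)"
  unfolding abelian_category_def
proof (intro conjI ballI impI)
  have "zero_object (ModCat A) (zero_module :: ('o, 'm, 'v) cmod)"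
    unfolding zero_object_ModCat using zero_module[OF A] by (auto simp: zero_module_def)
  then show "additive_category (ModCat A :: (('o, 'm, 'v) cmod, _) pcat)"
    unfolding additive_category_def using preadditive_ModCat biproduct_ModCat[OF inf A] by auto
next
  fix F G :: "('o, 'm, 'v) cmod" and \<eta>
  assume "F \<in> Ob (ModCat A)" "G \<in> Ob (ModCat A)" "\<eta> \<in> arr (ModCat A) F G"
  then have F: "additive_functor A Ab F" and G: "additive_functor A Ab G" and e: "\<eta> \<in> ntr A F G" by auto
  note K = kernel_module[OF A F G e]
  note C = cokernel_module[OF A F G e]
  have k: "is_kernel (ModCat A) F G \<eta> (kernel_module F G \<eta>) (nid A (kernel_module F G \<eta>))"
  proof (rule is_kernelI[OF F G K(1) e K(2)])
    fix a assume a: "a \<in> Ob A"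
    show "inj_on (nid A (kernel_module F G \<eta>) a) (carrier (fobj (kernel_module F G \<eta>) a))"
      using a by (simp add: inj_on_def)
    show "nid A (kernel_module F G \<eta>) a ` carrier (fobj (kernel_module F G \<eta>) a) = kernel (fobj F a) (fobj G a) (\<eta> a)"
      using a by (simp add: nid_def) (simp add: kernel_module_def)
  qed
  then show "\<exists>k i. is_kernel (ModCat A) F G \<eta> k i" by blast
  have c: "is_cokernel (ModCat A) F G \<eta> (cokernel_module F G \<eta>) (cokernel_proj A F G \<eta>)"
    by (rule is_cokernelI[OF F G C(1) e C(2-4)])
  then show "\<exists>k p. is_cokernel (ModCat A) F G \<eta> k p" by blast
  show "\<exists>c\<in>Ob (ModCat A). \<exists>g\<in>arr (ModCat A) G c. is_kernel (ModCat A) G c g F \<eta>"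
    if "monic (ModCat A) F G \<eta>"
  proof (intro bexI)
    show "is_kernel (ModCat A) G (cokernel_module F G \<eta>) (cokernel_proj A F G \<eta>) F \<eta>"
      by (rule is_kernelI[OF G C(1) F C(2) e monic_imp_inj[OF A F G e that] C(4)[symmetric]])
  qed (use C in simp_all)
  show "\<exists>c\<in>Ob (ModCat A). \<exists>g\<in>arr (ModCat A) c F. is_cokernel (ModCat A) c F g G \<eta>"
    if "epic (ModCat A) F G \<eta>"
  proof (intro bexI)
    show "is_cokernel (ModCat A) (kernel_module F G \<eta>) F (nid A (kernel_module F G \<eta>)) G \<eta>"
      by (rule is_cokernelI[OF K(1) F G K(2) e epic_imp_surj[OF A F G e that]
            is_kernelD(2)[OF A F G K(1) e k, symmetric]])
  qed (use K in simp_all)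
qed

text \<open>Exactness becomes a condition at single objects. This suits induction, whose value at
  \<open>d\<close> is an evaluation up to isomorphism.\<close>

lemma short_exact_ModCat:
  fixes F :: "('o, 'm, 'v) cmod"
  assumes A: "preadditive_category A"
  shows "short_exact (ModCat A) F G H \<eta> \<theta> \<longleftrightarrow>
    additive_functor A Ab F \<and> additive_functor A Ab G \<and> additive_functor A Ab H \<and>
    \<eta> \<in> ntr A F G \<and> \<theta> \<in> ntr A G H \<and>
    (\<forall>a\<in>Ob A. inj_on (\<eta> a) (carrier (fobj F a)) \<and>
      \<eta> a ` carrier (fobj F a) = kernel (fobj G a) (fobj H a) (\<theta> a) \<and>
      \<theta> a ` carrier (fobj G a) = carrier (fobj H a))" (is "?L \<longleftrightarrow> ?R")
proof
  assume ?L
  then have F: "additive_functor A Ab F" and G: "additive_functor A Ab G" and H: "additive_functor A Ab H"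
    and e: "\<eta> \<in> ntr A F G" "\<theta> \<in> ntr A G H" and k: "is_kernel (ModCat A) G H \<theta> F \<eta>"
    and c: "is_cokernel (ModCat A) F G \<eta> H \<theta>"
    by (simp_all add: short_exact_def)
  show ?R
    using F G H e is_kernelD[OF A G H F e(2) k] is_cokernelD[OF A F G H e(1) c] by simp
next
  assume r: ?R
  then have F: "additive_functor A Ab F" and G: "additive_functor A Ab G" and H: "additive_functor A Ab H"
    and e: "\<eta> \<in> ntr A F G" "\<theta> \<in> ntr A G H" by auto
  have "is_kernel (ModCat A) G H \<theta> F \<eta>" by (rule is_kernelI[OF G H F e(2,1)]) (use r in auto)
  moreover have "is_cokernel (ModCat A) F G \<eta> H \<theta>" by (rule is_cokernelI[OF F G H e]) (use r in auto)
  ultimately show ?L using F G H e by (simp add: short_exact_def)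
qed

section \<open>Adjunctions and natural isomorphisms\<close>

lemma fcomp_simps [simp]:
  "fobj (G \<circ>\<^sub>F F) a = fobj G (fobj F a)"
  "fmap (G \<circ>\<^sub>F F) a b f = fmap G (fobj F a) (fobj F b) (fmap F a b f)"
  by (simp_all add: fcomp_def)

lemma fid_simps [simp]: "fobj fid a = a" "fmap fid a b f = f"
  by (simp_all add: fid_def)

lemma additive_functor_Ob: "additive_functor C D F \<Longrightarrow> a \<in> Ob C \<Longrightarrow> fobj F a \<in> Ob D"
  by (simp add: additive_functor_def)

lemma additive_functor_hom:
  "additive_functor C D F \<Longrightarrow> a \<in> Ob C \<Longrightarrow> b \<in> Ob C \<Longrightarrow> fmap F a b \<in> hom (Hom C a b) (Hom D (fobj F a) (fobj F b))"
  by (simp add: additive_functor_def)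

lemma additive_functor_arr:
  "additive_functor C D F \<Longrightarrow> a \<in> Ob C \<Longrightarrow> b \<in> Ob C \<Longrightarrow> f \<in> arr C a b \<Longrightarrow> fmap F a b f \<in> arr D (fobj F a) (fobj F b)"
  by (rule hom_in_carrier[OF additive_functor_hom])

lemma additive_functor_add:
  "additive_functor C D F \<Longrightarrow> a \<in> Ob C \<Longrightarrow> b \<in> Ob C \<Longrightarrow> f \<in> arr C a b \<Longrightarrow> g \<in> arr C a b \<Longrightarrow>
    fmap F a b (f \<otimes>\<^bsub>Hom C a b\<^esub> g) = fmap F a b f \<otimes>\<^bsub>Hom D (fobj F a) (fobj F b)\<^esub> fmap F a b g"
  by (rule hom_mult[OF additive_functor_hom])

lemma additive_functor_Idt:
  "additive_functor C D F \<Longrightarrow> a \<in> Ob C \<Longrightarrow> fmap F a a (Idt C a) = Idt D (fobj F a)"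
  by (simp add: additive_functor_def)

lemma additive_functor_Cmp:
  "additive_functor C D F \<Longrightarrow> a \<in> Ob C \<Longrightarrow> b \<in> Ob C \<Longrightarrow> c \<in> Ob C \<Longrightarrow> f \<in> arr C a b \<Longrightarrow> g \<in> arr C b c \<Longrightarrow>
    fmap F a c (Cmp C a b c g f) = Cmp D (fobj F a) (fobj F b) (fobj F c) (fmap F b c g) (fmap F a b f)"
  by (simp add: additive_functor_def)

lemma additive_functorI:
  assumes "\<And>a. a \<in> Ob C \<Longrightarrow> fobj F a \<in> Ob D"
    and "\<And>a b f. a \<in> Ob C \<Longrightarrow> b \<in> Ob C \<Longrightarrow> f \<in> arr C a b \<Longrightarrow> fmap F a b f \<in> arr D (fobj F a) (fobj F b)"
    and "\<And>a b f g. a \<in> Ob C \<Longrightarrow> b \<in> Ob C \<Longrightarrow> f \<in> arr C a b \<Longrightarrow> g \<in> arr C a b \<Longrightarrow>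
      fmap F a b (f \<otimes>\<^bsub>Hom C a b\<^esub> g) = fmap F a b f \<otimes>\<^bsub>Hom D (fobj F a) (fobj F b)\<^esub> fmap F a b g"
    and "\<And>a. a \<in> Ob C \<Longrightarrow> fmap F a a (Idt C a) = Idt D (fobj F a)"
    and "\<And>a b c f g. a \<in> Ob C \<Longrightarrow> b \<in> Ob C \<Longrightarrow> c \<in> Ob C \<Longrightarrow> f \<in> arr C a b \<Longrightarrow> g \<in> arr C b c \<Longrightarrow>
      fmap F a c (Cmp C a b c g f) = Cmp D (fobj F a) (fobj F b) (fobj F c) (fmap F b c g) (fmap F a b f)"
  shows "additive_functor C D F"
  unfolding additive_functor_def by (intro conjI ballI homI assms)

lemma additive_functor_fid: "preadditive_category C \<Longrightarrow> additive_functor C C fid"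
  by (rule additive_functorI) simp_all

lemma additive_functor_fcomp:
  assumes F: "additive_functor C D F" and G: "additive_functor D E G"
  shows "additive_functor C E (G \<circ>\<^sub>F F)"
  by (rule additive_functorI)
    (simp_all add: additive_functor_Ob[OF F] additive_functor_Ob[OF G] additive_functor_arr[OF F]
      additive_functor_arr[OF G] additive_functor_add[OF F] additive_functor_add[OF G]
      additive_functor_Idt[OF F] additive_functor_Idt[OF G] additive_functor_Cmp[OF F] additive_functor_Cmp[OF G])

lemma (in preadditive_category) iso_arr_Idt: "a \<in> Ob C \<Longrightarrow> iso_arr C a a (Idt C a)"
  unfolding iso_arr_def by (auto intro!: bexI[of _ "Idt C a"] simp: Idt_arr Cmp_Idt_left)

lemma (in preadditive_category) isomorphic_trans:
  assumes ob: "a \<in> Ob C" "b \<in> Ob C" "c \<in> Ob C" and "isomorphic C a b" "isomorphic C b c"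
  shows "isomorphic C a c"
proof -
  obtain f g h k where f: "f \<in> arr C a b" and g: "g \<in> arr C b a" and h: "h \<in> arr C b c" and k: "k \<in> arr C c b"
    and eq: "Cmp C a b a g f = Idt C a" "Cmp C b a b f g = Idt C b"
      "Cmp C b c b k h = Idt C b" "Cmp C c b c h k = Idt C c"
    using assms(4,5) by (auto simp: isomorphic_def iso_arr_def)
  have "Cmp C a c a (Cmp C c b a g k) (Cmp C a b c h f) = Cmp C a b a g (Cmp C a b b (Cmp C b c b k h) f)"
    using ob f g h k by (simp add: Cmp_assoc Cmp_arr)
  moreover have "Cmp C c a c (Cmp C a b c h f) (Cmp C c b a g k) = Cmp C c b c h (Cmp C c b b (Cmp C b a b f g) k)"
    using ob f g h k by (simp add: Cmp_assoc Cmp_arr)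
  ultimately have "iso_arr C a c (Cmp C a b c h f)"
    unfolding iso_arr_def using ob f g h k
    by (auto simp: eq Cmp_arr Cmp_Idt_left intro!: bexI[of _ "Cmp C c b a g k"])
  then show ?thesis unfolding isomorphic_def by blast
qed

lemma isomorphic_sym: "isomorphic C a b \<Longrightarrow> isomorphic C b a"
  unfolding isomorphic_def iso_arr_def by blast

lemma isomorphic_fobj:
  assumes F: "additive_functor C D F" and ob: "a \<in> Ob C" "b \<in> Ob C" and i: "isomorphic C a b"
  shows "isomorphic D (fobj F a) (fobj F b)"
proof -
  obtain f g where f: "f \<in> arr C a b" and g: "g \<in> arr C b a"
    and eq: "Cmp C a b a g f = Idt C a" "Cmp C b a b f g = Idt C b"
    using i by (auto simp: isomorphic_def iso_arr_def)
  have "iso_arr D (fobj F a) (fobj F b) (fmap F a b f)"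
    unfolding iso_arr_def
    using additive_functor_arr[OF F ob f] additive_functor_arr[OF F ob(2,1) g]
      additive_functor_Cmp[OF F ob(1,2,1) f g] additive_functor_Cmp[OF F ob(2,1,2) g f]
      additive_functor_Idt[OF F ob(1)] additive_functor_Idt[OF F ob(2)] eq
    by (auto intro!: bexI[of _ "fmap F b a g"])
  then show ?thesis unfolding isomorphic_def by blast
qed

text \<open>The relation \<open>nat_isomorphic\<close> with its witness as an argument, so that
  further properties can be moved along a given transformation.\<close>

definition nat_iso ::
  "('o1, 'm1, 'z1) pcat_scheme \<Rightarrow> ('o2, 'm2, 'z2) pcat_scheme
    \<Rightarrow> ('o1, 'm1, 'o2, 'm2) cfunctor \<Rightarrow> ('o1, 'm1, 'o2, 'm2) cfunctor \<Rightarrow> ('o1 \<Rightarrow> 'm2) \<Rightarrow> bool"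
  where "nat_iso C D F G \<eta> \<longleftrightarrow> (\<forall>a\<in>Ob C. iso_arr D (fobj F a) (fobj G a) (\<eta> a)) \<and>
    (\<forall>a\<in>Ob C. \<forall>b\<in>Ob C. \<forall>f\<in>arr C a b.
      Cmp D (fobj F a) (fobj F b) (fobj G b) (\<eta> b) (fmap F a b f)
        = Cmp D (fobj F a) (fobj G a) (fobj G b) (fmap G a b f) (\<eta> a))"

lemma nat_iso_inverse:
  assumes "nat_iso C D F G \<eta>"
  obtains \<theta> where "\<And>a. a \<in> Ob C \<Longrightarrow> \<theta> a \<in> arr D (fobj G a) (fobj F a)"
    and "\<And>a. a \<in> Ob C \<Longrightarrow> Cmp D (fobj F a) (fobj G a) (fobj F a) (\<theta> a) (\<eta> a) = Idt D (fobj F a)"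
    and "\<And>a. a \<in> Ob C \<Longrightarrow> Cmp D (fobj G a) (fobj F a) (fobj G a) (\<eta> a) (\<theta> a) = Idt D (fobj G a)"
proof -
  have "\<forall>a\<in>Ob C. \<exists>g. g \<in> arr D (fobj G a) (fobj F a) \<and>
      Cmp D (fobj F a) (fobj G a) (fobj F a) g (\<eta> a) = Idt D (fobj F a) \<and>
      Cmp D (fobj G a) (fobj F a) (fobj G a) (\<eta> a) g = Idt D (fobj G a)"
    using assms unfolding nat_iso_def iso_arr_def by blast
  from bchoice[OF this] that show ?thesis by blast
qed

section \<open>Transfer of properties along a natural isomorphism\<close>

context
  fixes C :: "('o1, 'm1, 'z1) pcat_scheme" and D :: "('o2, 'm2, 'z2) pcat_scheme" and F G \<eta>
  assumes C: "preadditive_category C" and D: "preadditive_category D"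
    and F: "additive_functor C D F" and n: "nat_iso C D F G \<eta>"
    and G_Ob: "\<And>a. a \<in> Ob C \<Longrightarrow> fobj G a \<in> Ob D"
    and G_arr: "\<And>a b f. a \<in> Ob C \<Longrightarrow> b \<in> Ob C \<Longrightarrow> f \<in> arr C a b \<Longrightarrow> fmap G a b f \<in> arr D (fobj G a) (fobj G b)"
begin

interpretation C: preadditive_category C by (rule C)
interpretation D: preadditive_category D by (rule D)

lemma nat_iso_arr: "a \<in> Ob C \<Longrightarrow> \<eta> a \<in> arr D (fobj F a) (fobj G a)"
  using n by (simp add: nat_iso_def iso_arr_def)

lemma nat_iso_natural:
  "a \<in> Ob C \<Longrightarrow> b \<in> Ob C \<Longrightarrow> f \<in> arr C a b \<Longrightarrow>
    Cmp D (fobj F a) (fobj F b) (fobj G b) (\<eta> b) (fmap F a b f)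
      = Cmp D (fobj F a) (fobj G a) (fobj G b) (fmap G a b f) (\<eta> a)"
  using n by (simp add: nat_iso_def)

lemma nat_iso_cancel:
  assumes a: "a \<in> Ob C" and d: "d \<in> Ob D"
  shows "bij_betw (\<lambda>g. Cmp D (fobj F a) (fobj G a) d g (\<eta> a)) (arr D (fobj G a) d) (arr D (fobj F a) d)"
proof -
  obtain \<theta> where t: "\<And>a. a \<in> Ob C \<Longrightarrow> \<theta> a \<in> arr D (fobj G a) (fobj F a)"
    "\<And>a. a \<in> Ob C \<Longrightarrow> Cmp D (fobj F a) (fobj G a) (fobj F a) (\<theta> a) (\<eta> a) = Idt D (fobj F a)"
    "\<And>a. a \<in> Ob C \<Longrightarrow> Cmp D (fobj G a) (fobj F a) (fobj G a) (\<eta> a) (\<theta> a) = Idt D (fobj G a)"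
    using nat_iso_inverse[OF n] by blast
  note ob = additive_functor_Ob[OF F a] G_Ob[OF a] d
  show ?thesis
  proof (rule bij_betw_byWitness[where f' = "\<lambda>g. Cmp D (fobj G a) (fobj F a) d g (\<theta> a)"])
    show "\<forall>g\<in>arr D (fobj G a) d. Cmp D (fobj G a) (fobj F a) d (Cmp D (fobj F a) (fobj G a) d g (\<eta> a)) (\<theta> a) = g"
      using ob t[OF a] nat_iso_arr[OF a]
      by (auto simp: D.Cmp_assoc[symmetric] D.Cmp_Idt_right)
    show "\<forall>g\<in>arr D (fobj F a) d. Cmp D (fobj F a) (fobj G a) d (Cmp D (fobj G a) (fobj F a) d g (\<theta> a)) (\<eta> a) = g"
      using ob t[OF a] nat_iso_arr[OF a]
      by (auto simp: D.Cmp_assoc[symmetric] D.Cmp_Idt_right)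
  qed (use ob t[OF a] nat_iso_arr[OF a] in \<open>auto simp: D.Cmp_arr\<close>)
qed

lemma nat_iso_epi:
  "a \<in> Ob C \<Longrightarrow> d \<in> Ob D \<Longrightarrow> g \<in> arr D (fobj G a) d \<Longrightarrow> h \<in> arr D (fobj G a) d \<Longrightarrow>
    Cmp D (fobj F a) (fobj G a) d g (\<eta> a) = Cmp D (fobj F a) (fobj G a) d h (\<eta> a) \<Longrightarrow> g = h"
  using nat_iso_cancel[of a d] by (auto simp: bij_betw_def dest: inj_onD)

text \<open>The data \<open>G\<close> is only assumed to send objects to objects and arrows to
  arrows. Naturality determines \<open>fmap G a b f\<close> after composition with
  \<open>\<eta> a\<close>, and \<open>\<eta> a\<close> can be cancelled, so the functor laws of
  \<open>F\<close> pass to \<open>G\<close>.\<close>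

lemma additive_functor_nat_iso: "additive_functor C D G"
proof (rule additive_functorI)
  note [simp] = additive_functor_Ob[OF F] G_Ob G_arr nat_iso_arr additive_functor_arr[OF F]
  show "fmap G a b (f \<otimes>\<^bsub>Hom C a b\<^esub> g) = fmap G a b f \<otimes>\<^bsub>Hom D (fobj G a) (fobj G b)\<^esub> fmap G a b g"
    if ab: "a \<in> Ob C" "b \<in> Ob C" and f: "f \<in> arr C a b" and g: "g \<in> arr C a b" for a b f g
  proof (rule nat_iso_epi[OF ab(1) G_Ob[OF ab(2)]])
    have fg: "f \<otimes>\<^bsub>Hom C a b\<^esub> g \<in> arr C a b" using C.add_arr_closed[OF ab f g] .
    show "fmap G a b (f \<otimes>\<^bsub>Hom C a b\<^esub> g) \<in> arr D (fobj G a) (fobj G b)" using ab fg by simp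
    show "fmap G a b f \<otimes>\<^bsub>Hom D (fobj G a) (fobj G b)\<^esub> fmap G a b g \<in> arr D (fobj G a) (fobj G b)"
      using ab f g by (simp add: D.add_arr_closed)
    show "Cmp D (fobj F a) (fobj G a) (fobj G b) (fmap G a b (f \<otimes>\<^bsub>Hom C a b\<^esub> g)) (\<eta> a)
      = Cmp D (fobj F a) (fobj G a) (fobj G b) (fmap G a b f \<otimes>\<^bsub>Hom D (fobj G a) (fobj G b)\<^esub> fmap G a b g) (\<eta> a)"
      using ab f g fg by (simp add: nat_iso_natural[symmetric] additive_functor_add[OF F] D.Cmp_add_right D.Cmp_add_left)
  qed
  show "fmap G a a (Idt C a) = Idt D (fobj G a)" if a: "a \<in> Ob C" for a
  proof (rule nat_iso_epi[OF a G_Ob[OF a]])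
    show "Cmp D (fobj F a) (fobj G a) (fobj G a) (fmap G a a (Idt C a)) (\<eta> a)
      = Cmp D (fobj F a) (fobj G a) (fobj G a) (Idt D (fobj G a)) (\<eta> a)"
      using a by (simp add: nat_iso_natural[symmetric] C.Idt_arr additive_functor_Idt[OF F] D.Cmp_Idt_left D.Cmp_Idt_right)
  qed (use a in \<open>simp_all add: C.Idt_arr D.Idt_arr\<close>)
  show "fmap G a c (Cmp C a b c g f) = Cmp D (fobj G a) (fobj G b) (fobj G c) (fmap G b c g) (fmap G a b f)"
    if ob: "a \<in> Ob C" "b \<in> Ob C" "c \<in> Ob C" and f: "f \<in> arr C a b" and g: "g \<in> arr C b c" for a b c f g
  proof (rule nat_iso_epi[OF ob(1) G_Ob[OF ob(3)]])
    have "Cmp D (fobj F a) (fobj G a) (fobj G c) (fmap G a c (Cmp C a b c g f)) (\<eta> a)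
      = Cmp D (fobj F a) (fobj F c) (fobj G c) (\<eta> c) (Cmp D (fobj F a) (fobj F b) (fobj F c) (fmap F b c g) (fmap F a b f))"
      using ob f g by (simp add: nat_iso_natural[symmetric] C.Cmp_arr additive_functor_Cmp[OF F])
    also have "\<dots> = Cmp D (fobj F a) (fobj F b) (fobj G c) (Cmp D (fobj F b) (fobj G b) (fobj G c) (fmap G b c g) (\<eta> b)) (fmap F a b f)"
      using ob f g by (simp add: D.Cmp_assoc nat_iso_natural)
    also have "\<dots> = Cmp D (fobj F a) (fobj G b) (fobj G c) (fmap G b c g) (Cmp D (fobj F a) (fobj F b) (fobj G b) (\<eta> b) (fmap F a b f))"
      using ob f g by (subst D.Cmp_assoc) simp_all
    also have "\<dots> = Cmp D (fobj F a) (fobj G a) (fobj G c) (Cmp D (fobj G a) (fobj G b) (fobj G c) (fmap G b c g) (fmap G a b f)) (\<eta> a)"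
      using ob f g by (simp add: D.Cmp_assoc nat_iso_natural)
    finally show "Cmp D (fobj F a) (fobj G a) (fobj G c) (fmap G a c (Cmp C a b c g f)) (\<eta> a) =
      Cmp D (fobj F a) (fobj G a) (fobj G c) (Cmp D (fobj G a) (fobj G b) (fobj G c) (fmap G b c g) (fmap G a b f)) (\<eta> a)" .
  qed (use ob f g in \<open>simp_all add: C.Cmp_arr D.Cmp_arr\<close>)
qed (simp_all add: G_Ob G_arr)

text \<open>Composition with \<open>\<eta> b\<close> after \<open>fmap F\<close> is bijective. By
  naturality it equals \<open>fmap G\<close> followed by composition with \<open>\<eta> a\<close>,
  and the latter is bijective as well.\<close>

lemma fully_faithful_nat_iso:
  assumes ff: "fully_faithful C D F"
  shows "fully_faithful C D G"
  unfolding fully_faithful_def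
proof (intro ballI)
  fix a b assume ab: "a \<in> Ob C" "b \<in> Ob C"
  note [simp] = additive_functor_Ob[OF F] G_Ob G_arr nat_iso_arr additive_functor_arr[OF F]
  obtain \<theta> where t: "\<And>a. a \<in> Ob C \<Longrightarrow> \<theta> a \<in> arr D (fobj G a) (fobj F a)"
    "\<And>a. a \<in> Ob C \<Longrightarrow> Cmp D (fobj F a) (fobj G a) (fobj F a) (\<theta> a) (\<eta> a) = Idt D (fobj F a)"
    "\<And>a. a \<in> Ob C \<Longrightarrow> Cmp D (fobj G a) (fobj F a) (fobj G a) (\<eta> a) (\<theta> a) = Idt D (fobj G a)"
    using nat_iso_inverse[OF n] by blast
  have b1: "bij_betw (fmap F a b) (arr C a b) (arr D (fobj F a) (fobj F b))"
    using ff ab by (simp add: fully_faithful_def)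
  have b2: "bij_betw (\<lambda>h. Cmp D (fobj F a) (fobj F b) (fobj G b) (\<eta> b) h)
      (arr D (fobj F a) (fobj F b)) (arr D (fobj F a) (fobj G b))"
  proof (rule bij_betw_byWitness[where f' = "\<lambda>h. Cmp D (fobj F a) (fobj G b) (fobj F b) (\<theta> b) h"])
  qed (use ab t in \<open>auto simp: D.Cmp_assoc D.Cmp_Idt_left D.Cmp_arr\<close>)
  have "bij_betw (\<lambda>f. Cmp D (fobj F a) (fobj G a) (fobj G b) (fmap G a b f) (\<eta> a)) (arr C a b) (arr D (fobj F a) (fobj G b))"
    using bij_betw_trans[OF b1 b2] ab
    by (subst bij_betw_cong[OF nat_iso_natural[symmetric]]) (simp_all add: comp_def)
  moreover have "(\<lambda>f. Cmp D (fobj F a) (fobj G a) (fobj G b) (fmap G a b f) (\<eta> a))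
      = (\<lambda>g. Cmp D (fobj F a) (fobj G a) (fobj G b) g (\<eta> a)) \<circ> fmap G a b" by auto
  ultimately have "bij_betw ((\<lambda>g. Cmp D (fobj F a) (fobj G a) (fobj G b) g (\<eta> a)) \<circ> fmap G a b) (arr C a b) (arr D (fobj F a) (fobj G b))"
    by simp
  then show "bij_betw (fmap G a b) (arr C a b) (arr D (fobj G a) (fobj G b))"
    by (subst bij_betw_comp_iff2[OF nat_iso_cancel[OF ab(1) G_Ob[OF ab(2)]]]) (use ab in auto)
qed

text \<open>The adjunction bijection of \<open>F\<close> is applied after precomposition with
  \<open>\<eta> c\<close>; naturality of \<open>\<eta>\<close> gives compatibility in the first
  variable.\<close>

lemma adjoint_nat_iso:
  assumes adj: "adjoint C D F H"
  shows "adjoint C D G H"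
proof -
  note [simp] = additive_functor_Ob[OF F] G_Ob G_arr nat_iso_arr additive_functor_arr[OF F]
  obtain \<phi> where bij: "\<forall>c\<in>Ob C. \<forall>d\<in>Ob D. bij_betw (\<phi> c d) (arr D (fobj F c) d) (arr C c (fobj H d))"
    and nat: "\<forall>c\<in>Ob C. \<forall>c'\<in>Ob C. \<forall>d\<in>Ob D. \<forall>d'\<in>Ob D. \<forall>f\<in>arr C c' c. \<forall>g\<in>arr D (fobj F c) d. \<forall>h\<in>arr D d d'.
        \<phi> c' d' (Cmp D (fobj F c') d d' h (Cmp D (fobj F c') (fobj F c) d g (fmap F c' c f)))
          = Cmp C c' (fobj H d) (fobj H d') (fmap H d d' h) (Cmp C c' c (fobj H d) (\<phi> c d g) f)"
    using adj unfolding adjoint_def by blast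
  let ?\<psi> = "\<lambda>c d g. \<phi> c d (Cmp D (fobj F c) (fobj G c) d g (\<eta> c))"
  show ?thesis
    unfolding adjoint_def
  proof (intro exI[of _ ?\<psi>] conjI ballI)
    fix c d assume cd: "c \<in> Ob C" "d \<in> Ob D"
    have "bij_betw (\<phi> c d \<circ> (\<lambda>g. Cmp D (fobj F c) (fobj G c) d g (\<eta> c))) (arr D (fobj G c) d) (arr C c (fobj H d))"
      by (rule bij_betw_trans[OF nat_iso_cancel[OF cd]]) (use bij cd in blast)
    then show "bij_betw (?\<psi> c d) (arr D (fobj G c) d) (arr C c (fobj H d))" by (simp add: comp_def)
  next
    fix c c' d d' f g h
    assume ob: "c \<in> Ob C" "c' \<in> Ob C" "d \<in> Ob D" "d' \<in> Ob D"
      and f: "f \<in> arr C c' c" and g: "g \<in> arr D (fobj G c) d" and h: "h \<in> arr D d d'"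
    have gc: "Cmp D (fobj F c) (fobj G c) d g (\<eta> c) \<in> arr D (fobj F c) d"
      using ob g by (simp add: D.Cmp_arr)
    have "Cmp D (fobj F c') (fobj G c') d' (Cmp D (fobj G c') d d' h (Cmp D (fobj G c') (fobj G c) d g (fmap G c' c f))) (\<eta> c')
      = Cmp D (fobj F c') d d' h (Cmp D (fobj F c') (fobj G c) d g (Cmp D (fobj F c') (fobj G c') (fobj G c) (fmap G c' c f) (\<eta> c')))"
      using ob f g h by (simp add: D.Cmp_assoc D.Cmp_arr)
    also have "\<dots> = Cmp D (fobj F c') d d' h (Cmp D (fobj F c') (fobj F c) d (Cmp D (fobj F c) (fobj G c) d g (\<eta> c)) (fmap F c' c f))"
      using ob f g h by (simp add: nat_iso_natural[symmetric] D.Cmp_assoc D.Cmp_arr)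
    finally show "?\<psi> c' d' (Cmp D (fobj G c') d d' h (Cmp D (fobj G c') (fobj G c) d g (fmap G c' c f)))
       = Cmp C c' (fobj H d) (fobj H d') (fmap H d d' h) (Cmp C c' c (fobj H d) (?\<psi> c d g) f)"
      using nat[rule_format, OF ob f gc h] by simp
  qed
qed

end

lemma adjoint_fcomp:
  assumes D: "preadditive_category D" 
    and L: "additive_functor C D L" and G': "additive_functor E D G'"
    and a1: "adjoint C D L G" and a2: "adjoint D E L' G'"
  shows "adjoint C E (L' \<circ>\<^sub>F L) (G \<circ>\<^sub>F G')"
proof -
  interpret D: preadditive_category D by (rule D)
  note ob' = additive_functor_Ob[OF L] additive_functor_Ob[OF G']
  obtain \<phi> where bij: "\<And>c d. c \<in> Ob C \<Longrightarrow> d \<in> Ob D \<Longrightarrow> bij_betw (\<phi> c d) (arr D (fobj L c) d) (arr C c (fobj G d))"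
    and nat: "\<forall>c\<in>Ob C. \<forall>c'\<in>Ob C. \<forall>d\<in>Ob D. \<forall>d'\<in>Ob D. \<forall>f\<in>arr C c' c. \<forall>g\<in>arr D (fobj L c) d. \<forall>h\<in>arr D d d'.
        \<phi> c' d' (Cmp D (fobj L c') d d' h (Cmp D (fobj L c') (fobj L c) d g (fmap L c' c f)))
          = Cmp C c' (fobj G d) (fobj G d') (fmap G d d' h) (Cmp C c' c (fobj G d) (\<phi> c d g) f)"
    using a1 unfolding adjoint_def by blast
  obtain \<psi> where bij': "\<And>d e. d \<in> Ob D \<Longrightarrow> e \<in> Ob E \<Longrightarrow> bij_betw (\<psi> d e) (arr E (fobj L' d) e) (arr D d (fobj G' e))"
    and nat': "\<forall>c\<in>Ob D. \<forall>c'\<in>Ob D. \<forall>d\<in>Ob E. \<forall>d'\<in>Ob E. \<forall>f\<in>arr D c' c. \<forall>g\<in>arr E (fobj L' c) d. \<forall>h\<in>arr E d d'.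
        \<psi> c' d' (Cmp E (fobj L' c') d d' h (Cmp E (fobj L' c') (fobj L' c) d g (fmap L' c' c f)))
          = Cmp D c' (fobj G' d) (fobj G' d') (fmap G' d d' h) (Cmp D c' c (fobj G' d) (\<psi> c d g) f)"
    using a2 unfolding adjoint_def by blast
  show ?thesis
    unfolding adjoint_def fcomp_simps
  proof (intro exI[of _ "\<lambda>c e g. \<phi> c (fobj G' e) (\<psi> (fobj L c) e g)"] conjI ballI)
    fix c e assume ce: "c \<in> Ob C" "e \<in> Ob E"
    show "bij_betw (\<lambda>g. \<phi> c (fobj G' e) (\<psi> (fobj L c) e g)) (arr E (fobj L' (fobj L c)) e) (arr C c (fobj G (fobj G' e)))"
      using bij_betw_trans[OF bij'[OF ob'(1)[OF ce(1)] ce(2)] bij[OF ce(1) ob'(2)[OF ce(2)]]] by (simp add: comp_def)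
  next
    fix c c' d d' f g h
    assume ob: "c \<in> Ob C" "c' \<in> Ob C" "d \<in> Ob E" "d' \<in> Ob E"
      and f: "f \<in> arr C c' c" and g: "g \<in> arr E (fobj L' (fobj L c)) d" and h: "h \<in> arr E d d'"
    have Lf: "fmap L c' c f \<in> arr D (fobj L c') (fobj L c)" by (rule additive_functor_arr[OF L ob(2,1) f])
    have Gh: "fmap G' d d' h \<in> arr D (fobj G' d) (fobj G' d')" by (rule additive_functor_arr[OF G' ob(3,4) h])
    have pg: "\<psi> (fobj L c) d g \<in> arr D (fobj L c) (fobj G' d)"
      using bij_betwE[OF bij'[OF ob'(1)[OF ob(1)] ob(3)]] g by blast
    note n' = nat'[rule_format, OF ob'(1)[OF ob(1)] ob'(1)[OF ob(2)] ob(3,4) Lf g h]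
    show "\<phi> c' (fobj G' d') (\<psi> (fobj L c') d' (Cmp E (fobj L' (fobj L c')) d d' h
        (Cmp E (fobj L' (fobj L c')) (fobj L' (fobj L c)) d g (fmap L' (fobj L c') (fobj L c) (fmap L c' c f)))))
      = Cmp C c' (fobj G (fobj G' d)) (fobj G (fobj G' d')) (fmap G (fobj G' d) (fobj G' d') (fmap G' d d' h))
         (Cmp C c' c (fobj G (fobj G' d)) (\<phi> c (fobj G' d) (\<psi> (fobj L c) d g)) f)"
      unfolding n' by (rule nat[rule_format, OF ob(1,2) ob'(2)[OF ob(3)] ob'(2)[OF ob(4)] f pg Gh])
  qed
qed

lemma fully_faithful_fcomp:
  assumes F: "additive_functor C D F" and ff: "fully_faithful C D F" "fully_faithful D E G"
  shows "fully_faithful C E (G \<circ>\<^sub>F F)"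
  unfolding fully_faithful_def
proof (intro ballI)
  fix a b assume ab: "a \<in> Ob C" "b \<in> Ob C"
  note ob = additive_functor_Ob[OF F]
  have "bij_betw (fmap G (fobj F a) (fobj F b) \<circ> fmap F a b) (arr C a b)
      (arr E (fobj G (fobj F a)) (fobj G (fobj F b)))"
    by (rule bij_betw_trans[of _ _ "arr D (fobj F a) (fobj F b)"])
      (use ff ab ob in \<open>simp_all add: fully_faithful_def\<close>)
  then show "bij_betw (fmap (G \<circ>\<^sub>F F) a b) (arr C a b) (arr E (fobj (G \<circ>\<^sub>F F) a) (fobj (G \<circ>\<^sub>F F) b))"
    by (simp add: comp_def fcomp_def)
qed

lemma fcomp_assoc: "(H \<circ>\<^sub>F G) \<circ>\<^sub>F F = H \<circ>\<^sub>F (G \<circ>\<^sub>F F)"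
  by (simp add: fcomp_def)

lemma abelian_imp_preadditive: "abelian_category C \<Longrightarrow> preadditive_category C"
  by (simp add: abelian_category_def additive_category_def)

text \<open>Each triple contains a left and a right adjoint, so the equivalences are required to be
  adjoint in both orders: \<open>eB\<close> before \<open>fB\<close> for the left adjoint
  \<open>iu\<close>, and \<open>fB\<close> before \<open>eB\<close> for the right adjoint
  \<open>ix\<close>. The isomorphisms \<open>isoB\<close> keep the essential image of
  \<open>il\<close> unchanged.\<close>

lemma recollement_transport:
  assumes r: "recollement B A C iu il ix js ju jl"
    and B': "abelian_category B'" and C': "abelian_category C'"
    and eB: "additive_functor B B' eB" and fB: "additive_functor B' B fB"
    and aB: "adjoint B B' eB fB" "adjoint B' B fB eB" and ffB: "fully_faithful B' B fB"
    and isoB: "\<And>b. b \<in> Ob B \<Longrightarrow> isomorphic B b (fobj fB (fobj eB b))"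
    and eC: "additive_functor C C' eC" and fC: "additive_functor C' C fC"
    and aC: "adjoint C C' eC fC" "adjoint C' C fC eC" and ffC: "fully_faithful C' C fC"
    and zC: "\<And>c. c \<in> Ob C \<Longrightarrow> zero_object C' (fobj eC c) \<longleftrightarrow> zero_object C c"
  shows "recollement B' A C' (eB \<circ>\<^sub>F iu) (il \<circ>\<^sub>F fB) (eB \<circ>\<^sub>F ix) (js \<circ>\<^sub>F fC) (eC \<circ>\<^sub>F ju) (jl \<circ>\<^sub>F fC)"
proof -
  have A: "abelian_category A" and B: "abelian_category B" and C: "abelian_category C"
    and iu: "additive_functor A B iu" and il: "additive_functor B A il" and ix: "additive_functor A B ix"
    and js: "additive_functor C A js" and ju: "additive_functor A C ju" and jl: "additive_functor C A jl"
    and adj: "adjoint A B iu il" "adjoint B A il ix" "adjoint C A js ju" "adjoint A C ju jl"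
    and ker: "\<And>a. a \<in> Ob A \<Longrightarrow> zero_object C (fobj ju a) \<longleftrightarrow> (\<exists>b\<in>Ob B. isomorphic A a (fobj il b))"
    and ff: "fully_faithful B A il" "fully_faithful C A js" "fully_faithful C A jl"
    using r unfolding recollement_def by auto
  note pB = abelian_imp_preadditive[OF B] and pC = abelian_imp_preadditive[OF C]
  interpret A: preadditive_category A by (rule abelian_imp_preadditive[OF A])
  have "(\<exists>b\<in>Ob B. isomorphic A a (fobj il b)) \<longleftrightarrow> (\<exists>b\<in>Ob B'. isomorphic A a (fobj il (fobj fB b)))"
    if a: "a \<in> Ob A" for a
  proof
    assume "\<exists>b\<in>Ob B. isomorphic A a (fobj il b)"
    then obtain b where b: "b \<in> Ob B" "isomorphic A a (fobj il b)" by blast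
    have fe: "fobj fB (fobj eB b) \<in> Ob B" using b additive_functor_Ob[OF eB] additive_functor_Ob[OF fB] by blast
    have "isomorphic A (fobj il b) (fobj il (fobj fB (fobj eB b)))"
      by (rule isomorphic_fobj[OF il b(1) fe isoB[OF b(1)]])
    then have "isomorphic A a (fobj il (fobj fB (fobj eB b)))"
      using A.isomorphic_trans[OF a _ _ b(2)] b(1) fe additive_functor_Ob[OF il] by blast
    then show "\<exists>b\<in>Ob B'. isomorphic A a (fobj il (fobj fB b))"
      using b additive_functor_Ob[OF eB] by blast
  next
    assume "\<exists>b\<in>Ob B'. isomorphic A a (fobj il (fobj fB b))"
    then show "\<exists>b\<in>Ob B. isomorphic A a (fobj il b)" using additive_functor_Ob[OF fB] by blast
  qed
  then have "\<forall>a\<in>Ob A. zero_object C' (fobj (eC \<circ>\<^sub>F ju) a) \<longleftrightarrow> (\<exists>b\<in>Ob B'. isomorphic A a (fobj (il \<circ>\<^sub>F fB) b))"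
    using ker zC additive_functor_Ob[OF ju] by simp
  then show ?thesis
    unfolding recollement_def
    by (intro conjI A B' C' additive_functor_fcomp[OF iu eB] additive_functor_fcomp[OF fB il]
        additive_functor_fcomp[OF ix eB] additive_functor_fcomp[OF fC js] additive_functor_fcomp[OF ju eC]
        additive_functor_fcomp[OF fC jl] adjoint_fcomp[OF pB iu fB adj(1) aB(1)]
        adjoint_fcomp[OF pB fB ix aB(2) adj(2)] adjoint_fcomp[OF pC fC ju aC(2) adj(3)]
        adjoint_fcomp[OF pC ju fC adj(4) aC(1)] fully_faithful_fcomp[OF fB ffB ff(1)]
        fully_faithful_fcomp[OF fC ffC ff(2)] fully_faithful_fcomp[OF fC ffC ff(3)])
qed

section \<open>Restriction functors\<close>

lemma res_functor_simps [simp]: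
  "fobj (res_functor C P) N = N \<circ>\<^sub>F P"
  "fmap (res_functor C P) N N' \<eta> = (\<lambda>a\<in>Ob C. \<eta> (fobj P a))"
  by (simp_all add: res_functor_def)

lemma res_ntr:
  assumes P: "additive_functor C D P" and e: "\<eta> \<in> ntr D N N'"
  shows "(\<lambda>a\<in>Ob C. \<eta> (fobj P a)) \<in> ntr C (N \<circ>\<^sub>F P) (N' \<circ>\<^sub>F P)"
  by (rule ntrI)
    (simp_all add: additive_functor_Ob[OF P] ntr_comp_ext[OF e] ntr_closed[OF e] ntr_mult[OF e]
      ntr_natural[OF e] additive_functor_arr[OF P])

lemma res_functor_additive:
  assumes P: "additive_functor C D P"
  shows "additive_functor (ModCat D) (ModCat C) (res_functor C P :: (('p, 'n, 'v) cmod, _, _, _) cfunctor)"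
proof (rule additive_functorI; unfold ModCat_simps mem_Collect_eq res_functor_simps)
  fix N N' N'' :: "('p, 'n, 'v) cmod" and \<eta> \<theta>
  note PO = additive_functor_Ob[OF P]
  assume N: "additive_functor D Ab N"
  show N_P: "additive_functor C Ab (N \<circ>\<^sub>F P)" by (rule additive_functor_fcomp[OF P N])
  show "(\<lambda>a\<in>Ob C. nid D N (fobj P a)) = nid C (N \<circ>\<^sub>F P)"
    by (rule ntr_eqI[OF res_ntr[OF P nid_ntr[OF N]] nid_ntr[OF N_P]]) (simp add: PO)
  assume N': "additive_functor D Ab N'"
  have N'_P: "additive_functor C Ab (N' \<circ>\<^sub>F P)" by (rule additive_functor_fcomp[OF P N'])
  show "(\<lambda>a\<in>Ob C. \<eta> (fobj P a)) \<in> ntr C (N \<circ>\<^sub>F P) (N' \<circ>\<^sub>F P)" if "\<eta> \<in> ntr D N N'"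
    by (rule res_ntr[OF P that])
  show "(\<lambda>a\<in>Ob C. (\<eta> \<otimes>\<^bsub>nat_group D N N'\<^esub> \<theta>) (fobj P a)) =
      (\<lambda>a\<in>Ob C. \<eta> (fobj P a)) \<otimes>\<^bsub>nat_group C (N \<circ>\<^sub>F P) (N' \<circ>\<^sub>F P)\<^esub> (\<lambda>a\<in>Ob C. \<theta> (fobj P a))"
    if e: "\<eta> \<in> ntr D N N'" "\<theta> \<in> ntr D N N'"
    by (rule ntr_eqI[OF res_ntr[OF P nat_group_m_closed[OF N N' e]]
          nat_group_m_closed[OF N_P N'_P res_ntr[OF P e(1)] res_ntr[OF P e(2)]]])
      (simp add: nat_group_mult_apply PO)
  assume N'': "additive_functor D Ab N''"
  show "(\<lambda>a\<in>Ob C. ncmp D N \<theta> \<eta> (fobj P a)) =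
      ncmp C (N \<circ>\<^sub>F P) (\<lambda>a\<in>Ob C. \<theta> (fobj P a)) (\<lambda>a\<in>Ob C. \<eta> (fobj P a))"
    if e: "\<eta> \<in> ntr D N N'" and t: "\<theta> \<in> ntr D N' N''"
    by (rule ntr_eqI[OF res_ntr[OF P ncmp_ntr[OF N e t]] ncmp_ntr[OF N_P res_ntr[OF P e] res_ntr[OF P t]]])
      (simp add: PO)
qed

text \<open>\<open>P\<close> is left adjoint to \<open>S\<close>; restriction reverses the order, see \<open>res_functor_adjoint\<close>.\<close>

definition index_adjunction ::
  "('o, 'm, 'z) pcat_scheme \<Rightarrow> ('p, 'n, 'y) pcat_scheme \<Rightarrow> ('o, 'm, 'p, 'n) cfunctor \<Rightarrow> ('p, 'n, 'o, 'm) cfunctor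
    \<Rightarrow> ('o \<Rightarrow> 'm) \<Rightarrow> ('p \<Rightarrow> 'n) \<Rightarrow> bool"
  where "index_adjunction C D P S \<eta> \<epsilon> \<longleftrightarrow> additive_functor C D P \<and> additive_functor D C S \<and>
    (\<forall>c\<in>Ob C. \<eta> c \<in> arr C c (fobj S (fobj P c))) \<and>
    (\<forall>d\<in>Ob D. \<epsilon> d \<in> arr D (fobj P (fobj S d)) d) \<and>
    (\<forall>c\<in>Ob C. \<forall>c'\<in>Ob C. \<forall>f\<in>arr C c c'.
      Cmp C c c' (fobj S (fobj P c')) (\<eta> c') f =
      Cmp C c (fobj S (fobj P c)) (fobj S (fobj P c')) (fmap S (fobj P c) (fobj P c') (fmap P c c' f)) (\<eta> c)) \<and>
    (\<forall>d\<in>Ob D. \<forall>d'\<in>Ob D. \<forall>g\<in>arr D d d'.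
      Cmp D (fobj P (fobj S d)) (fobj P (fobj S d')) d' (\<epsilon> d') (fmap P (fobj S d) (fobj S d') (fmap S d d' g)) =
      Cmp D (fobj P (fobj S d)) d d' g (\<epsilon> d)) \<and>
    (\<forall>c\<in>Ob C. Cmp D (fobj P c) (fobj P (fobj S (fobj P c))) (fobj P c) (\<epsilon> (fobj P c))
      (fmap P c (fobj S (fobj P c)) (\<eta> c)) = Idt D (fobj P c)) \<and>
    (\<forall>d\<in>Ob D. Cmp C (fobj S d) (fobj S (fobj P (fobj S d))) (fobj S d) (fmap S (fobj P (fobj S d)) d (\<epsilon> d))
      (\<eta> (fobj S d)) = Idt C (fobj S d))"

context
  fixes C :: "('o, 'm, 'z) pcat_scheme" and D :: "('p, 'n, 'y) pcat_scheme" and P S \<eta> \<epsilon>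
  assumes adj: "index_adjunction C D P S \<eta> \<epsilon>"
begin

lemma index_adjunction_left: "additive_functor C D P"
  and index_adjunction_right: "additive_functor D C S"
  and unit_arr: "c \<in> Ob C \<Longrightarrow> \<eta> c \<in> arr C c (fobj S (fobj P c))"
  and counit_arr: "d \<in> Ob D \<Longrightarrow> \<epsilon> d \<in> arr D (fobj P (fobj S d)) d"
  and unit_natural: "c \<in> Ob C \<Longrightarrow> c' \<in> Ob C \<Longrightarrow> f \<in> arr C c c' \<Longrightarrow>
      Cmp C c c' (fobj S (fobj P c')) (\<eta> c') f =
      Cmp C c (fobj S (fobj P c)) (fobj S (fobj P c')) (fmap S (fobj P c) (fobj P c') (fmap P c c' f)) (\<eta> c)"
  and counit_natural: "d \<in> Ob D \<Longrightarrow> d' \<in> Ob D \<Longrightarrow> g \<in> arr D d d' \<Longrightarrow>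
      Cmp D (fobj P (fobj S d)) (fobj P (fobj S d')) d' (\<epsilon> d') (fmap P (fobj S d) (fobj S d') (fmap S d d' g)) =
      Cmp D (fobj P (fobj S d)) d d' g (\<epsilon> d)"
  and triangle_left: "c \<in> Ob C \<Longrightarrow> Cmp D (fobj P c) (fobj P (fobj S (fobj P c))) (fobj P c) (\<epsilon> (fobj P c))
      (fmap P c (fobj S (fobj P c)) (\<eta> c)) = Idt D (fobj P c)"
  and triangle_right: "d \<in> Ob D \<Longrightarrow> Cmp C (fobj S d) (fobj S (fobj P (fobj S d))) (fobj S d) (fmap S (fobj P (fobj S d)) d (\<epsilon> d))
      (\<eta> (fobj S d)) = Idt C (fobj S d)"
  using adj by (simp_all add: index_adjunction_def)

text \<open>A transformation out of \<open>N \<circ>\<^sub>F S\<close> is restricted along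
  \<open>P\<close> and precomposed with the action of the unit on \<open>N\<close>; in the other
  direction the action of the counit on \<open>X\<close> is applied. The triangle identities make
  the two passages inverse to each other.\<close>

lemma res_functor_adjoint:
  "adjoint (ModCat C) (ModCat D)
    (res_functor D S :: (('o, 'm, 'v) cmod, _, ('p, 'n, 'v) cmod, _) cfunctor) (res_functor C P)"
proof -
  note P = index_adjunction_left and S = index_adjunction_right
  note [simp] = additive_functor_Ob[OF P] additive_functor_Ob[OF S] unit_arr counit_arr
    additive_functor_arr[OF P] additive_functor_arr[OF S]
  define \<phi> where "\<phi> = (\<lambda>(N :: ('o, 'm, 'v) cmod) (X :: ('p, 'n, 'v) cmod) \<theta>. \<lambda>c\<in>Ob C. \<lambda>y\<in>carrier (fobj N c).
    (\<theta> (fobj P c) (fmap N c (fobj S (fobj P c)) (\<eta> c) y)) :: 'v)"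
  define \<psi> where "\<psi> = (\<lambda>(N :: ('o, 'm, 'v) cmod) (X :: ('p, 'n, 'v) cmod) \<zeta>. \<lambda>d\<in>Ob D. \<lambda>y\<in>carrier (fobj N (fobj S d)).
    fmap X (fobj P (fobj S d)) d (\<epsilon> d) (\<zeta> (fobj S d) y))"
  have phi: "\<phi> N X \<theta> \<in> ntr C N (X \<circ>\<^sub>F P)"
    if N: "additive_functor C Ab N" and X: "additive_functor D Ab X" and t: "\<theta> \<in> ntr D (N \<circ>\<^sub>F S) X" for N X \<theta>
  proof (rule ntrI)
    have t': "\<theta> d y \<in> carrier (fobj X d)" if "d \<in> Ob D" "y \<in> carrier (fobj N (fobj S d))" for d y
      using ntr_closed[OF t that(1)] that(2) by simp
    show "\<phi> N X \<theta> a x \<in> carrier (fobj (X \<circ>\<^sub>F P) a)" if "a \<in> Ob C" "x \<in> carrier (fobj N a)" for a x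
      using that by (simp add: \<phi>_def t' module_closed[OF N])
    show "\<phi> N X \<theta> a (x \<otimes>\<^bsub>fobj N a\<^esub> y) = \<phi> N X \<theta> a x \<otimes>\<^bsub>fobj (X \<circ>\<^sub>F P) a\<^esub> \<phi> N X \<theta> a y"
      if "a \<in> Ob C" "x \<in> carrier (fobj N a)" "y \<in> carrier (fobj N a)" for a x y
      using that ntr_mult[OF t, of "fobj P a"]
      by (simp add: \<phi>_def module_m_closed[OF N] module_mult[OF N] module_closed[OF N])
    show "\<phi> N X \<theta> b (fmap N a b f x) = fmap (X \<circ>\<^sub>F P) a b f (\<phi> N X \<theta> a x)"
      if ab: "a \<in> Ob C" "b \<in> Ob C" and f: "f \<in> arr C a b" and x: "x \<in> carrier (fobj N a)" for a b f x
    proof -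
      have "fmap N b (fobj S (fobj P b)) (\<eta> b) (fmap N a b f x)
          = fmap N (fobj S (fobj P a)) (fobj S (fobj P b)) (fmap S (fobj P a) (fobj P b) (fmap P a b f))
              (fmap N a (fobj S (fobj P a)) (\<eta> a) x)"
        using ab f x by (simp add: module_Cmp[OF N, symmetric] unit_natural)
      then show ?thesis
        using ab f x ntr_natural[OF t, of "fobj P a" "fobj P b" "fmap P a b f"]
        by (simp add: \<phi>_def module_closed[OF N])
    qed
  qed (simp_all add: \<phi>_def)
  have psi: "\<psi> N X \<zeta> \<in> ntr D (N \<circ>\<^sub>F S) X"
    if N: "additive_functor C Ab N" and X: "additive_functor D Ab X" and z: "\<zeta> \<in> ntr C N (X \<circ>\<^sub>F P)" for N X \<zeta>
  proof (rule ntrI)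
    have z': "\<zeta> c y \<in> carrier (fobj X (fobj P c))" if "c \<in> Ob C" "y \<in> carrier (fobj N c)" for c y
      using ntr_closed[OF z that(1)] that(2) by simp
    show "\<psi> N X \<zeta> a x \<in> carrier (fobj X a)" if "a \<in> Ob D" "x \<in> carrier (fobj (N \<circ>\<^sub>F S) a)" for a x
      using that by (simp add: \<psi>_def z' module_closed[OF X])
    show "\<psi> N X \<zeta> a (x \<otimes>\<^bsub>fobj (N \<circ>\<^sub>F S) a\<^esub> y) = \<psi> N X \<zeta> a x \<otimes>\<^bsub>fobj X a\<^esub> \<psi> N X \<zeta> a y"
      if "a \<in> Ob D" "x \<in> carrier (fobj (N \<circ>\<^sub>F S) a)" "y \<in> carrier (fobj (N \<circ>\<^sub>F S) a)" for a x y
      using that ntr_mult[OF z, of "fobj S a"]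
      by (simp add: \<psi>_def module_m_closed[OF N] module_mult[OF X] z')
    show "\<psi> N X \<zeta> b (fmap (N \<circ>\<^sub>F S) a b f x) = fmap X a b f (\<psi> N X \<zeta> a x)"
      if ab: "a \<in> Ob D" "b \<in> Ob D" and f: "f \<in> arr D a b" and x: "x \<in> carrier (fobj (N \<circ>\<^sub>F S) a)" for a b f x
      using ab f x ntr_natural[OF z, of "fobj S a" "fobj S b" "fmap S a b f"]
      by (simp add: \<psi>_def module_closed[OF N] module_Cmp[OF X, symmetric] counit_natural z')
  qed (simp_all add: \<psi>_def)
  have pp: "\<psi> N X (\<phi> N X \<theta>) = \<theta>"
    if N: "additive_functor C Ab N" and X: "additive_functor D Ab X" and t: "\<theta> \<in> ntr D (N \<circ>\<^sub>F S) X" for N X \<theta>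
  proof (rule ntr_eqI[OF psi[OF N X phi[OF N X t]] t])
    fix d y assume d: "d \<in> Ob D" and y': "y \<in> carrier (fobj (N \<circ>\<^sub>F S) d)"
    then have y: "y \<in> carrier (fobj N (fobj S d))" by simp
    let ?y = "fmap N (fobj S d) (fobj S (fobj P (fobj S d))) (\<eta> (fobj S d)) y"
    have yc: "?y \<in> carrier (fobj N (fobj S (fobj P (fobj S d))))" using d y by (simp add: module_closed[OF N])
    \<comment> \<open>Naturality of \<open>\<theta>\<close> along the counit moves its action from
      \<open>X\<close> to \<open>N\<close>, where the triangle identity applies.\<close>
    have "\<psi> N X (\<phi> N X \<theta>) d y = \<theta> d (fmap N (fobj S (fobj P (fobj S d))) (fobj S d) (fmap S (fobj P (fobj S d)) d (\<epsilon> d)) ?y)"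
      using d y yc ntr_natural[OF t _ d counit_arr[OF d], of ?y] by (simp add: \<psi>_def \<phi>_def)
    also have "\<dots> = \<theta> d y"
      using d y by (simp add: module_Cmp[OF N, symmetric] triangle_right module_Idt[OF N])
    finally show "\<psi> N X (\<phi> N X \<theta>) d y = \<theta> d y" .
  qed
  have pp': "\<phi> N X (\<psi> N X \<zeta>) = \<zeta>"
    if N: "additive_functor C Ab N" and X: "additive_functor D Ab X" and z: "\<zeta> \<in> ntr C N (X \<circ>\<^sub>F P)" for N X \<zeta>
  proof (rule ntr_eqI[OF phi[OF N X psi[OF N X z]] z])
    fix c y assume c: "c \<in> Ob C" and y: "y \<in> carrier (fobj N c)"
    have zc: "\<zeta> c y \<in> carrier (fobj X (fobj P c))" using ntr_closed[OF z c y] by simp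
    show "\<phi> N X (\<psi> N X \<zeta>) c y = \<zeta> c y"
      using c y zc ntr_natural[OF z c _ unit_arr[OF c] y]
      by (simp add: \<psi>_def \<phi>_def module_closed[OF N] module_Cmp[OF X, symmetric] triangle_left module_Idt[OF X])
  qed
  show ?thesis
    unfolding adjoint_def ModCat_simps res_functor_simps mem_Collect_eq
  proof (intro exI[of _ \<phi>] conjI ballI; unfold mem_Collect_eq)
    fix N :: "('o, 'm, 'v) cmod" and X :: "('p, 'n, 'v) cmod"
    assume N: "additive_functor C Ab N" and X: "additive_functor D Ab X"
    show "bij_betw (\<phi> N X) (ntr D (N \<circ>\<^sub>F S) X) (ntr C N (X \<circ>\<^sub>F P))"
      by (rule bij_betw_byWitness[where f' = "\<psi> N X"]) (use N X pp pp' phi psi in auto)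
  next
    fix N N' :: "('o, 'm, 'v) cmod" and X X' :: "('p, 'n, 'v) cmod" and f g h
    assume N: "additive_functor C Ab N" and N': "additive_functor C Ab N'"
      and X: "additive_functor D Ab X" and X': "additive_functor D Ab X'"
      and f: "f \<in> ntr C N' N" and g: "g \<in> ntr D (N \<circ>\<^sub>F S) X" and h: "h \<in> ntr D X X'"
    have NS: "additive_functor D Ab (N' \<circ>\<^sub>F S)" by (rule additive_functor_fcomp[OF S N'])
    have fS: "(\<lambda>a\<in>Ob D. f (fobj S a)) \<in> ntr D (N' \<circ>\<^sub>F S) (N \<circ>\<^sub>F S)" by (rule res_ntr[OF S f])
    have hP: "(\<lambda>a\<in>Ob C. h (fobj P a)) \<in> ntr C (X \<circ>\<^sub>F P) (X' \<circ>\<^sub>F P)" by (rule res_ntr[OF P h])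
    have l: "ncmp D (N' \<circ>\<^sub>F S) h (ncmp D (N' \<circ>\<^sub>F S) g (\<lambda>a\<in>Ob D. f (fobj S a))) \<in> ntr D (N' \<circ>\<^sub>F S) X'"
      by (rule ncmp_ntr[OF NS ncmp_ntr[OF NS fS g] h])
    have r: "ncmp C N' (\<lambda>a\<in>Ob C. h (fobj P a)) (ncmp C N' (\<phi> N X g) f) \<in> ntr C N' (X' \<circ>\<^sub>F P)"
      by (rule ncmp_ntr[OF N' ncmp_ntr[OF N' f phi[OF N X g]] hP])
    show "\<phi> N' X' (ncmp D (N' \<circ>\<^sub>F S) h (ncmp D (N' \<circ>\<^sub>F S) g (\<lambda>a\<in>Ob D. f (fobj S a)))) =
        ncmp C N' (\<lambda>a\<in>Ob C. h (fobj P a)) (ncmp C N' (\<phi> N X g) f)"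
    proof (rule ntr_eqI[OF phi[OF N' X' l] r])
      fix c y assume c: "c \<in> Ob C" and y: "y \<in> carrier (fobj N' c)"
      then show "\<phi> N' X' (ncmp D (N' \<circ>\<^sub>F S) h (ncmp D (N' \<circ>\<^sub>F S) g (\<lambda>a\<in>Ob D. f (fobj S a)))) c y =
        ncmp C N' (\<lambda>a\<in>Ob C. h (fobj P a)) (ncmp C N' (\<phi> N X g) f) c y"
        by (simp add: \<phi>_def module_closed[OF N'] ntr_closed[OF f] ntr_natural[OF f])
    qed
  qed
qed

end

text \<open>A transformation over \<open>C\<close> is carried to \<open>D\<close> by choosing a
  preimage \<open>s d\<close> of each object. Fullness of \<open>P\<close> makes the result natural
  and independent of the chosen preimages.\<close>

lemma res_functor_fully_faithful:
  assumes C: "preadditive_category C" and D: "preadditive_category D" and P: "additive_functor C D P"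
    and full: "\<And>a b g. a \<in> Ob C \<Longrightarrow> b \<in> Ob C \<Longrightarrow> g \<in> arr D (fobj P a) (fobj P b) \<Longrightarrow> \<exists>f\<in>arr C a b. fmap P a b f = g"
    and surj: "\<And>d. d \<in> Ob D \<Longrightarrow> \<exists>c\<in>Ob C. fobj P c = d"
  shows "fully_faithful (ModCat D) (ModCat C) (res_functor C P :: (('p, 'n, 'v) cmod, _, _, _) cfunctor)"
  unfolding fully_faithful_def ModCat_simps res_functor_simps
proof (intro ballI; unfold mem_Collect_eq)
  fix L L' :: "('p, 'n, 'v) cmod"
  assume L: "additive_functor D Ab L" and L': "additive_functor D Ab L'"
  interpret D: preadditive_category D by (rule D)
  note PO = additive_functor_Ob[OF P]
  have "\<forall>d\<in>Ob D. \<exists>c. c \<in> Ob C \<and> fobj P c = d" using surj by blast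
  from bchoice[OF this] obtain s where s: "\<And>d. d \<in> Ob D \<Longrightarrow> s d \<in> Ob C" "\<And>d. d \<in> Ob D \<Longrightarrow> fobj P (s d) = d" by blast
  define ext where "ext = (\<lambda>\<zeta>. \<lambda>d\<in>Ob D. (\<zeta> (s d) :: 'v \<Rightarrow> 'v))"
  have ext: "ext \<zeta> \<in> ntr D L L'" if z: "\<zeta> \<in> ntr C (L \<circ>\<^sub>F P) (L' \<circ>\<^sub>F P)" for \<zeta>
  proof (rule ntrI)
    show "ext \<zeta> b (fmap L a b g x) = fmap L' a b g (ext \<zeta> a x)"
      if ab: "a \<in> Ob D" "b \<in> Ob D" and g: "g \<in> arr D a b" and x: "x \<in> carrier (fobj L a)" for a b g x
    proof -
      obtain f where f: "f \<in> arr C (s a) (s b)" "fmap P (s a) (s b) f = g"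
        using full[of "s a" "s b" g] s ab g by auto
      show ?thesis using ntr_natural[OF z s(1)[OF ab(1)] s(1)[OF ab(2)] f(1)] x f(2) ab s(2) by (simp add: ext_def)
    qed
  qed (use ntr_closed[OF z s(1)] ntr_mult[OF z s(1)] ntr_comp_ext[OF z s(1)] s in \<open>simp_all add: ext_def\<close>)
  show "bij_betw (\<lambda>\<eta>. \<lambda>a\<in>Ob C. \<eta> (fobj P a)) (ntr D L L') (ntr C (L \<circ>\<^sub>F P) (L' \<circ>\<^sub>F P))"
  proof (rule bij_betw_byWitness[where f' = ext])
    show "\<forall>\<eta>\<in>ntr D L L'. ext (\<lambda>a\<in>Ob C. \<eta> (fobj P a)) = \<eta>"
    proof
      fix \<eta> assume e: "\<eta> \<in> ntr D L L'"
      show "ext (\<lambda>a\<in>Ob C. \<eta> (fobj P a)) = \<eta>"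
        by (rule ntr_eqI[OF ext[OF res_ntr[OF P e]] e]) (simp add: ext_def s)
    qed
    show "\<forall>\<zeta>\<in>ntr C (L \<circ>\<^sub>F P) (L' \<circ>\<^sub>F P). (\<lambda>a\<in>Ob C. ext \<zeta> (fobj P a)) = \<zeta>"
    proof
      fix \<zeta> assume z: "\<zeta> \<in> ntr C (L \<circ>\<^sub>F P) (L' \<circ>\<^sub>F P)"
      show "(\<lambda>a\<in>Ob C. ext \<zeta> (fobj P a)) = \<zeta>"
      proof (rule ntr_eqI[OF res_ntr[OF P ext[OF z]] z])
        fix c x assume c: "c \<in> Ob C" and x: "x \<in> carrier (fobj (L \<circ>\<^sub>F P) c)"
        let ?c = "s (fobj P c)"
        have sc: "?c \<in> Ob C" "fobj P ?c = fobj P c" using s PO[OF c] by auto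
        \<comment> \<open>A lift of the identity of \<open>fobj P c\<close> to an arrow from the
          chosen preimage to \<open>c\<close>; naturality along it identifies the two
          components.\<close>
        obtain f where f: "f \<in> arr C ?c c" "fmap P ?c c f = Idt D (fobj P c)"
          using full[OF sc(1) c, of "Idt D (fobj P c)"] sc(2) D.Idt_arr[OF PO[OF c]] by auto
        have x': "x \<in> carrier (fobj L (fobj P c))" "x \<in> carrier (fobj (L \<circ>\<^sub>F P) ?c)" using x sc(2) by auto
        have zx: "\<zeta> ?c x \<in> carrier (fobj L' (fobj P c))" using ntr_closed[OF z sc(1) x'(2)] sc(2) by simp
        have "\<zeta> c x = \<zeta> ?c x"
          using ntr_natural[OF z sc(1) c f(1) x'(2)] f(2) sc(2) module_Idt[OF L PO[OF c] x'(1)]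
            module_Idt[OF L' PO[OF c] zx] by simp
        then show "(\<lambda>a\<in>Ob C. ext \<zeta> (fobj P a)) c x = \<zeta> c x" using c PO by (simp add: ext_def)
      qed
    qed
  qed (use ext res_ntr[OF P] in auto)
qed

section \<open>Induction along a left adjoint\<close>

lemma opp_simps [simp]:
  "Ob (opp C) = Ob C" "Hom (opp C) a b = Hom C b a" "Idt (opp C) = Idt C"
  "Cmp (opp C) a b c g f = Cmp C c b a f g"
  by (simp_all add: opp_def)

lemma rep_right_simps [simp]:
  "fobj (rep_right C D P d) a = Hom D (fobj P a) d"
  "fmap (rep_right C D P d) b a f = (\<lambda>x\<in>arr D (fobj P b) d. Cmp D (fobj P a) (fobj P b) d x (fmap P a b f))"
  by (simp_all add: rep_right_def)

lemma rep_right_module: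
  assumes C: "preadditive_category C" and D: "preadditive_category D" and P: "additive_functor C D P" and d: "d \<in> Ob D"
  shows "additive_functor (opp C) Ab (rep_right C D P d)"
proof -
  interpret C: preadditive_category C by (rule C)
  interpret D: preadditive_category D by (rule D)
  note [simp] = additive_functor_Ob[OF P] additive_functor_arr[OF P]
  show ?thesis
    by (rule moduleI)
      (simp_all add: d D.Hom_comm_group D.Cmp_arr D.Cmp_add_left D.add_arr_closed C.add_arr_closed C.Idt_arr C.Cmp_arr
        additive_functor_add[OF P] D.Cmp_add_right additive_functor_Idt[OF P] D.Cmp_Idt_right
        additive_functor_Cmp[OF P] D.Cmp_assoc)
qed

section \<open>Symbols of the tensor product and maps between tensor products\<close>

abbreviation tens :: "('o, 'm, 'z) pcat_scheme \<Rightarrow> ('o, 'm, 'w) cmod \<Rightarrow> ('o, 'm, 'v) cmod \<Rightarrow> 'o \<Rightarrow> 'w \<Rightarrow> 'v \<Rightarrow> ('o \<times> 'w \<times> 'v \<Rightarrow>\<^sub>0 int) set"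
  where "tens A F N a x y \<equiv> tensor_class A F N (frag_of (a, x, y))"

lemma carrier_tensor: "carrier (tensor A F N) = tensor_class A F N ` carrier (free_Abelian_group (tensor_gen A F N))"
  by (auto simp: tensor_def tensor_class_def FactGroup_def RCOSETS_def)

lemma tensor_class_group_hom:
  assumes F: "additive_functor (opp A) Ab F" and N: "additive_functor A Ab N"
  shows "group_hom (free_Abelian_group (tensor_gen A F N)) (tensor A F N) (tensor_class A F N)"
proof (rule group_hom_comm_groups[OF abelian_free_Abelian_group comm_group_tensor[OF F N]])
  show "tensor_class A F N \<in> hom (free_Abelian_group (tensor_gen A F N)) (tensor A F N)"
    unfolding tensor_def tensor_class_def
    using normal.r_coset_hom_Mod[OF tensor_rel_normal[OF F N]] by (simp add: eta_contract_eq)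
qed

lemma tensor_class_diff:
  assumes F: "additive_functor (opp A) Ab F" and N: "additive_functor A Ab N"
    and s: "Poly_Mapping.keys s \<subseteq> tensor_gen A F N" and t: "Poly_Mapping.keys t \<subseteq> tensor_gen A F N"
  shows "tensor_class A F N (s - t) = tensor_class A F N s \<otimes>\<^bsub>tensor A F N\<^esub> inv\<^bsub>tensor A F N\<^esub> tensor_class A F N t"
proof -
  let ?Z = "free_Abelian_group (tensor_gen A F N)"
  interpret group_hom ?Z "tensor A F N" "tensor_class A F N" by (rule tensor_class_group_hom[OF F N])
  have c: "s \<in> carrier ?Z" "t \<in> carrier ?Z" using s t by auto
  show ?thesis using hom_mult[OF c(1) G.inv_closed[OF c(2)]] hom_inv[OF c(2)] t by simp
qed

lemma tens_closed: "(a, x, y) \<in> tensor_gen A F N \<Longrightarrow> tens A F N a x y \<in> carrier (tensor A F N)"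
  unfolding carrier_tensor by auto

text \<open>The symbols generate the tensor product, so it is enough to compare the two
  homomorphisms on them.\<close>

lemma tensor_hom_eqI:
  assumes F: "additive_functor (opp A) Ab F" and N: "additive_functor A Ab N" and G: "comm_group G"
    and h: "h \<in> hom (tensor A F N) G" and k: "k \<in> hom (tensor A F N) G"
    and eq: "\<And>a x y. (a, x, y) \<in> tensor_gen A F N \<Longrightarrow> h (tens A F N a x y) = k (tens A F N a x y)"
    and X: "X \<in> carrier (tensor A F N)"
  shows "h X = k X"
proof -
  interpret h: group_hom "tensor A F N" G h by (rule group_hom_comm_groups[OF comm_group_tensor[OF F N] G h])
  interpret k: group_hom "tensor A F N" G k by (rule group_hom_comm_groups[OF comm_group_tensor[OF F N] G k])
  interpret c: group_hom "free_Abelian_group (tensor_gen A F N)" "tensor A F N" "tensor_class A F N"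
    by (rule tensor_class_group_hom[OF F N])
  obtain s where s: "Poly_Mapping.keys s \<subseteq> tensor_gen A F N" "X = tensor_class A F N s"
    using X unfolding carrier_tensor by auto
  have "h (tensor_class A F N s) = k (tensor_class A F N s)"
  proof (rule free_Abelian_group_induct[OF s(1)])
    show "h (tensor_class A F N 0) = k (tensor_class A F N 0)"
      using c.hom_one h.hom_one k.hom_one by simp
  next
    fix s t assume st: "Poly_Mapping.keys s \<subseteq> tensor_gen A F N" "Poly_Mapping.keys t \<subseteq> tensor_gen A F N"
      and i: "h (tensor_class A F N s) = k (tensor_class A F N s)" "h (tensor_class A F N t) = k (tensor_class A F N t)"
    have m: "tensor_class A F N s \<in> carrier (tensor A F N)" "tensor_class A F N t \<in> carrier (tensor A F N)"
      using st unfolding carrier_tensor by auto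
    show "h (tensor_class A F N (s - t)) = k (tensor_class A F N (s - t))"
      unfolding tensor_class_diff[OF F N st]
      by (simp only: h.hom_mult[OF m(1) h.G.inv_closed[OF m(2)]] k.hom_mult[OF m(1) h.G.inv_closed[OF m(2)]]
        h.hom_inv[OF m(2)] k.hom_inv[OF m(2)] i)
  next
    show "h (tensor_class A F N (frag_of p)) = k (tensor_class A F N (frag_of p))" if "p \<in> tensor_gen A F N" for p
      using eq that by (cases p) auto
  qed
  then show ?thesis using s by simp
qed

context
  fixes A :: "('o, 'm, 'z) pcat_scheme" and F :: "('o, 'm, 'w) cmod" and N :: "('o, 'm, 'v) cmod"
  assumes F: "additive_functor (opp A) Ab F" and N: "additive_functor A Ab N"
begin

lemma tens_add_right:
  assumes a: "a \<in> Ob A" and x: "x \<in> carrier (fobj F a)" and y: "y \<in> carrier (fobj N a)" "y' \<in> carrier (fobj N a)"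
  shows "tens A F N a x (y \<otimes>\<^bsub>fobj N a\<^esub> y') = tens A F N a x y \<otimes>\<^bsub>tensor A F N\<^esub> tens A F N a x y'"
proof -
  let ?Z = "free_Abelian_group (tensor_gen A F N)"
  interpret c: group_hom ?Z "tensor A F N" "tensor_class A F N" by (rule tensor_class_group_hom[OF F N])
  have c: "frag_of (a, x, y \<otimes>\<^bsub>fobj N a\<^esub> y') \<in> carrier ?Z" "frag_of (a, x, y) \<in> carrier ?Z" "frag_of (a, x, y') \<in> carrier ?Z"
    using a x y module_m_closed[OF N a y] by (simp_all add: tensor_gen_def)
  have "tens A F N a x (y \<otimes>\<^bsub>fobj N a\<^esub> y') = tensor_class A F N (frag_of (a, x, y) \<otimes>\<^bsub>?Z\<^esub> frag_of (a, x, y'))"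
  proof (rule tensor_class_eqI[OF F N c(1) c.G.m_closed[OF c(2,3)]])
    show "frag_of (a, x, y \<otimes>\<^bsub>fobj N a\<^esub> y') - (frag_of (a, x, y) \<otimes>\<^bsub>?Z\<^esub> frag_of (a, x, y')) \<in> tensor_rels A F N"
      unfolding tensor_rels_def mult_free_Abelian_group diff_diff_add[symmetric]
      using a x y by (intro UnI1[OF UnI2]) blast
  qed
  then show ?thesis using c.hom_mult[OF c(2,3)] by simp
qed

lemma tens_add_left:
  assumes a: "a \<in> Ob A" and x: "x \<in> carrier (fobj F a)" "x' \<in> carrier (fobj F a)" and y: "y \<in> carrier (fobj N a)"
  shows "tens A F N a (x \<otimes>\<^bsub>fobj F a\<^esub> x') y = tens A F N a x y \<otimes>\<^bsub>tensor A F N\<^esub> tens A F N a x' y"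
proof -
  let ?Z = "free_Abelian_group (tensor_gen A F N)"
  interpret c: group_hom ?Z "tensor A F N" "tensor_class A F N" by (rule tensor_class_group_hom[OF F N])
  have c: "frag_of (a, x \<otimes>\<^bsub>fobj F a\<^esub> x', y) \<in> carrier ?Z" "frag_of (a, x, y) \<in> carrier ?Z" "frag_of (a, x', y) \<in> carrier ?Z"
    using a x y module_m_closed[OF F _ x] by (simp_all add: tensor_gen_def)
  have "tens A F N a (x \<otimes>\<^bsub>fobj F a\<^esub> x') y = tensor_class A F N (frag_of (a, x, y) \<otimes>\<^bsub>?Z\<^esub> frag_of (a, x', y))"
  proof (rule tensor_class_eqI[OF F N c(1) c.G.m_closed[OF c(2,3)]])
    show "frag_of (a, x \<otimes>\<^bsub>fobj F a\<^esub> x', y) - (frag_of (a, x, y) \<otimes>\<^bsub>?Z\<^esub> frag_of (a, x', y)) \<in> tensor_rels A F N"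
      unfolding tensor_rels_def mult_free_Abelian_group diff_diff_add[symmetric]
      using a x y by (intro UnI1) blast
  qed
  then show ?thesis using c.hom_mult[OF c(2,3)] by simp
qed

lemma tens_balanced:
  assumes "a \<in> Ob A" "b \<in> Ob A" "f \<in> arr A a b" "x \<in> carrier (fobj F b)" "y \<in> carrier (fobj N a)"
  shows "tens A F N a (fmap F b a f x) y = tens A F N b x (fmap N a b f y)"
proof (rule tensor_class_eqI[OF F N])
  show "frag_of (a, fmap F b a f x, y) \<in> carrier (free_Abelian_group (tensor_gen A F N))"
    using assms module_closed[OF F, of b a f x] by (simp add: tensor_gen_def)
  show "frag_of (b, x, fmap N a b f y) \<in> carrier (free_Abelian_group (tensor_gen A F N))"
    using assms module_closed[OF N, of a b f y] by (simp add: tensor_gen_def)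
  show "frag_of (a, fmap F b a f x, y) - frag_of (b, x, fmap N a b f y) \<in> tensor_rels A F N"
    unfolding tensor_rels_def using assms by (intro UnI2) blast
qed

end

text \<open>The value of \<open>tensor_map\<close> is a union over all representatives of a class.
  The universal property gives a homomorphism \<open>h\<close> with the required values on symbols;
  every member of the union equals the value of \<open>h\<close>, so the union collapses. The
  families \<open>\<alpha>\<close> and \<open>\<beta>\<close> are not assumed extensional, since
  they enter \<open>ind_mod\<close> and \<open>ind_functor\<close> as plain functions.\<close>

lemma tensor_map:
  fixes F F' :: "('o, 'm, 'w) cmod" and N N' :: "('o, 'm, 'v) cmod"
  assumes F: "additive_functor (opp A) Ab F" and N: "additive_functor A Ab N"
    and F': "additive_functor (opp A) Ab F'" and N': "additive_functor A Ab N'"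
    and \<alpha>: "\<And>a. a \<in> Ob A \<Longrightarrow> \<alpha> a \<in> hom (fobj F a) (fobj F' a)"
    and \<alpha>n: "\<And>a b f x. a \<in> Ob A \<Longrightarrow> b \<in> Ob A \<Longrightarrow> f \<in> arr A a b \<Longrightarrow> x \<in> carrier (fobj F b) \<Longrightarrow>
      \<alpha> a (fmap F b a f x) = fmap F' b a f (\<alpha> b x)"
    and \<beta>: "\<And>a. a \<in> Ob A \<Longrightarrow> \<beta> a \<in> hom (fobj N a) (fobj N' a)"
    and \<beta>n: "\<And>a b f y. a \<in> Ob A \<Longrightarrow> b \<in> Ob A \<Longrightarrow> f \<in> arr A a b \<Longrightarrow> y \<in> carrier (fobj N a) \<Longrightarrow>
      \<beta> b (fmap N a b f y) = fmap N' a b f (\<beta> a y)"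
    and axy: "a \<in> Ob A" "x \<in> carrier (fobj F a)" "y \<in> carrier (fobj N a)"
  shows "tensor_map A F N F' N' \<alpha> \<beta> (tens A F N a x y) = tens A F' N' a (\<alpha> a x) (\<beta> a y)"
proof -
  let ?Z = "free_Abelian_group (tensor_gen A F N)"
  let ?e = "frag_extend (\<lambda>(a, x, y). frag_of (a, \<alpha> a x, \<beta> a y))"
  have gen: "(a, \<alpha> a x, \<beta> a y) \<in> tensor_gen A F' N'" if "(a, x, y) \<in> tensor_gen A F N" for a x y
    using that \<alpha>[of a] \<beta>[of a] by (auto simp: tensor_gen_def hom_def)
  have "\<exists>!h. h \<in> carrier (Ab_hom (tensor A F N) (tensor A F' N')) \<and>
    (\<forall>(a, x, y) \<in> tensor_gen A F N. h (tens A F N a x y) = tens A F' N' a (\<alpha> a x) (\<beta> a y))"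
  proof (rule tensor_universal[OF F N comm_group_tensor[OF F' N']])
    show "tens A F' N' a (\<alpha> a x) (\<beta> a y) \<in> carrier (tensor A F' N')" if "(a, x, y) \<in> tensor_gen A F N" for a x y
      by (rule tens_closed[OF gen[OF that]])
  next
    fix a x x' y assume g: "(a, x, y) \<in> tensor_gen A F N" "(a, x', y) \<in> tensor_gen A F N"
    then show "tens A F' N' a (\<alpha> a (x \<otimes>\<^bsub>fobj F a\<^esub> x')) (\<beta> a y)
        = tens A F' N' a (\<alpha> a x) (\<beta> a y) \<otimes>\<^bsub>tensor A F' N'\<^esub> tens A F' N' a (\<alpha> a x') (\<beta> a y)"
      using \<alpha>[of a] gen[OF g(1)] gen[OF g(2)] tens_add_left[OF F' N', of a "\<alpha> a x" "\<alpha> a x'" "\<beta> a y"]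
      by (simp add: hom_def tensor_gen_def)
  next
    fix a x y y' assume g: "(a, x, y) \<in> tensor_gen A F N" "(a, x, y') \<in> tensor_gen A F N"
    then show "tens A F' N' a (\<alpha> a x) (\<beta> a (y \<otimes>\<^bsub>fobj N a\<^esub> y'))
        = tens A F' N' a (\<alpha> a x) (\<beta> a y) \<otimes>\<^bsub>tensor A F' N'\<^esub> tens A F' N' a (\<alpha> a x) (\<beta> a y')"
      using \<beta>[of a] gen[OF g(1)] gen[OF g(2)] tens_add_right[OF F' N', of a "\<alpha> a x" "\<beta> a y" "\<beta> a y'"]
      by (simp add: hom_def tensor_gen_def)
  next
    fix a b f x y assume g: "a \<in> Ob A" "b \<in> Ob A" "f \<in> arr A a b" "x \<in> carrier (fobj F b)" "y \<in> carrier (fobj N a)"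
    then show "tens A F' N' a (\<alpha> a (fmap F b a f x)) (\<beta> a y) = tens A F' N' b (\<alpha> b x) (\<beta> b (fmap N a b f y))"
      using \<alpha>[of b] \<beta>[of a] tens_balanced[OF F' N', of a b f "\<alpha> b x" "\<beta> a y"]
      by (auto simp: \<alpha>n \<beta>n hom_def)
  qed
  from ex1_implies_ex[OF this] obtain h where h': "h \<in> carrier (Ab_hom (tensor A F N) (tensor A F' N')) \<and>
    (\<forall>(a, x, y) \<in> tensor_gen A F N. h (tens A F N a x y) = tens A F' N' a (\<alpha> a x) (\<beta> a y))" by (elim exE)
  have h: "h \<in> hom (tensor A F N) (tensor A F' N')" using h' by (simp add: Ab_hom_def)
  have h_of: "h (tens A F N a x y) = tens A F' N' a (\<alpha> a x) (\<beta> a y)" if "(a, x, y) \<in> tensor_gen A F N" for a x y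
    using h' that by blast
  interpret h: group_hom "tensor A F N" "tensor A F' N'" h
    by (rule group_hom_comm_groups[OF comm_group_tensor[OF F N] comm_group_tensor[OF F' N'] h])
  interpret c: group_hom ?Z "tensor A F N" "tensor_class A F N" by (rule tensor_class_group_hom[OF F N])
  interpret c': group_hom "free_Abelian_group (tensor_gen A F' N')" "tensor A F' N'" "tensor_class A F' N'"
    by (rule tensor_class_group_hom[OF F' N'])
  have keys: "Poly_Mapping.keys (?e s) \<subseteq> tensor_gen A F' N'" if "Poly_Mapping.keys s \<subseteq> tensor_gen A F N" for s
    using keys_frag_extend[of "\<lambda>(a, x, y). frag_of (a, \<alpha> a x, \<beta> a y)" s] that gen by fastforce
  have e: "tensor_class A F' N' (?e s) = h (tensor_class A F N s)" if "Poly_Mapping.keys s \<subseteq> tensor_gen A F N" for s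
  proof (rule free_Abelian_group_induct[OF that])
    show "tensor_class A F' N' (?e 0) = h (tensor_class A F N 0)"
      using c.hom_one c'.hom_one h.hom_one by simp
  next
    fix s t assume st: "Poly_Mapping.keys s \<subseteq> tensor_gen A F N" "Poly_Mapping.keys t \<subseteq> tensor_gen A F N"
      and i: "tensor_class A F' N' (?e s) = h (tensor_class A F N s)" "tensor_class A F' N' (?e t) = h (tensor_class A F N t)"
    have m: "tensor_class A F N s \<in> carrier (tensor A F N)" "tensor_class A F N t \<in> carrier (tensor A F N)"
      using st unfolding carrier_tensor by auto
    show "tensor_class A F' N' (?e (s - t)) = h (tensor_class A F N (s - t))"
      unfolding frag_extend_diff tensor_class_diff[OF F N st] tensor_class_diff[OF F' N' keys[OF st(1)] keys[OF st(2)]] i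
      by (simp only: h.hom_mult[OF m(1) h.G.inv_closed[OF m(2)]] h.hom_inv[OF m(2)])
  next
    show "tensor_class A F' N' (?e (frag_of p)) = h (tensor_class A F N (frag_of p))" if "p \<in> tensor_gen A F N" for p
      using h_of that by (cases p) auto
  qed
  let ?X = "tens A F N a x y"
  have g: "(a, x, y) \<in> tensor_gen A F N" using axy by (simp add: tensor_gen_def)
  have sub: "subgroup (tensor_rel A F N) ?Z" using tensor_rel_normal[OF F N] by (rule normal_imp_subgroup)
  have fc: "frag_of (a, x, y) \<in> carrier ?Z" using g by simp
  \<comment> \<open>A representative of the class of a symbol has the same class as the symbol, so
    \<open>e\<close> gives the same set for all of them.\<close>
  have const: "tensor_class A F' N' (?e s) = h ?X" if s: "s \<in> ?X" for s
  proof -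
    have sZ: "s \<in> carrier ?Z"
      using s c.G.r_coset_subset_G[OF subgroup.subset[OF sub] fc] unfolding tensor_class_def by blast
    have "tensor_class A F N s = ?X"
      using c.G.repr_independence[OF _ fc sub] s unfolding tensor_class_def by blast
    then show ?thesis using e[of s] sZ by simp
  qed
  have "frag_of (a, x, y) \<in> ?X" unfolding tensor_class_def by (rule c.G.rcos_self[OF fc sub])
  then have "(\<Union>s\<in>?X. tensor_class A F' N' (?e s)) = h ?X" using const by auto
  then show ?thesis using h_of[OF g] tens_closed[OF g] by (simp add: tensor_map_def)
qed

section \<open>Comparison of induction with restriction along the right adjoint\<close>

context
  fixes C :: "('o, 'm) pcat" and D :: "('p, 'n) pcat" and P S \<eta> \<epsilon>
  assumes C: "preadditive_category C" and D: "preadditive_category D"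
    and adj: "index_adjunction C D P S \<eta> \<epsilon>"
  notes P = index_adjunction_left[OF adj] and S = index_adjunction_right[OF adj]
  notes [simp] = additive_functor_Ob[OF P] additive_functor_Ob[OF S] unit_arr[OF adj] counit_arr[OF adj]
    additive_functor_arr[OF P] additive_functor_arr[OF S]
begin

interpretation C: preadditive_category C by (rule C)
interpretation D: preadditive_category D by (rule D)

definition "ind_comp N d = (\<lambda>y\<in>carrier (fobj N (fobj S d)). tens C (rep_right C D P d) N (fobj S d) (\<epsilon> d) y)"

text \<open>The adjunction identifies the right module of arrows from \<open>P\<close> to
  \<open>d\<close> with the representable module of \<open>fobj S d\<close>, and the tensor product
  with a representable module is evaluation. The inverse sends the symbol of \<open>x\<close> and
  \<open>y\<close> to the action on \<open>y\<close> of the arrow corresponding to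
  \<open>x\<close>.\<close>

lemma ind_comp_iso:
  assumes N: "additive_functor C Ab N" and d: "d \<in> Ob D"
  shows "ind_comp N d \<in> iso (fobj N (fobj S d)) (tensor C (rep_right C D P d) N)"
proof -
  let ?F = "rep_right C D P d"
  have F: "additive_functor (opp C) Ab ?F" by (rule rep_right_module[OF C D P d])
  have Sd: "fobj S d \<in> Ob C" using d by simp
  have gen: "(a, x, y) \<in> tensor_gen C ?F N \<longleftrightarrow> a \<in> Ob C \<and> x \<in> arr D (fobj P a) d \<and> y \<in> carrier (fobj N a)" for a x y
    by (simp add: tensor_gen_def)
  have kh: "ind_comp N d \<in> hom (fobj N (fobj S d)) (tensor C ?F N)"
  proof (rule homI)
    fix y assume y: "y \<in> carrier (fobj N (fobj S d))"
    show "ind_comp N d y \<in> carrier (tensor C ?F N)"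
      using tens_closed[of "fobj S d" "\<epsilon> d" y C ?F N] y d by (simp add: ind_comp_def gen)
    fix y' assume y': "y' \<in> carrier (fobj N (fobj S d))"
    show "ind_comp N d (y \<otimes>\<^bsub>fobj N (fobj S d)\<^esub> y') = ind_comp N d y \<otimes>\<^bsub>tensor C ?F N\<^esub> ind_comp N d y'"
      using tens_add_right[OF F N Sd, of "\<epsilon> d" y y'] y y' d module_m_closed[OF N Sd y y'] by (simp add: ind_comp_def)
  qed
  \<comment> \<open>The arrow from \<open>a\<close> to \<open>fobj S d\<close> that corresponds to
    \<open>x\<close> under the adjunction.\<close>
  let ?adj = "\<lambda>a x. Cmp C a (fobj S (fobj P a)) (fobj S d) (fmap S (fobj P a) d x) (\<eta> a)"
  have adj_arr: "?adj a x \<in> arr C a (fobj S d)" if "a \<in> Ob C" "x \<in> arr D (fobj P a) d" for a x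
    using that d by (simp add: C.Cmp_arr)
  have "\<exists>!h. h \<in> carrier (Ab_hom (tensor C ?F N) (fobj N (fobj S d))) \<and>
    (\<forall>(a, x, y) \<in> tensor_gen C ?F N. h (tens C ?F N a x y) = fmap N a (fobj S d) (?adj a x) y)"
  proof (rule tensor_universal[OF F N module_group[OF N Sd]]; (unfold gen)?)
    show "fmap N a (fobj S d) (?adj a x) y \<in> carrier (fobj N (fobj S d))"
      if "a \<in> Ob C \<and> x \<in> arr D (fobj P a) d \<and> y \<in> carrier (fobj N a)" for a x y
      using that by (simp add: module_closed[OF N] Sd adj_arr)
  next
    fix a x x' y assume "a \<in> Ob C \<and> x \<in> arr D (fobj P a) d \<and> y \<in> carrier (fobj N a)"
      "a \<in> Ob C \<and> x' \<in> arr D (fobj P a) d \<and> y \<in> carrier (fobj N a)"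
    then show "fmap N a (fobj S d) (?adj a (x \<otimes>\<^bsub>fobj ?F a\<^esub> x')) y
        = fmap N a (fobj S d) (?adj a x) y \<otimes>\<^bsub>fobj N (fobj S d)\<^esub> fmap N a (fobj S d) (?adj a x') y"
      using d by (simp add: additive_functor_add[OF S] C.Cmp_add_left C.Cmp_arr module_add[OF N])
  next
    fix a x y y' assume "a \<in> Ob C \<and> x \<in> arr D (fobj P a) d \<and> y \<in> carrier (fobj N a)"
      "a \<in> Ob C \<and> x \<in> arr D (fobj P a) d \<and> y' \<in> carrier (fobj N a)"
    then show "fmap N a (fobj S d) (?adj a x) (y \<otimes>\<^bsub>fobj N a\<^esub> y')
        = fmap N a (fobj S d) (?adj a x) y \<otimes>\<^bsub>fobj N (fobj S d)\<^esub> fmap N a (fobj S d) (?adj a x) y'"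
      by (simp add: module_mult[OF N] Sd adj_arr)
  next
    fix a b f x y assume ab: "a \<in> Ob C" "b \<in> Ob C" and f: "f \<in> arr C a b" and x': "x \<in> carrier (fobj ?F b)" and y: "y \<in> carrier (fobj N a)"
    from x' have x: "x \<in> arr D (fobj P b) d" by simp
    \<comment> \<open>Naturality of the unit: the adjunct of a composite with
      \<open>fmap P a b f\<close> is the adjunct of \<open>x\<close> composed with \<open>f\<close>.
      This is the balancing condition.\<close>
    have "?adj a (fmap ?F b a f x) = Cmp C a b (fobj S d) (?adj b x) f"
      using ab f x d by (simp add: additive_functor_Cmp[OF S] C.Cmp_assoc[symmetric] C.Cmp_arr unit_natural[OF adj])
    then show "fmap N a (fobj S d) (?adj a (fmap ?F b a f x)) y = fmap N b (fobj S d) (?adj b x) (fmap N a b f y)"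
      using ab f x y by (simp add: module_Cmp[OF N] Sd adj_arr)
  qed
  from ex1_implies_ex[OF this] obtain h where h': "h \<in> carrier (Ab_hom (tensor C ?F N) (fobj N (fobj S d))) \<and>
    (\<forall>(a, x, y) \<in> tensor_gen C ?F N. h (tens C ?F N a x y) = fmap N a (fobj S d) (?adj a x) y)" by (elim exE)
  have h: "h \<in> hom (tensor C ?F N) (fobj N (fobj S d))" using h' by (simp add: Ab_hom_def)
  have h_of: "h (tens C ?F N a x y) = fmap N a (fobj S d) (?adj a x) y"
    if "a \<in> Ob C" "x \<in> arr D (fobj P a) d" "y \<in> carrier (fobj N a)" for a x y
    using h' gen[of a x y] that by blast
  have hk: "h (ind_comp N d y) = y" if "y \<in> carrier (fobj N (fobj S d))" for y
    using that d by (simp add: ind_comp_def h_of triangle_right[OF adj] module_Idt[OF N])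
  have kh': "ind_comp N d (h X) = X" if X: "X \<in> carrier (tensor C ?F N)" for X
  proof -
    have "(ind_comp N d \<circ> h) X = (\<lambda>X. X) X"
    proof (rule tensor_hom_eqI[OF F N comm_group_tensor[OF F N] hom_compose[OF h kh] _ _ X])
      show "(\<lambda>X. X) \<in> hom (tensor C ?F N) (tensor C ?F N)" by (simp add: hom_def)
      fix a x y assume "(a, x, y) \<in> tensor_gen C ?F N"
      then have a: "a \<in> Ob C" and x: "x \<in> arr D (fobj P a) d" and y: "y \<in> carrier (fobj N a)" by (auto simp: gen)
      \<comment> \<open>The counit composed with the image under \<open>P\<close> of the adjunct of
        \<open>x\<close> is \<open>x\<close> again. Balancing then rewrites the symbol of
        \<open>x\<close> and \<open>y\<close> as a symbol whose left entry is the counit.\<close>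
      have "Cmp D (fobj P a) (fobj P (fobj S d)) d (\<epsilon> d) (fmap P a (fobj S d) (?adj a x))
        = Cmp D (fobj P a) (fobj P (fobj S (fobj P a))) d
            (Cmp D (fobj P (fobj S (fobj P a))) (fobj P (fobj S d)) d (\<epsilon> d) (fmap P (fobj S (fobj P a)) (fobj S d) (fmap S (fobj P a) d x)))
            (fmap P a (fobj S (fobj P a)) (\<eta> a))"
        using a x d by (simp add: additive_functor_Cmp[OF P] D.Cmp_assoc)
      also have "\<dots> = Cmp D (fobj P a) (fobj P a) d x
          (Cmp D (fobj P a) (fobj P (fobj S (fobj P a))) (fobj P a) (\<epsilon> (fobj P a)) (fmap P a (fobj S (fobj P a)) (\<eta> a)))"
        using a x d by (simp add: counit_natural[OF adj] D.Cmp_assoc)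
      also have "\<dots> = x" using a x d by (simp add: triangle_left[OF adj] D.Cmp_Idt_right)
      finally have "fmap ?F (fobj S d) a (?adj a x) (\<epsilon> d) = x" using d by simp
      then have "tens C ?F N (fobj S d) (\<epsilon> d) (fmap N a (fobj S d) (?adj a x) y) = tens C ?F N a x y"
        using tens_balanced[OF F N a Sd adj_arr[OF a x] _ y, of "\<epsilon> d"] d by simp
      then show "(ind_comp N d \<circ> h) (tens C ?F N a x y) = tens C ?F N a x y"
        using a x y d by (simp add: h_of ind_comp_def module_closed[OF N] Sd adj_arr)
    qed
    then show ?thesis by simp
  qed
  have "bij_betw (ind_comp N d) (carrier (fobj N (fobj S d))) (carrier (tensor C ?F N))"
    by (rule bij_betw_byWitness[where f' = h])
      (use hk kh' hom_in_carrier[OF kh] hom_in_carrier[OF h] in auto)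
  then show ?thesis using kh by (simp add: iso_def)
qed

lemma ind_mod_simps [simp]:
  "fobj (ind_mod C D P N) d = tensor C (rep_right C D P d) N"
  "fmap (ind_mod C D P N) d d' g = tensor_map C (rep_right C D P d) N (rep_right C D P d') N
              (\<lambda>a x. Cmp D (fobj P a) d d' g x) (\<lambda>a y. y)"
  by (simp_all add: ind_mod_def)

text \<open>The module laws are not checked on tensor products; they are carried over from
  \<open>N \<circ>\<^sub>F S\<close> along \<open>ind_comp\<close>, which only requires
  compatibility with the maps.\<close>

lemma ind_mod_module:
  assumes N: "additive_functor C Ab N"
  shows "additive_functor D Ab (ind_mod C D P N)"
    and "niso D (N \<circ>\<^sub>F S) (ind_mod C D P N) (\<lambda>d\<in>Ob D. \<lambda>y\<in>carrier (fobj (N \<circ>\<^sub>F S) d). ind_comp N d y)"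
proof -
  have NS: "additive_functor D Ab (N \<circ>\<^sub>F S)" by (rule additive_functor_fcomp[OF S N])
  have k: "ind_comp N d \<in> iso (fobj (N \<circ>\<^sub>F S) d) (fobj (ind_mod C D P N) d)" if "d \<in> Ob D" for d
    using ind_comp_iso[OF N that] by simp
  have g: "comm_group (fobj (ind_mod C D P N) d)" if "d \<in> Ob D" for d
    using comm_group_tensor[OF rep_right_module[OF C D P that] N] by simp
  have ext: "fmap (ind_mod C D P N) d d' g \<in> extensional (carrier (fobj (ind_mod C D P N) d))" for d d' g
    by (simp add: tensor_map_def)
  have nat: "fmap (ind_mod C D P N) d d' g (ind_comp N d y) = ind_comp N d' (fmap (N \<circ>\<^sub>F S) d d' g y)"
    if d: "d \<in> Ob D" "d' \<in> Ob D" and g: "g \<in> arr D d d'" and y': "y \<in> carrier (fobj (N \<circ>\<^sub>F S) d)" for d d' g y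
  proof -
    from y' have y: "y \<in> carrier (fobj N (fobj S d))" by simp
    note F = rep_right_module[OF C D P d(1)] and F' = rep_right_module[OF C D P d(2)]
    have "fmap (ind_mod C D P N) d d' g (ind_comp N d y)
        = tens C (rep_right C D P d') N (fobj S d) (Cmp D (fobj P (fobj S d)) d d' g (\<epsilon> d)) y"
      unfolding ind_comp_def using y d g
      by (simp, subst tensor_map[OF F N F' N])
        (simp_all add: hom_def D.Cmp_arr D.Cmp_add_right D.Cmp_assoc)
    \<comment> \<open>Naturality of the counit moves \<open>g\<close> to the other side of it, after
      which balancing passes \<open>fmap S d d' g\<close> to the right entry.\<close>
    also have "Cmp D (fobj P (fobj S d)) d d' g (\<epsilon> d) = fmap (rep_right C D P d') (fobj S d') (fobj S d) (fmap S d d' g) (\<epsilon> d')"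
      using d g by (simp add: counit_natural[OF adj])
    also have "tens C (rep_right C D P d') N (fobj S d) (fmap (rep_right C D P d') (fobj S d') (fobj S d) (fmap S d d' g) (\<epsilon> d')) y
        = tens C (rep_right C D P d') N (fobj S d') (\<epsilon> d') (fmap N (fobj S d) (fobj S d') (fmap S d d' g) y)"
      by (rule tens_balanced[OF F' N]) (use d g y in simp_all)
    finally show ?thesis using d g y by (simp add: ind_comp_def module_closed[OF N])
  qed
  note t = module_transport[OF D NS k g ext nat]
  show "additive_functor D Ab (ind_mod C D P N)" by (rule t(1))
  show "niso D (N \<circ>\<^sub>F S) (ind_mod C D P N) (\<lambda>d\<in>Ob D. \<lambda>y\<in>carrier (fobj (N \<circ>\<^sub>F S) d). ind_comp N d y)" by (rule t(2))
qed

definition ind_iso :: "('o, 'm, 'v) cmod \<Rightarrow> 'p \<Rightarrow> 'v \<Rightarrow> 'v"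
  where "ind_iso N = ncmp D (N \<circ>\<^sub>F S) (copy_nat D (ind_mod C D P N)) (\<lambda>d\<in>Ob D. \<lambda>y\<in>carrier (fobj (N \<circ>\<^sub>F S) d). ind_comp N d y)"

lemma ind_functor_fobj: "fobj (ind_functor C D P) N = copy_mod (ind_mod C D P N)"
  by (simp add: ind_functor_def)

text \<open>The bijection with \<open>fobj N (fobj S d)\<close>, a group on a subset of the
  universe, bounds the size of the tensor product.\<close>

lemma ind_mod_fits:
  assumes N: "additive_functor C Ab (N :: ('o, 'm, 'v) cmod)" and d: "d \<in> Ob D"
  shows "fits TYPE('v) (carrier (fobj (ind_mod C D P N) d))"
proof -
  have "bij_betw (ind_comp N d) (carrier (fobj N (fobj S d))) (carrier (tensor C (rep_right C D P d) N))"
    using ind_comp_iso[OF N d] by (simp add: iso_def)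
  from fits_bij[OF this fits_same] show ?thesis by simp
qed

lemma ind_iso:
  assumes N: "additive_functor C Ab (N :: ('o, 'm, 'v) cmod)"
  shows "additive_functor D Ab (fobj (ind_functor C D P) N)"
    and "niso D (N \<circ>\<^sub>F S) (fobj (ind_functor C D P) N) (ind_iso N)"
proof -
  have NS: "additive_functor D Ab (N \<circ>\<^sub>F S)" by (rule additive_functor_fcomp[OF S N])
  note c = copy_module[OF D ind_mod_module(1)[OF N] ind_mod_fits[OF N]]
  show "additive_functor D Ab (fobj (ind_functor C D P) N)" unfolding ind_functor_fobj by (rule c(1))
  show "niso D (N \<circ>\<^sub>F S) (fobj (ind_functor C D P) N) (ind_iso N)"
    unfolding ind_functor_fobj ind_iso_def by (rule niso_ncmp[OF NS ind_mod_module(2)[OF N] c(2)])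
qed

lemma ind_iso_apply:
  assumes N: "additive_functor C Ab (N :: ('o, 'm, 'v) cmod)" and d: "d \<in> Ob D" and y: "y \<in> carrier (fobj N (fobj S d))"
  shows "ind_iso N d y = copy_iso (fobj (ind_mod C D P N) d) (ind_comp N d y)"
  using ind_comp_iso[OF N d] y d hom_in_carrier[of "ind_comp N d" "fobj N (fobj S d)" "tensor C (rep_right C D P d) N" y]
  by (simp add: ind_iso_def copy_nat_def iso_def)

lemma ind_functor_fmap_apply:
  assumes N: "additive_functor C Ab (N :: ('o, 'm, 'v) cmod)" and N': "additive_functor C Ab (N' :: ('o, 'm, 'v) cmod)"
    and b: "\<beta> \<in> ntr C N N'" and d: "d \<in> Ob D" and y: "y \<in> carrier (fobj N (fobj S d))"
  shows "fmap (ind_functor C D P) N N' \<beta> d (ind_iso N d y) = ind_iso N' d (\<beta> (fobj S d) y)"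
proof -
  note F = rep_right_module[OF C D P d]
  have kc: "ind_comp N d y \<in> carrier (fobj (ind_mod C D P N) d)"
    using ind_comp_iso[OF N d] y by (auto simp: iso_def hom_def)
  have "fmap (ind_functor C D P) N N' \<beta> d (ind_iso N d y)
      = copy_iso (fobj (ind_mod C D P N') d) (tensor_map C (rep_right C D P d) N (rep_right C D P d) N' (\<lambda>a x. x) \<beta> (ind_comp N d y))"
    using d by (simp only: ind_functor_def ind_iso_apply[OF N d y] cfunctor.simps restrict_apply if_True
      copy_map_apply[OF module_group[OF ind_mod_module(1)[OF N] d] ind_mod_fits[OF N d] kc])
  also have "tensor_map C (rep_right C D P d) N (rep_right C D P d) N' (\<lambda>a x. x) \<beta> (ind_comp N d y)
      = tens C (rep_right C D P d) N' (fobj S d) (\<epsilon> d) (\<beta> (fobj S d) y)"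
    unfolding ind_comp_def using y d
    by (simp, subst tensor_map[OF F N F N'])
      (simp_all add: hom_def ntr_closed[OF b] ntr_mult[OF b] ntr_natural[OF b])
  also have "\<dots> = ind_comp N' d (\<beta> (fobj S d) y)"
    using y d by (simp add: ind_comp_def ntr_closed[OF b])
  finally show ?thesis using y d by (simp add: ind_iso_apply[OF N' d] ntr_closed[OF b])
qed

text \<open>The conjugate \<open>?g\<close> of the restricted transformation by
  \<open>ind_iso\<close> is natural by construction. It agrees with the map of
  \<open>ind_functor\<close> on all values of \<open>ind_iso\<close>, that is, everywhere.\<close>

lemma ind_functor_fmap:
  assumes N: "additive_functor C Ab (N :: ('o, 'm, 'v) cmod)" and N': "additive_functor C Ab (N' :: ('o, 'm, 'v) cmod)"
    and b: "\<beta> \<in> ntr C N N'"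
  shows "fmap (ind_functor C D P) N N' \<beta> \<in> ntr D (fobj (ind_functor C D P) N) (fobj (ind_functor C D P) N')"
    and "ncmp D (N \<circ>\<^sub>F S) (ind_iso N') (\<lambda>d\<in>Ob D. \<beta> (fobj S d))
       = ncmp D (N \<circ>\<^sub>F S) (fmap (ind_functor C D P) N N' \<beta>) (ind_iso N)"
proof -
  let ?I = "fobj (ind_functor C D P)" and ?f = "fmap (ind_functor C D P) N N' \<beta>"
  have NS: "additive_functor D Ab (N \<circ>\<^sub>F S)" by (rule additive_functor_fcomp[OF S N])
  have bS: "(\<lambda>d\<in>Ob D. \<beta> (fobj S d)) \<in> ntr D (N \<circ>\<^sub>F S) (N' \<circ>\<^sub>F S)" by (rule res_ntr[OF S b])
  note i = ind_iso[OF N] and i' = ind_iso[OF N']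
  have k: "ind_iso N \<in> ntr D (N \<circ>\<^sub>F S) (?I N)" "ind_iso N' \<in> ntr D (N' \<circ>\<^sub>F S) (?I N')"
    using i i' by (simp_all add: niso_def)
  let ?g = "ncmp D (?I N) (ncmp D (N \<circ>\<^sub>F S) (ind_iso N') (\<lambda>d\<in>Ob D. \<beta> (fobj S d))) (ninv D (N \<circ>\<^sub>F S) (?I N) (ind_iso N))"
  have g: "?g \<in> ntr D (?I N) (?I N')"
    by (rule ncmp_ntr[OF i(1) ninv_ntr[OF NS i] ncmp_ntr[OF NS bS k(2)]])
  have "?f = ?g"
  proof (rule extensionalityI[of _ "Ob D"])
    show "?f d = ?g d" if d: "d \<in> Ob D" for d
    proof (rule extensionalityI[of _ "carrier (fobj (?I N) d)"])
      show "?f d \<in> extensional (carrier (fobj (?I N) d))"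
        using d by (simp add: ind_functor_def copy_map_def copy_mod_def)
      show "?g d \<in> extensional (carrier (fobj (?I N) d))" by (rule ntr_comp_ext[OF g d])
      fix x assume x: "x \<in> carrier (fobj (?I N) d)"
      let ?y = "ninv D (N \<circ>\<^sub>F S) (?I N) (ind_iso N) d x"
      have y: "?y \<in> carrier (fobj N (fobj S d))" "ind_iso N d ?y = x"
        using niso_apply(3,4)[OF i(2) d x] by simp_all
      then show "?f d x = ?g d x"
        using ind_functor_fmap_apply[OF N N' b d y(1)] d x by simp
    qed
  qed (simp_all add: ind_functor_def ncmp_def)
  then show f: "?f \<in> ntr D (?I N) (?I N')" using g by simp
  show "ncmp D (N \<circ>\<^sub>F S) (ind_iso N') (\<lambda>d\<in>Ob D. \<beta> (fobj S d)) = ncmp D (N \<circ>\<^sub>F S) ?f (ind_iso N)"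
    by (rule ntr_eqI[OF ncmp_ntr[OF NS bS k(2)] ncmp_ntr[OF NS k(1) f]])
      (simp add: ind_functor_fmap_apply[OF N N' b])
qed

text \<open>Additivity, adjointness and full faithfulness of induction are inherited through this
  isomorphism, without further computation in tensor products or copies.\<close>

theorem ind_functor_nat_iso:
  "nat_iso (ModCat C) (ModCat D) (res_functor D S :: (('o, 'm, 'v) cmod, _, ('p, 'n, 'v) cmod, _) cfunctor)
    (ind_functor C D P) ind_iso"
  unfolding nat_iso_def
proof (intro conjI ballI)
  fix N assume "N \<in> Ob (ModCat C :: (('o, 'm, 'v) cmod, _) pcat)"
  then have N: "additive_functor C Ab N" by simp
  show "iso_arr (ModCat D) (fobj (res_functor D S) N) (fobj (ind_functor C D P) N) (ind_iso N)"
    using ind_iso[OF N] additive_functor_fcomp[OF S N] by (simp add: iso_arr_ModCat)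
  fix N' \<beta> assume "N' \<in> Ob (ModCat C :: (('o, 'm, 'v) cmod, _) pcat)" "\<beta> \<in> arr (ModCat C) N N'"
  then have N': "additive_functor C Ab N'" and b: "\<beta> \<in> ntr C N N'" by simp_all
  show "Cmp (ModCat D) (fobj (res_functor D S) N) (fobj (res_functor D S) N') (fobj (ind_functor C D P) N') (ind_iso N') (fmap (res_functor D S) N N' \<beta>) =
    Cmp (ModCat D) (fobj (res_functor D S) N) (fobj (ind_functor C D P) N) (fobj (ind_functor C D P) N') (fmap (ind_functor C D P) N N' \<beta>) (ind_iso N)"
    using ind_functor_fmap(2)[OF N N' b] by simp
qed

lemma ind_functor_Ob: "N \<in> Ob (ModCat C :: (('o, 'm, 'v) cmod, _) pcat) \<Longrightarrow> fobj (ind_functor C D P) N \<in> Ob (ModCat D)"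
  using ind_iso(1) by simp

lemma ind_functor_arr:
  "N \<in> Ob (ModCat C :: (('o, 'm, 'v) cmod, _) pcat) \<Longrightarrow> N' \<in> Ob (ModCat C :: (('o, 'm, 'v) cmod, _) pcat) \<Longrightarrow>
    \<beta> \<in> arr (ModCat C) N N' \<Longrightarrow>
    fmap (ind_functor C D P) N N' \<beta> \<in> arr (ModCat D) (fobj (ind_functor C D P) N) (fobj (ind_functor C D P) N')"
  using ind_functor_fmap(1) by simp

lemma ind_functor_additive:
  "additive_functor (ModCat C :: (('o, 'm, 'v) cmod, _) pcat) (ModCat D) (ind_functor C D P)"
  by (rule additive_functor_nat_iso[OF preadditive_ModCat preadditive_ModCat res_functor_additive[OF S]
        ind_functor_nat_iso ind_functor_Ob ind_functor_arr])

lemma ind_functor_adjoint: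
  "adjoint (ModCat C :: (('o, 'm, 'v) cmod, _) pcat) (ModCat D) (ind_functor C D P) (res_functor C P)"
  by (rule adjoint_nat_iso[OF preadditive_ModCat preadditive_ModCat res_functor_additive[OF S]
        ind_functor_nat_iso ind_functor_Ob ind_functor_arr res_functor_adjoint[OF adj]])

lemma ind_functor_fully_faithful:
  assumes "fully_faithful (ModCat C :: (('o, 'm, 'v) cmod, _) pcat) (ModCat D) (res_functor D S)"
  shows "fully_faithful (ModCat C :: (('o, 'm, 'v) cmod, _) pcat) (ModCat D) (ind_functor C D P)"
  by (rule fully_faithful_nat_iso[OF preadditive_ModCat preadditive_ModCat res_functor_additive[OF S]
        ind_functor_nat_iso ind_functor_Ob ind_functor_arr assms])

text \<open>A tensor product is in general only right exact. Here the sequence at \<open>d\<close>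
  is, up to \<open>ind_iso\<close>, the given sequence at \<open>fobj S d\<close>, so injectivity on
  the left is kept too.\<close>

lemma ind_functor_exact:
  "exact_functor (ModCat C :: (('o, 'm, 'v) cmod, _) pcat) (ModCat D) (ind_functor C D P)"
  unfolding exact_functor_def
proof (intro conjI allI impI)
  fix F G H :: "('o, 'm, 'v) cmod" and \<beta> \<gamma>
  assume "short_exact (ModCat C) F G H \<beta> \<gamma>"
  then have F: "additive_functor C Ab F" and G: "additive_functor C Ab G" and H: "additive_functor C Ab H"
    and b: "\<beta> \<in> ntr C F G" and c: "\<gamma> \<in> ntr C G H"
    and s: "\<And>a. a \<in> Ob C \<Longrightarrow> inj_on (\<beta> a) (carrier (fobj F a))"
      "\<And>a. a \<in> Ob C \<Longrightarrow> \<beta> a ` carrier (fobj F a) = kernel (fobj G a) (fobj H a) (\<gamma> a)"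
      "\<And>a. a \<in> Ob C \<Longrightarrow> \<gamma> a ` carrier (fobj G a) = carrier (fobj H a)"
    unfolding short_exact_ModCat[OF C] by auto
  let ?I = "fobj (ind_functor C D P)" and ?b = "fmap (ind_functor C D P) F G \<beta>" and ?c = "fmap (ind_functor C D P) G H \<gamma>"
  have I: "bij_betw (ind_iso N d) (carrier (fobj N (fobj S d))) (carrier (fobj (?I N) d))"
    if "additive_functor C Ab N" "d \<in> Ob D" for N :: "('o, 'm, 'v) cmod" and d
    using niso_apply(1)[OF ind_iso(2)[OF that(1)] that(2)] by simp
  show "short_exact (ModCat D) (?I F) (?I G) (?I H) ?b ?c"
    unfolding short_exact_ModCat[OF D]
  proof (intro conjI ballI)
    fix d assume d: "d \<in> Ob D"
    then have Sd: "fobj S d \<in> Ob C" by simp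
    note IF = I[OF F d] and IG = I[OF G d] and IH = I[OF H d]
    have cF: "carrier (fobj (?I F) d) = ind_iso F d ` carrier (fobj F (fobj S d))"
      and cG: "carrier (fobj (?I G) d) = ind_iso G d ` carrier (fobj G (fobj S d))"
      and cH: "carrier (fobj (?I H) d) = ind_iso H d ` carrier (fobj H (fobj S d))"
      using IF IG IH by (simp_all add: bij_betw_def)
    have bx: "?b d (ind_iso F d x) = ind_iso G d (\<beta> (fobj S d) x)" if "x \<in> carrier (fobj F (fobj S d))" for x
      by (rule ind_functor_fmap_apply[OF F G b d that])
    have cx: "?c d (ind_iso G d x) = ind_iso H d (\<gamma> (fobj S d) x)" if "x \<in> carrier (fobj G (fobj S d))" for x
      by (rule ind_functor_fmap_apply[OF G H c d that])
    have bc: "\<beta> (fobj S d) x \<in> carrier (fobj G (fobj S d))" if "x \<in> carrier (fobj F (fobj S d))" for x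
      by (rule ntr_closed[OF b Sd that])
    have cc: "\<gamma> (fobj S d) x \<in> carrier (fobj H (fobj S d))" if "x \<in> carrier (fobj G (fobj S d))" for x
      by (rule ntr_closed[OF c Sd that])
    have injG: "inj_on (ind_iso G d) (carrier (fobj G (fobj S d)))"
      and injH: "inj_on (ind_iso H d) (carrier (fobj H (fobj S d)))"
      using IG IH by (auto simp: bij_betw_def)
    show "inj_on (?b d) (carrier (fobj (?I F) d))"
    proof (rule inj_onI)
      fix u v assume "u \<in> carrier (fobj (?I F) d)" "v \<in> carrier (fobj (?I F) d)" and eq: "?b d u = ?b d v"
      then obtain x y where x: "x \<in> carrier (fobj F (fobj S d))" "u = ind_iso F d x"
        and y: "y \<in> carrier (fobj F (fobj S d))" "v = ind_iso F d y" unfolding cF by blast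
      have "ind_iso G d (\<beta> (fobj S d) x) = ind_iso G d (\<beta> (fobj S d) y)"
        using eq unfolding x(2) y(2) bx[OF x(1)] bx[OF y(1)] .
      from inj_onD[OF s(1)[OF Sd] inj_onD[OF injG this bc[OF x(1)] bc[OF y(1)]] x(1) y(1)]
      show "u = v" unfolding x(2) y(2) by simp
    qed
    show "?c d ` carrier (fobj (?I G) d) = carrier (fobj (?I H) d)"
      unfolding cG cH s(3)[OF Sd, symmetric] by (auto simp: cx image_iff)
    interpret h: group_hom "fobj H (fobj S d)" "fobj (?I H) d" "ind_iso H d"
      using ntr_group_hom[OF additive_functor_fcomp[OF S H] ind_iso(1)[OF H] _ d, of "ind_iso H"] ind_iso(2)[OF H]
      by (simp add: niso_def)
    have "kernel (fobj (?I G) d) (fobj (?I H) d) (?c d) = ind_iso G d ` kernel (fobj G (fobj S d)) (fobj H (fobj S d)) (\<gamma> (fobj S d))"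
    proof -
      have "ind_iso H d (\<gamma> (fobj S d) x) = \<one>\<^bsub>fobj (?I H) d\<^esub> \<longleftrightarrow> \<gamma> (fobj S d) x = \<one>\<^bsub>fobj H (fobj S d)\<^esub>"
        if "x \<in> carrier (fobj G (fobj S d))" for x
        using inj_on_eq_iff[OF injH cc[OF that] h.G.one_closed] by simp
      then show ?thesis unfolding kernel_def cG by (auto simp: cx)
    qed
    then show "?b d ` carrier (fobj (?I F) d) = kernel (fobj (?I G) d) (fobj (?I H) d) (?c d)"
      unfolding s(2)[OF Sd, symmetric] cF by (auto simp: bx image_iff)
  qed (rule ind_iso(1)[OF F] ind_iso(1)[OF G] ind_iso(1)[OF H] ind_functor_fmap(1)[OF F G b] ind_functor_fmap(1)[OF G H c])+
qed (rule ind_functor_additive)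

end

section \<open>Coinduction\<close>

lemma rep_left_simps [simp]:
  "fobj (rep_left C D P d) a = Hom D d (fobj P a)"
  "fmap (rep_left C D P d) a b f = (\<lambda>x\<in>arr D d (fobj P a). Cmp D d (fobj P a) (fobj P b) (fmap P a b f) x)"
  by (simp_all add: rep_left_def)

lemma rep_left_module:
  assumes D: "preadditive_category D" and P: "additive_functor C D P" and d: "d \<in> Ob D"
  shows "additive_functor C Ab (rep_left C D P d)"
proof -
  have "rep_left C D P d = rep_left D D fid d \<circ>\<^sub>F P" by (simp add: rep_left_def fcomp_def fid_def)
  then show ?thesis using additive_functor_fcomp[OF P rep_left_additive[OF D d]] by simp
qed

lemma coind_mod_simps [simp]:
  "fobj (coind_mod C D P N) d = nat_group C (rep_left C D P d) N"
  "fmap (coind_mod C D P N) d d' g = (\<lambda>\<eta>\<in>ntr C (rep_left C D P d) N.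
              \<lambda>a\<in>Ob C. \<lambda>x\<in>arr D d' (fobj P a). \<eta> a (Cmp D d d' (fobj P a) x g))"
  by (simp_all add: coind_mod_def)

text \<open>Groups of natural transformations may exceed the universe. This condition isolates what
  the adjunction needs, so that one proof serves both the projection and the inclusion.\<close>

definition coind_fits :: "'v itself \<Rightarrow> ('o, 'm) pcat \<Rightarrow> ('p, 'n) pcat \<Rightarrow> ('o, 'm, 'p, 'n) cfunctor \<Rightarrow> bool"
  where "coind_fits _ C D P \<longleftrightarrow> (\<forall>(N :: ('o, 'm, 'v) cmod) d. additive_functor C Ab N \<longrightarrow> d \<in> Ob D \<longrightarrow>
    fits TYPE('v) (ntr C (rep_left C D P d) N))"

section \<open>The coinduced module before passing to copies\<close>

context
  fixes C :: "('o, 'm) pcat" and D :: "('p, 'n) pcat" and P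
  assumes C: "preadditive_category C" and D: "preadditive_category D" and P: "additive_functor C D P"
  notes [simp] = additive_functor_Ob[OF P] additive_functor_arr[OF P]
begin

interpretation C: preadditive_category C by (rule C)
interpretation D: preadditive_category D by (rule D)

lemma coind_ntrI:
  assumes d: "d \<in> Ob D"
    and "\<xi> \<in> extensional (Ob C)"
    and "\<And>a. a \<in> Ob C \<Longrightarrow> \<xi> a \<in> extensional (arr D d (fobj P a))"
    and "\<And>a x. a \<in> Ob C \<Longrightarrow> x \<in> arr D d (fobj P a) \<Longrightarrow> \<xi> a x \<in> carrier (fobj N a)"
    and "\<And>a x y. a \<in> Ob C \<Longrightarrow> x \<in> arr D d (fobj P a) \<Longrightarrow> y \<in> arr D d (fobj P a) \<Longrightarrow>
      \<xi> a (x \<otimes>\<^bsub>Hom D d (fobj P a)\<^esub> y) = \<xi> a x \<otimes>\<^bsub>fobj N a\<^esub> \<xi> a y"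
    and "\<And>a b f x. a \<in> Ob C \<Longrightarrow> b \<in> Ob C \<Longrightarrow> f \<in> arr C a b \<Longrightarrow> x \<in> arr D d (fobj P a) \<Longrightarrow>
      \<xi> b (Cmp D d (fobj P a) (fobj P b) (fmap P a b f) x) = fmap N a b f (\<xi> a x)"
  shows "\<xi> \<in> ntr C (rep_left C D P d) N"
  by (rule ntrI) (use assms in simp_all)

lemma coind_ntr:
  assumes x: "\<xi> \<in> ntr C (rep_left C D P d) N" and a: "a \<in> Ob C" and u: "u \<in> arr D d (fobj P a)"
  shows "\<xi> a u \<in> carrier (fobj N a)"
    and "v \<in> arr D d (fobj P a) \<Longrightarrow> \<xi> a (u \<otimes>\<^bsub>Hom D d (fobj P a)\<^esub> v) = \<xi> a u \<otimes>\<^bsub>fobj N a\<^esub> \<xi> a v"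
    and "b \<in> Ob C \<Longrightarrow> f \<in> arr C a b \<Longrightarrow> \<xi> b (Cmp D d (fobj P a) (fobj P b) (fmap P a b f) u) = fmap N a b f (\<xi> a u)"
  using ntr_closed[OF x a] ntr_mult[OF x a] ntr_natural[OF x a] u by auto

lemma coind_fmap_ntr:
  assumes N: "additive_functor C Ab N" and d: "d \<in> Ob D" "d' \<in> Ob D" and g: "g \<in> arr D d d'"
    and x: "\<xi> \<in> ntr C (rep_left C D P d) N"
  shows "fmap (coind_mod C D P N) d d' g \<xi> \<in> ntr C (rep_left C D P d') N"
  by (rule coind_ntrI)
    (use d g x in \<open>simp_all add: coind_ntr[OF x] D.Cmp_arr D.Cmp_add_left D.add_arr_closed D.Cmp_assoc[symmetric]\<close>)

lemma coind_fmap_apply: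
  assumes "\<xi> \<in> ntr C (rep_left C D P d) N" "a \<in> Ob C" "u \<in> arr D d' (fobj P a)"
  shows "fmap (coind_mod C D P N) d d' g \<xi> a u = \<xi> a (Cmp D d d' (fobj P a) u g)"
  using assms by simp

lemma coind_eqI:
  assumes "\<xi> \<in> ntr C (rep_left C D P d) N" "\<xi>' \<in> ntr C (rep_left C D P d) N"
    and "\<And>a u. a \<in> Ob C \<Longrightarrow> u \<in> arr D d (fobj P a) \<Longrightarrow> \<xi> a u = \<xi>' a u"
  shows "\<xi> = \<xi>'"
  by (rule ntr_eqI[OF assms(1,2)]) (use assms(3) in simp)

lemma coind_mult_apply:
  assumes "a \<in> Ob C" "u \<in> arr D d (fobj P a)"
  shows "(\<xi> \<otimes>\<^bsub>nat_group C (rep_left C D P d) N\<^esub> \<xi>') a u = \<xi> a u \<otimes>\<^bsub>fobj N a\<^esub> \<xi>' a u"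
  using assms by (simp add: nat_group_mult_apply)

lemma coind_mod_module:
  assumes N: "additive_functor C Ab N"
  shows "additive_functor D Ab (coind_mod C D P N)"
proof (rule moduleI)
  note R = rep_left_module[OF D P]
  show "comm_group (fobj (coind_mod C D P N) d)" if "d \<in> Ob D" for d
    using comm_group_nat_group[OF R[OF that] N] by simp
  have m: "\<xi> \<otimes>\<^bsub>nat_group C (rep_left C D P d) N\<^esub> \<xi>' \<in> ntr C (rep_left C D P d) N"
    if "d \<in> Ob D" "\<xi> \<in> ntr C (rep_left C D P d) N" "\<xi>' \<in> ntr C (rep_left C D P d) N" for d \<xi> \<xi>'
    by (rule nat_group_m_closed[OF R[OF that(1)] N that(2,3)])
  show "fmap (coind_mod C D P N) d d' g \<xi> \<in> carrier (fobj (coind_mod C D P N) d')"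
    if "d \<in> Ob D" "d' \<in> Ob D" "g \<in> arr D d d'" "\<xi> \<in> carrier (fobj (coind_mod C D P N) d)" for d d' g \<xi>
    using coind_fmap_ntr[OF N that(1-3), of \<xi>] that(4) by simp
  show "fmap (coind_mod C D P N) d d' g (\<xi> \<otimes>\<^bsub>fobj (coind_mod C D P N) d\<^esub> \<xi>')
      = fmap (coind_mod C D P N) d d' g \<xi> \<otimes>\<^bsub>fobj (coind_mod C D P N) d'\<^esub> fmap (coind_mod C D P N) d d' g \<xi>'"
    if d: "d \<in> Ob D" "d' \<in> Ob D" and g: "g \<in> arr D d d'"
      and "\<xi> \<in> carrier (fobj (coind_mod C D P N) d)" "\<xi>' \<in> carrier (fobj (coind_mod C D P N) d)" for d d' g \<xi> \<xi>'
  proof -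
    have x: "\<xi> \<in> ntr C (rep_left C D P d) N" "\<xi>' \<in> ntr C (rep_left C D P d) N" using that by simp_all
    show ?thesis
      unfolding coind_mod_simps(1)
      by (rule coind_eqI[OF coind_fmap_ntr[OF N d g m[OF d(1) x]] m[OF d(2) coind_fmap_ntr[OF N d g x(1)] coind_fmap_ntr[OF N d g x(2)]]])
        (use d g x m[OF d(1) x] in \<open>simp add: coind_mult_apply D.Cmp_arr\<close>)
  qed
  show "fmap (coind_mod C D P N) d d' (g \<otimes>\<^bsub>Hom D d d'\<^esub> g') \<xi>
      = fmap (coind_mod C D P N) d d' g \<xi> \<otimes>\<^bsub>fobj (coind_mod C D P N) d'\<^esub> fmap (coind_mod C D P N) d d' g' \<xi>"
    if d: "d \<in> Ob D" "d' \<in> Ob D" and g: "g \<in> arr D d d'" "g' \<in> arr D d d'"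
      and "\<xi> \<in> carrier (fobj (coind_mod C D P N) d)" for d d' g g' \<xi>
  proof -
    have x: "\<xi> \<in> ntr C (rep_left C D P d) N" using that by simp
    have gg: "g \<otimes>\<^bsub>Hom D d d'\<^esub> g' \<in> arr D d d'" by (rule D.add_arr_closed[OF d g])
    show ?thesis
      unfolding coind_mod_simps(1)
      by (rule coind_eqI[OF coind_fmap_ntr[OF N d gg x] m[OF d(2) coind_fmap_ntr[OF N d g(1) x] coind_fmap_ntr[OF N d g(2) x]]])
        (use d g x in \<open>simp add: coind_mult_apply D.Cmp_arr D.Cmp_add_right coind_ntr[OF x]\<close>)
  qed
  show "fmap (coind_mod C D P N) d d (Idt D d) \<xi> = \<xi>" if d: "d \<in> Ob D" and "\<xi> \<in> carrier (fobj (coind_mod C D P N) d)" for d \<xi>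
  proof -
    have x: "\<xi> \<in> ntr C (rep_left C D P d) N" using that by simp
    show ?thesis
      by (rule coind_eqI[OF coind_fmap_ntr[OF N d d D.Idt_arr[OF d] x] x]) (use d x in \<open>simp add: D.Cmp_Idt_right\<close>)
  qed
  show "fmap (coind_mod C D P N) d d'' (Cmp D d d' d'' h g) \<xi>
      = fmap (coind_mod C D P N) d' d'' h (fmap (coind_mod C D P N) d d' g \<xi>)"
    if d: "d \<in> Ob D" "d' \<in> Ob D" "d'' \<in> Ob D" and g: "g \<in> arr D d d'" and h: "h \<in> arr D d' d''"
      and "\<xi> \<in> carrier (fobj (coind_mod C D P N) d)" for d d' d'' g h \<xi>
  proof -
    have x: "\<xi> \<in> ntr C (rep_left C D P d) N" using that by simp
    have x': "fmap (coind_mod C D P N) d d' g \<xi> \<in> ntr C (rep_left C D P d') N"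
      by (rule coind_fmap_ntr[OF N d(1,2) g x])
    show ?thesis
    proof (rule coind_eqI[OF coind_fmap_ntr[OF N d(1,3) D.Cmp_arr[OF d g h] x] coind_fmap_ntr[OF N d(2,3) h x']])
      fix a u assume a: "a \<in> Ob C" and u: "u \<in> arr D d'' (fobj P a)"
      show "fmap (coind_mod C D P N) d d'' (Cmp D d d' d'' h g) \<xi> a u
        = fmap (coind_mod C D P N) d' d'' h (fmap (coind_mod C D P N) d d' g \<xi>) a u"
        \<comment> \<open>Precomposition is contravariant in the hom argument, which makes the
          result covariant in \<open>d\<close>; associativity identifies the two composites.\<close>
        unfolding coind_fmap_apply[OF x a u] coind_fmap_apply[OF x' a u]
        by (subst coind_fmap_apply[OF x a]) (use a u d g h in \<open>simp_all add: D.Cmp_arr D.Cmp_assoc\<close>)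
    qed
  qed
qed (simp_all add: D.add_arr_closed D.Idt_arr D.Cmp_arr)

section \<open>Coinduction inside the universe\<close>

context
  assumes coind_fits: "coind_fits TYPE('v) C D P"
begin

lemma coind_fitsD:
  "additive_functor C Ab (N :: ('o, 'm, 'v) cmod) \<Longrightarrow> d \<in> Ob D \<Longrightarrow> fits TYPE('v) (ntr C (rep_left C D P d) N)"
  using coind_fits by (simp add: coind_fits_def)

definition coind_iso :: "('o, 'm, 'v) cmod \<Rightarrow> 'p \<Rightarrow> ('o \<Rightarrow> 'n \<Rightarrow> 'v) \<Rightarrow> 'v"
  where "coind_iso N = copy_nat D (coind_mod C D P N)"

abbreviation coind :: "('o, 'm, 'v) cmod \<Rightarrow> ('p, 'n, 'v) cmod"
  where "coind N \<equiv> fobj (coind_functor C D P) N"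

lemma coind_iso:
  assumes N: "additive_functor C Ab N"
  shows "additive_functor D Ab (coind N)"
    and "niso D (coind_mod C D P N) (coind N) (coind_iso N)"
    and "coind_iso N \<in> ntr D (coind_mod C D P N) (coind N)"
    and "ninv D (coind_mod C D P N) (coind N) (coind_iso N) \<in> ntr D (coind N) (coind_mod C D P N)"
proof -
  have f: "fits TYPE('v) (carrier (fobj (coind_mod C D P N) d))" if "d \<in> Ob D" for d
    using coind_fitsD[OF N that] by simp
  note c = copy_module[OF D coind_mod_module[OF N] f]
  show "additive_functor D Ab (coind N)" using c(1) by (simp add: coind_functor_def)
  show n: "niso D (coind_mod C D P N) (coind N) (coind_iso N)"
    using c(2) by (simp add: coind_functor_def coind_iso_def)
  then show "coind_iso N \<in> ntr D (coind_mod C D P N) (coind N)" by (simp add: niso_def)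
  show "ninv D (coind_mod C D P N) (coind N) (coind_iso N) \<in> ntr D (coind N) (coind_mod C D P N)"
    by (rule ninv_ntr[OF coind_mod_module[OF N] \<open>additive_functor D Ab (coind N)\<close> n])
qed

lemma coind_surj:
  assumes N: "additive_functor C Ab N" and d: "d \<in> Ob D" and x: "x \<in> carrier (fobj (coind N) d)"
  obtains \<xi> where "\<xi> \<in> ntr C (rep_left C D P d) N" "x = coind_iso N d \<xi>"
    "ninv D (coind_mod C D P N) (coind N) (coind_iso N) d x = \<xi>"
  using niso_apply(3,4)[OF coind_iso(2)[OF N] d x] by auto

lemma coind_inj:
  assumes N: "additive_functor C Ab N" and d: "d \<in> Ob D"
    and x: "\<xi> \<in> ntr C (rep_left C D P d) N" "\<xi>' \<in> ntr C (rep_left C D P d) N"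
    and eq: "coind_iso N d \<xi> = coind_iso N d \<xi>'"
  shows "\<xi> = \<xi>'"
  using niso_apply(1)[OF coind_iso(2)[OF N] d] x eq by (auto simp: bij_betw_def dest: inj_onD)

lemma coind_functor_fmap_apply:
  assumes N: "additive_functor C Ab N" and d: "d \<in> Ob D" and x: "\<xi> \<in> ntr C (rep_left C D P d) N"
  shows "fmap (coind_functor C D P) N N' \<beta> d (coind_iso N d \<xi>) = copy_iso (nat_group C (rep_left C D P d) N') (ncmp C (rep_left C D P d) \<beta> \<xi>)"
proof -
  have "fmap (coind_functor C D P) N N' \<beta> d (coind_iso N d \<xi>)
      = copy_map (nat_group C (rep_left C D P d) N) (nat_group C (rep_left C D P d) N')
         (\<lambda>\<eta>. \<lambda>a\<in>Ob C. compose (arr D d (fobj P a)) (\<beta> a) (\<eta> a)) (copy_iso (nat_group C (rep_left C D P d) N) \<xi>)"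
    using d x by (simp add: coind_functor_def coind_iso_def copy_nat_def)
  then show ?thesis
    unfolding copy_map_apply[OF comm_group_nat_group[OF rep_left_module[OF D P d] N] coind_fitsD[OF N d] x]
    by (simp add: ncmp_def)
qed

lemma coind_functor_fmap_apply':
  assumes N: "additive_functor C Ab N" and d: "d \<in> Ob D" and x: "\<xi> \<in> ntr C (rep_left C D P d) N" and b: "\<beta> \<in> ntr C N N'"
  shows "fmap (coind_functor C D P) N N' \<beta> d (coind_iso N d \<xi>) = coind_iso N' d (ncmp C (rep_left C D P d) \<beta> \<xi>)"
  unfolding coind_functor_fmap_apply[OF N d x]
  using ncmp_ntr[OF rep_left_module[OF D P d] x b] d by (simp add: coind_iso_def copy_nat_def)

lemma coind_map_ntr:
  assumes N: "additive_functor C Ab N" and N': "additive_functor C Ab N'" and b: "\<beta> \<in> ntr C N N'"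
  shows "(\<lambda>d\<in>Ob D. \<lambda>\<xi>\<in>ntr C (rep_left C D P d) N. ncmp C (rep_left C D P d) \<beta> \<xi>)
    \<in> ntr D (coind_mod C D P N) (coind_mod C D P N')"
proof -
  note R = rep_left_module[OF D P]
  have c: "ncmp C (rep_left C D P d) \<beta> \<xi> \<in> ntr C (rep_left C D P d) N'"
    if "d \<in> Ob D" "\<xi> \<in> ntr C (rep_left C D P d) N" for d \<xi>
    by (rule ncmp_ntr[OF R[OF that(1)] that(2) b])
  show ?thesis
  proof (rule ntrI)
    fix d \<xi> \<xi>' assume d: "d \<in> Ob D" and "\<xi> \<in> carrier (fobj (coind_mod C D P N) d)" "\<xi>' \<in> carrier (fobj (coind_mod C D P N) d)"
    then have x: "\<xi> \<in> ntr C (rep_left C D P d) N" "\<xi>' \<in> ntr C (rep_left C D P d) N" by simp_all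
    show "(\<lambda>d\<in>Ob D. \<lambda>\<xi>\<in>ntr C (rep_left C D P d) N. ncmp C (rep_left C D P d) \<beta> \<xi>) d (\<xi> \<otimes>\<^bsub>fobj (coind_mod C D P N) d\<^esub> \<xi>')
      = (\<lambda>d\<in>Ob D. \<lambda>\<xi>\<in>ntr C (rep_left C D P d) N. ncmp C (rep_left C D P d) \<beta> \<xi>) d \<xi> \<otimes>\<^bsub>fobj (coind_mod C D P N') d\<^esub>
        (\<lambda>d\<in>Ob D. \<lambda>\<xi>\<in>ntr C (rep_left C D P d) N. ncmp C (rep_left C D P d) \<beta> \<xi>) d \<xi>'"
      using d x nat_group_m_closed[OF R[OF d] N x] hom_mult[OF ncmp_hom_right[OF R[OF d] N N' b] x] by simp
  next
    fix d d' g \<xi> assume d: "d \<in> Ob D" "d' \<in> Ob D" and g: "g \<in> arr D d d'" and "\<xi> \<in> carrier (fobj (coind_mod C D P N) d)"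
    then have x: "\<xi> \<in> ntr C (rep_left C D P d) N" by simp
    have "ncmp C (rep_left C D P d') \<beta> (fmap (coind_mod C D P N) d d' g \<xi>)
        = fmap (coind_mod C D P N') d d' g (ncmp C (rep_left C D P d) \<beta> \<xi>)"
    proof (rule coind_eqI[OF c[OF d(2) coind_fmap_ntr[OF N d g x]] coind_fmap_ntr[OF N' d g c[OF d(1) x]]])
      fix a u assume a: "a \<in> Ob C" and u: "u \<in> arr D d' (fobj P a)"
      have ug: "Cmp D d d' (fobj P a) u g \<in> arr D d (fobj P a)" using a u d g by (simp add: D.Cmp_arr)
      show "ncmp C (rep_left C D P d') \<beta> (fmap (coind_mod C D P N) d d' g \<xi>) a u
        = fmap (coind_mod C D P N') d d' g (ncmp C (rep_left C D P d) \<beta> \<xi>) a u"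
        using a u ug by (simp only: coind_fmap_apply[OF c[OF d(1) x] a u] coind_fmap_apply[OF x a u] ncmp_apply rep_left_simps)
    qed
    then show "(\<lambda>d\<in>Ob D. \<lambda>\<xi>\<in>ntr C (rep_left C D P d) N. ncmp C (rep_left C D P d) \<beta> \<xi>) d' (fmap (coind_mod C D P N) d d' g \<xi>)
      = fmap (coind_mod C D P N') d d' g ((\<lambda>d\<in>Ob D. \<lambda>\<xi>\<in>ntr C (rep_left C D P d) N. ncmp C (rep_left C D P d) \<beta> \<xi>) d \<xi>)"
      using d x coind_fmap_ntr[OF N d g x] by (simp del: coind_mod_simps(2))
  qed (simp_all add: c)
qed

text \<open>As for induction, the map is recognized as the conjugate \<open>?g\<close> of
  postcomposition with \<open>\<beta>\<close>, which is natural by construction.\<close>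

lemma coind_functor_fmap:
  assumes N: "additive_functor C Ab N" and N': "additive_functor C Ab N'" and b: "\<beta> \<in> ntr C N N'"
  shows "fmap (coind_functor C D P) N N' \<beta> \<in> ntr D (coind N) (coind N')"
proof -
  let ?f = "fmap (coind_functor C D P) N N' \<beta>"
  let ?m = "\<lambda>d\<in>Ob D. \<lambda>\<xi>\<in>ntr C (rep_left C D P d) N. ncmp C (rep_left C D P d) \<beta> \<xi>"
  let ?l = "ninv D (coind_mod C D P N) (coind N) (coind_iso N)"
  let ?g = "ncmp D (coind N) (ncmp D (coind_mod C D P N) (coind_iso N') ?m) ?l"
  note i = coind_iso[OF N] and i' = coind_iso[OF N']
  have g: "?g \<in> ntr D (coind N) (coind N')"
    by (rule ncmp_ntr[OF i(1) i(4) ncmp_ntr[OF coind_mod_module[OF N] coind_map_ntr[OF N N' b] i'(3)]])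
  have "?f = ?g"
  proof (rule extensionalityI[of _ "Ob D"])
    show "?f d = ?g d" if d: "d \<in> Ob D" for d
    proof (rule extensionalityI[of _ "carrier (fobj (coind N) d)"])
      show "?f d \<in> extensional (carrier (fobj (coind N) d))"
        using d by (simp add: coind_functor_def copy_map_def copy_mod_def)
      show "?g d \<in> extensional (carrier (fobj (coind N) d))" by (rule ntr_comp_ext[OF g d])
      fix x assume x: "x \<in> carrier (fobj (coind N) d)"
      obtain \<xi> where xi: "\<xi> \<in> ntr C (rep_left C D P d) N" "x = coind_iso N d \<xi>" "?l d x = \<xi>"
        by (rule coind_surj[OF N d x])
      have "?f d x = coind_iso N' d (ncmp C (rep_left C D P d) \<beta> \<xi>)"
        unfolding xi(2) by (rule coind_functor_fmap_apply'[OF N d xi(1) b])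
      also have "\<dots> = ?g d x" using d x xi by simp
      finally show "?f d x = ?g d x" .
    qed
  qed (simp_all add: coind_functor_def ncmp_def)
  then show ?thesis using g by simp
qed

lemma coind_functor_additive:
  "additive_functor (ModCat C :: (('o, 'm, 'v) cmod, _) pcat) (ModCat D) (coind_functor C D P)"
proof (rule additive_functorI; unfold ModCat_simps mem_Collect_eq)
  fix N N' N'' :: "('o, 'm, 'v) cmod" and \<beta> \<gamma>
  note R = rep_left_module[OF D P]
  let ?f = "fmap (coind_functor C D P)"
  assume N: "additive_functor C Ab N"
  note iN = coind_iso[OF N]
  show "additive_functor D Ab (coind N)" by (rule iN)
  show "?f N N (nid C N) = nid D (coind N)"
  proof (rule ntr_eqI[OF coind_functor_fmap[OF N N nid_ntr[OF N]] nid_ntr[OF iN(1)]])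
    fix d x assume d: "d \<in> Ob D" and x: "x \<in> carrier (fobj (coind N) d)"
    obtain \<xi> where xi: "\<xi> \<in> ntr C (rep_left C D P d) N" "x = coind_iso N d \<xi>" by (rule coind_surj[OF N d x])
    have "?f N N (nid C N) d x = x"
      unfolding xi(2) coind_functor_fmap_apply'[OF N d xi(1) nid_ntr[OF N]] ncmp_nid_left[OF xi(1) R[OF d] N] ..
    then show "?f N N (nid C N) d x = nid D (coind N) d x" using d x by simp
  qed
  assume N': "additive_functor C Ab N'"
  note iN' = coind_iso[OF N']
  show "?f N N' \<beta> \<in> ntr D (coind N) (coind N')" if "\<beta> \<in> ntr C N N'" by (rule coind_functor_fmap[OF N N' that])
  show "?f N N' (\<beta> \<otimes>\<^bsub>nat_group C N N'\<^esub> \<gamma>) = ?f N N' \<beta> \<otimes>\<^bsub>nat_group D (coind N) (coind N')\<^esub> ?f N N' \<gamma>"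
    if b: "\<beta> \<in> ntr C N N'" "\<gamma> \<in> ntr C N N'"
  proof (rule ntr_eqI[OF coind_functor_fmap[OF N N' nat_group_m_closed[OF N N' b]]
        nat_group_m_closed[OF iN(1) iN'(1) coind_functor_fmap[OF N N' b(1)] coind_functor_fmap[OF N N' b(2)]]])
    fix d x assume d: "d \<in> Ob D" and x: "x \<in> carrier (fobj (coind N) d)"
    obtain \<xi> where xi: "\<xi> \<in> ntr C (rep_left C D P d) N" "x = coind_iso N d \<xi>" by (rule coind_surj[OF N d x])
    have c: "ncmp C (rep_left C D P d) \<beta> \<xi> \<in> carrier (fobj (coind_mod C D P N') d)"
      "ncmp C (rep_left C D P d) \<gamma> \<xi> \<in> carrier (fobj (coind_mod C D P N') d)"
      using ncmp_ntr[OF R[OF d] xi(1) b(1)] ncmp_ntr[OF R[OF d] xi(1) b(2)] by simp_all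
    have "?f N N' (\<beta> \<otimes>\<^bsub>nat_group C N N'\<^esub> \<gamma>) d x = coind_iso N' d (ncmp C (rep_left C D P d) \<beta> \<xi>) \<otimes>\<^bsub>fobj (coind N') d\<^esub>
       coind_iso N' d (ncmp C (rep_left C D P d) \<gamma> \<xi>)"
      unfolding xi(2) coind_functor_fmap_apply'[OF N d xi(1) nat_group_m_closed[OF N N' b]]
        hom_mult[OF ncmp_hom_left[OF R[OF d] N N' xi(1)] b]
      using ntr_mult[OF iN'(3) d c] by simp
    then show "?f N N' (\<beta> \<otimes>\<^bsub>nat_group C N N'\<^esub> \<gamma>) d x = (?f N N' \<beta> \<otimes>\<^bsub>nat_group D (coind N) (coind N')\<^esub> ?f N N' \<gamma>) d x"
      unfolding nat_group_mult_apply[OF d x] unfolding xi(2)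
        coind_functor_fmap_apply'[OF N d xi(1) b(1)] coind_functor_fmap_apply'[OF N d xi(1) b(2)] .
  qed
  assume N'': "additive_functor C Ab N''"
  show "?f N N'' (ncmp C N \<gamma> \<beta>) = ncmp D (coind N) (?f N' N'' \<gamma>) (?f N N' \<beta>)"
    if b: "\<beta> \<in> ntr C N N'" and c: "\<gamma> \<in> ntr C N' N''"
  proof (rule ntr_eqI[OF coind_functor_fmap[OF N N'' ncmp_ntr[OF N b c]]
        ncmp_ntr[OF iN(1) coind_functor_fmap[OF N N' b] coind_functor_fmap[OF N' N'' c]]])
    fix d x assume d: "d \<in> Ob D" and x: "x \<in> carrier (fobj (coind N) d)"
    obtain \<xi> where xi: "\<xi> \<in> ntr C (rep_left C D P d) N" "x = coind_iso N d \<xi>" by (rule coind_surj[OF N d x])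
    show "?f N N'' (ncmp C N \<gamma> \<beta>) d x = ncmp D (coind N) (?f N' N'' \<gamma>) (?f N N' \<beta>) d x"
      unfolding ncmp_apply[OF d x] unfolding xi(2)
        coind_functor_fmap_apply'[OF N d xi(1) b] coind_functor_fmap_apply'[OF N d xi(1) ncmp_ntr[OF N b c]]
        coind_functor_fmap_apply'[OF N' d ncmp_ntr[OF R[OF d] xi(1) b] c]
        ncmp_assoc[OF R[OF d] N xi(1) b c] ..
  qed
qed

text \<open>A transformation \<open>\<theta>\<close> over \<open>C\<close> turns an element
  \<open>x\<close> of \<open>X\<close> at \<open>d\<close> into the family of all values of
  \<open>\<theta>\<close> on translates of \<open>x\<close> along arrows from \<open>d\<close> to
  \<open>fobj P a\<close>. The way back evaluates such a family at the identity of
  \<open>fobj P a\<close>.\<close>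

lemma coind_functor_adjoint:
  "adjoint (ModCat D) (ModCat C :: (('o, 'm, 'v) cmod, _) pcat) (res_functor C P) (coind_functor C D P)"
proof -
  note R = rep_left_module[OF D P]
  define tr where "tr = (\<lambda>(X :: ('p, 'n, 'v) cmod) (\<theta> :: 'o \<Rightarrow> 'v \<Rightarrow> 'v) d x. \<lambda>a\<in>Ob C. \<lambda>u\<in>arr D d (fobj P a). \<theta> a (fmap X d (fobj P a) u x))"
  define \<phi> where "\<phi> = (\<lambda>(X :: ('p, 'n, 'v) cmod) (N :: ('o, 'm, 'v) cmod) \<theta>. \<lambda>d\<in>Ob D. \<lambda>x\<in>carrier (fobj X d). coind_iso N d (tr X \<theta> d x))"
  define \<psi> where "\<psi> = (\<lambda>(X :: ('p, 'n, 'v) cmod) (N :: ('o, 'm, 'v) cmod) \<zeta>. \<lambda>a\<in>Ob C. \<lambda>y\<in>carrier (fobj X (fobj P a)).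
    (ninv D (coind_mod C D P N) (coind N) (coind_iso N) (fobj P a) (\<zeta> (fobj P a) y)) a (Idt D (fobj P a)))"
  have tr: "tr X \<theta> d x \<in> ntr C (rep_left C D P d) N"
    if X: "additive_functor D Ab X" and t: "\<theta> \<in> ntr C (X \<circ>\<^sub>F P) N" and d: "d \<in> Ob D" and x: "x \<in> carrier (fobj X d)" for X N \<theta> d x
  proof -
    have tc: "\<theta> a y \<in> carrier (fobj N a)" if "a \<in> Ob C" "y \<in> carrier (fobj X (fobj P a))" for a y
      using ntr_closed[OF t that(1)] that(2) by simp
    have tm: "\<theta> a (y \<otimes>\<^bsub>fobj X (fobj P a)\<^esub> z) = \<theta> a y \<otimes>\<^bsub>fobj N a\<^esub> \<theta> a z"
      if "a \<in> Ob C" "y \<in> carrier (fobj X (fobj P a))" "z \<in> carrier (fobj X (fobj P a))" for a y z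
      using ntr_mult[OF t that(1)] that(2,3) by simp
    have tn: "\<theta> b (fmap X (fobj P a) (fobj P b) (fmap P a b f) y) = fmap N a b f (\<theta> a y)"
      if "a \<in> Ob C" "b \<in> Ob C" "f \<in> arr C a b" "y \<in> carrier (fobj X (fobj P a))" for a b f y
      using ntr_natural[OF t that(1-3)] that(4) by simp
    show ?thesis
      by (rule coind_ntrI[OF d])
        (use d x in \<open>simp_all add: tr_def module_closed[OF X] tc tm tn module_add[OF X] D.add_arr_closed module_Cmp[OF X] D.Cmp_arr\<close>)
  qed
  have tr_add: "tr X \<theta> d (x \<otimes>\<^bsub>fobj X d\<^esub> y) = tr X \<theta> d x \<otimes>\<^bsub>nat_group C (rep_left C D P d) N\<^esub> tr X \<theta> d y"
    if X: "additive_functor D Ab X" and N: "additive_functor C Ab N" and t: "\<theta> \<in> ntr C (X \<circ>\<^sub>F P) N" and d: "d \<in> Ob D"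
      and x: "x \<in> carrier (fobj X d)" and y: "y \<in> carrier (fobj X d)" for X N \<theta> d x y
    by (rule coind_eqI[OF tr[OF X t d module_m_closed[OF X d x y]] nat_group_m_closed[OF R[OF d] N tr[OF X t d x] tr[OF X t d y]]])
      (use d x y ntr_mult[OF t] in \<open>simp add: tr_def coind_mult_apply module_mult[OF X] module_closed[OF X]\<close>)
  have tr_nat: "tr X \<theta> d' (fmap X d d' g x) = fmap (coind_mod C D P N) d d' g (tr X \<theta> d x)"
    if X: "additive_functor D Ab X" and N: "additive_functor C Ab N" and t: "\<theta> \<in> ntr C (X \<circ>\<^sub>F P) N" and d: "d \<in> Ob D" "d' \<in> Ob D"
      and g: "g \<in> arr D d d'" and x: "x \<in> carrier (fobj X d)" for X N \<theta> d d' g x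
    by (rule coind_eqI[OF tr[OF X t d(2) module_closed[OF X d g x]] coind_fmap_ntr[OF N d g tr[OF X t d(1) x]]], subst coind_fmap_apply[OF tr[OF X t d(1) x]])
      (use d x g in \<open>simp_all add: tr_def module_closed[OF X] module_Cmp[OF X] D.Cmp_arr\<close>)
  have phi: "\<phi> X N \<theta> \<in> ntr D X (coind N)"
    if X: "additive_functor D Ab X" and N: "additive_functor C Ab N" and t: "\<theta> \<in> ntr C (X \<circ>\<^sub>F P) N" for X N \<theta>
  proof -
    have tr': "tr X \<theta> d x \<in> carrier (fobj (coind_mod C D P N) d)" if "d \<in> Ob D" "x \<in> carrier (fobj X d)" for d x
      using tr[OF X t that] by simp
    show ?thesis
    proof (rule ntrI)
      show "\<phi> X N \<theta> d x \<in> carrier (fobj (coind N) d)" if "d \<in> Ob D" "x \<in> carrier (fobj X d)" for d x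
        using that ntr_closed[OF coind_iso(3)[OF N] that(1) tr'[OF that]] by (simp add: \<phi>_def)
      show "\<phi> X N \<theta> d (x \<otimes>\<^bsub>fobj X d\<^esub> y) = \<phi> X N \<theta> d x \<otimes>\<^bsub>fobj (coind N) d\<^esub> \<phi> X N \<theta> d y"
        if "d \<in> Ob D" "x \<in> carrier (fobj X d)" "y \<in> carrier (fobj X d)" for d x y
        using that ntr_mult[OF coind_iso(3)[OF N] that(1) tr'[OF that(1,2)] tr'[OF that(1,3)]] tr_add[OF X N t that]
        by (simp add: \<phi>_def module_m_closed[OF X])
      show "\<phi> X N \<theta> d' (fmap X d d' g x) = fmap (coind N) d d' g (\<phi> X N \<theta> d x)"
        if "d \<in> Ob D" "d' \<in> Ob D" "g \<in> arr D d d'" "x \<in> carrier (fobj X d)" for d d' g x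
        using that ntr_natural[OF coind_iso(3)[OF N] that(1-3) tr'[OF that(1,4)]] tr_nat[OF X N t that]
        by (simp add: \<phi>_def module_closed[OF X] del: coind_mod_simps(2))
    qed (simp_all add: \<phi>_def)
  qed
  have psi: "\<psi> X N \<zeta> \<in> ntr C (X \<circ>\<^sub>F P) N"
    and psi_tr: "\<And>d x. d \<in> Ob D \<Longrightarrow> x \<in> carrier (fobj X d) \<Longrightarrow> tr X (\<psi> X N \<zeta>) d x = ninv D (coind_mod C D P N) (coind N) (coind_iso N) d (\<zeta> d x)"
    if X: "additive_functor D Ab X" and N: "additive_functor C Ab N" and z: "\<zeta> \<in> ntr D X (coind N)" for X N \<zeta>
  proof -
    \<comment> \<open>The transformation \<open>\<zeta>\<close> with the copy undone, so that its
      values are families which can be evaluated.\<close>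
    define \<omega> where "\<omega> = ncmp D X (ninv D (coind_mod C D P N) (coind N) (coind_iso N)) \<zeta>"
    have w: "\<omega> \<in> ntr D X (coind_mod C D P N)"
      unfolding \<omega>_def by (rule ncmp_ntr[OF X z coind_iso(4)[OF N]])
    have wc: "\<omega> d x \<in> ntr C (rep_left C D P d) N" if "d \<in> Ob D" "x \<in> carrier (fobj X d)" for d x
      using ntr_closed[OF w that] by simp
    have w_eq: "\<omega> d x = ninv D (coind_mod C D P N) (coind N) (coind_iso N) d (\<zeta> d x)"
      if "d \<in> Ob D" "x \<in> carrier (fobj X d)" for d x using that by (simp add: \<omega>_def)
    have ps: "\<psi> X N \<zeta> a y = \<omega> (fobj P a) y a (Idt D (fobj P a))"
      if "a \<in> Ob C" "y \<in> carrier (fobj X (fobj P a))" for a y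
      using that by (simp add: \<psi>_def w_eq)
    \<comment> \<open>The Yoneda step: naturality of \<open>\<omega>\<close> along \<open>u\<close>,
      evaluated at the identity of \<open>fobj P a\<close>, recovers the entry of the family at
      \<open>u\<close>.\<close>
    have ev: "\<psi> X N \<zeta> a (fmap X d (fobj P a) u x) = \<omega> d x a u"
      if a: "a \<in> Ob C" and d: "d \<in> Ob D" and u: "u \<in> arr D d (fobj P a)" and x: "x \<in> carrier (fobj X d)" for a d u x
    proof -
      have Pa: "fobj P a \<in> Ob D" using a by simp
      have "\<omega> (fobj P a) (fmap X d (fobj P a) u x) = fmap (coind_mod C D P N) d (fobj P a) u (\<omega> d x)"
        by (rule ntr_natural[OF w d Pa u x])
      then have "\<omega> (fobj P a) (fmap X d (fobj P a) u x) a (Idt D (fobj P a)) = \<omega> d x a (Cmp D d (fobj P a) (fobj P a) (Idt D (fobj P a)) u)"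
        using coind_fmap_apply[OF wc[OF d x] a D.Idt_arr[OF Pa]] by simp
      then show ?thesis using a d u x by (simp add: ps module_closed[OF X] D.Cmp_Idt_left)
    qed
    show "\<psi> X N \<zeta> \<in> ntr C (X \<circ>\<^sub>F P) N"
    proof (rule ntrI)
      show "\<psi> X N \<zeta> a y \<in> carrier (fobj N a)" if "a \<in> Ob C" "y \<in> carrier (fobj (X \<circ>\<^sub>F P) a)" for a y
        using that coind_ntr(1)[OF wc[of "fobj P a" y] that(1) D.Idt_arr] by (simp add: ps)
      show "\<psi> X N \<zeta> a (x \<otimes>\<^bsub>fobj (X \<circ>\<^sub>F P) a\<^esub> y) = \<psi> X N \<zeta> a x \<otimes>\<^bsub>fobj N a\<^esub> \<psi> X N \<zeta> a y"
        if "a \<in> Ob C" "x \<in> carrier (fobj (X \<circ>\<^sub>F P) a)" "y \<in> carrier (fobj (X \<circ>\<^sub>F P) a)" for a x y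
        using that ntr_mult[OF w, of "fobj P a" x y] coind_mult_apply[OF that(1) D.Idt_arr]
        by (simp add: ps module_m_closed[OF X])
      show "\<psi> X N \<zeta> b (fmap (X \<circ>\<^sub>F P) a b f y) = fmap N a b f (\<psi> X N \<zeta> a y)"
        if ab: "a \<in> Ob C" "b \<in> Ob C" and f: "f \<in> arr C a b" and y: "y \<in> carrier (fobj (X \<circ>\<^sub>F P) a)" for a b f y
        using that coind_ntr(3)[OF wc[of "fobj P a" y] ab(1) D.Idt_arr ab(2) f]
        by (simp add: ps ev D.Cmp_Idt_right)
    qed (simp_all add: \<psi>_def)
    show "tr X (\<psi> X N \<zeta>) d x = ninv D (coind_mod C D P N) (coind N) (coind_iso N) d (\<zeta> d x)"
      if d: "d \<in> Ob D" and x: "x \<in> carrier (fobj X d)" for d x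
      unfolding w_eq[OF d x, symmetric]
      by (rule coind_eqI[OF tr[OF X \<open>\<psi> X N \<zeta> \<in> _\<close> d x] wc[OF d x]]) (use d x in \<open>simp add: tr_def ev\<close>)
  qed
  have pp: "\<phi> X N (\<psi> X N \<zeta>) = \<zeta>"
    if X: "additive_functor D Ab X" and N: "additive_functor C Ab N" and z: "\<zeta> \<in> ntr D X (coind N)" for X N \<zeta>
  proof (rule ntr_eqI[OF phi[OF X N psi[OF X N z]] z])
    fix d x assume d: "d \<in> Ob D" and x: "x \<in> carrier (fobj X d)"
    show "\<phi> X N (\<psi> X N \<zeta>) d x = \<zeta> d x"
      using d x niso_apply(3)[OF coind_iso(2)[OF N] d ntr_closed[OF z d x]] by (simp add: \<phi>_def psi_tr[OF X N z])
  qed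
  have pp': "\<psi> X N (\<phi> X N \<theta>) = \<theta>"
    if X: "additive_functor D Ab X" and N: "additive_functor C Ab N" and t: "\<theta> \<in> ntr C (X \<circ>\<^sub>F P) N" for X N \<theta>
  proof (rule ntr_eqI[OF psi[OF X N phi[OF X N t]] t])
    fix a y assume a: "a \<in> Ob C" and y: "y \<in> carrier (fobj (X \<circ>\<^sub>F P) a)"
    have Pa: "fobj P a \<in> Ob D" and y': "y \<in> carrier (fobj X (fobj P a))" using a y by simp_all
    have "tr X \<theta> (fobj P a) y \<in> carrier (fobj (coind_mod C D P N) (fobj P a))" using tr[OF X t Pa y'] by simp
    then show "\<psi> X N (\<phi> X N \<theta>) a y = \<theta> a y"
      using a y' niso_apply(2)[OF coind_iso(2)[OF N] Pa] by (simp add: \<psi>_def \<phi>_def tr_def D.Idt_arr module_Idt[OF X])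
  qed
  show ?thesis
    unfolding adjoint_def ModCat_simps res_functor_simps mem_Collect_eq
  proof (intro exI[of _ \<phi>] conjI ballI; unfold mem_Collect_eq)
    fix X :: "('p, 'n, 'v) cmod" and N :: "('o, 'm, 'v) cmod"
    assume X: "additive_functor D Ab X" and N: "additive_functor C Ab N"
    show "bij_betw (\<phi> X N) (ntr C (X \<circ>\<^sub>F P) N) (ntr D X (coind N))"
      by (rule bij_betw_byWitness[where f' = "\<psi> X N"]) (use X N pp pp' phi psi in auto)
  next
    fix X X' :: "('p, 'n, 'v) cmod" and N N' :: "('o, 'm, 'v) cmod" and f g h
    assume X: "additive_functor D Ab X" and X': "additive_functor D Ab X'"
      and N: "additive_functor C Ab N" and N': "additive_functor C Ab N'"
      and f: "f \<in> ntr D X' X" and g: "g \<in> ntr C (X \<circ>\<^sub>F P) N" and h: "h \<in> ntr C N N'"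
    have XP: "additive_functor C Ab (X' \<circ>\<^sub>F P)" by (rule additive_functor_fcomp[OF P X'])
    have fP: "(\<lambda>a\<in>Ob C. f (fobj P a)) \<in> ntr C (X' \<circ>\<^sub>F P) (X \<circ>\<^sub>F P)" by (rule res_ntr[OF P f])
    have l: "ncmp C (X' \<circ>\<^sub>F P) h (ncmp C (X' \<circ>\<^sub>F P) g (\<lambda>a\<in>Ob C. f (fobj P a))) \<in> ntr C (X' \<circ>\<^sub>F P) N'"
      by (rule ncmp_ntr[OF XP ncmp_ntr[OF XP fP g] h])
    have ch: "fmap (coind_functor C D P) N N' h \<in> ntr D (coind N) (coind N')" by (rule coind_functor_fmap[OF N N' h])
    show "\<phi> X' N' (ncmp C (X' \<circ>\<^sub>F P) h (ncmp C (X' \<circ>\<^sub>F P) g (\<lambda>a\<in>Ob C. f (fobj P a)))) =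
        ncmp D X' (fmap (coind_functor C D P) N N' h) (ncmp D X' (\<phi> X N g) f)"
    proof (rule ntr_eqI[OF phi[OF X' N' l] ncmp_ntr[OF X' ncmp_ntr[OF X' f phi[OF X N g]] ch]])
      fix d x assume d: "d \<in> Ob D" and x: "x \<in> carrier (fobj X' d)"
      have fx: "f d x \<in> carrier (fobj X d)" by (rule ntr_closed[OF f d x])
      have t: "tr X g d (f d x) \<in> ntr C (rep_left C D P d) N" by (rule tr[OF X g d fx])
      have "tr X' (ncmp C (X' \<circ>\<^sub>F P) h (ncmp C (X' \<circ>\<^sub>F P) g (\<lambda>a\<in>Ob C. f (fobj P a)))) d x
          = ncmp C (rep_left C D P d) h (tr X g d (f d x))"
        by (rule coind_eqI[OF tr[OF X' l d x] ncmp_ntr[OF R[OF d] t h]])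
          (use d x fx in \<open>simp add: tr_def module_closed[OF X'] ntr_natural[OF f]\<close>)
      then show "\<phi> X' N' (ncmp C (X' \<circ>\<^sub>F P) h (ncmp C (X' \<circ>\<^sub>F P) g (\<lambda>a\<in>Ob C. f (fobj P a)))) d x =
          ncmp D X' (fmap (coind_functor C D P) N N' h) (ncmp D X' (\<phi> X N g) f) d x"
        using d x fx coind_functor_fmap_apply'[OF N d t h] by (simp add: \<phi>_def)
    qed
  qed
qed

end

end

subsection \<open>Coinduction from a full subcategory\<close>

lemma full_subcat_simps [simp]:
  "Ob (full_subcat D B) = B" "Hom (full_subcat D B) = Hom D" "Idt (full_subcat D B) = Idt D" "Cmp (full_subcat D B) = Cmp D"
  by (simp_all add: full_subcat_def)

lemma preadditive_full_subcat:
  assumes "preadditive_category D" "B \<subseteq> Ob D"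
  shows "preadditive_category (full_subcat D B)"
proof -
  interpret preadditive_category D by fact
  note s = subsetD[OF assms(2)]
  show ?thesis
    by (rule preadditive_category.intro)
      (simp_all add: s Hom_comm_group Idt_arr Cmp_hom_right Cmp_hom_left Cmp_Idt_left Cmp_Idt_right Cmp_assoc)
qed

lemma additive_functor_incl: "B \<subseteq> Ob D \<Longrightarrow> additive_functor (full_subcat D B) D incl"
  by (rule additive_functorI) auto

text \<open>An entry of a family at an arrow \<open>u\<close> from \<open>d\<close> to an object
  \<open>b\<close> of \<open>B\<close> is visible after translating the family along
  \<open>u\<close> to \<open>b\<close>. By Yoneda the coinduced module has value \<open>N\<close> at
  \<open>b\<close>, so every transformation of coinduced modules acts entry by entry through a
  single transformation from \<open>N\<close> to \<open>N'\<close>.\<close>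

lemma coind_functor_fully_faithful:
  fixes D :: "('o, 'm) pcat"
  assumes D: "preadditive_category D" and B: "B \<subseteq> Ob D"
    and fit: "coind_fits TYPE('v) (full_subcat D B) D incl"
  shows "fully_faithful (ModCat (full_subcat D B) :: (('o, 'm, 'v) cmod, _) pcat) (ModCat D)
    (coind_functor (full_subcat D B) D incl)"
  unfolding fully_faithful_def ModCat_simps
proof (intro ballI; unfold mem_Collect_eq)
  fix N N' :: "('o, 'm, 'v) cmod"
  let ?C = "full_subcat D B" and ?I = "coind_functor (full_subcat D B) D incl"
  let ?R = "rep_left ?C D incl"
  let ?m = "coind_mod ?C D incl"
  let ?k = "coind_iso ?C D incl"
  assume N: "additive_functor ?C Ab N" and N': "additive_functor ?C Ab N'"
  interpret D: preadditive_category D by (rule D)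
  note C = preadditive_full_subcat[OF D B] and P = additive_functor_incl[OF B]
  note [simp] = subsetD[OF B]
  note R = rep_left_module[OF D P]
  note iN = coind_iso[OF C D P fit N] and iN' = coind_iso[OF C D P fit N']
  note app = coind_functor_fmap_apply'[OF C D P fit N]
  note cntr = coind_ntr[OF C D P]
  note cf = coind_fmap_ntr[OF C D P]
  \<comment> \<open>The Yoneda isomorphism from \<open>N\<close> to the restriction of its coinduced module.\<close>
  define hat where "hat = (\<lambda>a y. \<lambda>b\<in>B. \<lambda>u\<in>arr D a b. fmap N a b u y)"
  have hat_apply: "hat a y b u = fmap N a b u y" if "b \<in> B" "u \<in> arr D a b" for a y b u
    using that by (simp add: hat_def)
  have hat: "hat a y \<in> ntr ?C (?R a) N" if "a \<in> B" "y \<in> carrier (fobj N a)" for a y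
    by (rule coind_ntrI[OF C D P])
      (use that in \<open>simp_all add: hat_def module_closed[OF N] module_add[OF N, simplified] D.add_arr_closed D.Cmp_arr
        module_Cmp[OF N, simplified]\<close>)
  \<comment> \<open>The transformation \<open>\<zeta>\<close> read on the coinduced modules without
    their copies.\<close>
  define \<omega> where "\<omega> = (\<lambda>\<zeta>. ncmp D (?m N) (ncmp D (fobj ?I N) (ninv D (?m N') (fobj ?I N') (?k N')) \<zeta>) (?k N))"
  have w: "\<omega> \<zeta> \<in> ntr D (?m N) (?m N')" if "\<zeta> \<in> ntr D (fobj ?I N) (fobj ?I N')" for \<zeta>
    unfolding \<omega>_def by (rule ncmp_ntr[OF coind_mod_module[OF C D P N] iN(3) ncmp_ntr[OF iN(1) that iN'(4)]])
  have w_apply: "?k N' d (\<omega> \<zeta> d \<xi>) = \<zeta> d (?k N d \<xi>)" "\<omega> \<zeta> d \<xi> \<in> ntr ?C (?R d) N'"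
    if z: "\<zeta> \<in> ntr D (fobj ?I N) (fobj ?I N')" and d: "d \<in> Ob D" and x: "\<xi> \<in> ntr ?C (?R d) N" for \<zeta> d \<xi>
  proof -
    have kx: "?k N d \<xi> \<in> carrier (fobj (fobj ?I N) d)" using ntr_closed[OF iN(3) d] x by simp
    show "?k N' d (\<omega> \<zeta> d \<xi>) = \<zeta> d (?k N d \<xi>)"
      using niso_apply(3)[OF iN'(2) d ntr_closed[OF z d kx]] d x kx by (simp add: \<omega>_def)
    show "\<omega> \<zeta> d \<xi> \<in> ntr ?C (?R d) N'" using ntr_closed[OF w[OF z] d] x by simp
  qed
  \<comment> \<open>The component of \<open>\<zeta>\<close> at an object of \<open>B\<close>, read
    through Yoneda: \<open>hat\<close> on the source side and evaluation at the identity on the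
    target side.\<close>
  define ret where "ret = (\<lambda>\<zeta>. \<lambda>a\<in>B. \<lambda>y\<in>carrier (fobj N a). \<omega> \<zeta> a (hat a y) a (Idt D a))"
  \<comment> \<open>This gives surjectivity: \<open>\<omega> \<zeta>\<close> is postcomposition with
    \<open>ret \<zeta>\<close>.\<close>
  have key: "\<omega> \<zeta> d \<xi> b u = ret \<zeta> b (\<xi> b u)"
    if z: "\<zeta> \<in> ntr D (fobj ?I N) (fobj ?I N')" and d: "d \<in> Ob D" and x: "\<xi> \<in> ntr ?C (?R d) N"
      and b: "b \<in> B" and u: "u \<in> arr D d b" for \<zeta> d \<xi> b u
  proof -
    have bD: "b \<in> Ob D" and bC: "b \<in> Ob ?C" and uI: "u \<in> arr D d (fobj (incl :: ('o, 'm, 'o, 'm) cfunctor) b)" using b u by simp_all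
    have xu: "\<xi> b u \<in> carrier (fobj N b)" using cntr(1)[OF x, of b u] b u by simp
    \<comment> \<open>By naturality of \<open>\<xi>\<close>, its translate along \<open>u\<close> is
      the Yoneda family of the element \<open>\<xi> b u\<close>.\<close>
    have "fmap (?m N) d b u \<xi> = hat b (\<xi> b u)"
    proof (rule coind_eqI[OF C D P cf[OF N d bD u x] hat[OF b xu]])
      fix c v assume c: "c \<in> Ob ?C" and v: "v \<in> arr D b (fobj (incl :: ('o, 'm, 'o, 'm) cfunctor) c)"
      show "fmap (?m N) d b u \<xi> c v = hat b (\<xi> b u) c v"
        using c v cntr(3)[OF x bC uI c, of v] coind_fmap_apply[OF C D P x c v, of u] by (simp add: hat_def del: coind_mod_simps)
    qed
    then have "\<omega> \<zeta> b (hat b (\<xi> b u)) = fmap (?m N') d b u (\<omega> \<zeta> d \<xi>)"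
      using ntr_natural[OF w[OF z] d bD u, of \<xi>] x by simp
    then have "\<omega> \<zeta> b (hat b (\<xi> b u)) b (Idt D b) = \<omega> \<zeta> d \<xi> b (Cmp D d b b (Idt D b) u)"
      using coind_fmap_apply[OF C D P w_apply(2)[OF z d x] bC, of "Idt D b" b u] D.Idt_arr[OF bD] by simp
    then show ?thesis using b xu d u bD by (simp add: ret_def D.Cmp_Idt_left)
  qed
  have ret: "ret \<zeta> \<in> ntr ?C N N'" if z: "\<zeta> \<in> ntr D (fobj ?I N) (fobj ?I N')" for \<zeta>
  proof (rule ntrI)
    fix a y assume "a \<in> Ob ?C" and y: "y \<in> carrier (fobj N a)"
    then have a: "a \<in> B" and aD: "a \<in> Ob D" by simp_all
    note wh = w_apply(2)[OF z aD hat[OF a y]]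
    show "ret \<zeta> a y \<in> carrier (fobj N' a)"
      using a y cntr(1)[OF wh, of a "Idt D a"] D.Idt_arr[OF aD] by (simp add: ret_def)
    fix y' assume y': "y' \<in> carrier (fobj N a)"
    have "hat a (y \<otimes>\<^bsub>fobj N a\<^esub> y') = hat a y \<otimes>\<^bsub>nat_group ?C (?R a) N\<^esub> hat a y'"
      by (rule coind_eqI[OF C D P hat nat_group_m_closed[OF R[OF aD] N hat hat]])
        (use a y y' module_m_closed[OF N _ y y'] in \<open>simp_all add: coind_mult_apply[OF C D P] hat_def module_mult[OF N]\<close>)
    then show "ret \<zeta> a (y \<otimes>\<^bsub>fobj N a\<^esub> y') = ret \<zeta> a y \<otimes>\<^bsub>fobj N' a\<^esub> ret \<zeta> a y'"
      using a y y' ntr_mult[OF w[OF z] aD, of "hat a y" "hat a y'"] hat[OF a y] hat[OF a y'] module_m_closed[OF N _ y y']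
        coind_mult_apply[OF C D P, of a "Idt D a" a] D.Idt_arr[OF aD]
      by (simp add: ret_def)
    fix b f assume "b \<in> Ob ?C" and "f \<in> arr ?C a b"
    then have b: "b \<in> B" and bD: "b \<in> Ob D" and f: "f \<in> arr D a b" by simp_all
    have "ret \<zeta> b (fmap N a b f y) = \<omega> \<zeta> a (hat a y) b f"
      using key[OF z aD hat[OF a y] b f] hat_apply[OF b f] by simp
    also have "\<dots> = fmap N' a b f (\<omega> \<zeta> a (hat a y) a (Idt D a))"
      using cntr(3)[OF wh, of a "Idt D a" b f] a b f aD bD D.Idt_arr[OF aD] by (simp add: D.Cmp_Idt_right)
    also have "\<dots> = fmap N' a b f (ret \<zeta> a y)" using a y by (simp add: ret_def)
    finally show "ret \<zeta> b (fmap N a b f y) = fmap N' a b f (ret \<zeta> a y)" .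
  qed (simp_all add: ret_def)
  show "bij_betw (fmap ?I N N') (ntr ?C N N') (ntr D (fobj ?I N) (fobj ?I N'))"
  proof (rule bij_betw_byWitness[where f' = ret])
    show "\<forall>\<beta>\<in>ntr ?C N N'. ret (fmap ?I N N' \<beta>) = \<beta>"
    proof
      fix \<beta> assume b: "\<beta> \<in> ntr ?C N N'"
      note z = coind_functor_fmap[OF C D P fit N N' b]
      show "ret (fmap ?I N N' \<beta>) = \<beta>"
      proof (rule ntr_eqI[OF ret[OF z] b])
        fix a y assume "a \<in> Ob ?C" and y: "y \<in> carrier (fobj N a)"
        then have a: "a \<in> B" and aD: "a \<in> Ob D" by simp_all
        have "\<omega> (fmap ?I N N' \<beta>) a (hat a y) = ncmp ?C (?R a) \<beta> (hat a y)"
        proof (rule coind_inj[OF C D P fit N' aD w_apply(2)[OF z aD hat[OF a y]] ncmp_ntr[OF R[OF aD] hat[OF a y] b]])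
          show "?k N' a (\<omega> (fmap ?I N N' \<beta>) a (hat a y)) = ?k N' a (ncmp ?C (?R a) \<beta> (hat a y))"
            unfolding w_apply(1)[OF z aD hat[OF a y]] by (rule app[OF aD hat[OF a y] b])
        qed
        then show "ret (fmap ?I N N' \<beta>) a y = \<beta> a y"
          using a y D.Idt_arr[OF aD] module_Idt[OF N, of a y] by (simp add: ret_def hat_def)
      qed
    qed
    show "\<forall>\<zeta>\<in>ntr D (fobj ?I N) (fobj ?I N'). fmap ?I N N' (ret \<zeta>) = \<zeta>"
    proof
      fix \<zeta> assume z: "\<zeta> \<in> ntr D (fobj ?I N) (fobj ?I N')"
      show "fmap ?I N N' (ret \<zeta>) = \<zeta>"
      proof (rule ntr_eqI[OF coind_functor_fmap[OF C D P fit N N' ret[OF z]] z])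
        fix d x assume d: "d \<in> Ob D" and x: "x \<in> carrier (fobj (fobj ?I N) d)"
        obtain \<xi> where xi: "\<xi> \<in> ntr ?C (?R d) N" "x = ?k N d \<xi>" by (rule coind_surj[OF C D P fit N d x])
        have "ncmp ?C (?R d) (ret \<zeta>) \<xi> = \<omega> \<zeta> d \<xi>"
          by (rule coind_eqI[OF C D P ncmp_ntr[OF R[OF d] xi(1) ret[OF z]] w_apply(2)[OF z d xi(1)]])
            (simp add: key[OF z d xi(1)])
        then show "fmap ?I N N' (ret \<zeta>) d x = \<zeta> d x"
          unfolding xi(2) app[OF d xi(1) ret[OF z]] using w_apply(1)[OF z d xi(1)] by simp
      qed
    qed
  qed (use ret coind_functor_fmap[OF C D P fit N N'] in auto)
qed

subsection \<open>Smallness\<close>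

text \<open>Currying: a function on the disjoint union is a family of functions on the fibres. Each
  fibre is encoded by one element of the universe, and then so is the resulting function on
  \<open>S\<close>.\<close>

lemma small_Sigma:
  assumes S: "small TYPE('v) S" and X: "\<And>s. s \<in> S \<Longrightarrow> small TYPE('v) (X s)"
  shows "small TYPE('v) (Sigma S X)"
proof -
  obtain e :: "('a \<Rightarrow> 'v) \<Rightarrow> 'v" where e: "inj_on e (S \<rightarrow>\<^sub>E UNIV)" using S by (auto simp: small_def)
  have "\<forall>s\<in>S. \<exists>k :: ('b \<Rightarrow> 'v) \<Rightarrow> 'v. inj_on k (X s \<rightarrow>\<^sub>E UNIV)" using X by (auto simp: small_def)
  from bchoice[OF this] obtain k :: "'a \<Rightarrow> ('b \<Rightarrow> 'v) \<Rightarrow> 'v" where k: "\<And>s. s \<in> S \<Longrightarrow> inj_on (k s) (X s \<rightarrow>\<^sub>E UNIV)"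
    by blast
  define E where "E = (\<lambda>f. e (\<lambda>s\<in>S. k s (\<lambda>x\<in>X s. f (s, x))))"
  have "inj_on E (Sigma S X \<rightarrow>\<^sub>E UNIV)"
  proof (rule inj_onI)
    fix f g assume f: "f \<in> Sigma S X \<rightarrow>\<^sub>E UNIV" and g: "g \<in> Sigma S X \<rightarrow>\<^sub>E UNIV" and eq: "E f = E g"
    have "(\<lambda>s\<in>S. k s (\<lambda>x\<in>X s. f (s, x))) = (\<lambda>s\<in>S. k s (\<lambda>x\<in>X s. g (s, x)))"
      by (rule inj_onD[OF e]) (use eq in \<open>auto simp: E_def\<close>)
    then have "k s (\<lambda>x\<in>X s. f (s, x)) = k s (\<lambda>x\<in>X s. g (s, x))" if "s \<in> S" for s
      using that by (auto dest: fun_cong[of _ _ s])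
    then have fg: "(\<lambda>x\<in>X s. f (s, x)) = (\<lambda>x\<in>X s. g (s, x))" if "s \<in> S" for s
      using that by (intro inj_onD[OF k[OF that]]) auto
    have "f (s, x) = g (s, x)" if "s \<in> S" "x \<in> X s" for s x
      using fun_cong[OF fg[OF that(1)], of x] that(2) by simp
    then show "f = g" by (intro PiE_ext[OF f g]) auto
  qed
  then show ?thesis unfolding small_def by blast
qed

text \<open>Functions on \<open>X\<close> become functions on \<open>Y\<close> by composition with
  an inverse of \<open>f\<close>, and this passage is injective.\<close>

lemma small_inj:
  assumes Y: "small TYPE('v) Y" and f: "inj_on f X" "f ` X \<subseteq> Y"
  shows "small TYPE('v) X"
proof -
  obtain e :: "('a \<Rightarrow> 'v) \<Rightarrow> 'v" where e: "inj_on e (Y \<rightarrow>\<^sub>E UNIV)" using Y by (auto simp: small_def)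
  define E where "E = (\<lambda>g. e (\<lambda>y\<in>Y. g (inv_into X f y)))"
  have "inj_on E (X \<rightarrow>\<^sub>E UNIV)"
  proof (rule inj_onI)
    fix g h assume g: "g \<in> X \<rightarrow>\<^sub>E UNIV" and h: "h \<in> X \<rightarrow>\<^sub>E UNIV" and eq: "E g = E h"
    have *: "(\<lambda>y\<in>Y. g (inv_into X f y)) = (\<lambda>y\<in>Y. h (inv_into X f y))"
      by (rule inj_onD[OF e]) (use eq in \<open>auto simp: E_def\<close>)
    have "g x = h x" if "x \<in> X" for x
      using fun_cong[OF *, of "f x"] that f by (auto simp: inv_into_f_f)
    then show "g = h" by (intro PiE_ext[OF g h]) auto
  qed
  then show ?thesis unfolding small_def by blast
qed

lemma small_singleton: "small TYPE('v) {x}"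
  unfolding small_def by (intro exI[of _ "\<lambda>f. f x"] inj_onI) (auto intro: PiE_ext)

context
  fixes C :: "('o, 'm) pcat" and D :: "('p, 'n) pcat" and P
  assumes C: "preadditive_category C" and D: "preadditive_category D" and P: "additive_functor C D P"
begin

text \<open>By fullness every arrow out of \<open>fobj P a\<close> is the image of an arrow out of
  \<open>a\<close>, so naturality determines a transformation from its value at the identity. The
  value lies in \<open>fobj N a\<close>.\<close>

lemma fits_coind_full:
  assumes N: "additive_functor C Ab (N :: ('o, 'm, 'v) cmod)" and a: "a \<in> Ob C"
    and full: "\<And>b u. b \<in> Ob C \<Longrightarrow> u \<in> arr D (fobj P a) (fobj P b) \<Longrightarrow> \<exists>f\<in>arr C a b. fmap P a b f = u"
  shows "fits TYPE('v) (ntr C (rep_left C D P (fobj P a)) N)"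
proof (rule fits_inj[OF fits_same])
  interpret D: preadditive_category D by (rule D)
  note Pa = additive_functor_Ob[OF P a]
  let ?f = "\<lambda>\<xi>. \<xi> a (Idt D (fobj P a))"
  show "?f ` ntr C (rep_left C D P (fobj P a)) N \<subseteq> carrier (fobj N a)"
    using coind_ntr(1)[OF C D P _ a D.Idt_arr[OF Pa]] by auto
  show "inj_on ?f (ntr C (rep_left C D P (fobj P a)) N)"
  proof (rule inj_onI)
    fix \<xi> \<xi>' assume x: "\<xi> \<in> ntr C (rep_left C D P (fobj P a)) N" "\<xi>' \<in> ntr C (rep_left C D P (fobj P a)) N"
      and eq: "\<xi> a (Idt D (fobj P a)) = \<xi>' a (Idt D (fobj P a))"
    show "\<xi> = \<xi>'"
    proof (rule coind_eqI[OF C D P x])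
      fix b u assume b: "b \<in> Ob C" and u: "u \<in> arr D (fobj P a) (fobj P b)"
      from full[OF b u] obtain f where f: "f \<in> arr C a b" "fmap P a b f = u" by blast
      have "Cmp D (fobj P a) (fobj P a) (fobj P b) (fmap P a b f) (Idt D (fobj P a)) = u"
        using f u D.Cmp_Idt_right[OF Pa additive_functor_Ob[OF P b]] by simp
      then show "\<xi> b u = \<xi>' b u"
        using coind_ntr(3)[OF C D P x(1) a D.Idt_arr[OF Pa] b f(1)] coind_ntr(3)[OF C D P x(2) a D.Idt_arr[OF Pa] b f(1)] eq
        by simp
    qed
  qed
qed

text \<open>A transformation is determined by its entries at the objects of a skeleton, which
  together form one function on a small set with values in the universe.\<close>

lemma fits_coind_small:
  assumes N: "additive_functor C Ab (N :: ('o, 'm, 'v) cmod)" and d: "d \<in> Ob D"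
    and S: "S \<subseteq> Ob C" "small TYPE('v) S" and sm: "\<And>s. s \<in> S \<Longrightarrow> small TYPE('v) (arr D d (fobj P s))"
    and sk: "\<And>a. a \<in> Ob C \<Longrightarrow> \<exists>s\<in>S. isomorphic C a s"
  shows "fits TYPE('v) (ntr C (rep_left C D P d) N)"
proof -
  interpret D: preadditive_category D by (rule D)
  let ?X = "SIGMA s : S. arr D d (fobj P s)"
  obtain e :: "_ \<Rightarrow> 'v" where e: "inj_on e (?X \<rightarrow>\<^sub>E (UNIV :: 'v set))"
    using small_Sigma[OF S(2), of "\<lambda>s. arr D d (fobj P s)"] sm unfolding small_def by blast
  let ?f = "\<lambda>\<xi>. \<lambda>(s, u)\<in>?X. (\<xi> s u :: 'v)"
  have "inj_on ?f (ntr C (rep_left C D P d) N)"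
  proof (rule inj_onI)
    fix \<xi> \<xi>' assume x: "\<xi> \<in> ntr C (rep_left C D P d) N" "\<xi>' \<in> ntr C (rep_left C D P d) N" and eq: "?f \<xi> = ?f \<xi>'"
    have eqS: "\<xi> s u = \<xi>' s u" if "s \<in> S" "u \<in> arr D d (fobj P s)" for s u
      using fun_cong[OF eq, of "(s, u)"] that by simp
    show "\<xi> = \<xi>'"
    proof (rule coind_eqI[OF C D P x])
      fix a u assume a: "a \<in> Ob C" and u: "u \<in> arr D d (fobj P a)"
      obtain s f g where s: "s \<in> S" and f: "f \<in> arr C a s" and g: "g \<in> arr C s a" and gf: "Cmp C a s a g f = Idt C a"
        using sk[OF a] by (auto simp: isomorphic_def iso_arr_def)
      have sC: "s \<in> Ob C" using s S by auto
      note ob = additive_functor_Ob[OF P a] additive_functor_Ob[OF P sC]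
      \<comment> \<open>The arrow \<open>u\<close> moved to the skeleton along \<open>f\<close>.
        Naturality along \<open>g\<close> recovers the entry at \<open>u\<close> from the entry at
        \<open>?v\<close>.\<close>
      let ?v = "Cmp D d (fobj P a) (fobj P s) (fmap P a s f) u"
      have v: "?v \<in> arr D d (fobj P s)" by (rule D.Cmp_arr[OF d ob u additive_functor_arr[OF P a sC f]])
      have "Cmp D d (fobj P s) (fobj P a) (fmap P s a g) ?v = Cmp D d (fobj P a) (fobj P a) (fmap P a a (Cmp C a s a g f)) u"
        using D.Cmp_assoc[OF d ob(1,2,1) u additive_functor_arr[OF P a sC f] additive_functor_arr[OF P sC a g]]
          additive_functor_Cmp[OF P a sC a f g] by simp
      also have "\<dots> = u" using d ob u a by (simp add: gf additive_functor_Idt[OF P] D.Cmp_Idt_left)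
      finally show "\<xi> a u = \<xi>' a u"
        using coind_ntr(3)[OF C D P x(1) sC v a g] coind_ntr(3)[OF C D P x(2) sC v a g] eqS[OF s v] by simp
    qed
  qed
  moreover have "?f ` ntr C (rep_left C D P d) N \<subseteq> ?X \<rightarrow>\<^sub>E UNIV" by (auto simp: PiE_iff extensional_def split: if_splits)
  ultimately have "inj_on (e \<circ> ?f) (ntr C (rep_left C D P d) N)"
    using comp_inj_on[OF _ inj_on_subset[OF e]] by blast
  then show ?thesis unfolding fits_def by blast
qed

end

section \<open>Bimodules\<close>

lemma frag_extend_fun_diff: "frag_extend (\<lambda>p. f p - g p) s = frag_extend f s - frag_extend g s"
proof (rule frag_induction[of s UNIV])
  show "frag_extend (\<lambda>p. f p - g p) (a - b) = frag_extend f (a - b) - frag_extend g (a - b)"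
    if "frag_extend (\<lambda>p. f p - g p) a = frag_extend f a - frag_extend g a"
      "frag_extend (\<lambda>p. f p - g p) b = frag_extend f b - frag_extend g b" for a b
    using that by (simp add: frag_extend_diff)
qed simp_all

lemma module_sum_closed: "module R X \<Longrightarrow> x \<in> carrier X \<Longrightarrow> y \<in> carrier X \<Longrightarrow> x \<oplus>\<^bsub>X\<^esub> y \<in> carrier X"
  by (rule abelian_monoid.a_closed[OF abelian_group.axioms(1)[OF module.axioms(2)]])

context
  fixes R :: "'r ring" and X :: "('r, 'x) module" and Y :: "('r, 'y) module"
  assumes X: "module R X" and Y: "module R Y"
begin

lemma rtensor_rel_subgroup: "subgroup (rtensor_rel R X Y) (free_Abelian_group (carrier X \<times> carrier Y))"
proof -
  let ?Z = "free_Abelian_group (carrier X \<times> carrier Y)"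
  interpret Z: comm_group ?Z by (rule abelian_free_Abelian_group)
  have d: "s - t \<in> carrier ?Z" if "s \<in> carrier ?Z" "t \<in> carrier ?Z" for s t
    using that keys_diff[of s t] by auto
  show ?thesis
    unfolding rtensor_rel_def
    by (rule Z.generate_is_subgroup, intro Un_least subsetI; clarify; intro d;
        simp add: module_sum_closed[OF X] module_sum_closed[OF Y] module.smult_closed[OF X] module.smult_closed[OF Y])
qed

lemma rtensor_rel_zero: "0 \<in> rtensor_rel R X Y"
  using subgroup.one_closed[OF rtensor_rel_subgroup] by simp

lemma rtensor_rel_keys: "s \<in> rtensor_rel R X Y \<Longrightarrow> Poly_Mapping.keys s \<subseteq> carrier X \<times> carrier Y"
  using subsetD[OF subgroup.subset[OF rtensor_rel_subgroup]] by simp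

lemma rtensor_rel_plus: "s \<in> rtensor_rel R X Y \<Longrightarrow> t \<in> rtensor_rel R X Y \<Longrightarrow> s + t \<in> rtensor_rel R X Y"
  using subgroup.m_closed[OF rtensor_rel_subgroup] by simp

lemma rtensor_rel_uminus: "s \<in> rtensor_rel R X Y \<Longrightarrow> - s \<in> rtensor_rel R X Y"
  using subgroup.m_inv_closed[OF rtensor_rel_subgroup, of s] rtensor_rel_keys[of s] by simp

lemma rtensor_rel_diff: "s \<in> rtensor_rel R X Y \<Longrightarrow> t \<in> rtensor_rel R X Y \<Longrightarrow> s - t \<in> rtensor_rel R X Y"
  using rtensor_rel_plus[OF _ rtensor_rel_uminus, of s t] by simp

lemma rtensor_rel_gen:
  "x \<in> carrier X \<Longrightarrow> x' \<in> carrier X \<Longrightarrow> y \<in> carrier Y \<Longrightarrow>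
    frag_of (x \<oplus>\<^bsub>X\<^esub> x', y) - frag_of (x, y) - frag_of (x', y) \<in> rtensor_rel R X Y"
  "x \<in> carrier X \<Longrightarrow> y \<in> carrier Y \<Longrightarrow> y' \<in> carrier Y \<Longrightarrow>
    frag_of (x, y \<oplus>\<^bsub>Y\<^esub> y') - frag_of (x, y) - frag_of (x, y') \<in> rtensor_rel R X Y"
  "r \<in> carrier R \<Longrightarrow> x \<in> carrier X \<Longrightarrow> y \<in> carrier Y \<Longrightarrow>
    frag_of (r \<odot>\<^bsub>X\<^esub> x, y) - frag_of (x, r \<odot>\<^bsub>Y\<^esub> y) \<in> rtensor_rel R X Y"
  unfolding rtensor_rel_def by (rule generate.incl, blast)+

lemma rtensor_rel_induct:
  assumes s: "s \<in> rtensor_rel R X Y"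
    and zero: "P 0" and plus: "\<And>s t. P s \<Longrightarrow> P t \<Longrightarrow> P (s + t)" and minus: "\<And>s. P s \<Longrightarrow> P (- s)"
    and gen: "\<And>x x' y. x \<in> carrier X \<Longrightarrow> x' \<in> carrier X \<Longrightarrow> y \<in> carrier Y \<Longrightarrow>
        P (frag_of (x \<oplus>\<^bsub>X\<^esub> x', y) - frag_of (x, y) - frag_of (x', y))"
      "\<And>x y y'. x \<in> carrier X \<Longrightarrow> y \<in> carrier Y \<Longrightarrow> y' \<in> carrier Y \<Longrightarrow>
        P (frag_of (x, y \<oplus>\<^bsub>Y\<^esub> y') - frag_of (x, y) - frag_of (x, y'))"
      "\<And>r x y. r \<in> carrier R \<Longrightarrow> x \<in> carrier X \<Longrightarrow> y \<in> carrier Y \<Longrightarrow>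
        P (frag_of (r \<odot>\<^bsub>X\<^esub> x, y) - frag_of (x, r \<odot>\<^bsub>Y\<^esub> y))"
  shows "P s"
  using s unfolding rtensor_rel_def
proof (induction rule: generate.induct)
  case one
  then show ?case by (simp add: zero)
next
  case (incl h)
  then show ?case using gen by blast
next
  case (inv h)
  then have "h \<in> rtensor_rel R X Y" unfolding rtensor_rel_def by (rule generate.incl)
  moreover have "P h" using inv gen by blast
  ultimately show ?case using rtensor_rel_keys[of h] minus[of h] by simp
next
  case (eng s t)
  then show ?case by (simp add: plus)
qed

lemma rtensor_class_eqI:
  assumes "Poly_Mapping.keys t \<subseteq> carrier X \<times> carrier Y" and "s - t \<in> rtensor_rel R X Y"
  shows "rtensor_class R X Y s = rtensor_class R X Y t"
proof -
  let ?Z = "free_Abelian_group (carrier X \<times> carrier Y)"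
  interpret Z: comm_group ?Z by (rule abelian_free_Abelian_group)
  have "s \<in> rtensor_rel R X Y #>\<^bsub>?Z\<^esub> t"
    unfolding r_coset_def using assms(2) by (auto intro!: bexI[of _ "s - t"])
  then show ?thesis
    unfolding rtensor_class_def using Z.repr_independence[OF _ _ rtensor_rel_subgroup, of s t] assms(1) by simp
qed

lemma rtensor_class_iff:
  assumes "Poly_Mapping.keys t \<subseteq> carrier X \<times> carrier Y"
  shows "s \<in> rtensor_class R X Y t \<longleftrightarrow> s - t \<in> rtensor_rel R X Y"
  unfolding rtensor_class_def r_coset_def by (force intro!: bexI[of _ "s - t"])

lemma rtensor_class_closed: "x \<in> carrier X \<Longrightarrow> y \<in> carrier Y \<Longrightarrow> rtensor_class R X Y (frag_of (x, y)) \<in> carrier (rtensor R X Y)"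
  by (auto simp: rtensor_def rtensor_class_def carrier_FactGroup)

lemma rtensor_class_plus:
  assumes "Poly_Mapping.keys s \<subseteq> carrier X \<times> carrier Y" "Poly_Mapping.keys t \<subseteq> carrier X \<times> carrier Y"
  shows "rtensor_class R X Y (s + t) = rtensor_class R X Y s \<otimes>\<^bsub>rtensor R X Y\<^esub> rtensor_class R X Y t"
proof -
  let ?Z = "free_Abelian_group (carrier X \<times> carrier Y)"
  interpret Z: comm_group ?Z by (rule abelian_free_Abelian_group)
  show ?thesis
    using normal.rcos_sum[OF Z.subgroup_imp_normal[OF rtensor_rel_subgroup], of s t] assms
    by (simp add: rtensor_def rtensor_class_def)
qed

lemma rtensor_class_add_left:
  assumes "x \<in> carrier X" "x' \<in> carrier X" "y \<in> carrier Y"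
  shows "rtensor_class R X Y (frag_of (x \<oplus>\<^bsub>X\<^esub> x', y))
    = rtensor_class R X Y (frag_of (x, y)) \<otimes>\<^bsub>rtensor R X Y\<^esub> rtensor_class R X Y (frag_of (x', y))"
proof -
  have k: "Poly_Mapping.keys (frag_of (x, y)) \<subseteq> carrier X \<times> carrier Y"
    "Poly_Mapping.keys (frag_of (x', y)) \<subseteq> carrier X \<times> carrier Y" using assms by simp_all
  show ?thesis
    unfolding rtensor_class_plus[OF k, symmetric]
  proof (rule rtensor_class_eqI)
    show "Poly_Mapping.keys (frag_of (x, y) + frag_of (x', y)) \<subseteq> carrier X \<times> carrier Y"
      using keys_add k by (rule order_trans[OF _ Un_least])
  qed (use rtensor_rel_gen(1)[OF assms] in \<open>simp add: diff_diff_add\<close>)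
qed

lemma rtensor_class_add_right:
  assumes "x \<in> carrier X" "y \<in> carrier Y" "y' \<in> carrier Y"
  shows "rtensor_class R X Y (frag_of (x, y \<oplus>\<^bsub>Y\<^esub> y'))
    = rtensor_class R X Y (frag_of (x, y)) \<otimes>\<^bsub>rtensor R X Y\<^esub> rtensor_class R X Y (frag_of (x, y'))"
proof -
  have k: "Poly_Mapping.keys (frag_of (x, y)) \<subseteq> carrier X \<times> carrier Y"
    "Poly_Mapping.keys (frag_of (x, y')) \<subseteq> carrier X \<times> carrier Y" using assms by simp_all
  show ?thesis
    unfolding rtensor_class_plus[OF k, symmetric]
  proof (rule rtensor_class_eqI)
    show "Poly_Mapping.keys (frag_of (x, y) + frag_of (x, y')) \<subseteq> carrier X \<times> carrier Y"
      using keys_add k by (rule order_trans[OF _ Un_least])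
  qed (use rtensor_rel_gen(2)[OF assms] in \<open>simp add: diff_diff_add\<close>)
qed

end

text \<open>The composite in the tensor product category does not depend on representatives.\<close>

lemma rtensor_composition:
  fixes R :: "'r ring" and X1 X2 X3 :: "('r, 'x) module" and Y1 Y2 Y3 :: "('r, 'y) module"
  assumes m: "module R X1" "module R Y1" "module R X2" "module R Y2" "module R X3" "module R Y3"
    and cx: "\<And>x x'. x \<in> carrier X2 \<Longrightarrow> x' \<in> carrier X1 \<Longrightarrow> cx x x' \<in> carrier X3"
    and cxl: "\<And>x w x'. x \<in> carrier X2 \<Longrightarrow> w \<in> carrier X2 \<Longrightarrow> x' \<in> carrier X1 \<Longrightarrow> cx (x \<oplus>\<^bsub>X2\<^esub> w) x' = cx x x' \<oplus>\<^bsub>X3\<^esub> cx w x'"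
    and cxr: "\<And>x w x'. x \<in> carrier X1 \<Longrightarrow> w \<in> carrier X1 \<Longrightarrow> x' \<in> carrier X2 \<Longrightarrow> cx x' (x \<oplus>\<^bsub>X1\<^esub> w) = cx x' x \<oplus>\<^bsub>X3\<^esub> cx x' w"
    and cxs: "\<And>r x x'. r \<in> carrier R \<Longrightarrow> x \<in> carrier X2 \<Longrightarrow> x' \<in> carrier X1 \<Longrightarrow> cx (r \<odot>\<^bsub>X2\<^esub> x) x' = r \<odot>\<^bsub>X3\<^esub> cx x x'"
    and cxs': "\<And>r x x'. r \<in> carrier R \<Longrightarrow> x \<in> carrier X2 \<Longrightarrow> x' \<in> carrier X1 \<Longrightarrow> cx x (r \<odot>\<^bsub>X1\<^esub> x') = r \<odot>\<^bsub>X3\<^esub> cx x x'"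
    and cy: "\<And>x x'. x \<in> carrier Y2 \<Longrightarrow> x' \<in> carrier Y1 \<Longrightarrow> cy x x' \<in> carrier Y3"
    and cyl: "\<And>x w x'. x \<in> carrier Y2 \<Longrightarrow> w \<in> carrier Y2 \<Longrightarrow> x' \<in> carrier Y1 \<Longrightarrow> cy (x \<oplus>\<^bsub>Y2\<^esub> w) x' = cy x x' \<oplus>\<^bsub>Y3\<^esub> cy w x'"
    and cyr: "\<And>x w x'. x \<in> carrier Y1 \<Longrightarrow> w \<in> carrier Y1 \<Longrightarrow> x' \<in> carrier Y2 \<Longrightarrow> cy x' (x \<oplus>\<^bsub>Y1\<^esub> w) = cy x' x \<oplus>\<^bsub>Y3\<^esub> cy x' w"
    and cys: "\<And>r x x'. r \<in> carrier R \<Longrightarrow> x \<in> carrier Y2 \<Longrightarrow> x' \<in> carrier Y1 \<Longrightarrow> cy (r \<odot>\<^bsub>Y2\<^esub> x) x' = r \<odot>\<^bsub>Y3\<^esub> cy x x'"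
    and cys': "\<And>r x x'. r \<in> carrier R \<Longrightarrow> x \<in> carrier Y2 \<Longrightarrow> x' \<in> carrier Y1 \<Longrightarrow> cy x (r \<odot>\<^bsub>Y1\<^esub> x') = r \<odot>\<^bsub>Y3\<^esub> cy x x'"
    and el: "x \<in> carrier X2" "y \<in> carrier Y2" "x' \<in> carrier X1" "y' \<in> carrier Y1"
  shows "(\<Union>s\<in>rtensor_class R X2 Y2 (frag_of (x, y)). \<Union>s'\<in>rtensor_class R X1 Y1 (frag_of (x', y')).
      rtensor_class R X3 Y3 (frag_extend (\<lambda>(x, y). frag_extend (\<lambda>(x', y'). frag_of (cx x x', cy y y')) s') s))
    = rtensor_class R X3 Y3 (frag_of (cx x x', cy y y'))"
proof -
  \<comment> \<open>The composition on formal sums. It is biadditive before any relation is divided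
    out.\<close>
  define B where "B = (\<lambda>s s'. frag_extend (\<lambda>(x, y). frag_extend (\<lambda>(x', y'). frag_of (cx x x', cy y y')) s') s)"
  let ?S1 = "carrier X1 \<times> carrier Y1" and ?S2 = "carrier X2 \<times> carrier Y2"
  let ?R1 = "rtensor_rel R X1 Y1" and ?R2 = "rtensor_rel R X2 Y2" and ?R3 = "rtensor_rel R X3 Y3"
  have B_diff_left: "B (s - t) s' = B s s' - B t s'" for s t s' by (simp add: B_def frag_extend_diff)
  have B_diff_right: "B s (s' - t') = B s s' - B s t'" for s s' t'
    by (simp add: B_def frag_extend_diff frag_extend_fun_diff case_prod_beta')
  have B_0: "B 0 s' = 0" "B s 0 = 0" for s s' by (simp_all add: B_def frag_extend_eq_0 case_prod_beta')
  have B_of: "B (frag_of (a, b)) (frag_of (c, d)) = frag_of (cx a c, cy b d)" for a b c d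
    by (simp add: B_def)
  have B_minus: "B (- s) s' = - B s s'" "B s (- s') = - B s s'" for s s'
    using B_diff_left[of 0 s s'] B_diff_right[of s 0 s'] by (simp_all add: B_0)
  have B_plus: "B (s + t) s' = B s s' + B t s'" "B s (s' + t') = B s s' + B s t'" for s t s' t'
    using B_diff_left[of s "- t" s'] B_diff_right[of s s' "- t'"] by (simp_all add: B_minus)
  note R3 = rtensor_rel_gen[OF m(5,6)]
  note z3 = rtensor_rel_zero[OF m(5,6)] and d3 = rtensor_rel_diff[OF m(5,6)]
    and p3 = rtensor_rel_plus[OF m(5,6)] and u3 = rtensor_rel_uminus[OF m(5,6)]
  \<comment> \<open>Induction on \<open>s'\<close> reduces to a single pair on the right, and
    induction on the relation \<open>s\<close> then to a generator. Bilinearity of \<open>cx\<close>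
    and \<open>cy\<close> turns it into a generating relation of the target.\<close>
  have L: "B s s' \<in> ?R3" if s: "s \<in> ?R2" and s': "Poly_Mapping.keys s' \<subseteq> ?S1" for s s'
  proof (rule free_Abelian_group_induct[OF s'])
    fix p assume "p \<in> ?S1"
    then obtain c d where p: "p = (c, d)" "c \<in> carrier X1" "d \<in> carrier Y1" by auto
    show "B s (frag_of p) \<in> ?R3"
      unfolding p(1)
      by (rule rtensor_rel_induct[OF m(3,4) s])
        (simp_all add: B_0 z3 B_plus p3 B_minus u3 B_diff_left B_of cxl cyl cxs cys R3 cx cy p)
  qed (simp_all add: B_0 z3 B_diff_right d3)
  have Rr: "B s s' \<in> ?R3" if s': "s' \<in> ?R1" and s: "Poly_Mapping.keys s \<subseteq> ?S2" for s s'
  proof (rule free_Abelian_group_induct[OF s])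
    fix p assume "p \<in> ?S2"
    then obtain c d where p: "p = (c, d)" "c \<in> carrier X2" "d \<in> carrier Y2" by auto
    show "B (frag_of p) s' \<in> ?R3"
      unfolding p(1)
      by (rule rtensor_rel_induct[OF m(1,2) s'])
        (simp_all add: B_0 z3 B_plus p3 B_minus u3 B_diff_right B_of cxr cyr cxs' cys' R3 cx cy p)
  qed (simp_all add: B_0 z3 B_diff_left d3)
  have f1: "Poly_Mapping.keys (frag_of (x', y')) \<subseteq> ?S1" and f2: "Poly_Mapping.keys (frag_of (x, y)) \<subseteq> ?S2"
    and f3: "Poly_Mapping.keys (frag_of (cx x x', cy y y')) \<subseteq> carrier X3 \<times> carrier Y3"
    using el cx cy by auto
  have const: "rtensor_class R X3 Y3 (B s s') = rtensor_class R X3 Y3 (frag_of (cx x x', cy y y'))"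
    if s: "s \<in> rtensor_class R X2 Y2 (frag_of (x, y))" and s': "s' \<in> rtensor_class R X1 Y1 (frag_of (x', y'))" for s s'
  proof (rule rtensor_class_eqI[OF m(5,6) f3])
    have r: "s - frag_of (x, y) \<in> ?R2" using s rtensor_class_iff[OF m(3,4) f2] by simp
    have r': "s' - frag_of (x', y') \<in> ?R1" using s' rtensor_class_iff[OF m(1,2) f1] by simp
    have "Poly_Mapping.keys (frag_of (x', y') + (s' - frag_of (x', y'))) \<subseteq> ?S1"
      using keys_add[of "frag_of (x', y')" "s' - frag_of (x', y')"] f1 rtensor_rel_keys[OF m(1,2) r'] by blast
    then have k: "Poly_Mapping.keys s' \<subseteq> ?S1" by simp
    \<comment> \<open>The two representatives are exchanged one at a time, which leaves one term for
      \<open>L\<close> and one for \<open>Rr\<close>.\<close>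
    have "B s s' - frag_of (cx x x', cy y y') = B (s - frag_of (x, y)) s' + B (frag_of (x, y)) (s' - frag_of (x', y'))"
      by (simp add: B_diff_left B_diff_right B_of)
    then show "B s s' - frag_of (cx x x', cy y y') \<in> ?R3"
      using p3[OF L[OF r k] Rr[OF r' f2]] by simp
  qed
  have "frag_of (x, y) \<in> rtensor_class R X2 Y2 (frag_of (x, y))" "frag_of (x', y') \<in> rtensor_class R X1 Y1 (frag_of (x', y'))"
    using rtensor_class_iff[OF m(3,4) f2] rtensor_class_iff[OF m(1,2) f1] rtensor_rel_zero[OF m(3,4)] rtensor_rel_zero[OF m(1,2)]
    by simp_all
  then have "(\<Union>s\<in>rtensor_class R X2 Y2 (frag_of (x, y)). \<Union>s'\<in>rtensor_class R X1 Y1 (frag_of (x', y')).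
      rtensor_class R X3 Y3 (B s s')) = rtensor_class R X3 Y3 (frag_of (cx x x', cy y y'))"
    using const by blast
  then show ?thesis by (simp only: B_def)
qed

lemma hom_module_simps [simp]:
  "carrier (hom_module C a b) = arr C a b" "add (hom_module C a b) = mult (Hom C a b)"
  "smult (hom_module C a b) = Scal C a b"
  by (simp_all add: hom_module_def)

lemma ropp_simps [simp]:
  "Ob (ropp C) = Ob C" "Idt (ropp C) = Idt C" "Cmp (ropp C) a b c g f = Cmp C c b a f g"
  "hom_module (ropp C) a b = hom_module C b a"
  by (simp_all add: ropp_def hom_module_def opp_def)

lemma zero_object_arr:
  assumes C: "preadditive_category C" and z: "zero_object C z" and a: "a \<in> Ob C"
  shows "arr C a z = {zero_arr C a z}" "arr C z a = {zero_arr C z a}" "Idt C z = zero_arr C z z"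
proof -
  interpret preadditive_category C by fact
  have zO: "z \<in> Ob C" using z by (simp add: zero_object_def)
  have u: "\<exists>!f. f \<in> arr C z b" "\<exists>!f. f \<in> arr C b z" if "b \<in> Ob C" for b using z that by (auto simp: zero_object_def)
  show "arr C a z = {zero_arr C a z}" using u(2)[OF a] zero_arr_closed[OF a zO] by blast
  show "arr C z a = {zero_arr C z a}" using u(1)[OF a] zero_arr_closed[OF zO a] by blast
  show "Idt C z = zero_arr C z z" using u(1)[OF zO] zero_arr_closed[OF zO zO] Idt_arr[OF zO] by blast
qed

section \<open>The two actions on the bimodule\<close>

locale triangular =
  fixes R :: "'r ring" and T :: "('ot, 't, 'r) rcat" and U :: "('ou, 'u, 'r) rcat"
    and M :: "('ou \<times> 'ot, ('u \<times> 't \<Rightarrow>\<^sub>0 int) set, 'w) cmod"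
  assumes R_T: "R_category R T" and R_U: "R_category R U" and M: "additive_functor (tensor_cat R U (ropp T)) Ab M"
begin

sublocale T: preadditive_category T using R_T by (simp add: R_category_def)
sublocale U: preadditive_category U using R_U by (simp add: R_category_def)

abbreviation "UT \<equiv> tensor_cat R U (ropp T)"

lemma Hom_module: "a \<in> Ob T \<Longrightarrow> a' \<in> Ob T \<Longrightarrow> module R (hom_module T a a')"
  "b \<in> Ob U \<Longrightarrow> b' \<in> Ob U \<Longrightarrow> module R (hom_module U b b')"
  using R_T R_U by (simp_all add: R_category_def)

lemma tri_tensor_eq: "tri_tensor R T U b b' a' a u t = rtensor_class R (hom_module U b b') (hom_module T a a') (frag_of (u, t))"
  by (simp add: tri_tensor_def)

lemma UT_simps: "Ob UT = Ob U \<times> Ob T" "Hom UT (b, a') (b', a) = rtensor R (hom_module U b b') (hom_module T a a')"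
  "Idt UT (b, a) = tri_tensor R T U b b a a (Idt U b) (Idt T a)"
  by (simp_all add: tensor_cat_def tri_tensor_def)

lemma tri_tensor_arr:
  assumes "b \<in> Ob U" "b' \<in> Ob U" "a \<in> Ob T" "a' \<in> Ob T" "u \<in> arr U b b'" "t \<in> arr T a a'"
  shows "tri_tensor R T U b b' a' a u t \<in> arr UT (b, a') (b', a)"
  using assms rtensor_class_closed[OF Hom_module(2,1), of b b' a a' u t] by (simp add: tri_tensor_eq UT_simps)

lemma tri_tensor_add:
  assumes "b \<in> Ob U" "b' \<in> Ob U" "a \<in> Ob T" "a' \<in> Ob T" "u \<in> arr U b b'" "t \<in> arr T a a'"
  shows "u' \<in> arr U b b' \<Longrightarrow> tri_tensor R T U b b' a' a (u \<otimes>\<^bsub>Hom U b b'\<^esub> u') t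
      = tri_tensor R T U b b' a' a u t \<otimes>\<^bsub>Hom UT (b, a') (b', a)\<^esub> tri_tensor R T U b b' a' a u' t"
    and "t' \<in> arr T a a' \<Longrightarrow> tri_tensor R T U b b' a' a u (t \<otimes>\<^bsub>Hom T a a'\<^esub> t')
      = tri_tensor R T U b b' a' a u t \<otimes>\<^bsub>Hom UT (b, a') (b', a)\<^esub> tri_tensor R T U b b' a' a u t'"
  using assms rtensor_class_add_left[OF Hom_module(2,1), of b b' a a' u u' t]
    rtensor_class_add_right[OF Hom_module(2,1), of b b' a a' u t t']
  by (simp_all add: tri_tensor_eq UT_simps)

lemma tri_tensor_Cmp:
  assumes ob: "b \<in> Ob U" "b' \<in> Ob U" "b'' \<in> Ob U" "a \<in> Ob T" "a' \<in> Ob T" "a'' \<in> Ob T"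
    and u: "u \<in> arr U b b'" "u' \<in> arr U b' b''" and t: "t \<in> arr T a a'" "t' \<in> arr T a' a''"
  shows "Cmp UT (b, a'') (b', a') (b'', a) (tri_tensor R T U b' b'' a' a u' t) (tri_tensor R T U b b' a'' a' u t')
    = tri_tensor R T U b b'' a'' a (Cmp U b b' b'' u' u) (Cmp T a a' a'' t' t)"
proof -
  have S: "Cmp T a a' a'' (Scal T a' a'' r g) f = Scal T a a'' r (Cmp T a a' a'' g f)"
    "Cmp T a a' a'' g (Scal T a a' r f) = Scal T a a'' r (Cmp T a a' a'' g f)"
    if "r \<in> carrier R" "f \<in> arr T a a'" "g \<in> arr T a' a''" for r f g
    using R_T ob that by (simp_all add: R_category_def)
  have S': "Cmp U b b' b'' (Scal U b' b'' r g) f = Scal U b b'' r (Cmp U b b' b'' g f)"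
    "Cmp U b b' b'' g (Scal U b b' r f) = Scal U b b'' r (Cmp U b b' b'' g f)"
    if "r \<in> carrier R" "f \<in> arr U b b'" "g \<in> arr U b' b''" for r f g
    using R_U ob that by (simp_all add: R_category_def)
  \<comment> \<open>The second factors compose in the opposite of \<open>T\<close>, hence the
    flipped composition for \<open>cy\<close>.\<close>
  have "(\<Union>s\<in>rtensor_class R (hom_module U b' b'') (hom_module T a a') (frag_of (u', t)).
      \<Union>s'\<in>rtensor_class R (hom_module U b b') (hom_module T a' a'') (frag_of (u, t')).
      rtensor_class R (hom_module U b b'') (hom_module T a a'')
        (frag_extend (\<lambda>(x, y). frag_extend (\<lambda>(x', y'). frag_of (Cmp U b b' b'' x x', Cmp T a a' a'' y' y)) s') s))
    = rtensor_class R (hom_module U b b'') (hom_module T a a'') (frag_of (Cmp U b b' b'' u' u, Cmp T a a' a'' t' t))"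
    by (rule rtensor_composition[OF Hom_module(2)[OF ob(1,2)] Hom_module(1)[OF ob(5,6)]
          Hom_module(2)[OF ob(2,3)] Hom_module(1)[OF ob(4,5)] Hom_module(2)[OF ob(1,3)] Hom_module(1)[OF ob(4,6)],
          where cy = "\<lambda>y y'. Cmp T a a' a'' y' y"])
      (use ob u t in \<open>simp_all add: U.Cmp_arr T.Cmp_arr U.Cmp_add_left U.Cmp_add_right T.Cmp_add_left T.Cmp_add_right S S'\<close>)
  then show ?thesis by (simp add: tensor_cat_def tri_tensor_eq)
qed

text \<open>The left action \<open>u \<bullet> m\<close> from the composition of triangular
  matrices; its counterpart \<open>ract\<close> is the right action
  \<open>m \<bullet> t\<close>.\<close>

definition lact :: "'ou \<Rightarrow> 'ou \<Rightarrow> 'ot \<Rightarrow> 'u \<Rightarrow> 'w \<Rightarrow> 'w"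
  where "lact b b' a u = fmap M (b, a) (b', a) (tri_tensor R T U b b' a a u (Idt T a))"

definition ract :: "'ou \<Rightarrow> 'ot \<Rightarrow> 'ot \<Rightarrow> 't \<Rightarrow> 'w \<Rightarrow> 'w"
  where "ract b a' a t = fmap M (b, a') (b, a) (tri_tensor R T U b b a' a (Idt U b) t)"

lemma M_group: "b \<in> Ob U \<Longrightarrow> a \<in> Ob T \<Longrightarrow> comm_group (fobj M (b, a))"
  by (rule module_group[OF M]) (simp add: UT_simps)

lemma M_one_closed: "b \<in> Ob U \<Longrightarrow> a \<in> Ob T \<Longrightarrow> \<one>\<^bsub>fobj M (b, a)\<^esub> \<in> carrier (fobj M (b, a))"
  by (rule module_one_closed[OF M]) (simp add: UT_simps)

lemma M_m_closed: "b \<in> Ob U \<Longrightarrow> a \<in> Ob T \<Longrightarrow> m \<in> carrier (fobj M (b, a)) \<Longrightarrow> n \<in> carrier (fobj M (b, a)) \<Longrightarrow>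
    m \<otimes>\<^bsub>fobj M (b, a)\<^esub> n \<in> carrier (fobj M (b, a))"
  by (rule module_m_closed[OF M]) (simp_all add: UT_simps)

context
  fixes b b' a u
  assumes ob: "b \<in> Ob U" "b' \<in> Ob U" "a \<in> Ob T" and u: "u \<in> arr U b b'"
begin

lemma lact_closed: "m \<in> carrier (fobj M (b, a)) \<Longrightarrow> lact b b' a u m \<in> carrier (fobj M (b', a))"
  unfolding lact_def using ob u by (intro module_closed[OF M] tri_tensor_arr T.Idt_arr) (simp_all add: UT_simps)

lemma lact_mult:
  "m \<in> carrier (fobj M (b, a)) \<Longrightarrow> n \<in> carrier (fobj M (b, a)) \<Longrightarrow>
    lact b b' a u (m \<otimes>\<^bsub>fobj M (b, a)\<^esub> n) = lact b b' a u m \<otimes>\<^bsub>fobj M (b', a)\<^esub> lact b b' a u n"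
  unfolding lact_def using ob u by (intro module_mult[OF M] tri_tensor_arr T.Idt_arr) (simp_all add: UT_simps)

lemma lact_one: "lact b b' a u \<one>\<^bsub>fobj M (b, a)\<^esub> = \<one>\<^bsub>fobj M (b', a)\<^esub>"
  unfolding lact_def using ob u by (intro module_one[OF M] tri_tensor_arr T.Idt_arr) (simp_all add: UT_simps)

lemma lact_add:
  "u' \<in> arr U b b' \<Longrightarrow> m \<in> carrier (fobj M (b, a)) \<Longrightarrow>
    lact b b' a (u \<otimes>\<^bsub>Hom U b b'\<^esub> u') m = lact b b' a u m \<otimes>\<^bsub>fobj M (b', a)\<^esub> lact b b' a u' m"
  unfolding lact_def tri_tensor_add(1)[OF ob(1,2,3,3) u T.Idt_arr[OF ob(3)]]
  using ob u by (intro module_add[OF M] tri_tensor_arr T.Idt_arr) (simp_all add: UT_simps)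

lemma lact_Cmp:
  "b'' \<in> Ob U \<Longrightarrow> u' \<in> arr U b' b'' \<Longrightarrow> m \<in> carrier (fobj M (b, a)) \<Longrightarrow>
    lact b b'' a (Cmp U b b' b'' u' u) m = lact b' b'' a u' (lact b b' a u m)"
  unfolding lact_def
  using ob u tri_tensor_Cmp[OF ob(1,2) _ ob(3,3,3) u _ T.Idt_arr[OF ob(3)] T.Idt_arr[OF ob(3)], of b'' u']
  by (subst module_Cmp[OF M, symmetric]) (simp_all add: UT_simps(1) tri_tensor_arr T.Idt_arr T.Cmp_Idt_left)

end

lemma lact_Idt: "b \<in> Ob U \<Longrightarrow> a \<in> Ob T \<Longrightarrow> m \<in> carrier (fobj M (b, a)) \<Longrightarrow> lact b b a (Idt U b) m = m"
  unfolding lact_def UT_simps(3)[symmetric] by (rule module_Idt[OF M]) (simp_all add: UT_simps)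

context
  fixes b a a' t
  assumes ob: "b \<in> Ob U" "a \<in> Ob T" "a' \<in> Ob T" and t: "t \<in> arr T a a'"
begin

lemma ract_closed: "m \<in> carrier (fobj M (b, a')) \<Longrightarrow> ract b a' a t m \<in> carrier (fobj M (b, a))"
  unfolding ract_def using ob t by (intro module_closed[OF M] tri_tensor_arr U.Idt_arr) (simp_all add: UT_simps)

lemma ract_mult:
  "m \<in> carrier (fobj M (b, a')) \<Longrightarrow> n \<in> carrier (fobj M (b, a')) \<Longrightarrow>
    ract b a' a t (m \<otimes>\<^bsub>fobj M (b, a')\<^esub> n) = ract b a' a t m \<otimes>\<^bsub>fobj M (b, a)\<^esub> ract b a' a t n"
  unfolding ract_def using ob t by (intro module_mult[OF M] tri_tensor_arr U.Idt_arr) (simp_all add: UT_simps)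

lemma ract_one: "ract b a' a t \<one>\<^bsub>fobj M (b, a')\<^esub> = \<one>\<^bsub>fobj M (b, a)\<^esub>"
  unfolding ract_def using ob t by (intro module_one[OF M] tri_tensor_arr U.Idt_arr) (simp_all add: UT_simps)

lemma ract_add:
  "t' \<in> arr T a a' \<Longrightarrow> m \<in> carrier (fobj M (b, a')) \<Longrightarrow>
    ract b a' a (t \<otimes>\<^bsub>Hom T a a'\<^esub> t') m = ract b a' a t m \<otimes>\<^bsub>fobj M (b, a)\<^esub> ract b a' a t' m"
  unfolding ract_def tri_tensor_add(2)[OF ob(1,1,2,3) U.Idt_arr[OF ob(1)] t]
  using ob t by (intro module_add[OF M] tri_tensor_arr U.Idt_arr) (simp_all add: UT_simps)

lemma ract_Cmp:
  "a'' \<in> Ob T \<Longrightarrow> t' \<in> arr T a' a'' \<Longrightarrow> m \<in> carrier (fobj M (b, a'')) \<Longrightarrow>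
    ract b a'' a (Cmp T a a' a'' t' t) m = ract b a' a t (ract b a'' a' t' m)"
  unfolding ract_def
  using ob t tri_tensor_Cmp[OF ob(1,1,1,2,3) _ U.Idt_arr[OF ob(1)] U.Idt_arr[OF ob(1)] t, of a'' t']
  by (subst module_Cmp[OF M, symmetric]) (simp_all add: UT_simps(1) tri_tensor_arr U.Idt_arr U.Cmp_Idt_left)

text \<open>Both sides are the action of the tensor of \<open>u\<close> and \<open>t\<close>,
  factored in its two possible orders.\<close>

lemma ract_lact:
  assumes "b' \<in> Ob U" "u \<in> arr U b b'" "m \<in> carrier (fobj M (b, a'))"
  shows "ract b' a' a t (lact b b' a' u m) = lact b b' a u (ract b a' a t m)"
proof -
  note Ib = U.Idt_arr[OF ob(1)] and Ib' = U.Idt_arr[OF assms(1)] and Ia = T.Idt_arr[OF ob(2)] and Ia' = T.Idt_arr[OF ob(3)]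
  have "ract b' a' a t (lact b b' a' u m) = fmap M (b, a') (b', a) (tri_tensor R T U b b' a' a u t) m"
    unfolding ract_def lact_def
    using ob t assms tri_tensor_Cmp[OF ob(1) assms(1,1) ob(2,3,3) assms(2) Ib' t Ia'] Ib' Ia'
    by (subst module_Cmp[OF M, symmetric]) (simp_all add: UT_simps(1) tri_tensor_arr U.Cmp_Idt_left T.Cmp_Idt_left)
  also have "\<dots> = lact b b' a u (ract b a' a t m)"
    unfolding ract_def lact_def
    using ob t assms tri_tensor_Cmp[OF ob(1,1) assms(1) ob(2,2,3) Ib assms(2) Ia t] Ib Ia
    by (subst module_Cmp[OF M, symmetric]) (simp_all add: UT_simps(1) tri_tensor_arr U.Cmp_Idt_right T.Cmp_Idt_right)
  finally show ?thesis .
qed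

end

lemma ract_Idt: "b \<in> Ob U \<Longrightarrow> a \<in> Ob T \<Longrightarrow> m \<in> carrier (fobj M (b, a)) \<Longrightarrow> ract b a a (Idt T a) m = m"
  unfolding ract_def UT_simps(3)[symmetric] by (rule module_Idt[OF M]) (simp_all add: UT_simps)

text \<open>At a zero object the identity is the zero arrow, so it equals its own double. Acting on
  \<open>m\<close> gives \<open>m + m = m\<close>.\<close>

lemma M_zero_U:
  assumes z: "zero_object U b" and a: "a \<in> Ob T" and m: "m \<in> carrier (fobj M (b, a))"
  shows "m = \<one>\<^bsub>fobj M (b, a)\<^esub>"
proof -
  have b: "b \<in> Ob U" using z by (simp add: zero_object_def)
  interpret B: comm_group "fobj M (b, a)" by (rule M_group[OF b a])
  have I: "Idt U b \<otimes>\<^bsub>Hom U b b\<^esub> Idt U b = Idt U b"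
    using zero_object_arr(3)[OF U.preadditive_category_axioms z b] U.zero_arr_closed[OF b b]
      monoid.l_one[OF group.is_monoid[OF comm_group_imp_group[OF U.Hom_comm_group[OF b b]]]] by simp
  have "m \<otimes>\<^bsub>fobj M (b, a)\<^esub> m = m"
    using lact_add[OF b b a U.Idt_arr[OF b] U.Idt_arr[OF b] m] lact_Idt[OF b a m] I by simp
  then show ?thesis using m B.l_cancel_one by blast
qed

lemma M_zero_T:
  assumes z: "zero_object T a" and b: "b \<in> Ob U" and m: "m \<in> carrier (fobj M (b, a))"
  shows "m = \<one>\<^bsub>fobj M (b, a)\<^esub>"
proof -
  have a: "a \<in> Ob T" using z by (simp add: zero_object_def)
  interpret B: comm_group "fobj M (b, a)" by (rule M_group[OF b a])
  have I: "Idt T a \<otimes>\<^bsub>Hom T a a\<^esub> Idt T a = Idt T a"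
    using zero_object_arr(3)[OF T.preadditive_category_axioms z a] T.zero_arr_closed[OF a a]
      monoid.l_one[OF group.is_monoid[OF comm_group_imp_group[OF T.Hom_comm_group[OF a a]]]] by simp
  have "m \<otimes>\<^bsub>fobj M (b, a)\<^esub> m = m"
    using ract_add[OF b a a T.Idt_arr[OF a] T.Idt_arr[OF a] m] ract_Idt[OF b a m] I by simp
  then show ?thesis using m B.l_cancel_one by blast
qed

subsection \<open>The triangular matrix category\<close>

abbreviation "\<Lambda> \<equiv> tri_cat R T M U"

lemma tri_simps [simp]:
  "Ob \<Lambda> = Ob T \<times> Ob U"
  "arr \<Lambda> (a, b) (a', b') = arr T a a' \<times> (carrier (fobj M (b', a)) \<times> arr U b b')"
  "(t, m, u) \<otimes>\<^bsub>Hom \<Lambda> (a, b) (a', b')\<^esub> (t', m', u') = (t \<otimes>\<^bsub>Hom T a a'\<^esub> t', m \<otimes>\<^bsub>fobj M (b', a)\<^esub> m', u \<otimes>\<^bsub>Hom U b b'\<^esub> u')"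
  "zero_arr \<Lambda> (a, b) (a', b') = (zero_arr T a a', \<one>\<^bsub>fobj M (b', a)\<^esub>, zero_arr U b b')"
  "Idt \<Lambda> (a, b) = (Idt T a, \<one>\<^bsub>fobj M (b, a)\<^esub>, Idt U b)"
  "Cmp \<Lambda> (a, b) (a', b') (a'', b'') (t2, m2, u2) (t1, m1, u1) = (Cmp T a a' a'' t2 t1,
     ract b'' a' a t1 m2 \<otimes>\<^bsub>fobj M (b'', a)\<^esub> lact b' b'' a u2 m1, Cmp U b b' b'' u2 u1)"
  by (simp_all add: tri_cat_def lact_def ract_def)

lemma Hom_tri: "Hom \<Lambda> (a, b) (a', b') = Hom T a a' \<times>\<times> (fobj M (b', a) \<times>\<times> Hom U b b')"
  by (simp add: tri_cat_def)

text \<open>Associativity in the lower left entry amounts to the actions being multiplicative and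
  commuting with each other. Biadditivity of composition uses that the groups of \<open>M\<close>
  are commutative.\<close>

lemma preadditive_tri: "preadditive_category \<Lambda>"
proof (rule preadditive_category.intro)
  fix x y w v assume "x \<in> Ob \<Lambda>"
  then obtain a b where x: "x = (a, b)" "a \<in> Ob T" "b \<in> Ob U" by auto
  note one = monoid.l_one[OF group.is_monoid[OF comm_group_imp_group[OF M_group]]]
    monoid.r_one[OF group.is_monoid[OF comm_group_imp_group[OF M_group]]]
  show "Idt \<Lambda> x \<in> arr \<Lambda> x x" using x by (simp add: T.Idt_arr U.Idt_arr M_one_closed)
  assume "y \<in> Ob \<Lambda>"
  then obtain a' b' where y: "y = (a', b')" "a' \<in> Ob T" "b' \<in> Ob U" by auto
  show "comm_group (Hom \<Lambda> x y)"
    using x y by (simp add: Hom_tri comm_group_DirProd T.Hom_comm_group U.Hom_comm_group M_group)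
  show "Cmp \<Lambda> x y y (Idt \<Lambda> y) f = f" if "f \<in> arr \<Lambda> x y" for f
    using x y that by (auto simp: T.Cmp_Idt_left U.Cmp_Idt_left ract_one lact_Idt one)
  show "Cmp \<Lambda> x x y f (Idt \<Lambda> x) = f" if "f \<in> arr \<Lambda> x y" for f
    using x y that by (auto simp: T.Cmp_Idt_right U.Cmp_Idt_right lact_one ract_Idt one)
  assume "w \<in> Ob \<Lambda>"
  then obtain a'' b'' where w: "w = (a'', b'')" "a'' \<in> Ob T" "b'' \<in> Ob U" by auto
  interpret M'': comm_group "fobj M (b'', a)" by (rule M_group[OF w(3) x(2)])
  note [simp] = T.Cmp_arr U.Cmp_arr lact_closed ract_closed M_m_closed
  show "Cmp \<Lambda> x y w g \<in> hom (Hom \<Lambda> x y) (Hom \<Lambda> x w)" if "g \<in> arr \<Lambda> y w" for g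
    using x y w that
    by (intro homI) (auto simp: T.Cmp_add_right U.Cmp_add_right ract_add lact_mult M''.m_ac)
  show "(\<lambda>g. Cmp \<Lambda> x y w g f) \<in> hom (Hom \<Lambda> y w) (Hom \<Lambda> x w)" if "f \<in> arr \<Lambda> x y" for f
    using x y w that
    by (intro homI) (auto simp: T.Cmp_add_left U.Cmp_add_left lact_add ract_mult M''.m_ac)
  assume "v \<in> Ob \<Lambda>"
  then obtain a3 b3 where v: "v = (a3, b3)" "a3 \<in> Ob T" "b3 \<in> Ob U" by auto
  interpret M3: comm_group "fobj M (b3, a)" by (rule M_group[OF v(3) x(2)])
  show "Cmp \<Lambda> x w v h (Cmp \<Lambda> x y w g f) = Cmp \<Lambda> x y v (Cmp \<Lambda> y w v h g) f"
    if "f \<in> arr \<Lambda> x y" "g \<in> arr \<Lambda> y w" "h \<in> arr \<Lambda> w v" for f g h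
    using x y w v that
    by (auto simp: T.Cmp_assoc U.Cmp_assoc ract_Cmp lact_Cmp ract_lact lact_mult ract_mult M3.m_assoc)
qed

end

text \<open>The object \<open>z\<close> serves to form \<open>U'\<close>. The zero object
  \<open>zU\<close> of \<open>U\<close> provides the objects \<open>(a, zU)\<close>, whose incoming
  arrows are determined by their entry in \<open>T\<close>.\<close>

locale triangular_zero = triangular R T U M
  for R :: "'r ring" and T :: "('ot, 't, 'r) rcat" and U :: "('ou, 'u, 'r) rcat"
    and M :: "('ou \<times> 'ot, ('u \<times> 't \<Rightarrow>\<^sub>0 int) set, 'w) cmod" +
  fixes z :: 'ot and zU :: 'ou
  assumes z: "zero_object T z" and zU: "zero_object U zU"
begin

lemma zero_Ob [simp]: "z \<in> Ob T" "zU \<in> Ob U"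
  using z zU by (simp_all add: zero_object_def)

lemmas zero_arr_T = zero_object_arr[OF T.preadditive_category_axioms z]
lemmas zero_arr_U = zero_object_arr[OF U.preadditive_category_axioms zU]

lemma Idt_zero [simp]: "Idt T z = zero_arr T z z" "Idt U zU = zero_arr U zU zU"
  using zero_arr_T(3) zero_arr_U(3) zero_Ob by blast+

lemma M_z: "b \<in> Ob U \<Longrightarrow> carrier (fobj M (b, z)) = {\<one>\<^bsub>fobj M (b, z)\<^esub>}"
  by (auto intro: M_zero_T[OF z] M_one_closed)

lemma M_zU: "a \<in> Ob T \<Longrightarrow> carrier (fobj M (zU, a)) = {\<one>\<^bsub>fobj M (zU, a)\<^esub>}"
  by (auto intro: M_zero_U[OF zU] M_one_closed)

lemma lact_zU [simp]:
  "b \<in> Ob U \<Longrightarrow> a \<in> Ob T \<Longrightarrow> u \<in> arr U b zU \<Longrightarrow> m \<in> carrier (fobj M (b, a)) \<Longrightarrow> lact b zU a u m = \<one>\<^bsub>fobj M (zU, a)\<^esub>"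
  by (rule M_zero_U[OF zU]) (simp_all add: lact_closed)

lemma ract_z [simp]:
  "b \<in> Ob U \<Longrightarrow> a \<in> Ob T \<Longrightarrow> t \<in> arr T z a \<Longrightarrow> m \<in> carrier (fobj M (b, a)) \<Longrightarrow> ract b a z t m = \<one>\<^bsub>fobj M (b, z)\<^esub>"
  by (rule M_zero_T[OF z]) (simp_all add: ract_closed)

lemmas [simp] = T.Cmp_arr U.Cmp_arr T.Idt_arr U.Idt_arr T.zero_arr_closed U.zero_arr_closed M_one_closed M_m_closed
  T.add_arr_closed U.add_arr_closed lact_closed ract_closed lact_one ract_one
  T.Cmp_Idt_left T.Cmp_Idt_right U.Cmp_Idt_left U.Cmp_Idt_right
  T.Cmp_zero_left T.Cmp_zero_right U.Cmp_zero_left U.Cmp_zero_right lact_Idt ract_Idt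

lemma M_one_mult [simp]:
  "b \<in> Ob U \<Longrightarrow> a \<in> Ob T \<Longrightarrow> m \<in> carrier (fobj M (b, a)) \<Longrightarrow> \<one>\<^bsub>fobj M (b, a)\<^esub> \<otimes>\<^bsub>fobj M (b, a)\<^esub> m = m"
  "b \<in> Ob U \<Longrightarrow> a \<in> Ob T \<Longrightarrow> m \<in> carrier (fobj M (b, a)) \<Longrightarrow> m \<otimes>\<^bsub>fobj M (b, a)\<^esub> \<one>\<^bsub>fobj M (b, a)\<^esub> = m"
  by (simp_all add: monoid.l_one[OF group.is_monoid[OF comm_group_imp_group[OF M_group]]]
    monoid.r_one[OF group.is_monoid[OF comm_group_imp_group[OF M_group]]])

lemma zero_add [simp]:
  "a \<in> Ob T \<Longrightarrow> a' \<in> Ob T \<Longrightarrow> t \<in> arr T a a' \<Longrightarrow> zero_arr T a a' \<otimes>\<^bsub>Hom T a a'\<^esub> t = t"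
  "b \<in> Ob U \<Longrightarrow> b' \<in> Ob U \<Longrightarrow> u \<in> arr U b b' \<Longrightarrow> zero_arr U b b' \<otimes>\<^bsub>Hom U b b'\<^esub> u = u"
  "a \<in> Ob T \<Longrightarrow> a' \<in> Ob T \<Longrightarrow> t \<in> arr T a a' \<Longrightarrow> t \<otimes>\<^bsub>Hom T a a'\<^esub> zero_arr T a a' = t"
  "b \<in> Ob U \<Longrightarrow> b' \<in> Ob U \<Longrightarrow> u \<in> arr U b b' \<Longrightarrow> u \<otimes>\<^bsub>Hom U b b'\<^esub> zero_arr U b b' = u"
  by (simp_all add: monoid.l_one[OF group.is_monoid[OF comm_group_imp_group[OF T.Hom_comm_group]]]
    monoid.l_one[OF group.is_monoid[OF comm_group_imp_group[OF U.Hom_comm_group]]]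
    monoid.r_one[OF group.is_monoid[OF comm_group_imp_group[OF T.Hom_comm_group]]]
    monoid.r_one[OF group.is_monoid[OF comm_group_imp_group[OF U.Hom_comm_group]]])

abbreviation "B \<equiv> {z} \<times> Ob U"
abbreviation "U' \<equiv> full_subcat \<Lambda> B"
abbreviation "Q \<equiv> quotient_cat \<Lambda> B"
abbreviation "\<pi> \<equiv> quotient_proj \<Lambda> B"

lemma B_subset: "B \<subseteq> Ob \<Lambda>" by auto

lemma preadditive_U': "preadditive_category U'"
  by (rule preadditive_full_subcat[OF preadditive_tri B_subset])

subsection \<open>The quotient category\<close>

text \<open>The ideal consists of all \<open>(0, m, u)\<close>, so a coset is determined by its entry in \<open>T\<close>.\<close>

definition cls :: "'ot \<times> 'ou \<Rightarrow> 'ot \<times> 'ou \<Rightarrow> 't \<Rightarrow> ('t \<times> 'w \<times> 'u) set"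
  where "cls x y t = {t} \<times> (carrier (fobj M (snd y, fst x)) \<times> arr U (snd x) (snd y))"

context
  fixes a b a' b'
  assumes ob [simp]: "a \<in> Ob T" "b \<in> Ob U" "a' \<in> Ob T" "b' \<in> Ob U"
begin

text \<open>Arrows through \<open>z\<close> vanish, which kills the entry in \<open>T\<close> of a
  composite. Conversely \<open>(0, m, u)\<close> factors through \<open>(z, b')\<close>, with the
  identity of \<open>b'\<close> in the second factor. So the single composites already form a
  subgroup.\<close>

lemma fact_ideal_tri: "fact_ideal \<Lambda> B (a, b) (a', b') = cls (a, b) (a', b') (zero_arr T a a')"
proof
  show "fact_ideal \<Lambda> B (a, b) (a', b') \<subseteq> cls (a, b) (a', b') (zero_arr T a a')"
    by (auto simp: fact_ideal_def cls_def zero_arr_T)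
  show "cls (a, b) (a', b') (zero_arr T a a') \<subseteq> fact_ideal \<Lambda> B (a, b) (a', b')"
  proof
    fix f assume "f \<in> cls (a, b) (a', b') (zero_arr T a a')"
    then obtain m u where f: "f = (zero_arr T a a', m, u)" "m \<in> carrier (fobj M (b', a))" "u \<in> arr U b b'"
      by (auto simp: cls_def)
    have "f = Cmp \<Lambda> (a, b) (z, b') (a', b') (zero_arr T z a', \<one>\<^bsub>fobj M (b', z)\<^esub>, Idt U b') (zero_arr T a z, m, u)"
      using f by simp
    moreover have "(zero_arr T z a', \<one>\<^bsub>fobj M (b', z)\<^esub>, Idt U b') \<in> arr \<Lambda> (z, b') (a', b')" by simp
    moreover have "(zero_arr T a z, m, u) \<in> arr \<Lambda> (a, b) (z, b')" using f by simp
    moreover have "(z, b') \<in> B" by simp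
    ultimately show "f \<in> fact_ideal \<Lambda> B (a, b) (a', b')" unfolding fact_ideal_def by blast
  qed
qed

text \<open>The ideal is the kernel of the projection to the entry in \<open>T\<close>.\<close>

lemma fact_ideal_normal: "fact_ideal \<Lambda> B (a, b) (a', b') \<lhd> Hom \<Lambda> (a, b) (a', b')"
proof -
  interpret L: comm_group "Hom \<Lambda> (a, b) (a', b')"
    by (rule preadditive_category.Hom_comm_group[OF preadditive_tri]) simp_all
  interpret h: group_hom "Hom \<Lambda> (a, b) (a', b')" "Hom T a a'" fst
    by (rule group_hom_comm_groups[OF L.comm_group_axioms T.Hom_comm_group]) (auto intro!: homI)
  have "fact_ideal \<Lambda> B (a, b) (a', b') = kernel (Hom \<Lambda> (a, b) (a', b')) (Hom T a a') fst"
    unfolding fact_ideal_tri by (auto simp: kernel_def cls_def)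
  then show ?thesis using L.subgroup_imp_normal[OF h.subgroup_kernel] by simp
qed

lemma coset_tri:
  assumes f: "(t, m, u) \<in> arr \<Lambda> (a, b) (a', b')"
  shows "fact_ideal \<Lambda> B (a, b) (a', b') #>\<^bsub>Hom \<Lambda> (a, b) (a', b')\<^esub> (t, m, u) = cls (a, b) (a', b') t"
proof
  have tmu: "t \<in> arr T a a'" "m \<in> carrier (fobj M (b', a))" "u \<in> arr U b b'" using f by auto
  interpret Mg: comm_group "fobj M (b', a)" by (rule M_group) simp_all
  interpret Ug: comm_group "Hom U b b'" by (rule U.Hom_comm_group) simp_all
  show "fact_ideal \<Lambda> B (a, b) (a', b') #>\<^bsub>Hom \<Lambda> (a, b) (a', b')\<^esub> (t, m, u) \<subseteq> cls (a, b) (a', b') t"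
    unfolding fact_ideal_tri r_coset_def using tmu by (auto simp: cls_def)
  show "cls (a, b) (a', b') t \<subseteq> fact_ideal \<Lambda> B (a, b) (a', b') #>\<^bsub>Hom \<Lambda> (a, b) (a', b')\<^esub> (t, m, u)"
  proof
    fix g assume "g \<in> cls (a, b) (a', b') t"
    then obtain n v where g: "g = (t, n, v)" "n \<in> carrier (fobj M (b', a))" "v \<in> arr U b b'" by (auto simp: cls_def)
    let ?h = "(zero_arr T a a', n \<otimes>\<^bsub>fobj M (b', a)\<^esub> inv\<^bsub>fobj M (b', a)\<^esub> m, v \<otimes>\<^bsub>Hom U b b'\<^esub> inv\<^bsub>Hom U b b'\<^esub> u)"
    have "?h \<in> cls (a, b) (a', b') (zero_arr T a a')" using g tmu by (simp add: cls_def)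
    moreover have "g = ?h \<otimes>\<^bsub>Hom \<Lambda> (a, b) (a', b')\<^esub> (t, m, u)"
      using g tmu by (simp add: Mg.m_assoc Ug.m_assoc)
    ultimately show "g \<in> fact_ideal \<Lambda> B (a, b) (a', b') #>\<^bsub>Hom \<Lambda> (a, b) (a', b')\<^esub> (t, m, u)"
      unfolding fact_ideal_tri r_coset_def by blast
  qed
qed

lemma cls_coset:
  assumes "t \<in> arr T a a'"
  shows "cls (a, b) (a', b') t
    = fact_ideal \<Lambda> B (a, b) (a', b') #>\<^bsub>Hom \<Lambda> (a, b) (a', b')\<^esub> (t, \<one>\<^bsub>fobj M (b', a)\<^esub>, zero_arr U b b')"
  using assms by (simp add: coset_tri)

text \<open>The other two entries range over nonempty sets, so the image under \<open>fst\<close> is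
  a singleton and the entry in \<open>T\<close> can be recovered from the coset.\<close>

lemma fst_cls [simp]: "the_elem (fst ` cls (a, b) (a', b') t) = t"
proof -
  have "carrier (fobj M (b', a)) \<times> arr U b b' \<noteq> {}"
    using M_one_closed[OF ob(4,1)] U.zero_arr_closed[OF ob(2,4)] by blast
  then show ?thesis by (simp add: cls_def)
qed

lemma arr_Q: "arr Q (a, b) (a', b') = cls (a, b) (a', b') ` arr T a a'"
proof -
  have "arr Q (a, b) (a', b') = (\<lambda>f. fact_ideal \<Lambda> B (a, b) (a', b') #>\<^bsub>Hom \<Lambda> (a, b) (a', b')\<^esub> f) ` arr \<Lambda> (a, b) (a', b')"
    by (simp add: quotient_cat_def carrier_FactGroup del: tri_simps)
  also have "\<dots> = (\<lambda>f. cls (a, b) (a', b') (fst f)) ` arr \<Lambda> (a, b) (a', b')"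
  proof (rule image_cong[OF refl])
    fix f assume "f \<in> arr \<Lambda> (a, b) (a', b')"
    then show "fact_ideal \<Lambda> B (a, b) (a', b') #>\<^bsub>Hom \<Lambda> (a, b) (a', b')\<^esub> f = cls (a, b) (a', b') (fst f)"
      by (cases f) (auto simp: coset_tri)
  qed
  also have "\<dots> = cls (a, b) (a', b') ` fst ` arr \<Lambda> (a, b) (a', b')" by (simp only: image_image)
  also have "fst ` arr \<Lambda> (a, b) (a', b') = arr T a a'"
  proof -
    have "carrier (fobj M (b', a)) \<times> arr U b b' \<noteq> {}"
      using M_one_closed[OF ob(4,1)] U.zero_arr_closed[OF ob(2,4)] by blast
    then show ?thesis by simp
  qed
  finally show ?thesis .
qed

lemma comm_group_Q: "comm_group (Hom Q (a, b) (a', b'))"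
proof -
  interpret L: comm_group "Hom \<Lambda> (a, b) (a', b')"
    by (rule preadditive_category.Hom_comm_group[OF preadditive_tri]) simp_all
  show ?thesis
    using L.abelian_FactGroup[OF normal_imp_subgroup[OF fact_ideal_normal]] by (simp add: quotient_cat_def)
qed

lemma mult_Q:
  assumes "t \<in> arr T a a'" "t' \<in> arr T a a'"
  shows "cls (a, b) (a', b') t \<otimes>\<^bsub>Hom Q (a, b) (a', b')\<^esub> cls (a, b) (a', b') t' = cls (a, b) (a', b') (t \<otimes>\<^bsub>Hom T a a'\<^esub> t')"
proof -
  have arr: "(t, \<one>\<^bsub>fobj M (b', a)\<^esub>, zero_arr U b b') \<in> arr \<Lambda> (a, b) (a', b')"
    "(t', \<one>\<^bsub>fobj M (b', a)\<^esub>, zero_arr U b b') \<in> arr \<Lambda> (a, b) (a', b')" using assms by simp_all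
  show ?thesis
    using normal.rcos_sum[OF fact_ideal_normal arr] assms by (simp add: quotient_cat_def cls_coset)
qed

lemma zero_Q: "zero_arr Q (a, b) (a', b') = cls (a, b) (a', b') (zero_arr T a a')"
  by (simp add: quotient_cat_def fact_ideal_tri)

lemma \<pi>_fmap: "f \<in> arr \<Lambda> (a, b) (a', b') \<Longrightarrow> fmap \<pi> (a, b) (a', b') f = cls (a, b) (a', b') (fst f)"
  by (cases f) (simp add: quotient_proj_def coset_tri)

end

lemma Ob_Q [simp]: "Ob Q = Ob T \<times> Ob U" by (simp add: quotient_cat_def)

lemma \<pi>_fobj [simp]: "fobj \<pi> x = x" by (simp add: quotient_proj_def)

lemma Idt_Q: "a \<in> Ob T \<Longrightarrow> b \<in> Ob U \<Longrightarrow> Idt Q (a, b) = cls (a, b) (a, b) (Idt T a)"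
  by (simp add: quotient_cat_def \<pi>_fmap)

lemma Cmp_Q:
  assumes ob: "a \<in> Ob T" "b \<in> Ob U" "a' \<in> Ob T" "b' \<in> Ob U" "a'' \<in> Ob T" "b'' \<in> Ob U"
    and t: "t \<in> arr T a a'" "t' \<in> arr T a' a''"
  shows "Cmp Q (a, b) (a', b') (a'', b'') (cls (a', b') (a'', b'') t') (cls (a, b) (a', b') t)
    = cls (a, b) (a'', b'') (Cmp T a a' a'' t' t)"
proof -
  have c: "fmap \<pi> (a, b) (a'', b'') (Cmp \<Lambda> (a, b) (a', b') (a'', b'') g f) = cls (a, b) (a'', b'') (Cmp T a a' a'' t' t)"
    if "g \<in> cls (a', b') (a'', b'') t'" "f \<in> cls (a, b) (a', b') t" for f g
    using that ob t by (auto simp: cls_def \<pi>_fmap)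
  \<comment> \<open>Both cosets are nonempty, so the union of equal sets in the definition of
    composition is that set.\<close>
  have ne: "(t', \<one>\<^bsub>fobj M (b'', a')\<^esub>, zero_arr U b' b'') \<in> cls (a', b') (a'', b'') t'"
    "(t, \<one>\<^bsub>fobj M (b', a)\<^esub>, zero_arr U b b') \<in> cls (a, b) (a', b') t"
    using ob by (simp_all add: cls_def)
  have "Cmp Q (a, b) (a', b') (a'', b'') (cls (a', b') (a'', b'') t') (cls (a, b) (a', b') t)
    = (\<Union>g\<in>cls (a', b') (a'', b'') t'. \<Union>f\<in>cls (a, b) (a', b') t. fmap \<pi> (a, b) (a'', b'') (Cmp \<Lambda> (a, b) (a', b') (a'', b'') g f))"
    by (simp add: quotient_cat_def)
  also have "\<dots> = cls (a, b) (a'', b'') (Cmp T a a' a'' t' t)" using c ne by blast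
  finally show ?thesis .
qed

lemmas Q_simps = arr_Q mult_Q zero_Q \<pi>_fmap Idt_Q Cmp_Q

lemma preadditive_Q: "preadditive_category Q"
proof (rule preadditive_category.intro)
  fix x y w v assume "x \<in> Ob Q"
  then obtain a b where x: "x = (a, b)" "a \<in> Ob T" "b \<in> Ob U" by auto
  show "Idt Q x \<in> arr Q x x" using x by (simp add: Q_simps)
  assume "y \<in> Ob Q"
  then obtain a' b' where y: "y = (a', b')" "a' \<in> Ob T" "b' \<in> Ob U" by auto
  show "comm_group (Hom Q x y)" using x y by (simp add: comm_group_Q)
  show "Cmp Q x y y (Idt Q y) f = f" if "f \<in> arr Q x y" for f
    using x y that by (auto simp: Q_simps)
  show "Cmp Q x x y f (Idt Q x) = f" if "f \<in> arr Q x y" for f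
    using x y that by (auto simp: Q_simps)
  assume "w \<in> Ob Q"
  then obtain a'' b'' where w: "w = (a'', b'')" "a'' \<in> Ob T" "b'' \<in> Ob U" by auto
  show "Cmp Q x y w g \<in> hom (Hom Q x y) (Hom Q x w)" if "g \<in> arr Q y w" for g
    using x y w that by (intro homI) (auto simp: Q_simps T.Cmp_add_right)
  show "(\<lambda>g. Cmp Q x y w g f) \<in> hom (Hom Q y w) (Hom Q x w)" if "f \<in> arr Q x y" for f
    using x y w that by (intro homI) (auto simp: Q_simps T.Cmp_add_left)
  assume "v \<in> Ob Q"
  then obtain a3 b3 where v: "v = (a3, b3)" "a3 \<in> Ob T" "b3 \<in> Ob U" by auto
  show "Cmp Q x w v h (Cmp Q x y w g f) = Cmp Q x y v (Cmp Q y w v h g) f"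
    if "f \<in> arr Q x y" "g \<in> arr Q y w" "h \<in> arr Q w v" for f g h
    using x y w v that by (auto simp: Q_simps T.Cmp_assoc)
qed

subsection \<open>Functors and adjunctions between the index categories\<close>

text \<open>The right adjoint of \<open>\<pi>\<close>. On a coset it uses the common entry in
  \<open>T\<close>, so it is well defined on \<open>Q\<close>.\<close>

definition sect :: "('ot \<times> 'ou, ('t \<times> 'w \<times> 'u) set, 'ot \<times> 'ou, 't \<times> 'w \<times> 'u) cfunctor"
  where "sect = \<lparr>fobj = (\<lambda>x. (fst x, zU)),
    fmap = (\<lambda>x y X. (the_elem (fst ` X), \<one>\<^bsub>fobj M (zU, fst x)\<^esub>, zero_arr U zU zU))\<rparr>"

text \<open>The right adjoint of the inclusion of \<open>U'\<close>, and a retraction onto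
  \<open>U'\<close>.\<close>

definition retr :: "('ot \<times> 'ou, 't \<times> 'w \<times> 'u, 'ot \<times> 'ou, 't \<times> 'w \<times> 'u) cfunctor"
  where "retr = \<lparr>fobj = (\<lambda>x. (z, snd x)),
    fmap = (\<lambda>x y f. (zero_arr T z z, \<one>\<^bsub>fobj M (snd y, z)\<^esub>, snd (snd f)))\<rparr>"

definition emb_T :: "('ot, 't, 'ot \<times> 'ou, ('t \<times> 'w \<times> 'u) set) cfunctor"
  where "emb_T = \<lparr>fobj = (\<lambda>a. (a, zU)), fmap = (\<lambda>a a' t. cls (a, zU) (a', zU) t)\<rparr>"

definition emb_U :: "('ou, 'u, 'ot \<times> 'ou, 't \<times> 'w \<times> 'u) cfunctor"
  where "emb_U = \<lparr>fobj = (\<lambda>b. (z, b)), fmap = (\<lambda>b b' u. (zero_arr T z z, \<one>\<^bsub>fobj M (b', z)\<^esub>, u))\<rparr>"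

lemma functor_simps [simp]:
  "fobj sect (a, b) = (a, zU)" "fmap sect (a, b) y X = (the_elem (fst ` X), \<one>\<^bsub>fobj M (zU, a)\<^esub>, zero_arr U zU zU)"
  "fobj retr (a, b) = (z, b)" "fmap retr x (a', b') (t, m, u) = (zero_arr T z z, \<one>\<^bsub>fobj M (b', z)\<^esub>, u)"
  "fobj emb_T a = (a, zU)" "fmap emb_T a a' t = cls (a, zU) (a', zU) t"
  "fobj emb_U c = (z, c)" "fmap emb_U c c' u = (zero_arr T z z, \<one>\<^bsub>fobj M (c', z)\<^esub>, u)"
  "fobj diag_T (a, b) = a" "fmap diag_T x y X = the_elem (fst ` X)"
  "fobj diag_U (a, b) = b" "fmap diag_U x y (t, m, u) = u"
  by (simp_all add: sect_def retr_def emb_T_def emb_U_def diag_T_def diag_U_def)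

lemma \<pi>_additive: "additive_functor \<Lambda> Q \<pi>"
  by (rule additive_functorI) (auto simp: Q_simps)

lemma sect_additive: "additive_functor Q \<Lambda> sect"
  by (rule additive_functorI) (auto simp: Q_simps zero_arr_U)

lemma retr_additive: "additive_functor \<Lambda> U' retr"
  by (rule additive_functorI) (auto simp: zero_arr_T)

lemma emb_T_additive: "additive_functor T Q emb_T"
  by (rule additive_functorI) (auto simp: Q_simps)

lemma diag_T_additive: "additive_functor Q T diag_T"
  by (rule additive_functorI) (auto simp: Q_simps)

lemma emb_U_additive: "additive_functor U U' emb_U"
  by (rule additive_functorI) (auto simp: zero_arr_T)

lemma diag_U_additive: "additive_functor U' U diag_U"
  by (rule additive_functorI) auto

text \<open>An arrow of \<open>\<Lambda>\<close> into \<open>(a', zU)\<close> has trivial entries in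
  \<open>M\<close> and \<open>U\<close>, and an arrow of \<open>Q\<close> is determined by its entry
  in \<open>T\<close>. Both sides of the adjunction are therefore the arrows of
  \<open>T\<close>.\<close>

lemma adj_\<pi>_sect: "index_adjunction \<Lambda> Q \<pi> sect
   (\<lambda>x. (Idt T (fst x), \<one>\<^bsub>fobj M (zU, fst x)\<^esub>, zero_arr U (snd x) zU)) (\<lambda>x. cls (fst x, zU) x (Idt T (fst x)))"
  unfolding index_adjunction_def
  by (intro conjI \<pi>_additive sect_additive ballI) (auto simp: Q_simps zero_arr_U M_zU lact_one)

text \<open>An arrow of \<open>\<Lambda>\<close> out of \<open>(z, b)\<close> has trivial entries in
  \<open>T\<close> and \<open>M\<close>, so only its entry in \<open>U\<close> remains on either
  side.\<close>

lemma adj_incl_retr: "index_adjunction U' \<Lambda> incl retr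
   (Idt \<Lambda>) (\<lambda>x. (zero_arr T z (fst x), \<one>\<^bsub>fobj M (snd x, z)\<^esub>, Idt U (snd x)))"
  unfolding index_adjunction_def
  by (intro conjI additive_functor_incl[OF B_subset] retr_additive ballI) (auto simp: zero_arr_T M_z)

text \<open>Each equivalence is recorded as an adjunction in both orders, because
  \<open>recollement_transport\<close> uses its restriction functors as left and as right
  adjoints.\<close>

lemma adj_diag_T_emb_T: "index_adjunction Q T diag_T emb_T (\<lambda>x. cls x (fst x, zU) (Idt T (fst x))) (Idt T)"
  unfolding index_adjunction_def
  by (intro conjI diag_T_additive emb_T_additive ballI) (auto simp: Q_simps)

lemma adj_emb_T_diag_T: "index_adjunction T Q emb_T diag_T (Idt T) (\<lambda>x. cls (fst x, zU) x (Idt T (fst x)))"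
  unfolding index_adjunction_def
  by (intro conjI diag_T_additive emb_T_additive ballI) (auto simp: Q_simps)

lemma adj_diag_U_emb_U: "index_adjunction U' U diag_U emb_U (Idt \<Lambda>) (Idt U)"
  unfolding index_adjunction_def
  by (intro conjI diag_U_additive emb_U_additive ballI) (auto simp: zero_arr_T M_z)

lemma adj_emb_U_diag_U: "index_adjunction U U' emb_U diag_U (Idt U) (Idt \<Lambda>)"
  unfolding index_adjunction_def
  by (intro conjI diag_U_additive emb_U_additive ballI) (auto simp: zero_arr_T M_z)

text \<open>In \<open>Q\<close> the objects \<open>(a, zU)\<close> and \<open>(a, b)\<close> become
  isomorphic through the class of the identity of \<open>a\<close>: the entries in \<open>M\<close>
  and \<open>U\<close> no longer count.\<close>

lemma equivalence_T: "equivalence_pair Q T diag_T emb_T"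
  unfolding equivalence_pair_def
proof (intro conjI diag_T_additive emb_T_additive)
  have "iso_arr Q (a, zU) (a, b) (cls (a, zU) (a, b) (Idt T a))" if "a \<in> Ob T" "b \<in> Ob U" for a b
    unfolding iso_arr_def using that
    by (auto simp: Q_simps intro!: bexI[of _ "cls (a, b) (a, zU) (Idt T a)"])
  then show "nat_isomorphic Q Q (emb_T \<circ>\<^sub>F diag_T) fid"
    unfolding nat_isomorphic_def
    by (intro exI[of _ "\<lambda>x. cls (fst x, zU) x (Idt T (fst x))"] conjI ballI) (auto simp: Q_simps)
  show "nat_isomorphic T T (diag_T \<circ>\<^sub>F emb_T) fid"
    unfolding nat_isomorphic_def
    by (intro exI[of _ "Idt T"] conjI ballI) (auto simp: T.iso_arr_Idt)
qed

lemma equivalence_U: "equivalence_pair U' U diag_U emb_U"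
  unfolding equivalence_pair_def
proof (intro conjI diag_U_additive emb_U_additive)
  interpret U': preadditive_category U' by (rule preadditive_U')
  show "nat_isomorphic U' U' (emb_U \<circ>\<^sub>F diag_U) fid"
    unfolding nat_isomorphic_def
    by (intro exI[of _ "Idt \<Lambda>"] conjI ballI) (use U'.iso_arr_Idt in \<open>auto simp: zero_arr_T M_z\<close>)
  show "nat_isomorphic U U (diag_U \<circ>\<^sub>F emb_U) fid"
    unfolding nat_isomorphic_def
    by (intro exI[of _ "Idt U"] conjI ballI) (auto simp: U.iso_arr_Idt)
qed

end

section \<open>The recollements\<close>

lemma isomorphic_fcomp:
  assumes F: "additive_functor C D F" and F': "additive_functor C D F'" and n: "nat_isomorphic C D F F'"
    and N: "additive_functor D Ab (N :: ('p, 'n, 'v) cmod)"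
  shows "isomorphic (ModCat C) (N \<circ>\<^sub>F F) (N \<circ>\<^sub>F F')"
proof -
  obtain \<eta> where e: "\<And>a. a \<in> Ob C \<Longrightarrow> iso_arr D (fobj F a) (fobj F' a) (\<eta> a)"
    and nat: "\<And>a b f. a \<in> Ob C \<Longrightarrow> b \<in> Ob C \<Longrightarrow> f \<in> arr C a b \<Longrightarrow>
      Cmp D (fobj F a) (fobj F b) (fobj F' b) (\<eta> b) (fmap F a b f)
        = Cmp D (fobj F a) (fobj F' a) (fobj F' b) (fmap F' a b f) (\<eta> a)"
    using n unfolding nat_isomorphic_def by blast
  note NF = additive_functor_fcomp[OF F N] and NF' = additive_functor_fcomp[OF F' N]
  note [simp] = additive_functor_Ob[OF F] additive_functor_Ob[OF F'] additive_functor_arr[OF F] additive_functor_arr[OF F']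
  let ?k = "\<lambda>a\<in>Ob C. fmap N (fobj F a) (fobj F' a) (\<eta> a)"
  have arr: "\<eta> a \<in> arr D (fobj F a) (fobj F' a)" if "a \<in> Ob C" for a using e[OF that] by (simp add: iso_arr_def)
  have k: "?k \<in> ntr C (N \<circ>\<^sub>F F) (N \<circ>\<^sub>F F')"
    by (rule ntrI) (simp_all add: arr module_ext[OF N] module_closed[OF N] module_mult[OF N] module_Cmp[OF N, symmetric] nat)
  have "niso C (N \<circ>\<^sub>F F) (N \<circ>\<^sub>F F') ?k"
    unfolding niso_def
  proof (intro conjI ballI k)
    fix a assume a: "a \<in> Ob C"
    obtain g where g: "g \<in> arr D (fobj F' a) (fobj F a)"
      and eq: "Cmp D (fobj F a) (fobj F' a) (fobj F a) g (\<eta> a) = Idt D (fobj F a)"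
        "Cmp D (fobj F' a) (fobj F a) (fobj F' a) (\<eta> a) g = Idt D (fobj F' a)"
      using e[OF a] by (auto simp: iso_arr_def)
    show "bij_betw (?k a) (carrier (fobj (N \<circ>\<^sub>F F) a)) (carrier (fobj (N \<circ>\<^sub>F F') a))"
      by (rule bij_betw_byWitness[where f' = "fmap N (fobj F' a) (fobj F a) g"])
        (use a arr[OF a] g in \<open>auto simp: module_closed[OF N] module_Cmp[OF N, symmetric] eq module_Idt[OF N]\<close>)
  qed
  then show ?thesis unfolding isomorphic_def using iso_arr_ModCat[OF NF NF'] by blast
qed

lemma fcomp_fid [simp]: "N \<circ>\<^sub>F fid = N"
  by (simp add: fcomp_def)

context triangular_zero
begin

text \<open>The module over \<open>Q\<close> in the forward direction is
  \<open>N \<circ>\<^sub>F sect\<close>. In the converse direction, the identity of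
  \<open>(z, b)\<close> is zero in \<open>Q\<close>, which makes every module pulled back along
  \<open>\<pi>\<close> vanish there.\<close>

lemma zero_iff_factors:
  assumes N: "additive_functor \<Lambda> Ab (N :: ('ot \<times> 'ou, 't \<times> 'w \<times> 'u, 'v) cmod)"
  shows "zero_object (ModCat U') (fobj (res_functor U' incl) N) \<longleftrightarrow>
    (\<exists>L\<in>Ob (ModCat Q). isomorphic (ModCat \<Lambda>) N (fobj (res_functor \<Lambda> \<pi>) (L :: ('ot \<times> 'ou, ('t \<times> 'w \<times> 'u) set, 'v) cmod)))"
    (is "?zero \<longleftrightarrow> ?fact")
proof
  assume ?zero
  then have zero: "y = \<one>\<^bsub>fobj N (z, b)\<^esub>" if "b \<in> Ob U" "y \<in> carrier (fobj N (z, b))" for b y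
    using that unfolding zero_object_ModCat by auto
  note L = additive_functor_fcomp[OF sect_additive N]
  note L\<pi> = additive_functor_fcomp[OF \<pi>_additive L]
  let ?\<eta> = "\<lambda>x. (Idt T (fst x), \<one>\<^bsub>fobj M (zU, fst x)\<^esub>, zero_arr U (snd x) zU)"
  let ?k = "\<lambda>x\<in>Ob \<Lambda>. fmap N x (fst x, zU) (?\<eta> x)"
  have arr: "?\<eta> x \<in> arr \<Lambda> x (fst x, zU)" if "x \<in> Ob \<Lambda>" for x using that by auto
  have sx: "fobj sect x = (fst x, zU)" for x by (cases x) simp
  have k: "?k \<in> ntr \<Lambda> N ((N \<circ>\<^sub>F sect) \<circ>\<^sub>F \<pi>)"
  proof (rule ntrI)
    fix x y f n assume xy: "x \<in> Ob \<Lambda>" "y \<in> Ob \<Lambda>" and f: "f \<in> arr \<Lambda> x y" and n: "n \<in> carrier (fobj N x)"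
    have s: "fmap sect x y (fmap \<pi> x y f) \<in> arr \<Lambda> (fst x, zU) (fst y, zU)"
      using additive_functor_arr[OF sect_additive _ _ additive_functor_arr[OF \<pi>_additive xy f]] xy by (simp add: sx)
    have "fmap N y (fst y, zU) (?\<eta> y) (fmap N x y f n) = fmap N (fst x, zU) (fst y, zU) (fmap sect x y (fmap \<pi> x y f)) (fmap N x (fst x, zU) (?\<eta> x) n)"
      using unit_natural[OF adj_\<pi>_sect xy f] xy f n s arr[OF xy(1)] arr[OF xy(2)]
      by (subst (1 2) module_Cmp[OF N, symmetric]) (auto simp: sx)
    then show "?k y (fmap N x y f n) = fmap ((N \<circ>\<^sub>F sect) \<circ>\<^sub>F \<pi>) x y f (?k x n)" using xy by (simp add: sx)
  next
    fix x m n assume x: "x \<in> Ob \<Lambda>" and mn: "m \<in> carrier (fobj N x)" "n \<in> carrier (fobj N x)"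
    have x': "(fst x, zU) \<in> Ob \<Lambda>" using x by auto
    show "?k x m \<in> carrier (fobj ((N \<circ>\<^sub>F sect) \<circ>\<^sub>F \<pi>) x)"
      using x module_closed[OF N x x' arr[OF x] mn(1)] by (simp add: sx)
    show "?k x (m \<otimes>\<^bsub>fobj N x\<^esub> n) = ?k x m \<otimes>\<^bsub>fobj ((N \<circ>\<^sub>F sect) \<circ>\<^sub>F \<pi>) x\<^esub> ?k x n"
      using x module_mult[OF N x x' arr[OF x] mn] by (simp add: sx)
  next
    show "?k x \<in> extensional (carrier (fobj N x))" if "x \<in> Ob \<Lambda>" for x
      using that by (simp only: restrict_apply if_True, intro module_ext[OF N that _ arr[OF that]]) auto
  qed simp
  have "niso \<Lambda> N ((N \<circ>\<^sub>F sect) \<circ>\<^sub>F \<pi>) ?k"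
    unfolding niso_def
  proof (intro conjI ballI k)
    fix x assume "x \<in> Ob \<Lambda>"
    then obtain a b where x: "x = (a, b)" and a: "a \<in> Ob T" and b: "b \<in> Ob U" by auto
    have ob: "(a, b) \<in> Ob \<Lambda>" "(a, zU) \<in> Ob \<Lambda>" "(z, b) \<in> Ob \<Lambda>" using a b by simp_all
    let ?e = "(Idt T a, \<one>\<^bsub>fobj M (zU, a)\<^esub>, zero_arr U b zU)"
    let ?e' = "(Idt T a, \<one>\<^bsub>fobj M (b, a)\<^esub>, zero_arr U zU b)"
    \<comment> \<open>The four arrows split the identity of \<open>(a, b)\<close> into idempotents
      through \<open>(a, zU)\<close> and \<open>(z, b)\<close>.\<close>
    let ?p = "(zero_arr T a z, \<one>\<^bsub>fobj M (b, a)\<^esub>, Idt U b)" and ?q = "(zero_arr T z a, \<one>\<^bsub>fobj M (b, z)\<^esub>, Idt U b)"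
    have e: "?e \<in> arr \<Lambda> (a, b) (a, zU)" "?e' \<in> arr \<Lambda> (a, zU) (a, b)" "?p \<in> arr \<Lambda> (a, b) (z, b)" "?q \<in> arr \<Lambda> (z, b) (a, b)"
      using a b by simp_all
    interpret L: preadditive_category \<Lambda> by (rule preadditive_tri)
    interpret G: comm_group "fobj N (a, b)" by (rule module_group[OF N ob(1)])
    have inv: "fmap N (a, zU) (a, b) ?e' (fmap N (a, b) (a, zU) ?e n) = n" if n: "n \<in> carrier (fobj N (a, b))" for n
    proof -
      let ?r = "Cmp \<Lambda> (a, b) (a, zU) (a, b) ?e' ?e" and ?s = "Cmp \<Lambda> (a, b) (z, b) (a, b) ?q ?p"
      have rs: "?r \<in> arr \<Lambda> (a, b) (a, b)" "?s \<in> arr \<Lambda> (a, b) (a, b)"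
        by (rule L.Cmp_arr[OF ob(1,2,1) e(1,2)], rule L.Cmp_arr[OF ob(1,3,1) e(3,4)])
      \<comment> \<open>The second summand factors through \<open>(z, b)\<close>, where \<open>N\<close> vanishes.\<close>
      have "Idt \<Lambda> (a, b) = ?r \<otimes>\<^bsub>Hom \<Lambda> (a, b) (a, b)\<^esub> ?s" using a b by simp
      then have "n = fmap N (a, b) (a, b) ?r n \<otimes>\<^bsub>fobj N (a, b)\<^esub> fmap N (a, b) (a, b) ?s n"
        using module_Idt[OF N ob(1) n] module_add[OF N ob(1,1) rs n] by simp
      also have "fmap N (a, b) (a, b) ?s n = fmap N (z, b) (a, b) ?q (fmap N (a, b) (z, b) ?p n)"
        by (rule module_Cmp[OF N ob(1,3,1) e(3,4) n])
      also have "fmap N (a, b) (z, b) ?p n = \<one>\<^bsub>fobj N (z, b)\<^esub>"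
        by (rule zero[OF b module_closed[OF N ob(1,3) e(3) n]])
      also have "fmap N (z, b) (a, b) ?q \<one>\<^bsub>fobj N (z, b)\<^esub> = \<one>\<^bsub>fobj N (a, b)\<^esub>"
        by (rule module_one[OF N ob(3,1) e(4)])
      also have "fmap N (a, b) (a, b) ?r n = fmap N (a, zU) (a, b) ?e' (fmap N (a, b) (a, zU) ?e n)"
        by (rule module_Cmp[OF N ob(1,2,1) e(1,2) n])
      finally show ?thesis
        using module_closed[OF N ob(2,1) e(2) module_closed[OF N ob(1,2) e(1) n]] by simp
    qed
    have inv': "fmap N (a, b) (a, zU) ?e (fmap N (a, zU) (a, b) ?e' n) = n" if n: "n \<in> carrier (fobj N (a, zU))" for n
    proof -
      have "Cmp \<Lambda> (a, zU) (a, b) (a, zU) ?e ?e' = Idt \<Lambda> (a, zU)" using a b by simp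
      then show ?thesis
        using module_Cmp[OF N ob(2,1,2) e(2,1) n] module_Idt[OF N ob(2) n] by simp
    qed
    have "bij_betw (fmap N (a, b) (a, zU) ?e) (carrier (fobj N (a, b))) (carrier (fobj N (a, zU)))"
      by (rule bij_betw_byWitness[where f' = "fmap N (a, zU) (a, b) ?e'"])
        (use inv inv' module_closed[OF N ob(1,2) e(1)] module_closed[OF N ob(2,1) e(2)] in auto)
    then show "bij_betw (?k x) (carrier (fobj N x)) (carrier (fobj ((N \<circ>\<^sub>F sect) \<circ>\<^sub>F \<pi>) x))"
      using a b by (simp add: x sx)
  qed
  then have "isomorphic (ModCat \<Lambda>) N ((N \<circ>\<^sub>F sect) \<circ>\<^sub>F \<pi>)"
    unfolding isomorphic_def using iso_arr_ModCat[OF N L\<pi>] by blast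
  then show ?fact using L by (intro bexI[of _ "N \<circ>\<^sub>F sect"]) simp_all
next
  assume ?fact
  then obtain L :: "('ot \<times> 'ou, ('t \<times> 'w \<times> 'u) set, 'v) cmod" and \<eta>
    where L: "additive_functor Q Ab L" and i: "iso_arr (ModCat \<Lambda>) N (L \<circ>\<^sub>F \<pi>) \<eta>"
    by (auto simp: isomorphic_def)
  have n: "niso \<Lambda> N (L \<circ>\<^sub>F \<pi>) \<eta>"
    using i iso_arr_ModCat[OF N additive_functor_fcomp[OF \<pi>_additive L]] by blast
  have "y = \<one>\<^bsub>fobj N (z, b)\<^esub>" if b: "b \<in> Ob U" and y: "y \<in> carrier (fobj N (z, b))" for b y
  proof -
    have ob: "(z, b) \<in> Ob \<Lambda>" "(z, b) \<in> Ob Q" using b by simp_all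
    \<comment> \<open>The identity and the zero arrow of \<open>(z, b)\<close> are the same coset,
      so \<open>w\<close> is fixed by a map that sends everything to zero.\<close>
    have L0: "w = \<one>\<^bsub>fobj L (z, b)\<^esub>" if "w \<in> carrier (fobj L (z, b))" for w
      using module_Idt[OF L ob(2) that] module_zero[OF preadditive_Q L ob(2,2) that] b
      by (simp add: Idt_Q zero_Q)
    have "\<eta> (z, b) y' = \<one>\<^bsub>fobj L (z, b)\<^esub>" if "y' \<in> carrier (fobj N (z, b))" for y'
      using bij_betwE[OF niso_apply(1)[OF n ob(1)]] that by (intro L0) simp
    then have "\<eta> (z, b) y = \<eta> (z, b) \<one>\<^bsub>fobj N (z, b)\<^esub>" using y module_one_closed[OF N ob(1)] by simp
    then show ?thesis
      using niso_apply(1)[OF n ob(1)] y module_one_closed[OF N ob(1)] by (auto simp: bij_betw_def dest: inj_onD)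
  qed
  then have "carrier (fobj N (z, b)) = {\<one>\<^bsub>fobj N (z, b)\<^esub>}" if "b \<in> Ob U" for b
    using module_one_closed[OF N, of "(z, b)"] that B_subset by blast
  then show ?zero
    unfolding zero_object_ModCat using additive_functor_fcomp[OF additive_functor_incl[OF B_subset] N] by auto
qed

lemma \<pi>_full:
  assumes "x \<in> Ob \<Lambda>" "y \<in> Ob \<Lambda>" "g \<in> arr Q x y"
  shows "\<exists>f\<in>arr \<Lambda> x y. fmap \<pi> x y f = g"
proof -
  obtain a b a' b' where xy: "x = (a, b)" "y = (a', b')" and ob: "a \<in> Ob T" "b \<in> Ob U" "a' \<in> Ob T" "b' \<in> Ob U"
    using assms(1,2) by auto
  obtain t where t: "t \<in> arr T a a'" "g = cls x y t" using assms(3) ob unfolding xy arr_Q[OF ob] by auto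
  show ?thesis
    by (rule bexI[of _ "(t, \<one>\<^bsub>fobj M (b', a)\<^esub>, zero_arr U b b')"]) (use t ob in \<open>simp_all add: xy \<pi>_fmap\<close>)
qed

text \<open>The projection is full and the identity on objects, so evaluation at an identity embeds
  each value into a value of \<open>N\<close>.\<close>

lemma coind_fits_\<pi>: "coind_fits TYPE('v) \<Lambda> Q \<pi>"
  unfolding coind_fits_def
proof (intro allI impI)
  fix N :: "('ot \<times> 'ou, 't \<times> 'w \<times> 'u, 'v) cmod" and d
  assume N: "additive_functor \<Lambda> Ab N" and d: "d \<in> Ob Q"
  have "\<exists>f\<in>arr \<Lambda> d y. fmap \<pi> d y f = g" if "y \<in> Ob \<Lambda>" "g \<in> arr Q (fobj \<pi> d) (fobj \<pi> y)" for y g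
    using \<pi>_full d that by simp
  from fits_coind_full[OF preadditive_tri preadditive_Q \<pi>_additive N _ this] d
  show "fits TYPE('v) (ntr \<Lambda> (rep_left \<Lambda> Q \<pi> d) N)" by simp
qed

text \<open>The arrows of \<open>\<Lambda>\<close> from \<open>(a, b)\<close> to
  \<open>(z, s)\<close> are a product of a singleton, a value of \<open>M\<close> and a hom set of
  \<open>U\<close>. Smallness of the values of \<open>M\<close> enters here.\<close>

lemma coind_fits_incl:
  assumes sk: "skeletally_small TYPE('v) U"
    and M_small: "\<And>b a. b \<in> Ob U \<Longrightarrow> a \<in> Ob T \<Longrightarrow> small TYPE('v) (carrier (fobj M (b, a)))"
  shows "coind_fits TYPE('v) U' \<Lambda> incl"
  unfolding coind_fits_def
proof (intro allI impI)
  fix N :: "('ot \<times> 'ou, 't \<times> 'w \<times> 'u, 'v) cmod" and d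
  assume N: "additive_functor U' Ab N" and d: "d \<in> Ob \<Lambda>"
  obtain S where S: "S \<subseteq> Ob U" "small TYPE('v) S" and SS: "\<And>s s'. s \<in> S \<Longrightarrow> s' \<in> S \<Longrightarrow> small TYPE('v) (arr U s s')"
    and iso: "\<And>b. b \<in> Ob U \<Longrightarrow> \<exists>s\<in>S. isomorphic U b s"
    using sk unfolding skeletally_small_def by blast
  \<comment> \<open>Smallness is given between objects of the skeleton. Precomposition with an
    isomorphism from a skeleton object to \<open>b\<close> extends it to an arbitrary
    source.\<close>
  have US: "small TYPE('v) (arr U b s)" if b: "b \<in> Ob U" and s: "s \<in> S" for b s
  proof -
    obtain s' f g where s': "s' \<in> S" and f: "f \<in> arr U b s'" and g: "g \<in> arr U s' b" and gf: "Cmp U b s' b g f = Idt U b"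
      using iso[OF b] by (auto simp: isomorphic_def iso_arr_def)
    have ob: "s \<in> Ob U" "s' \<in> Ob U" using s s' S by auto
    show ?thesis
    proof (rule small_inj[OF SS[OF s' s]])
      show "(\<lambda>u. Cmp U s' b s u g) ` arr U b s \<subseteq> arr U s' s" using ob b g by auto
      have "Cmp U b s' s (Cmp U s' b s u g) f = u" if "u \<in> arr U b s" for u
        using ob b f g that by (simp add: U.Cmp_assoc[symmetric] gf)
      then show "inj_on (\<lambda>u. Cmp U s' b s u g) (arr U b s)" by (rule inj_on_inverseI)
    qed
  qed
  show "fits TYPE('v) (ntr U' (rep_left U' \<Lambda> incl d) N)"
  proof (rule fits_coind_small[OF preadditive_U' preadditive_tri additive_functor_incl[OF B_subset] N d])
    show "{z} \<times> S \<subseteq> Ob U'" using S(1) by auto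
    show "small TYPE('v) ({z} \<times> S)" by (rule small_inj[OF S(2), of snd]) (auto simp: inj_on_def)
    show "small TYPE('v) (arr \<Lambda> d (fobj incl x))" if "x \<in> {z} \<times> S" for x
    proof -
      obtain a b s where x: "d = (a, b)" "x = (z, s)" and ob: "a \<in> Ob T" "b \<in> Ob U" "s \<in> S" "s \<in> Ob U"
        using d \<open>x \<in> {z} \<times> S\<close> S(1) by auto
      have "small TYPE('v) (arr T a z)" using zero_arr_T(1)[OF ob(1)] by (simp add: small_singleton)
      then show ?thesis
        unfolding x fid_simps tri_simps by (intro small_Sigma M_small US ob)
    qed
    show "\<exists>s\<in>{z} \<times> S. isomorphic U' x s" if "x \<in> Ob U'" for x
    proof -
      obtain b where x: "x = (z, b)" and b: "b \<in> Ob U" using \<open>x \<in> Ob U'\<close> by auto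
      obtain s where s: "s \<in> S" "isomorphic U b s" using iso[OF b] by blast
      have "isomorphic U' (fobj emb_U b) (fobj emb_U s)"
        by (rule isomorphic_fobj[OF emb_U_additive b _ s(2)]) (use s S in auto)
      then show ?thesis using s(1) x by auto
    qed
  qed
qed

lemma retr_full:
  assumes "x \<in> Ob \<Lambda>" "y \<in> Ob \<Lambda>" "g \<in> arr U' (fobj retr x) (fobj retr y)"
  shows "\<exists>f\<in>arr \<Lambda> x y. fmap retr x y f = g"
proof -
  obtain a b a' b' where xy: "x = (a, b)" "y = (a', b')" and ob: "a \<in> Ob T" "b \<in> Ob U" "a' \<in> Ob T" "b' \<in> Ob U"
    using assms(1,2) by auto
  obtain u where "u \<in> arr U b b'" "g = (zero_arr T z z, \<one>\<^bsub>fobj M (b', z)\<^esub>, u)"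
    using assms(3) ob by (auto simp: xy zero_arr_T M_z)
  then show ?thesis
    by (intro bexI[of _ "(zero_arr T a a', \<one>\<^bsub>fobj M (b', a)\<^esub>, u)"]) (use ob in \<open>simp_all add: xy\<close>)
qed

lemma diag_T_full:
  assumes "x \<in> Ob Q" "y \<in> Ob Q" "g \<in> arr T (fobj diag_T x) (fobj diag_T y)"
  shows "\<exists>f\<in>arr Q x y. fmap diag_T x y f = g"
  using assms by (intro bexI[of _ "cls x y g"]) (auto simp: arr_Q)

lemma diag_U_full:
  assumes "x \<in> Ob U'" "y \<in> Ob U'" "g \<in> arr U (fobj diag_U x) (fobj diag_U y)"
  shows "\<exists>f\<in>arr U' x y. fmap diag_U x y f = g"
  using assms by (intro bexI[of _ "(zero_arr T z z, \<one>\<^bsub>fobj M (snd y, z)\<^esub>, g)"]) auto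

lemma recollement_tri:
  assumes inf: "infinite (UNIV :: 'v set)" and sk: "skeletally_small TYPE('v) U"
    and M_small: "\<And>b a. b \<in> Ob U \<Longrightarrow> a \<in> Ob T \<Longrightarrow> small TYPE('v) (carrier (fobj M (b, a)))"
  shows "recollement
      (ModCat Q :: (('ot \<times> 'ou, ('t \<times> 'w \<times> 'u) set, 'v) cmod, _) pcat)
      (ModCat \<Lambda> :: (('ot \<times> 'ou, 't \<times> 'w \<times> 'u, 'v) cmod, _) pcat)
      (ModCat U' :: (('ot \<times> 'ou, 't \<times> 'w \<times> 'u, 'v) cmod, _) pcat)
      (ind_functor \<Lambda> Q \<pi>) (res_functor \<Lambda> \<pi>) (coind_functor \<Lambda> Q \<pi>)
      (ind_functor U' \<Lambda> incl) (res_functor U' incl) (coind_functor U' \<Lambda> incl)"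
proof -
  note L = preadditive_tri and Q = preadditive_Q and U' = preadditive_U'
  note i = additive_functor_incl[OF B_subset]
  have fi: "coind_fits TYPE('v) U' \<Lambda> incl" by (rule coind_fits_incl[OF sk M_small])
  have ker: "\<forall>N\<in>Ob (ModCat \<Lambda> :: (('ot \<times> 'ou, 't \<times> 'w \<times> 'u, 'v) cmod, _) pcat).
      zero_object (ModCat U') (fobj (res_functor U' incl) N) \<longleftrightarrow>
      (\<exists>L\<in>Ob (ModCat Q). isomorphic (ModCat \<Lambda>) N (fobj (res_functor \<Lambda> \<pi>) L))"
    by (intro ballI zero_iff_factors) simp
  \<comment> \<open>Induction from \<open>U'\<close> is isomorphic to restriction along
    \<open>retr\<close>, so full faithfulness is shown for the latter.\<close>
  have "fully_faithful (ModCat U') (ModCat \<Lambda>)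
      (res_functor \<Lambda> retr :: (('ot \<times> 'ou, 't \<times> 'w \<times> 'u, 'v) cmod, _, _, _) cfunctor)"
  proof (rule res_functor_fully_faithful[OF L U' retr_additive retr_full])
    show "\<exists>c\<in>Ob \<Lambda>. fobj retr c = d" if "d \<in> Ob U'" for d
      using that by (intro bexI[of _ d]) auto
  qed
  note ff_ind = ind_functor_fully_faithful[OF U' L adj_incl_retr this]
  have ff_res: "fully_faithful (ModCat Q) (ModCat \<Lambda>)
      (res_functor \<Lambda> \<pi> :: (('ot \<times> 'ou, ('t \<times> 'w \<times> 'u) set, 'v) cmod, _, _, _) cfunctor)"
    by (rule res_functor_fully_faithful[OF L Q \<pi>_additive]) (use \<pi>_full in auto)
  show ?thesis
    unfolding recollement_def
    by (intro conjI abelian_ModCat[OF inf L] abelian_ModCat[OF inf Q] abelian_ModCat[OF inf U']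
        ind_functor_additive[OF L Q adj_\<pi>_sect] res_functor_additive[OF \<pi>_additive]
        coind_functor_additive[OF L Q \<pi>_additive coind_fits_\<pi>]
        ind_functor_additive[OF U' L adj_incl_retr] res_functor_additive[OF i] coind_functor_additive[OF U' L i fi]
        ind_functor_adjoint[OF L Q adj_\<pi>_sect] coind_functor_adjoint[OF L Q \<pi>_additive coind_fits_\<pi>]
        ind_functor_adjoint[OF U' L adj_incl_retr] coind_functor_adjoint[OF U' L i fi]
        ker ff_res ff_ind coind_functor_fully_faithful[OF L B_subset fi])
qed

text \<open>The modules over \<open>Q\<close> and over \<open>U'\<close> are exchanged for modules
  over \<open>T\<close> and \<open>U\<close> by restriction along \<open>emb_T\<close> and
  \<open>emb_U\<close>, with restriction along \<open>diag_T\<close> and \<open>diag_U\<close> as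
  inverses up to isomorphism.\<close>

lemma recollement_tri_diag:
  assumes inf: "infinite (UNIV :: 'v set)" and sk: "skeletally_small TYPE('v) U"
    and M_small: "\<And>b a. b \<in> Ob U \<Longrightarrow> a \<in> Ob T \<Longrightarrow> small TYPE('v) (carrier (fobj M (b, a)))"
  shows "recollement
        (ModCat T :: (('ot, 't, 'v) cmod, _) pcat)
        (ModCat \<Lambda> :: (('ot \<times> 'ou, 't \<times> 'w \<times> 'u, 'v) cmod, _) pcat)
        (ModCat U :: (('ou, 'u, 'v) cmod, _) pcat)
        (res_functor T emb_T \<circ>\<^sub>F ind_functor \<Lambda> Q \<pi>)
        (res_functor \<Lambda> \<pi> \<circ>\<^sub>F res_functor Q diag_T)
        (res_functor T emb_T \<circ>\<^sub>F coind_functor \<Lambda> Q \<pi>)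
        (ind_functor U' \<Lambda> incl \<circ>\<^sub>F res_functor U' diag_U)
        (res_functor U emb_U \<circ>\<^sub>F res_functor U' incl)
        (coind_functor U' \<Lambda> incl \<circ>\<^sub>F res_functor U' diag_U)"
proof (rule recollement_transport[OF recollement_tri[OF inf sk]])
  show "small TYPE('v) (carrier (fobj M (b, a)))" if "b \<in> Ob U" "a \<in> Ob T" for b a
    by (rule M_small[OF that])
  note T = T.preadditive_category_axioms and U = U.preadditive_category_axioms
  show "fully_faithful (ModCat T :: (('ot, 't, 'v) cmod, _) pcat) (ModCat Q) (res_functor Q diag_T)"
  proof (rule res_functor_fully_faithful[OF preadditive_Q T diag_T_additive diag_T_full])
    show "\<exists>c\<in>Ob Q. fobj diag_T c = a" if "a \<in> Ob T" for a
      using that by (intro bexI[of _ "(a, zU)"]) simp_all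
  qed
  show "fully_faithful (ModCat U :: (('ou, 'u, 'v) cmod, _) pcat) (ModCat U') (res_functor U' diag_U)"
  proof (rule res_functor_fully_faithful[OF preadditive_U' U diag_U_additive diag_U_full])
    show "\<exists>c\<in>Ob U'. fobj diag_U c = b" if "b \<in> Ob U" for b
      using that by (intro bexI[of _ "(z, b)"]) simp_all
  qed
  show "isomorphic (ModCat Q) L (fobj (res_functor Q diag_T) (fobj (res_functor T emb_T) L))"
    if "L \<in> Ob (ModCat Q :: (('ot \<times> 'ou, ('t \<times> 'w \<times> 'u) set, 'v) cmod, _) pcat)" for L
  proof -
    have "isomorphic (ModCat Q) (L \<circ>\<^sub>F (emb_T \<circ>\<^sub>F diag_T)) (L \<circ>\<^sub>F fid)"
      by (rule isomorphic_fcomp[OF additive_functor_fcomp[OF diag_T_additive emb_T_additive]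
            additive_functor_fid[OF preadditive_Q]])
        (use equivalence_T that in \<open>simp_all add: equivalence_pair_def\<close>)
    from isomorphic_sym[OF this] show ?thesis by (simp add: fcomp_assoc)
  qed
  \<comment> \<open>Every object of \<open>U'\<close> is the image under \<open>emb_U\<close> of its
    second entry, so both sides test the same values.\<close>
  show "zero_object (ModCat U) (fobj (res_functor U emb_U) N) \<longleftrightarrow> zero_object (ModCat U') N"
    if "N \<in> Ob (ModCat U' :: (('ot \<times> 'ou, 't \<times> 'w \<times> 'u, 'v) cmod, _) pcat)" for N
    using that additive_functor_fcomp[OF emb_U_additive, of Ab N] unfolding zero_object_ModCat by auto
qed (rule abelian_ModCat[OF inf T.preadditive_category_axioms] abelian_ModCat[OF inf U.preadditive_category_axioms]
    res_functor_additive[OF emb_T_additive] res_functor_additive[OF diag_T_additive]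
    res_functor_additive[OF emb_U_additive] res_functor_additive[OF diag_U_additive]
    res_functor_adjoint[OF adj_diag_T_emb_T] res_functor_adjoint[OF adj_emb_T_diag_T]
    res_functor_adjoint[OF adj_diag_U_emb_U] res_functor_adjoint[OF adj_emb_U_diag_U])+

end

theorem proposition4p7:
  fixes R :: "'r ring"
    and T :: "('ot, 't, 'r) rcat"
    and U :: "('ou, 'u, 'r) rcat"
    and M :: "('ou \<times> 'ot, ('u \<times> 't \<Rightarrow>\<^sub>0 int) set, 'w) cmod"
    and z :: 'ot
    and \<Lambda> U' :: "('ot \<times> 'ou, 't \<times> 'w \<times> 'u) pcat"
    and Q :: "('ot \<times> 'ou, ('t \<times> 'w \<times> 'u) set) pcat"
    and \<pi> :: "('ot \<times> 'ou, 't \<times> 'w \<times> 'u, 'ot \<times> 'ou, ('t \<times> 'w \<times> 'u) set) cfunctor"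
  assumes "cring R"
    and "R_category R U" and "additive_category U" and "skeletally_small TYPE('v) U"
    and "R_category R T" and "additive_category T" and "skeletally_small TYPE('v) T"
    and "M \<in> Ob (ModCat (tensor_cat R U (ropp T)))"
    and "\<And>b a. b \<in> Ob U \<Longrightarrow> a \<in> Ob T \<Longrightarrow> small TYPE('v) (carrier (fobj M (b, a)))"
    and "infinite (UNIV :: 'v set)"
    and "zero_object T z"
    and "\<Lambda> = tri_cat R T M U"
    and "U' = full_subcat \<Lambda> ({z} \<times> Ob U)"
    and "Q = quotient_cat \<Lambda> (Ob U')" and "\<pi> = quotient_proj \<Lambda> (Ob U')"
  shows "recollement
      (ModCat Q :: (('ot \<times> 'ou, ('t \<times> 'w \<times> 'u) set, 'v) cmod, _) pcat)
      (ModCat \<Lambda> :: (('ot \<times> 'ou, 't \<times> 'w \<times> 'u, 'v) cmod, _) pcat)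
      (ModCat U' :: (('ot \<times> 'ou, 't \<times> 'w \<times> 'u, 'v) cmod, _) pcat)
      (ind_functor \<Lambda> Q \<pi>) (res_functor \<Lambda> \<pi>) (coind_functor \<Lambda> Q \<pi>)
      (ind_functor U' \<Lambda> incl) (res_functor U' incl) (coind_functor U' \<Lambda> incl) \<and>
    exact_functor
      (ModCat \<Lambda> :: (('ot \<times> 'ou, 't \<times> 'w \<times> 'u, 'v) cmod, _) pcat) (ModCat Q)
      (ind_functor \<Lambda> Q \<pi>) \<and>
    (\<exists>E G. equivalence_pair Q T diag_T E \<and> equivalence_pair U' U diag_U G \<and>
      recollement
        (ModCat T :: (('ot, 't, 'v) cmod, _) pcat)
        (ModCat \<Lambda> :: (('ot \<times> 'ou, 't \<times> 'w \<times> 'u, 'v) cmod, _) pcat)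
        (ModCat U :: (('ou, 'u, 'v) cmod, _) pcat)
        (res_functor T E \<circ>\<^sub>F ind_functor \<Lambda> Q \<pi>)
        (res_functor \<Lambda> \<pi> \<circ>\<^sub>F res_functor Q diag_T)
        (res_functor T E \<circ>\<^sub>F coind_functor \<Lambda> Q \<pi>)
        (ind_functor U' \<Lambda> incl \<circ>\<^sub>F res_functor U' diag_U)
        (res_functor U G \<circ>\<^sub>F res_functor U' incl)
        (coind_functor U' \<Lambda> incl \<circ>\<^sub>F res_functor U' diag_U))"
proof -
  \<comment> \<open>The choice of \<open>zU\<close> reaches the statement only through the witness
    \<open>emb_T\<close> for \<open>E\<close>; the witness for \<open>G\<close> is
    \<open>emb_U\<close>.\<close>
  obtain zU where zU: "zero_object U zU" using \<open>additive_category U\<close> by (auto simp: additive_category_def)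
  interpret triangular_zero R T U M z zU
    by unfold_locales (use assms(2,5,8,11) zU in simp_all)
  have eqs: "\<Lambda> = tri_cat R T M U" "U' = full_subcat (tri_cat R T M U) ({z} \<times> Ob U)"
    "Q = quotient_cat (tri_cat R T M U) ({z} \<times> Ob U)" "\<pi> = quotient_proj (tri_cat R T M U) ({z} \<times> Ob U)"
    using assms(12-15) by simp_all
  note r = recollement_tri[OF assms(10,4)] recollement_tri_diag[OF assms(10,4)]
  have "exact_functor
      (ModCat \<Lambda> :: (('ot \<times> 'ou, 't \<times> 'w \<times> 'u, 'v) cmod, _) pcat) (ModCat Q) (ind_functor \<Lambda> Q \<pi>)"
    unfolding eqs by (rule ind_functor_exact[OF preadditive_tri preadditive_Q adj_\<pi>_sect])
  with r equivalence_T equivalence_U assms(9) show ?thesis unfolding eqs by blast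
qed

end
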